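(* Let $X=\{(X_t)_{t\ge 0};(\mathbf P_\mu)_{\mu\in\mathcal M^1_E}\}$ be a $(\xi,\psi)$-superprocess such that: the spatial motion $\xi$ satisfies the density assumption; $\tilde\phi$ is bounded and the semigroup $(P_t)_{t\ge 0}$ of $\xi$ is intrinsically ultracontractive; $X$ is critical, i.e. $\lambda=0$; and the branching mechanism is $\psi(x,z)=-\beta(x)z+\kappa(x)z^{\gamma(x)}$ with $\beta,\kappa,\gamma$ satisfying the stable branching assumption (all terms as defined in the context). Then: (1) $X$ is non-persistent, that is, $\mathbf P_{\delta_x}(\|X_t\|=0)>0$ for each $t>0$ and $x\in E$. (2) For each $\mu\in\mathcal M^1_E$, $\mathbf P_\mu(\|X_t\|\ne 0)$ converges to $0$ as $t\to\infty$ and is regularly varying at infinity with index $-(\gamma_0-1)^{-1}$. Furthermore, if $m(\{x:\gamma(x)=\gamma_0\})>0$, then $$\lim_{t\to\infty}\eta_t^{-1}\,\mathbf P_\mu(\|X_t\|\ne 0)=\mu(\phi).$$ (3) Suppose $m(\{x:\gamma(x)=\gamma_0\})>0$. Let $f$ be a non-negative Borel function on $E$ with $\langle f,\phi^*\rangle_m>0$ and $\|\phi^{-1}f\|_\infty<\infty$. Then for each $\mu\in\mathcal M^1_E$, the law of $\eta_tX_t(f)$ under the conditional probability $\mathbf P_\mu(\,\cdot\mid\|X_t\|\ne 0)$ converges weakly, as $t\to\infty$, to the law of $\langle f,\phi^*\rangle_m\,\mathbf z^{(\gamma_0-1)}$. Here $C_X:=\langle \mathbf 1_{\gamma(\cdot)=\gamma_0}\,\kappa\,\phi^{\gamma_0},\phi^*\rangle_m$,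 $\eta_t:=\big(C_X(\gamma_0-1)t\big)^{-1/(\gamma_0-1)}$, and $\mathbf z^{(\gamma_0-1)}$ is a positive random variable with Laplace transform $E[e^{-u\mathbf z^{(\gamma_0-1)}}]=1-(1+u^{-(\gamma_0-1)})^{-1/(\gamma_0-1)}$, $u\ge 0$.
   Context: Notation. $E$ is a locally compact separable metric space; $\mathscr B_b(E)$ (resp. $\mathscr B_b^+(E)$) denotes the bounded (resp. bounded non-negative) Borel functions on $E$; $\mathcal M_E^1$ is the set of finite Borel measures on $E$; $\mu(f)=\int f\,d\mu$, $\|\mu\|=\mu(E)$; $\|\cdot\|_\infty$ is the sup norm. A strictly positive Borel function $h$ on $(0,\infty)$ is regularly varying at infinity with index $\alpha\in\mathbb R$ if $\lim_{t\to\infty}h(ut)/h(t)=u^{\alpha}$ for every $u\in(0,\infty)$. Motion. $\xi=\{(\xi_t)_{t\ge0};(\Pi_x)_{x\in E}\}$ is an $E$-valued Hunt process with lifetime $\zeta$ and semigroup $P_tf(x)=\Pi_x[f(\xi_t)\mathbf 1_{t<\zeta}]$. Stable branching assumption. $\psi(x,z)=-\beta(x)z+\kappa(x)z^{\gamma(x)}$, $x\in E$, $z\ge0$, where $\beta\in\mathscr B_b(E)$; $\kappa$ is bounded Borel and strictly positive with $\kappa_0:=\operatorname{ess\,inf}_{m(dx)}\kappa(x)>0$; $\gamma$ is Borel with $1<\gamma(x)<2$ for all $x$ and $\gamma_0:=\operatorname{ess\,inf}_{m(dx)}\gamma(x)>1$. (Here $m$ is the reference measure below. Equivalently $\kappa(x)z^{\gamma(x)}=\int_0^\infty(e^{-zy}-1+zy)\,\pi(x,dy)$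 with $\pi(x,dy)=\kappa(x)\,dy/(\Gamma(-\gamma(x))y^{1+\gamma(x)})$.) Superprocess. A $(\xi,\psi)$-superprocess is an $\mathcal M_E^1$-valued Hunt process $X=\{(X_t)_{t\ge0};(\mathbf P_\mu)_{\mu\in\mathcal M_E^1}\}$ with $\mathbf P_\mu[e^{-X_t(f)}]=e^{-\mu(V_tf)}$ for all $t\ge0$, $\mu\in\mathcal M^1_E$, $f\in\mathscr B_b^+(E)$, where $(t,x)\mapsto V_tf(x)$ is the unique locally bounded non-negative solution of $$V_tf(x)+\Pi_x\Big[\int_0^{t\wedge\zeta}\psi(\xi_s,V_{t-s}f(\xi_s))\,ds\Big]=\Pi_x[f(\xi_t)\mathbf 1_{t<\zeta}],\quad t\ge0,\ x\in E.$$ Density assumption. There are a $\sigma$-finite Borel measure $m$ on $E$ with full support and strictly positive bounded continuous functions $p_t(\cdot,\cdot)$ on $E\times E$, $t>0$, such that $P_tf(x)=\int_E p_t(x,y)f(y)\,m(dy)$ for $t>0$, $x\in E$, $f\in\mathscr B_b(E)$; $\int_E p_t(y,x)\,m(dy)\le1$ for all $t>0$, $x\in E$; $\int_E\int_E p_t(x,y)^2m(dx)m(dy)<\infty$ for all $t>0$; and $x\mapsto\int_E p_t(x,y)^2m(dy)$ and $x\mapsto\int_E p_t(y,x)^2m(dy)$ are continuous. Write $\langle f,g\rangle_m=\int_E fg\,dm$. Eigenfunctions. $(P_t)$ and its dual $P_t^*f(x)=\int p_t(y,x)f(y)m(dy)$ are strongly continuous semigroups of compact operators on $L^2(E,m)$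 with generators $\tilde L,\tilde L^*$; $\tilde\lambda:=\sup\mathrm{Re}\,\sigma(\tilde L)=\sup\mathrm{Re}\,\sigma(\tilde L^* )$ is an eigenvalue of multiplicity one of both, and $\tilde\phi,\tilde\phi^*$ are the corresponding strictly positive continuous eigenfunctions with $\langle\tilde\phi,\tilde\phi\rangle_m=\langle\tilde\phi,\tilde\phi^*\rangle_m=1$. Likewise the Feynman–Kac semigroup $P_t^\beta f(x)=\Pi_x[e^{\int_0^t\beta(\xi_r)dr}f(\xi_t)\mathbf 1_{t<\zeta}]$ has a density $p_t^\beta(x,y)$ with respect to $m$, continuous in $(x,y)$; it and its dual (with kernel $p^\beta_t(y,x)$) are strongly continuous semigroups of compact operators on $L^2(E,m)$ with generators $L,L^*$; $\lambda:=\sup\mathrm{Re}\,\sigma(L)=\sup\mathrm{Re}\,\sigma(L^* )$ is an eigenvalue of multiplicity one of both, with strictly positive continuous eigenfunctions $\phi$ of $L$ and $\phi^*$ of $L^*$, normalized by $\langle\phi,\phi\rangle_m=\langle\phi,\phi^*\rangle_m=1$. Critical: $\lambda=0$. Intrinsically ultracontractive: for each $t>0$ there is $c_t>0$ with $p_t(x,y)\le c_t\tilde\phi(x)\tilde\phi^*(y)$ for all $x,y\in E$. (Under these assumptions $\phi$ is bounded and $\phi^*dm$ is a finite measure.)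
   Formalization: Regular variation in (2) and the conditional limit in (3) are stated only for μ with ‖μ‖≠0: for μ=0 the survival probability is identically 0, so it is not regularly varying and the conditional probability is undefined. *)

theory Defs
  imports "HOL-Probability.Probability"
begin

section \<open>Hunt processes\<close>

definition borel_of :: "'s topology \<Rightarrow> 's measure" where
  "borel_of S = sigma (topspace S) {U. openin S U}"

text \<open>Times range over \<open>[0, \<infinity>]\<close>, represented by \<^typ>\<open>ennreal\<close>; processes are indexed by
  real numbers, of which only the non-negative ones matter.\<close>

definition natural_filtration ::
  "'s topology \<Rightarrow> 'w measure \<Rightarrow> (real \<Rightarrow> 'w \<Rightarrow> 's) \<Rightarrow> ennreal \<Rightarrow> 'w measure" where
  "natural_filtration S W X t = sigma (space W)
     {X s -` B \<inter> space W | s B. 0 \<le> s \<and> ennreal s \<le> t \<and> B \<in> sets (borel_of S)}"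

text \<open>The index set is \<open>{t<..}\<close> for finite \<open>t\<close> and \<open>{\<infinity>}\<close> for \<open>t = \<infinity>\<close>.\<close>

definition right_cont_filtration ::
  "'s topology \<Rightarrow> 'w measure \<Rightarrow> (real \<Rightarrow> 'w \<Rightarrow> 's) \<Rightarrow> ennreal \<Rightarrow> 'w measure" where
  "right_cont_filtration S W X t = sigma (space W)
     (\<Inter>u\<in>{u. t < u \<or> u = \<infinity>}. sets (natural_filtration S W X u))"

text \<open>A Hunt process with infinite lifetime on the topological state space \<open>S\<close>. The family \<open>P\<close> of
  laws lives on the measurable space \<open>W\<close>. The strong Markov property and quasi-left-continuity
  refer to the right-continuous natural filtration. They hold for it if and only if they hold for
  some right-continuous filtration to which the process is adapted, and if and only if they hold
  for its usual augmentation; likewise, deterministic initial states suffice.\<close>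

locale hunt_process =
  fixes S :: "'s topology" and W :: "'w measure"
    and X :: "real \<Rightarrow> 'w \<Rightarrow> 's" and P :: "'s \<Rightarrow> 'w measure"
  assumes measurable_process:
      "\<And>t. 0 \<le> t \<Longrightarrow> X t \<in> W \<rightarrow>\<^sub>M borel_of S"
    and prob_law:
      "\<And>x. x \<in> topspace S \<Longrightarrow> prob_space (P x)"
    and sets_law:
      "\<And>x. x \<in> topspace S \<Longrightarrow> sets (P x) = sets W"
    and measurable_law:
      "\<And>A. A \<in> sets (natural_filtration S W X \<infinity>) \<Longrightarrow>
         (\<lambda>x. measure (P x) A) \<in> borel_measurable (borel_of S)"
    and initial_state:
      "\<And>x. x \<in> topspace S \<Longrightarrow> AE \<omega> in P x. X 0 \<omega> = x"
    and shift_operators: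
      "\<exists>\<theta>. \<forall>t\<ge>0. \<forall>\<omega>\<in>space W. \<theta> t \<omega> \<in> space W \<and> (\<forall>s\<ge>0. X s (\<theta> t \<omega>) = X (t + s) \<omega>)"
    and right_continuous_paths:
      "\<And>\<omega> t. \<omega> \<in> space W \<Longrightarrow> 0 \<le> t \<Longrightarrow> limitin S (\<lambda>s. X s \<omega>) (X t \<omega>) (at_right t)"
    and left_limits:
      "\<And>\<omega> t. \<omega> \<in> space W \<Longrightarrow> 0 < t \<Longrightarrow> \<exists>l. limitin S (\<lambda>s. X s \<omega>) l (at_left t)"
    and strong_markov:
      "\<And>x \<tau> A t B. x \<in> topspace S \<Longrightarrow> stopping_time (right_cont_filtration S W X) \<tau> \<Longrightarrow>
         A \<in> sets (filtration.pre_sigma (space W) (right_cont_filtration S W X) \<tau>) \<Longrightarrow>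
         0 \<le> t \<Longrightarrow> B \<in> sets (borel_of S) \<Longrightarrow>
         emeasure (P x) {\<omega> \<in> A. \<tau> \<omega> < \<infinity> \<and> X (enn2real (\<tau> \<omega>) + t) \<omega> \<in> B} =
         (\<integral>\<^sup>+\<omega>. emeasure (P (X (enn2real (\<tau> \<omega>)) \<omega>)) {\<omega>' \<in> space W. X t \<omega>' \<in> B}
                * indicator {\<omega> \<in> A. \<tau> \<omega> < \<infinity>} \<omega> \<partial>P x)"
    and quasi_left_continuous:
      "\<And>x \<tau>. x \<in> topspace S \<Longrightarrow> (\<And>n. stopping_time (right_cont_filtration S W X) (\<tau> n)) \<Longrightarrow>
         (\<And>\<omega>. \<omega> \<in> space W \<Longrightarrow> incseq (\<lambda>n::nat. \<tau> n \<omega>)) \<Longrightarrow>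
         AE \<omega> in P x. (SUP n. \<tau> n \<omega>) < \<infinity> \<longrightarrow>
           limitin S (\<lambda>n. X (enn2real (\<tau> n \<omega>)) \<omega>) (X (enn2real (SUP n. \<tau> n \<omega>)) \<omega>) sequentially"

text \<open>A Hunt process with lifetime: \<^const>\<open>None\<close> is the cemetery, adjoined as the point at infinity
  (as an isolated point if the space is compact), and the lifetime is
  \<open>\<zeta> = inf {t. \<xi> t = None}\<close>. As the cemetery is a trap and paths are right-continuous,
  \<open>t < \<zeta>\<close> holds if and only if \<open>\<xi> t \<noteq> None\<close>.\<close>

locale killed_hunt_process =
  hunt_process "Alexandroff_compactification (euclidean :: 'e topology)" W \<xi> Pr
  for W :: "'w measure" and \<xi> :: "real \<Rightarrow> 'w \<Rightarrow> 'e::{metric_space, second_countable_topology} option"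
    and Pr :: "'e option \<Rightarrow> 'w measure" +
  assumes cemetery_trap:
    "\<And>\<omega> s t. \<omega> \<in> space W \<Longrightarrow> 0 \<le> s \<Longrightarrow> s \<le> t \<Longrightarrow> \<xi> s \<omega> = None \<Longrightarrow> \<xi> t \<omega> = None"

text \<open>\<open>at_alive f (\<xi> t \<omega>)\<close> is \<open>f(\<xi>\<^sub>t) 1(t < \<zeta>)\<close>.\<close>

definition at_alive :: "('e \<Rightarrow> real) \<Rightarrow> 'e option \<Rightarrow> real" where
  "at_alive f z = (case z of None \<Rightarrow> 0 | Some y \<Rightarrow> f y)"

definition bounded_borel :: "('e::topological_space \<Rightarrow> real) set" where
  "bounded_borel = {f \<in> borel_measurable borel. bounded (range f)}"

definition motion_semigroup ::
  "(real \<Rightarrow> 'w \<Rightarrow> 'e option) \<Rightarrow> ('e option \<Rightarrow> 'w measure) \<Rightarrow> real \<Rightarrow> ('e \<Rightarrow> real) \<Rightarrow> 'e \<Rightarrow> real" where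
  "motion_semigroup \<xi> Pr t f x = (\<integral>\<omega>. at_alive f (\<xi> t \<omega>) \<partial>Pr (Some x))"

definition feynman_kac ::
  "(real \<Rightarrow> 'w \<Rightarrow> 'e option) \<Rightarrow> ('e option \<Rightarrow> 'w measure) \<Rightarrow> ('e \<Rightarrow> real)
     \<Rightarrow> real \<Rightarrow> ('e \<Rightarrow> real) \<Rightarrow> 'e \<Rightarrow> real" where
  "feynman_kac \<xi> Pr \<beta> t f x =
     (\<integral>\<omega>. exp (LINT r:{0..t}|lborel. at_alive \<beta> (\<xi> r \<omega>)) * at_alive f (\<xi> t \<omega>) \<partial>Pr (Some x))"


section \<open>Superprocesses\<close>

definition finite_measures :: "'e::topological_space measure set" where
  "finite_measures = {\<mu>. sets \<mu> = sets borel \<and> finite_measure \<mu>}"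

definition weak_topology :: "'e::topological_space measure topology" where
  "weak_topology = topology_generated_by
     {{\<mu> \<in> finite_measures. (\<integral>x. f x \<partial>\<mu>) \<in> U} | (f :: 'e \<Rightarrow> real) U.
        continuous_on UNIV f \<and> bounded (range f) \<and> open U}"

definition total_mass :: "'e measure \<Rightarrow> real" where
  "total_mass \<mu> = measure \<mu> (space \<mu>)"

definition mild_solution ::
  "(real \<Rightarrow> 'w \<Rightarrow> 'e::{metric_space, second_countable_topology} option) \<Rightarrow> ('e option \<Rightarrow> 'w measure)
     \<Rightarrow> ('e \<Rightarrow> real \<Rightarrow> real) \<Rightarrow> ('e \<Rightarrow> real) \<Rightarrow> (real \<Rightarrow> 'e \<Rightarrow> real) \<Rightarrow> bool" where
  "mild_solution \<xi> Pr \<psi> f v \<longleftrightarrow>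
     (\<lambda>(t, x). v t x) \<in> borel_measurable (restrict_space borel {0..} \<Otimes>\<^sub>M borel) \<and>
     (\<forall>t\<ge>0. \<forall>x. 0 \<le> v t x) \<and>
     (\<forall>T\<ge>0. \<exists>C. \<forall>t\<in>{0..T}. \<forall>x. v t x \<le> C) \<and>
     (\<forall>t\<ge>0. \<forall>x.
        v t x + (\<integral>\<omega>. (LINT s:{0..t}|lborel. at_alive (\<lambda>y. \<psi> y (v (t - s) y)) (\<xi> s \<omega>)) \<partial>Pr (Some x))
        = motion_semigroup \<xi> Pr t f x)"

locale superprocess =
  motion: killed_hunt_process W \<xi> Pr + hunt_process weak_topology W' X P
  for W :: "'w measure" and \<xi> :: "real \<Rightarrow> 'w \<Rightarrow> 'e::{metric_space, second_countable_topology} option"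
    and Pr :: "'e option \<Rightarrow> 'w measure" and \<psi> :: "'e \<Rightarrow> real \<Rightarrow> real"
    and W' :: "'v measure" and X :: "real \<Rightarrow> 'v \<Rightarrow> 'e measure" and P :: "'e measure \<Rightarrow> 'v measure" +
  assumes laplace_functional:
    "\<And>f. f \<in> bounded_borel \<Longrightarrow> (\<And>x. 0 \<le> f x) \<Longrightarrow>
       \<exists>v. mild_solution \<xi> Pr \<psi> f v \<and>
           (\<forall>v'. mild_solution \<xi> Pr \<psi> f v' \<longrightarrow> (\<forall>t\<ge>0. v' t = v t)) \<and>
           (\<forall>t\<ge>0. \<forall>\<mu>\<in>finite_measures.
              (\<integral>\<omega>. exp (- (\<integral>x. f x \<partial>X t \<omega>)) \<partial>P \<mu>) = exp (- (\<integral>x. v t x \<partial>\<mu>)))"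


section \<open>Stable branching\<close>

definition ess_inf :: "'e measure \<Rightarrow> ('e \<Rightarrow> real) \<Rightarrow> real" where
  "ess_inf m f = real_of_ereal (- esssup m (\<lambda>x. - ereal (f x)))"

definition stable_branching ::
  "('e \<Rightarrow> real) \<Rightarrow> ('e \<Rightarrow> real) \<Rightarrow> ('e \<Rightarrow> real) \<Rightarrow> 'e \<Rightarrow> real \<Rightarrow> real" where
  "stable_branching \<beta> \<kappa> \<gamma> x z = - \<beta> x * z + \<kappa> x * z powr \<gamma> x"

definition stable_branching_assumption ::
  "'e::topological_space measure \<Rightarrow> ('e \<Rightarrow> real) \<Rightarrow> ('e \<Rightarrow> real) \<Rightarrow> ('e \<Rightarrow> real) \<Rightarrow> bool" where
  "stable_branching_assumption m \<beta> \<kappa> \<gamma> \<longleftrightarrow>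
     \<beta> \<in> bounded_borel \<and>
     \<kappa> \<in> bounded_borel \<and> (\<forall>x. 0 < \<kappa> x) \<and> 0 < ess_inf m \<kappa> \<and>
     \<gamma> \<in> borel_measurable borel \<and> (\<forall>x. 1 < \<gamma> x \<and> \<gamma> x < 2) \<and> 1 < ess_inf m \<gamma>"


section \<open>Transition densities and principal eigenfunctions\<close>

definition continuous_density ::
  "'e::topological_space measure \<Rightarrow> (real \<Rightarrow> ('e \<Rightarrow> real) \<Rightarrow> 'e \<Rightarrow> real) \<Rightarrow> (real \<Rightarrow> 'e \<Rightarrow> 'e \<Rightarrow> real) \<Rightarrow> bool"
  where
  "continuous_density m Q q \<longleftrightarrow>
     (\<forall>t>0. continuous_on UNIV (\<lambda>(x, y). q t x y) \<and>
        (\<forall>x. integrable m (q t x)) \<and>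
        (\<forall>f\<in>bounded_borel. \<forall>x. Q t f x = (\<integral>y. q t x y * f y \<partial>m)))"

definition density_assumption ::
  "(real \<Rightarrow> 'w \<Rightarrow> 'e::topological_space option) \<Rightarrow> ('e option \<Rightarrow> 'w measure)
     \<Rightarrow> 'e measure \<Rightarrow> (real \<Rightarrow> 'e \<Rightarrow> 'e \<Rightarrow> real) \<Rightarrow> bool" where
  "density_assumption \<xi> Pr m p \<longleftrightarrow>
     sets m = sets borel \<and> sigma_finite_measure m \<and>
     (\<forall>U. open U \<and> U \<noteq> {} \<longrightarrow> 0 < emeasure m U) \<and>
     continuous_density m (motion_semigroup \<xi> Pr) p \<and>
     (\<forall>t>0.
        (\<forall>x y. 0 < p t x y) \<and> (\<exists>C. \<forall>x y. p t x y \<le> C) \<and>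
        (\<forall>x. (\<integral>\<^sup>+y. ennreal (p t y x) \<partial>m) \<le> 1) \<and>
        (\<integral>\<^sup>+y. (\<integral>\<^sup>+x. ennreal ((p t x y)\<^sup>2) \<partial>m) \<partial>m) < \<infinity> \<and>
        continuous_on UNIV (\<lambda>x. \<integral>y. (p t x y)\<^sup>2 \<partial>m) \<and>
        continuous_on UNIV (\<lambda>x. \<integral>y. (p t y x)\<^sup>2 \<partial>m))"

definition pairing :: "'e measure \<Rightarrow> ('e \<Rightarrow> real) \<Rightarrow> ('e \<Rightarrow> real) \<Rightarrow> real" where
  "pairing m f g = (\<integral>x. f x * g x \<partial>m)"

text \<open>The complex space \<open>L\<^sup>2(m)\<close> is represented by square-integrable functions, not by classes; an
  unbounded operator is its graph, a relation compatible with almost everywhere equality.\<close>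

definition sqnorm_L2 :: "'e measure \<Rightarrow> ('e \<Rightarrow> complex) \<Rightarrow> ennreal" where
  "sqnorm_L2 m f = (\<integral>\<^sup>+x. ennreal ((cmod (f x))\<^sup>2) \<partial>m)"

definition L2_space :: "'e measure \<Rightarrow> ('e \<Rightarrow> complex) set" where
  "L2_space m = {f \<in> borel_measurable m. sqnorm_L2 m f < \<infinity>}"

definition generator ::
  "'e measure \<Rightarrow> (real \<Rightarrow> 'e \<Rightarrow> 'e \<Rightarrow> real) \<Rightarrow> (('e \<Rightarrow> complex) \<times> ('e \<Rightarrow> complex)) set" where
  "generator m k = {(f, g). f \<in> L2_space m \<and> g \<in> L2_space m \<and>
     ((\<lambda>t. sqnorm_L2 m (\<lambda>x. ((\<integral>y. complex_of_real (k t x y) * f y \<partial>m) - f x) / complex_of_real t - g x))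
        \<longlongrightarrow> 0) (at_right 0)}"

text \<open>The estimate contains both the injectivity of \<open>z - A\<close> and the boundedness of its inverse.\<close>

definition resolvent_set ::
  "'e measure \<Rightarrow> (('e \<Rightarrow> complex) \<times> ('e \<Rightarrow> complex)) set \<Rightarrow> complex set" where
  "resolvent_set m A = {z.
     (\<forall>h\<in>L2_space m. \<exists>(f, g)\<in>A. AE x in m. z * f x - g x = h x) \<and>
     (\<exists>C::real. \<forall>(f, g)\<in>A. sqnorm_L2 m f \<le> ennreal C * sqnorm_L2 m (\<lambda>x. z * f x - g x))}"

definition spectrum_L2 ::
  "'e measure \<Rightarrow> (('e \<Rightarrow> complex) \<times> ('e \<Rightarrow> complex)) set \<Rightarrow> complex set" where
  "spectrum_L2 m A = - resolvent_set m A"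

text \<open>\<open>F 0\<close> lies in the kernel of \<open>(A - z)\<^sup>n\<close>, as witnessed by \<open>F i = (A - z)\<^sup>i (F 0)\<close>.\<close>

definition generalized_eigenvectors ::
  "'e measure \<Rightarrow> (('e \<Rightarrow> complex) \<times> ('e \<Rightarrow> complex)) set \<Rightarrow> complex \<Rightarrow> ('e \<Rightarrow> complex) set" where
  "generalized_eigenvectors m A z = {f. \<exists>(n::nat) F. F 0 = f \<and>
     (\<forall>i<n. (F i, \<lambda>x. z * F i x + F (Suc i) x) \<in> A) \<and> (AE x in m. F n x = 0)}"

definition multiplicity_one ::
  "'e measure \<Rightarrow> (('e \<Rightarrow> complex) \<times> ('e \<Rightarrow> complex)) set \<Rightarrow> complex \<Rightarrow> bool" where
  "multiplicity_one m A z \<longleftrightarrow>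
     (\<exists>f. (f, \<lambda>x. z * f x) \<in> A \<and> \<not> (AE x in m. f x = 0) \<and>
        (\<forall>g\<in>generalized_eigenvectors m A z. \<exists>c. AE x in m. g x = c * f x))"

text \<open>The supremum is taken in the extended reals, so that it is not arbitrary for empty or
  unbounded spectra.\<close>

definition principal_eigenfunction ::
  "'e::topological_space measure \<Rightarrow> (real \<Rightarrow> 'e \<Rightarrow> 'e \<Rightarrow> real) \<Rightarrow> real \<Rightarrow> ('e \<Rightarrow> real) \<Rightarrow> bool" where
  "principal_eigenfunction m k l \<phi> \<longleftrightarrow>
     ereal l = (SUP z\<in>spectrum_L2 m (generator m k). ereal (Re z)) \<and>
     multiplicity_one m (generator m k) (complex_of_real l) \<and>
     (\<lambda>x. complex_of_real (\<phi> x), \<lambda>x. complex_of_real (l * \<phi> x)) \<in> generator m k \<and>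
     continuous_on UNIV \<phi> \<and> (\<forall>x. 0 < \<phi> x)"

definition principal_eigenpair ::
  "'e::topological_space measure \<Rightarrow> (real \<Rightarrow> 'e \<Rightarrow> 'e \<Rightarrow> real) \<Rightarrow> real \<Rightarrow> ('e \<Rightarrow> real) \<Rightarrow> ('e \<Rightarrow> real) \<Rightarrow> bool" where
  "principal_eigenpair m k l \<phi> \<phi>' \<longleftrightarrow>
     principal_eigenfunction m k l \<phi> \<and>
     principal_eigenfunction m (\<lambda>t x y. k t y x) l \<phi>' \<and>
     pairing m \<phi> \<phi> = 1 \<and> pairing m \<phi> \<phi>' = 1"

definition intrinsically_ultracontractive ::
  "(real \<Rightarrow> 'e \<Rightarrow> 'e \<Rightarrow> real) \<Rightarrow> ('e \<Rightarrow> real) \<Rightarrow> ('e \<Rightarrow> real) \<Rightarrow> bool" where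
  "intrinsically_ultracontractive p \<phi> \<phi>' \<longleftrightarrow>
     (\<forall>t>0. \<exists>c>0. \<forall>x y. p t x y \<le> c * \<phi> x * \<phi>' y)"


section \<open>Notions in the conclusion\<close>

definition survival_probability ::
  "(real \<Rightarrow> 'v \<Rightarrow> 'e measure) \<Rightarrow> ('e measure \<Rightarrow> 'v measure) \<Rightarrow> 'e measure \<Rightarrow> real \<Rightarrow> real" where
  "survival_probability X P \<mu> t = \<P>(\<omega> in P \<mu>. total_mass (X t \<omega>) \<noteq> 0)"

definition survival_conditioned ::
  "(real \<Rightarrow> 'v \<Rightarrow> 'e measure) \<Rightarrow> ('e measure \<Rightarrow> 'v measure) \<Rightarrow> 'e measure \<Rightarrow> real \<Rightarrow> 'v measure" where
  "survival_conditioned X P \<mu> t =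
     uniform_measure (P \<mu>) {\<omega> \<in> space (P \<mu>). total_mass (X t \<omega>) \<noteq> 0}"

definition regularly_varying :: "(real \<Rightarrow> real) \<Rightarrow> real \<Rightarrow> bool" where
  "regularly_varying h \<alpha> \<longleftrightarrow>
     h \<in> borel_measurable (restrict_space borel {0<..}) \<and> (\<forall>t>0. 0 < h t) \<and>
     (\<forall>u>0. ((\<lambda>t. h (u * t) / h t) \<longlongrightarrow> u powr \<alpha>) at_top)"

definition C_X ::
  "'e measure \<Rightarrow> ('e \<Rightarrow> real) \<Rightarrow> ('e \<Rightarrow> real) \<Rightarrow> ('e \<Rightarrow> real) \<Rightarrow> ('e \<Rightarrow> real) \<Rightarrow> real" where
  "C_X m \<kappa> \<gamma> \<phi> \<phi>' =
     pairing m (\<lambda>x. indicator {x. \<gamma> x = ess_inf m \<gamma>} x * \<kappa> x * \<phi> x powr ess_inf m \<gamma>) \<phi>'"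

definition eta ::
  "'e measure \<Rightarrow> ('e \<Rightarrow> real) \<Rightarrow> ('e \<Rightarrow> real) \<Rightarrow> ('e \<Rightarrow> real) \<Rightarrow> ('e \<Rightarrow> real) \<Rightarrow> real \<Rightarrow> real" where
  "eta m \<kappa> \<gamma> \<phi> \<phi>' t =
     (C_X m \<kappa> \<gamma> \<phi> \<phi>' * (ess_inf m \<gamma> - 1) * t) powr (- 1 / (ess_inf m \<gamma> - 1))"

text \<open>\<open>Z\<close> is the law of the positive random variable with parameter \<open>a\<close>. In Isabelle \<open>0 powr (- a)\<close>
  is \<open>0\<close>, whereas the formula means \<open>\<infinity>\<close> there, so \<open>u = 0\<close> is treated separately.\<close>

definition limit_law :: "real \<Rightarrow> real measure \<Rightarrow> bool" where
  "limit_law a Z \<longleftrightarrow> real_distribution Z \<and> (AE z in Z. 0 < z) \<and>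
     (\<forall>u\<ge>0. (\<integral>z. exp (- u * z) \<partial>Z) =
        (if u = 0 then 1 else 1 - (1 + u powr (- a)) powr (- 1 / a)))"

text \<open>Weak convergence as time tends to infinity, along all sequences of times.\<close>

definition weak_conv_at_top :: "(real \<Rightarrow> real measure) \<Rightarrow> real measure \<Rightarrow> bool" where
  "weak_conv_at_top M L \<longleftrightarrow>
     (\<forall>t :: nat \<Rightarrow> real. filterlim t at_top sequentially \<longrightarrow> weak_conv_m (\<lambda>n. M (t n)) L)"

end

theory Submission
 imports Defs "HOL-Real_Asymp.Real_Asymp"
begin

text \<open>By Laplace duality the survival probability is \<open>1 - exp (- \<mu>(w\<^sub>t))\<close>, where \<open>w\<close> is the increasing limit
 of the solutions \<open>V\<^sub>t \<theta>\<close> as the constant \<open>\<theta>\<close> tends to infinity; \<open>w\<^sub>t\<close> is finite for \<open>t > 0\<close> because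
 \<open>\<kappa>\<close> is bounded below. Duhamel's formula rewrites the equation of \<open>V\<close> with the Feynman-Kac semigroup,
 whose kernel lies between multiples of \<open>\<phi>(x) \<phi>'(y)\<close> by intrinsic ultracontractivity and converges to it
 uniformly in the relative sense. Hence a small solution \<open>v\<close> has the shape \<open>a\<^sub>t \<phi>\<close> with
 \<open>a\<^sub>t = (v\<^sub>t, \<phi>')\<close>, and \<open>a\<close> asymptotically solves \<open>a' = - G a\<close> with \<open>G z = (\<kappa> (z \<phi>) powr \<gamma>, \<phi>')\<close>. The function
 \<open>G\<close> is regularly varying at 0 with index \<open>\<gamma>\<^sub>0\<close>, which gives the regular variation of \<open>a\<close>; if
 \<open>\<gamma> = \<gamma>\<^sub>0\<close> has positive measure, then \<open>G z \<sim> C\<^sub>X z powr \<gamma>\<^sub>0\<close>, so that \<open>a\<^sub>t \<sim> \<eta>\<^sub>t\<close>. Since \<open>a\<^sub>t powr (1 - \<gamma>\<^sub>0)\<close> grows linearly at a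
 rate which is uniform over small initial values, the same argument applied to \<open>V\<^sub>t (u \<eta>\<^sub>t f)\<close>
 yields the conditional Laplace transform.\<close>

text \<open>As \<open>\<gamma>\<close> varies over the space, the equation has no scaling, and
  different powers act at different points; only after the collapse onto the one coordinate along
  \<open>ph\<close> does a scalar equation appear. Its solution is never differentiated: increments
  of \<open>a v\<close> are compared with \<open>G\<close>, and a primitive of
  \<open>- 1 / G\<close>, evaluated along \<open>a v\<close>, is shown to grow at a rate close to 1.
  Regular variation and the sharp constant are then both matters of inverting that primitive. In the
  conditional limit the initial value depends on the final time, so no estimate about one fixed
  solution suffices; waiting time and smallness threshold have to be chosen before the solution.
  Three facts are not given but derived: the lower bound for the kernel (ultracontractivity is
  one-sided), the pointwise invariance of the eigenfunctions (the generator lives in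
  \<open>L2\<close> and sees time 0 only), and the existence of the limit law, which arises from the
  conditioned laws themselves. The equation is analysed for abstract semigroups; process and
  equation meet only in the Laplace functional.\<close>

notation borel_measurable ("\<B>")
notation LIMSEQ ("((_)/ ----> (_))" [60, 60] 60)
notation tendsto (infixr "--->" 55)

abbreviation borel2 :: "('a::topological_space \<times> 'b::topological_space) measure" where
 "borel2 == borel \<Otimes>\<^sub>M borel"

lemmas set_integral_cong = set_lebesgue_integral_cong
 and bochner_cong = Bochner_Integration.integral_cong

section \<open>Integrals, increments and scalar differential inequalities on compact
  intervals\<close>

lemma set_integrable_Icc_bounded:
 fixes f :: "real => real"
 assumes [measurable]: "f : \<B> borel" and bd: "!!x. a <= x ==> x <= b ==> \<bar>f x\<bar> <= C"
 shows "set_integrable lborel {a..b} f"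
proof -
 have "integrable lborel (%x. indicator {a..b} x *\<^sub>R f x)"
 proof (rule integrableI_bounded_set[where A="{a..b}" and B=C])
  show "emeasure lborel {a..b} < \<infinity>"
   by (cases "a <= b") auto
  show "AE x\<in>{a..b} in lborel. norm (indicator {a..b} x *\<^sub>R f x) <= C"
   using bd by auto
 qed auto
 thus ?thesis by (simp add: set_integrable_def)
qed

lemma set_integral_Icc_split:
 fixes f :: "real => real"
 assumes [measurable]: "f : \<B> borel" and bd: "!!x. a <= x ==> x <= c ==> \<bar>f x\<bar> <= C"
  and "a <= b" "b <= c"
 shows "(LBINT x:{a..c}. f x) = (LBINT x:{a..b}. f x) + (LBINT x:{b..c}. f x)"
proof -
 have "{a..c} = {a..b} \<union> {b..c}" using assms by auto
 moreover have "(LINT x:{a..b} \<union> {b..c}|lborel. f x) = (LBINT x:{a..b}. f x) + (LBINT x:{b..c}. f x)"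
 proof (rule set_integral_Un_AE)
  show "AE x in lborel. \<not> (x : {a..b} \<and> x : {b..c})"
   using AE_lborel_singleton[of b] by eventually_elim auto
  show "set_integrable lborel {a..b} f" "set_integrable lborel {b..c} f"
   using assms by (auto intro!: set_integrable_Icc_bounded[where C=C])
 qed auto
 ultimately show ?thesis by simp
qed

lemma set_integral_Icc_bound:
 fixes f :: "real => real"
 assumes [measurable]: "f : \<B> borel" and bd: "!!x. a <= x ==> x <= b ==> \<bar>f x\<bar> <= C"
  and "a <= b"
 shows "\<bar>LBINT x:{a..b}. f x\<bar> <= C * (b - a)"
proof -
 have "\<bar>LBINT x:{a..b}. f x\<bar> <= (LBINT x:{a..b}. \<bar>f x\<bar>)"
  using set_integral_norm_bound[OF set_integrable_Icc_bounded[of f a b C]] assms by auto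
 also have "... <= (LBINT x:{a..b}. C)"
  using assms by (intro set_integral_mono set_integrable_Icc_bounded[where C=C]
   set_integrable_Icc_bounded[where C="\<bar>C\<bar>"]) auto
 also have "... = C * (b - a)"
  using \<open>a <= b\<close> by (simp add: set_lebesgue_integral_def)
 finally show ?thesis .
qed

text \<open>The left endpoint is excluded from both bounds because the integrand is often controlled
  at positive times only: the semigroup has a density, and hence respects almost everywhere
  inequalities, only there.\<close>

lemma set_integral_Icc_between:
 fixes f :: "real => real"
 assumes [measurable]: "f : \<B> borel" and bd: "!!x. a <= x ==> x <= b ==> \<bar>f x\<bar> <= C"
  and "a <= b"
 shows "(!!x. a < x ==> x <= b ==> l <= f x) ==> l * (b - a) <= (LBINT x:{a..b}. f x)"
  and "(!!x. a < x ==> x <= b ==> f x <= u) ==> (LBINT x:{a..b}. f x) <= u * (b - a)"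
proof -
 have i: "integrable lborel (%x. indicator {a..b} x *\<^sub>R f x)"
  using set_integrable_Icc_bounded[of f a b C] bd by (simp add: set_integrable_def)
 have c: "(LBINT x:{a..b}. k) = k * (b - a)" "integrable lborel (%x. indicator {a..b} x *\<^sub>R k)" for k :: real
  using \<open>a <= b\<close> set_integrable_Icc_bounded[of "%_. k" a b "\<bar>k\<bar>"]
  by (simp_all add: set_lebesgue_integral_def set_integrable_def)
 show "l * (b - a) <= (LBINT x:{a..b}. f x)" if "!!x. a < x ==> x <= b ==> l <= f x"
  unfolding c(1)[symmetric] set_lebesgue_integral_def
 proof (rule integral_mono_AE[OF c(2) i])
  show "AE x in lborel. indicator {a..b} x *\<^sub>R l <= indicator {a..b} x *\<^sub>R f x"
   using AE_lborel_singleton[of a] by eventually_elim (use that in \<open>auto simp: indicator_def\<close>)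
 qed
 show "(LBINT x:{a..b}. f x) <= u * (b - a)" if "!!x. a < x ==> x <= b ==> f x <= u"
  unfolding c(1)[symmetric] set_lebesgue_integral_def
 proof (rule integral_mono_AE[OF i c(2)])
  show "AE x in lborel. indicator {a..b} x *\<^sub>R f x <= indicator {a..b} x *\<^sub>R u"
   using AE_lborel_singleton[of a] by eventually_elim (use that in \<open>auto simp: indicator_def\<close>)
 qed
qed

lemma borel_measurable_set_integral_Icc:
 fixes f :: "'a => real => real"
 assumes f [measurable]: "(%(x, r). f x r) : \<B> (M \<Otimes>\<^sub>M borel)"
  and [measurable]: "g : \<B> M" "h : \<B> M"
 shows "(%x. LBINT r:{g x..h x}. f x r) : \<B> M"
 unfolding set_lebesgue_integral_def
proof (rule lborel.borel_measurable_lebesgue_integral)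
 have "(%(x, r). (if g x <= r \<and> r <= h x then 1 else 0) * f x r) : \<B> (M \<Otimes>\<^sub>M borel)"
  by measurable
 also have "(%(x, r). (if g x <= r \<and> r <= h x then 1 else 0) * f x r) =
  (%(x, r). indicator {g x..h x} r *\<^sub>R f x r)"
  by (auto simp: fun_eq_iff indicator_def)
 also have "\<B> (M \<Otimes>\<^sub>M borel) = (\<B> (M \<Otimes>\<^sub>M lborel) :: ('a \<times> real => real) set)"
  by (intro measurable_cong_sets sets_pair_measure_cong) auto
 finally show "(%(x, r). indicator {g x..h x} r *\<^sub>R f x r) : \<B> (M \<Otimes>\<^sub>M lborel)" .
qed

text \<open>Subdivision: \<open>Bolzano\<close> adds up the bounds of short intervals, so the total
  increment is at most \<open>e\<close> times the length, for every \<open>e\<close>. The lemma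
  stands in for differentiation where a derivative exists only almost everywhere or in mean
  square.\<close>

lemma constant_of_small_increments:
 fixes g :: "real => real"
 assumes ab: "a <= b" and small: "!!e. 0 < e ==> \<exists>d>0. \<forall>x y. a <= x --> x <= y --> y <= b --> y - x < d --> \<bar>g y - g x\<bar> <= e * (y - x)"
 shows "g b = g a"
proof -
 have le: "\<bar>g b - g a\<bar> <= e * (b - a)" if e: "e > 0" for e
 proof -
  obtain d where d: "0 < d" "\<forall>x y. a <= x --> x <= y --> y <= b --> y - x < d --> \<bar>g y - g x\<bar> <= e * (y - x)"
   using small[OF e] by blast
  have "a <= a --> a <= b --> b <= b --> \<bar>g b - g a\<bar> <= e * (b - a)"
  proof (rule Bolzano[where P="%x y. a <= x --> x <= y --> y <= b --> \<bar>g y - g x\<bar> <= e * (y - x)", OF ab])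
   show "\<exists>d>0. \<forall>y z. y <= x \<and> x <= z \<and> z - y < d --> (a <= y --> y <= z --> z <= b --> \<bar>g z - g y\<bar> <= e * (z - y))" for x
    using d by blast
  qed (auto simp: algebra_simps)
  thus ?thesis using ab by simp
 qed
 show ?thesis
 proof (rule ccontr)
  assume ne: "g b ~= g a"
  hence "a < b" using ab by (cases "a = b") auto
  \<comment> \<open>Half the average slope, which contradicts the bound \<open>le\<close> at this
    very slope.\<close>
  define c q where "c = b - a" and "q = \<bar>g b - g a\<bar> / (2 * c)"
  have c: "0 < c" using \<open>a < b\<close> by (simp add: c_def)
  hence q: "q * c = \<bar>g b - g a\<bar> / 2" "0 < q" using ne by (auto simp: q_def)
  show False using le[OF q(2)] ne unfolding c_def[symmetric] q(1) by simp
 qed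
qed

lemma constant_of_quadratic_increments:
 fixes g :: "real => real"
 assumes "a <= b" and quad: "!!x y. a <= x ==> x <= y ==> y <= b ==> \<bar>g y - g x\<bar> <= C * (y - x)^2"
 shows "g b = g a"
proof (rule constant_of_small_increments[OF assms(1)])
 fix e :: real assume e: "0 < e"
 have "\<bar>g y - g x\<bar> <= e * (y - x)" if "a <= x" "x <= y" "y <= b" "y - x < e / (\<bar>C\<bar> + 1)" for x y
 proof -
  have "C * (y - x) <= (\<bar>C\<bar> + 1) * (y - x)" using that by (intro mult_right_mono) auto
  also have "... <= e" using that(4) by (simp add: pos_less_divide_eq mult.commute less_imp_le)
  finally have "C * (y - x) * (y - x) <= e * (y - x)" using that by (intro mult_right_mono) auto
  thus ?thesis using quad[OF that(1-3)] by (simp add: power2_eq_square mult.assoc)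
 qed
 thus "\<exists>d>0. \<forall>x y. a <= x --> x <= y --> y <= b --> y - x < d --> \<bar>g y - g x\<bar> <= e * (y - x)"
  using e by (intro exI[of _ "e / (\<bar>C\<bar> + 1)"]) auto
qed

lemma exp_minus_affine_bound:
 fixes x :: real
 assumes "\<bar>x\<bar> <= R"
 shows "\<bar>exp x - 1 - x\<bar> <= exp R * x^2" "\<bar>exp x - 1\<bar> <= exp R * \<bar>x\<bar>"
proof -
 obtain t where t: "\<bar>t\<bar> <= \<bar>x\<bar>" "exp x = (\<Sum>m<1. x ^ m / fact m) + exp t / fact 1 * x ^ 1"
  using Maclaurin_exp_le[of x 1] by auto
 have "exp t <= exp R" using t assms by simp
 thus "\<bar>exp x - 1\<bar> <= exp R * \<bar>x\<bar>"
  using t by (auto simp: abs_mult intro!: mult_right_mono)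
 obtain t where t: "\<bar>t\<bar> <= \<bar>x\<bar>" "exp x = (\<Sum>m<2. x ^ m / fact m) + exp t / fact 2 * x ^ 2"
  using Maclaurin_exp_le[of x 2] by auto
 have "exp t <= exp R" using t assms by simp
 hence "exp t / 2 <= exp R" by (smt (verit) exp_gt_zero field_sum_of_halves)
 moreover have "exp x - 1 - x = exp t / 2 * x^2"
  using t by (simp add: numeral_2_eq_2)
 moreover have "\<bar>exp t / 2 * x^2\<bar> = exp t / 2 * x^2" by simp
 ultimately show "\<bar>exp x - 1 - x\<bar> <= exp R * x^2"
  using mult_right_mono[of "exp t / 2" "exp R" "x^2"] by (metis zero_le_power2)
qed

text \<open>The exponent is a Lipschitz function of its upper limit, but as \<open>b\<close> is
  merely measurable it need not be differentiable everywhere, so the chain rule is replaced by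
  second-order estimates of increments. The identity is applied to each path of the motion in the
  Duhamel formula.\<close>

lemma exp_set_integral:
 fixes b :: "real => real"
 assumes [measurable]: "b : \<B> borel" and bd: "!!s. \<bar>b s\<bar> <= B" and t: "0 <= t"
 shows "exp (LBINT s:{0..t}. b s) =
  1 + (LBINT s:{0..t}. b s * exp (LBINT r:{0..s}. b r))"
proof -
 define A where "A s = (LBINT r:{0..s}. b r)" for s
 have [measurable]: "A : \<B> borel"
  unfolding A_def by (rule borel_measurable_set_integral_Icc) measurable
 have B: "0 <= B" using bd[of 0] by auto
 define R where "R = B * t"
 have Ab: "\<bar>A s\<bar> <= R" if "0 <= s" "s <= t" for s
 proof -
  have "\<bar>A s\<bar> <= B * (s - 0)" unfolding A_def
   using that bd by (intro set_integral_Icc_bound) auto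
  also have "... <= B * t" using that B by (simp add: mult_left_mono)
  finally show ?thesis by (simp add: R_def)
 qed
 have Ad: "A y - A x = (LBINT r:{x..y}. b r)" "\<bar>A y - A x\<bar> <= B * (y - x)"
  if "0 <= x" "x <= y" for x y
 proof -
  show *: "A y - A x = (LBINT r:{x..y}. b r)"
   using set_integral_Icc_split[of b 0 y B x] that bd by (simp add: A_def)
  show "\<bar>A y - A x\<bar> <= B * (y - x)"
   unfolding * using that bd by (intro set_integral_Icc_bound) auto
 qed
 have R: "0 <= R" using B t by (simp add: R_def)
 define h where "h s = b s * exp (A s)" for s
 have [measurable]: "h : \<B> borel" unfolding h_def by measurable
 have hb: "\<bar>h s\<bar> <= B * exp R" if "0 <= s" "s <= t" for s
  using Ab[OF that] bd[of s] B by (auto simp: h_def abs_mult intro!: mult_mono)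
 define g where "g s = exp (A s) - (LBINT r:{0..s}. h r)" for s
 \<comment> \<open>Over a short interval both \<open>exp (A s)\<close> and the integral of
   \<open>h\<close> move by \<open>exp (A x) * (A y - A x)\<close>, each up to a multiple of the
   squared length: fact 2 is Taylor's formula for \<open>exp\<close>, fact 3 freezes the factor
   \<open>exp (A r)\<close> at the left end.\<close>
 have "g t = g 0"
 proof (rule constant_of_quadratic_increments[where C="exp R * exp R * B^2 + exp R * exp R * B^2", OF t])
  fix x y assume xy: "0 <= x" "x <= y" "y <= t"
  have 1: "(LBINT r:{0..y}. h r) = (LBINT r:{0..x}. h r) + (LBINT r:{x..y}. h r)"
   using xy hb by (intro set_integral_Icc_split[where C="B * exp R"]) auto
  have dA: "\<bar>A y - A x\<bar> <= R"
   using Ad(2)[OF xy(1,2)] xy mult_left_mono[of "y - x" t B] B by (simp add: R_def)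
  have 2: "\<bar>exp (A y) - exp (A x) - exp (A x) * (A y - A x)\<bar> <= exp R * exp R * B^2 * (y - x)^2"
  proof -
   have "exp (A y) - exp (A x) - exp (A x) * (A y - A x)
     = exp (A x) * (exp (A y - A x) - 1 - (A y - A x))"
    by (simp add: algebra_simps exp_diff)
   also have "\<bar>...\<bar> <= exp R * (exp R * (A y - A x)^2)"
    unfolding abs_mult using Ab[of x] xy dA exp_minus_affine_bound(1)[OF dA]
    by (intro mult_mono) auto
   also have "(A y - A x)^2 <= (B * (y - x))^2"
    using Ad(2)[OF xy(1,2)] by (rule power2_le_iff_abs_le[THEN iffD2, rotated])
     (use B xy in auto)
   finally show ?thesis by (simp only: power_mult_distrib mult.assoc mult_left_mono exp_ge_zero)
  qed
  have i1: "set_integrable lborel {x..y} h"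
   using hb xy by (intro set_integrable_Icc_bounded[where C="B * exp R"]) auto
  have i2: "set_integrable lborel {x..y} (%r. exp (A x) * b r)"
   using bd xy by (intro set_integrable_Icc_bounded[where C="exp (A x) * B"]) (auto simp: abs_mult)
  have "(LBINT r:{x..y}. h r) - exp (A x) * (A y - A x)
   = (LBINT r:{x..y}. h r - exp (A x) * b r)"
   using Ad(1)[OF xy(1,2)] set_integral_diff(2)[OF i1 i2] by simp
  also have "\<bar>...\<bar> <= (exp R * exp R * B^2 * (y - x)) * (y - x)"
  proof (rule set_integral_Icc_bound)
   fix r assume r: "x <= r" "r <= y"
   have dAr: "\<bar>A r - A x\<bar> <= B * (y - x)"
    using Ad(2)[of x r] xy r B by (smt (verit) mult_left_mono)
   hence dAR: "\<bar>A r - A x\<bar> <= R"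
    using xy mult_left_mono[of "y - x" t B] B by (simp add: R_def)
   have "h r - exp (A x) * b r = b r * (exp (A x) * (exp (A r - A x) - 1))"
    by (simp add: h_def algebra_simps exp_diff)
   also have "\<bar>...\<bar> <= B * (exp R * (exp R * (B * (y - x))))"
    unfolding abs_mult
   proof (intro mult_mono)
    show "\<bar>exp (A r - A x) - 1\<bar> <= exp R * (B * (y - x))"
     using exp_minus_affine_bound(2)[OF dAR] dAr by (smt (verit) exp_ge_zero mult_left_mono)
   qed (use bd Ab[of x] xy B in auto)
   finally show "\<bar>h r - exp (A x) * b r\<bar> <= exp R * exp R * B^2 * (y - x)"
    by (simp add: algebra_simps power2_eq_square)
  qed (use xy in auto)
  finally have 3: "\<bar>(LBINT r:{x..y}. h r) - exp (A x) * (A y - A x)\<bar> <= exp R * exp R * B^2 * (y - x)^2"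
   by (simp add: power2_eq_square algebra_simps)
  show "\<bar>g y - g x\<bar> <= (exp R * exp R * B^2 + exp R * exp R * B^2) * (y - x)^2"
   using 2 3 unfolding g_def 1 distrib_right by linarith
 qed
 moreover have "g 0 = 1"
 proof -
  have "(LBINT r:{0..0}. f r) = 0" for f :: "real => real"
   unfolding set_lebesgue_integral_def
   by (intro integral_eq_zero_AE) (use AE_lborel_singleton[of 0] in \<open>eventually_elim, auto\<close>)
  thus ?thesis by (simp add: g_def A_def)
 qed
 ultimately show ?thesis by (simp add: g_def h_def A_def)
qed

text \<open>Integrated form of \<open>- L * G a <= a' <= - l * G a\<close>: as \<open>Ph\<close> is
  a primitive of \<open>- 1 / G\<close>, the function \<open>Ph\<close> along \<open>a\<close> has
  slope between \<open>l\<close> and \<open>L\<close>. Increments are bounded with \<open>G\<close>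
  at the end of the interval where each bound is weakest, which is all that monotone estimates of
  \<open>a\<close> can supply; no derivative of \<open>a\<close> enters.\<close>

lemma decrease_rate:
 fixes a G Ph :: "real => real"
 assumes st: "s <= t"
  and apos: "!!x. s <= x ==> x <= t ==> 0 < a x"
  and Gpos: "!!z. 0 < z ==> 0 < G z"
  and Gmono: "!!y z. 0 < y ==> y <= z ==> G y <= G z"
  and Gcont: "!!z. 0 < z ==> isCont G z"
  and deriv: "!!z. 0 < z ==> (Ph has_real_derivative - (1 / G z)) (at z)"
  and l: "0 <= l" "0 <= L"
  and lower: "!!x y. s <= x ==> x <= y ==> y <= t ==> l * (y - x) * G (a y) <= a x - a y"
  and upper: "!!x y. s <= x ==> x <= y ==> y <= t ==> a x - a y <= L * (y - x) * G (a x)"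
 shows "l * (t - s) <= Ph (a t) - Ph (a s)" "Ph (a t) - Ph (a s) <= L * (t - s)"
proof -
 have dec: "a y <= a x" if "s <= x" "x <= y" "y <= t" for x y
 proof -
  have "0 <= l * (y - x) * G (a y)" using that l apos[of y] Gpos[of "a y"] by auto
  thus ?thesis using lower[OF that] by linarith
 qed
 have lip: "\<bar>a y - a x\<bar> <= L * G (a s) * \<bar>y - x\<bar>" if "x : {s..t}" "y : {s..t}" for x y
 proof -
  have *: "\<bar>a y - a x\<bar> <= L * G (a s) * \<bar>y - x\<bar>" if "s <= x" "x <= y" "y <= t" for x y
  proof -
   have "\<bar>a y - a x\<bar> = a x - a y" using dec[OF that] by simp
   also have "... <= L * (y - x) * G (a x)" using upper[OF that] .
   also have "... <= L * (y - x) * G (a s)"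
    using that l by (intro mult_left_mono Gmono dec apos) auto
   finally show ?thesis using that by (simp add: mult_ac)
  qed
  show ?thesis
  proof (cases "x <= y")
   case True thus ?thesis using * that by auto
  next
   case False thus ?thesis using *[of y x] that by (auto simp: abs_minus_commute)
  qed
 qed
 have acont: "continuous_on {s..t} a"
  by (rule lipschitz_on_continuous_on[where L="L * G (a s)"], rule lipschitz_onI)
   (use lip l Gpos[of "a s"] apos[of s] st in \<open>auto simp: dist_real_def abs_minus_commute\<close>)
 have Gacont: "continuous_on {s..t} (%x. G (a x))"
 proof (rule continuous_on_compose2[OF _ acont])
  show "continuous_on {0<..} G" using Gcont by (auto intro: continuous_at_imp_continuous_on)
  show "a ` {s..t} \<subseteq> {0<..}" using apos by auto
 qed
 \<comment> \<open>A factor \<open>z < 1\<close> absorbs the oscillation of \<open>G\<close> along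
   \<open>a\<close> on a short interval; it is removed at the very end by letting \<open>z\<close>
   tend to 1.\<close>
 have main: "z * l * (t - s) <= Ph (a t) - Ph (a s) \<and> z * (Ph (a t) - Ph (a s)) <= L * (t - s)" if z: "0 < z" "z < 1" for z
 proof -
  have "s <= s --> t <= t --> s <= t --> z * l * (t - s) <= Ph (a t) - Ph (a s) \<and> z * (Ph (a t) - Ph (a s)) <= L * (t - s)"
  proof (rule Bolzano[where P="%x y. s <= x --> y <= t --> x <= y -->
    z * l * (y - x) <= Ph (a y) - Ph (a x) \<and> z * (Ph (a y) - Ph (a x)) <= L * (y - x)"])
   show "s <= t" by fact
   fix u v w :: real
   assume "s <= u --> v <= t --> u <= v --> z * l * (v - u) <= Ph (a v) - Ph (a u) \<and> z * (Ph (a v) - Ph (a u)) <= L * (v - u)"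
    "s <= v --> w <= t --> v <= w --> z * l * (w - v) <= Ph (a w) - Ph (a v) \<and> z * (Ph (a w) - Ph (a v)) <= L * (w - v)"
    "u <= v" "v <= w"
   thus "s <= u --> w <= t --> u <= w --> z * l * (w - u) <= Ph (a w) - Ph (a u) \<and> z * (Ph (a w) - Ph (a u)) <= L * (w - u)"
    by (auto simp: algebra_simps)
  next
   fix x0 assume x0: "s <= x0" "x0 <= t"
   define g0 where "g0 = G (a x0)"
   have g0: "0 < g0" using Gpos apos x0 by (auto simp: g0_def)
   \<comment> \<open>The two thresholds lie on either side of \<open>g0\<close> and have quotient
     \<open>z\<close>, so near \<open>x0\<close> any two values of \<open>G\<close> along
     \<open>a\<close> differ at most by the factor \<open>z\<close>.\<close>
   have "g0 * (2 / (1 + z)) > g0" using g0 z by (simp add: field_simps)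
   moreover have "g0 * (2 * z / (1 + z)) < g0" using g0 z by (simp add: field_simps)
   moreover have "((%x. G (a x)) ---> g0) (at x0 within {s..t})"
    using Gacont x0 by (auto simp: continuous_on_def g0_def)
   ultimately have "eventually (%x. G (a x) < g0 * (2 / (1 + z)) \<and> g0 * (2 * z / (1 + z)) < G (a x)) (at x0 within {s..t})"
    by (auto intro!: eventually_conj dest: order_tendstoD)
   then obtain d where d: "d > 0" "!!x. x : {s..t} ==> x ~= x0 ==> dist x x0 < d ==>
     G (a x) < g0 * (2 / (1 + z)) \<and> g0 * (2 * z / (1 + z)) < G (a x)"
    unfolding eventually_at by auto
   have dd: "G (a x) <= g0 * (2 / (1 + z)) \<and> g0 * (2 * z / (1 + z)) <= G (a x)"
    if "x : {s..t}" "dist x x0 < d" for x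
    using d(2)[of x] that \<open>g0 * (2 / (1 + z)) > g0\<close> \<open>g0 * (2 * z / (1 + z)) < g0\<close>
    by (cases "x = x0") (auto simp: g0_def)
   show "\<exists>d>0. \<forall>x y. x <= x0 \<and> x0 <= y \<and> y - x < d --> s <= x --> y <= t --> x <= y -->
    z * l * (y - x) <= Ph (a y) - Ph (a x) \<and> z * (Ph (a y) - Ph (a x)) <= L * (y - x)"
   proof (intro exI[of _ d] conjI \<open>d > 0\<close> allI impI; elim conjE)
    fix x y assume xy: "x <= x0" "x0 <= y" "y - x < d" "s <= x" "y <= t" "x <= y"
    have r: "z * G (a x) <= G (a y)"
    proof -
     have "z * G (a x) <= z * (g0 * (2 / (1 + z)))"
      using dd[of x] xy z by (intro mult_left_mono) (auto simp: dist_real_def)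
     also have "... = g0 * (2 * z / (1 + z))" by simp
     also have "... <= G (a y)" using dd[of y] xy by (auto simp: dist_real_def)
     finally show ?thesis .
    qed
    have ay: "0 < a y" "0 < a x" "a y <= a x" using apos xy dec by auto
    have Gy: "0 < G (a y)" "0 < G (a x)" using ay Gpos by auto
    \<comment> \<open>Mean value theorem; by monotonicity \<open>G xi\<close> lies between
      \<open>G (a y)\<close> and \<open>G (a x)\<close>, which are comparable up to
      \<open>z\<close>.\<close>
    obtain xi where xi: "a y <= xi" "xi <= a x" "Ph (a y) - Ph (a x) = (a x - a y) / G xi"
    proof (cases "a y = a x")
     case True thus ?thesis using that[of "a x"] by simp
    next
     case False
     hence "a y < a x" using ay by simp
     then obtain c where "a y < c" "c < a x" "Ph (a x) - Ph (a y) = (a x - a y) * - (1 / G c)"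
      using MVT2[of "a y" "a x" Ph "%z. - (1 / G z)"] deriv ay by fastforce
     thus ?thesis using that[of c] by (auto simp: field_simps)
    qed
    have Gxi: "G (a y) <= G xi" "G xi <= G (a x)" "0 < G xi"
     using xi ay Gmono Gpos by auto
    have "z * l * (y - x) * G xi <= z * l * (y - x) * G (a x)"
     using z l xy Gxi by (intro mult_left_mono) auto
    also have "... = l * (y - x) * (z * G (a x))" by simp
    also have "... <= l * (y - x) * G (a y)"
     using l xy r by (intro mult_left_mono) auto
    also have "... <= a x - a y" using lower xy by auto
    finally have 1: "z * l * (y - x) <= (a x - a y) / G xi"
     using Gxi by (simp add: pos_le_divide_eq)
    have "z * (a x - a y) <= z * (L * (y - x) * G (a x))"
     using upper[of x y] xy z by (intro mult_left_mono) auto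
    also have "... = L * (y - x) * (z * G (a x))" by simp
    also have "... <= L * (y - x) * G xi"
     using l xy r Gxi by (intro mult_left_mono) auto
    finally have 2: "z * ((a x - a y) / G xi) <= L * (y - x)"
     using Gxi by (simp add: pos_divide_le_eq)
    show "z * l * (y - x) <= Ph (a y) - Ph (a x)" "z * (Ph (a y) - Ph (a x)) <= L * (y - x)"
     using 1 2 xi(3) by auto
   qed
  qed
  thus ?thesis using st by auto
 qed
 show "l * (t - s) <= Ph (a t) - Ph (a s)"
  by (rule field_le_mult_one_interval) (use main in \<open>auto simp: mult_ac\<close>)
 show "Ph (a t) - Ph (a s) <= L * (t - s)"
  by (rule field_le_mult_one_interval) (use main in auto)
qed

text \<open>\<open>a\<close> is an asymptotic inverse of \<open>Ph\<close>, because
  \<open>Ph (a t)\<close> behaves like \<open>t\<close>. The ratio \<open>a (u * t) / a t\<close> is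
  compared with a constant \<open>c\<close> by applying the decreasing function \<open>Ph\<close>:
  \<open>Ph (a (u * t)) / t\<close> tends to \<open>u\<close> and \<open>Ph (c * a t) / t\<close> to
  \<open>c powr (1 - g)\<close>, and these limits agree precisely for the claimed
  \<open>c\<close>.\<close>

lemma regularly_varying_inverse:
 fixes a G Ph :: "real => real"
 assumes g: "1 < g"
  and Gpos: "!!z. 0 < z ==> 0 < G z"
  and Grv: "!!u. 0 < u ==> ((%z. G (u * z) / G z) ---> u powr g) (at_right 0)"
  and deriv: "!!z. 0 < z ==> (Ph has_real_derivative - (1 / G z)) (at z)"
  and apos: "!!t. 0 < t ==> 0 < a t"
  and a0: "(a ---> 0) at_top"
  and Pha: "((%t. Ph (a t) / t) ---> 1) at_top"
  and u: "0 < u"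
 shows "((%t. a (u * t) / a t) ---> u powr - (1 / (g - 1))) at_top"
proof -
 have Phdec: "Ph z < Ph y" if "0 < y" "y < z" for y z
 proof (rule DERIV_neg_imp_decreasing[OF that(2)])
  fix x assume "y <= x" "x <= z"
  thus "\<exists>y. DERIV Ph x :> y \<and> y < 0"
   using deriv[of x] Gpos[of x] that by (intro exI[of _ "- (1 / G x)"]) auto
 qed
 have Phdec': "Ph z <= Ph y" if "0 < y" "y <= z" for y z
  using Phdec[of y z] that by (cases "y = z") auto
 have at0: "filterlim a (at_right 0) at_top"
  unfolding filterlim_at using a0 eventually_mono[OF eventually_gt_at_top[of 0], of "%t. a t : {0<..} \<and> a t ~= 0"] apos
  by (simp add: less_le)
 have Phinf: "filterlim Ph at_top (at_right 0)"
  unfolding filterlim_at_top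
 proof
  fix Z :: real
  have "eventually (%t. Ph (a t) / t > 1 / 2) at_top"
   using order_tendstoD(1)[OF Pha, of "1/2"] by simp
  hence "eventually (%t. Ph (a t) >= Z \<and> t > 0) at_top"
   using eventually_gt_at_top[of "2 * \<bar>Z\<bar> + 1"]
   by eventually_elim (auto simp: field_simps)
  then obtain t where t: "Ph (a t) >= Z" "t > 0"
   by (auto dest: eventually_happens)
  have "eventually (%z. z : {0<..<a t}) (at_right 0)"
   using apos[OF t(2)] by (rule eventually_at_right_real)
  thus "eventually (%z. Z <= Ph z) (at_right 0)"
  proof eventually_elim
   case (elim z)
   thus ?case using t(1) Phdec'[of z "a t"] by simp
  qed
 qed
 \<comment> \<open>L'Hospital's rule at an infinite limit: the derivatives have quotient
   \<open>c / (G (c * z) / G z)\<close>, so the index \<open>g\<close> of \<open>G\<close> turns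
   into \<open>1 - g\<close> for \<open>Ph\<close>.\<close>
 have ratio: "((%z. Ph (c * z) / Ph z) ---> c powr (1 - g)) (at_right 0)" if c: "0 < c" for c
 proof (rule lhopital_right_0_at_top[OF Phinf, where f'="%z. - (1 / G (c * z)) * c" and g'="%z. - (1 / G z)"])
  have pos: "eventually (%z::real. 0 < z) (at_right 0)"
   by (simp add: eventually_at_right_less)
  show "eventually (%z. - (1 / G z) ~= 0) (at_right 0)"
   using pos by eventually_elim (use Gpos in force)
  show "eventually (%z. ((%z. Ph (c * z)) has_real_derivative - (1 / G (c * z)) * c) (at z)) (at_right 0)"
   using pos
  proof eventually_elim
   case (elim z)
   show ?case
    by (rule DERIV_chain2[where g="%z. c * z" and f=Ph])
     (use elim c in \<open>auto intro!: deriv derivative_eq_intros\<close>)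
  qed
  show "eventually (%z. (Ph has_real_derivative - (1 / G z)) (at z)) (at_right 0)"
   using pos by eventually_elim (rule deriv)
  have "((%z. c / (G (c * z) / G z)) ---> c / c powr g) (at_right 0)"
   using c by (intro tendsto_divide tendsto_const Grv) auto
  moreover have "c / c powr g = c powr (1 - g)" using c by (simp add: powr_diff)
  moreover have "eventually (%z. c / (G (c * z) / G z) = - (1 / G (c * z)) * c / - (1 / G z)) (at_right 0)"
   using pos by eventually_elim (simp add: field_simps)
  ultimately show "((%z. - (1 / G (c * z)) * c / - (1 / G z)) ---> c powr (1 - g)) (at_right 0)"
   by (auto intro: Lim_transform_eventually)
 qed
 have R: "((%t. Ph (c * a t) / t) ---> c powr (1 - g)) at_top" if c: "0 < c" for c
 proof -
  have 1: "((%t. Ph (c * a t) / Ph (a t) * (Ph (a t) / t)) ---> c powr (1 - g) * 1) at_top"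
   by (intro tendsto_mult Pha filterlim_compose[OF ratio[OF c] at0])
  have "eventually (%t. Ph (a t) > 0) at_top"
   using filterlim_compose[OF Phinf at0] by (simp add: filterlim_at_top_dense)
  hence "eventually (%t. Ph (c * a t) / Ph (a t) * (Ph (a t) / t) = Ph (c * a t) / t) at_top"
   by eventually_elim simp
  with 1 show ?thesis by (auto intro: Lim_transform_eventually)
 qed
 have U: "((%t. Ph (a (u * t)) / t) ---> u) at_top"
 proof -
  have "filterlim (%t. u * t) at_top at_top"
   using u by (simp add: filterlim_tendsto_pos_mult_at_top[OF tendsto_const] filterlim_ident)
  from filterlim_compose[OF Pha this]
  have "((%t. u * (Ph (a (u * t)) / (u * t))) ---> u * 1) at_top"
   by (intro tendsto_mult tendsto_const)
  thus ?thesis using u by simp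
 qed
 have pw: "(x powr (1 - g) < u \<longleftrightarrow> u powr - (1 / (g - 1)) < x) \<and> (u < x powr (1 - g) \<longleftrightarrow> x < u powr - (1 / (g - 1)))" if "0 < x" for x
 proof -
  have e: "u = (u powr - (1 / (g - 1))) powr (1 - g)"
  proof -
   have "- (1 / (g - 1)) * (1 - g) = 1" using g by (simp add: divide_simps)
   thus ?thesis using u by (simp only: powr_powr) simp
  qed
  have p: "0 < u powr - (1 / (g - 1))" using u by simp
  have "y powr (1 - g) < x powr (1 - g) \<longleftrightarrow> x < y" if "0 < x" "0 < y" for x y :: real
   using that g powr_less_mono2_neg[of "1 - g" x y] powr_less_mono2_neg[of "1 - g" y x]
   by (smt (verit) powr_gt_zero)
  from this[OF p that] this[OF that p] e show ?thesis by metis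
 qed
 have pos: "eventually (%t. 0 < a t \<and> 0 < a (u * t) \<and> 0 < t) at_top"
  using eventually_gt_at_top[of 0] by eventually_elim (use apos u in auto)
 show ?thesis
 proof (rule order_tendstoI)
  fix c assume c: "c < u powr - (1 / (g - 1))"
  show "eventually (%t. c < a (u * t) / a t) at_top"
  proof (cases "c > 0")
   case False
   show ?thesis using pos
   proof eventually_elim
    case (elim t)
    hence "0 < a (u * t) / a t" by simp
    thus ?case using False by linarith
   qed
  next
   case True
   hence "u < c powr (1 - g)" using c pw by blast
   \<comment> \<open>Any \<open>k\<close> strictly between the two limits separates
     \<open>Ph (a (u * t)) / t\<close> from \<open>Ph (c * a t) / t\<close> for large
     \<open>t\<close>.\<close>
   then obtain k where k: "u < k" "k < c powr (1 - g)" using dense by blast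
   show ?thesis
    using order_tendstoD(1)[OF R[OF True] k(2)] order_tendstoD(2)[OF U k(1)] pos
   proof eventually_elim
    case (elim t)
    hence "Ph (a (u * t)) < Ph (c * a t)"
     by (smt (verit) divide_strict_right_mono divide_right_mono)
    hence "\<not> a (u * t) <= c * a t"
     using Phdec'[of "a (u * t)" "c * a t"] elim by auto
    thus ?case using elim by (simp add: pos_less_divide_eq)
   qed
  qed
 next
  fix c assume c: "u powr - (1 / (g - 1)) < c"
  hence c0: "0 < c" using u by (smt (verit) powr_gt_zero)
  hence "c powr (1 - g) < u" using c pw by blast
  then obtain k where k: "c powr (1 - g) < k" "k < u" using dense by blast
  show "eventually (%t. a (u * t) / a t < c) at_top"
   using order_tendstoD(2)[OF R[OF c0] k(1)] order_tendstoD(1)[OF U k(2)] pos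
  proof eventually_elim
   case (elim t)
   hence "Ph (c * a t) < Ph (a (u * t))"
    by (smt (verit) divide_strict_right_mono divide_right_mono)
   hence "\<not> c * a t <= a (u * t)"
    using Phdec'[of "c * a t" "a (u * t)"] elim c0 by auto
   thus ?case using elim by (simp add: pos_divide_less_eq)
  qed
 qed
qed

section \<open>Laplace transforms and weak convergence on the half-line\<close>

lemma laplace_weak_conv:
 fixes M :: "nat => real measure" and Z :: "real measure"
 assumes M: "!!n. real_distribution (M n)" "!!n. AE x in M n. 0 <= x"
  and Z: "real_distribution Z" "AE x in Z. 0 <= x"
  and lim: "!!k::nat. 0 < k ==> (%n. \<integral>x. exp (- (real k * x)) \<partial>M n) ----> (LINT x|Z. exp (- (real k * x)))"
 shows "weak_conv_m M Z"
proof (rule integral_cts_step_conv_imp_weak_conv[OF M(1) Z(1)])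
 fix x y :: real assume xy: "x < y"
 \<comment> \<open>In the variable \<open>s = exp (- z)\<close>, Laplace transforms at integers are
   moments on \<open>{0..1}\<close>, so it suffices to approximate the test function by polynomials
   in \<open>s\<close>. The cutoff at \<open>exp (- (y + 1))\<close> makes \<open>h\<close>
   continuous at 0 and changes nothing, since \<open>cts_step x y\<close> vanishes from
   \<open>y\<close> on.\<close>
 define h where "h s = cts_step x y (- ln (max s (exp (- (y + 1)))))" for s
 have hz: "h (exp (- z)) = cts_step x y z" for z
 proof (cases "z <= y + 1")
  case True
  hence "max (exp (- z)) (exp (- (y + 1))) = exp (- z)" by (simp add: max_def)
  thus ?thesis by (simp add: h_def)
 next
  case False
  hence "max (exp (- z)) (exp (- (y + 1))) = exp (- (y + 1))" by (simp add: max_def)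
  thus ?thesis using xy False by (simp add: h_def cts_step_def)
 qed
 have hc: "continuous_on {0..1} h"
  unfolding h_def
  by (rule continuous_on_compose2[OF uniformly_continuous_imp_continuous[OF cts_step_uniformly_continuous[OF xy]]])
   (auto intro!: continuous_intros, metis exp_gt_zero less_max_iff_disj less_irrefl)
 have int: "integrable D (%x. exp (- (real k * x)))" if "real_distribution D" "AE x in D. 0 <= x" for D k
 proof -
  interpret D: real_distribution D by fact
  show ?thesis
   using that(2) by (intro D.integrable_const_bound[where B=1]) auto
 qed
 show "(%n. integral\<^sup>L (M n) (cts_step x y)) ----> integral\<^sup>L Z (cts_step x y)"
 proof (rule LIMSEQ_I)
  fix e :: real assume e: "e > 0"
  then obtain g where g: "real_polynomial_function g" "!!s. s : {0..1} ==> \<bar>h s - g s\<bar> < e / 3"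
   using Stone_Weierstrass_real_polynomial_function[OF _ hc, of "e / 3"] by auto
  obtain c n where c: "g = (%x. \<Sum>i\<le>n. c i * x ^ i)"
   using real_polynomial_function_imp_sum[OF g(1)] by blast
  have gz: "g (exp (- z)) = (\<Sum>i\<le>n. c i * exp (- (real i * z)))" for z
   by (simp add: c exp_of_nat_mult[symmetric])
  have close: "\<bar>integral\<^sup>L D (cts_step x y) - (LINT z|D. g (exp (- z)))\<bar> <= e / 3"
   if D: "real_distribution D" "AE x in D. 0 <= x" for D
  proof -
   interpret D: real_distribution D by fact
   have i: "integrable D (%z. g (exp (- z)))"
    unfolding gz using int[OF D] by auto
   have "\<bar>integral\<^sup>L D (cts_step x y) - (LINT z|D. g (exp (- z)))\<bar> = \<bar>\<integral>z. cts_step x y z - g (exp (- z)) \<partial>D\<bar>"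
    using i D.integrable_cts_step[OF xy] by simp
   also have "... <= (LINT z|D. \<bar>cts_step x y z - g (exp (- z))\<bar>)"
    by (rule integral_abs_bound)
   also have "... <= (LINT z|D. e / 3)"
   proof (rule integral_mono_AE)
    show "integrable D (%z. \<bar>cts_step x y z - g (exp (- z))\<bar>)"
     using i D.integrable_cts_step[OF xy] by auto
    show "AE z in D. \<bar>cts_step x y z - g (exp (- z))\<bar> <= e / 3"
     using D(2)
    proof eventually_elim
     case (elim z)
     thus ?case using g(2)[of "exp (- z)"] hz[of z] by auto
    qed
   qed auto
   also have "... = e / 3" by (simp add: D.prob_space[simplified])
   finally show ?thesis .
  qed
  have G: "(LINT z|D. g (exp (- z))) = (\<Sum>i\<le>n. c i * (LINT z|D. exp (- (real i * z))))"
   if D: "real_distribution D" "AE x in D. 0 <= x" for D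
   unfolding gz using int[OF D] by (subst Bochner_Integration.integral_sum) auto
  have lim': "(%n. \<integral>x. exp (- (real k * x)) \<partial>M n) ----> (LINT x|Z. exp (- (real k * x)))" for k
  proof (cases k)
   case 0
   have "measure D UNIV = 1" if "real_distribution D" for D
   proof -
    interpret D: real_distribution D by fact
    show ?thesis using D.prob_space by simp
   qed
   thus ?thesis using 0 M Z real_distribution.space_eq_univ by simp
  qed (use lim[of k] in auto)
  have "(%n. \<integral>z. g (exp (- z)) \<partial>M n) ----> (LINT z|Z. g (exp (- z)))"
   unfolding G[OF M] G[OF Z] by (intro tendsto_sum tendsto_mult tendsto_const lim')
  from LIMSEQ_D[OF this, of "e / 3"] e
  obtain N where N: "\<forall>n\<ge>N. norm ((LINT z|M n. g (exp (- z))) - (LINT z|Z. g (exp (- z)))) < e / 3"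
   by auto
  show "\<exists>N. \<forall>n\<ge>N. norm (integral\<^sup>L (M n) (cts_step x y) - integral\<^sup>L Z (cts_step x y)) < e"
  proof (intro exI[of _ N] allI impI)
   fix n assume "n >= N"
   thus "norm (integral\<^sup>L (M n) (cts_step x y) - integral\<^sup>L Z (cts_step x y)) < e"
    using N[rule_format, OF \<open>n >= N\<close>] close[OF M, of n] close[OF Z] unfolding real_norm_def by linarith
  qed
 qed
qed

text \<open>Continuity of the limit at 0 prevents mass from escaping to infinity; a weak limit along
  a subsequence then has the transform \<open>\<Lambda>\<close>. Only existence is claimed, and it
  is what produces the limit law of the theorem.\<close>

lemma laplace_limit_exists:
 fixes M :: "nat => real measure" and \<Lambda> :: "real => real"
 assumes M: "!!n. real_distribution (M n)" "!!n. AE x in M n. 0 <= x"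
  and lim: "!!u. 0 < u ==> (%n. \<integral>x. exp (- (u * x)) \<partial>M n) ----> \<Lambda> u"
  and \<Lambda>: "(\<Lambda> ---> 1) (at_right 0)"
 shows "\<exists>Z. real_distribution Z \<and> (AE z in Z. 0 <= z) \<and> (\<forall>u>0. (LINT z|Z. exp (- (u * z))) = \<Lambda> u)"
proof -
 interpret M: real_distribution "M n" for n by (rule M)
 \<comment> \<open>Beyond \<open>1 / u\<close> the function \<open>1 - exp (- (u * x))\<close> is at
   least \<open>1 - exp (- 1)\<close>, so a Markov type inequality bounds the tail by the defect of
   the Laplace transform.\<close>
 have tail: "1 - (1 - (LINT x|M n. exp (- (u * x)))) / (1 - exp (- 1)) <= cdf (M n) (1 / u)" if u: "u > 0" for u n
 proof -
  have e: "exp (- 1) < (1::real)" by simp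
  have i: "integrable (M n) (%x. exp (- (u * x)))"
   using M(2)[of n] u by (intro M.integrable_const_bound[where B=1]) auto
  have "1 - cdf (M n) (1 / u) = (LINT x|M n. 1 - indicator {..1/u} x)"
   using M.prob_space by (simp add: cdf_def M.emeasure_eq_measure)
  also have "... <= (LINT x|M n. (1 - exp (- (u * x))) / (1 - exp (- 1)))"
  proof (rule integral_mono_AE)
   show "AE x in M n. 1 - indicator {..1/u} x <= (1 - exp (- (u * x))) / (1 - exp (- 1))"
    using M(2)[of n]
   proof eventually_elim
    case (elim x)
    show ?case
    proof (cases "x <= 1 / u")
     case True
     thus ?thesis using elim u e by (simp add: divide_nonneg_nonneg)
    next
     case False
     hence "1 <= u * x" using u by (simp add: field_simps)
     hence "exp (- (u * x)) <= exp (- 1)" by simp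
     thus ?thesis using False e by (simp add: pos_le_divide_eq)
    qed
   qed
  next
   show "integrable (M n) (%x. 1 - indicator {..1/u} x :: real)"
    by (rule M.integrable_const_bound[where B=1]) (auto simp: indicator_def)
  qed (use i in auto)
  also have "... = (1 - (LINT x|M n. exp (- (u * x)))) / (1 - exp (- 1))"
   using i M.prob_space by simp
  finally show ?thesis by simp
 qed
 have tight: "tight M"
  unfolding tight_def
 proof (intro conjI allI impI M(1))
  fix ep :: real assume ep: "ep > 0"
  define k where "k = 1 - exp (- (1::real))"
  have k: "0 < k" by (simp add: k_def)
  have "eventually (%u. \<Lambda> u > 1 - ep * k) (at_right 0)"
   using order_tendstoD(1)[OF \<Lambda>, of "1 - ep * k"] ep k by simp
  moreover have "eventually (%u::real. 0 < u) (at_right 0)"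
   by (simp add: eventually_at_right_less)
  ultimately have "eventually (%u. \<Lambda> u > 1 - ep * k \<and> 0 < u) (at_right 0)"
   by eventually_elim simp
  then obtain u where u: "\<Lambda> u > 1 - ep * k" "0 < u"
   using eventually_happens'[OF trivial_limit_at_right_real] by blast
  obtain N where N: "!!n. n >= N ==> (LINT x|M n. exp (- (u * x))) > 1 - ep * k"
   using order_tendstoD(1)[OF lim[OF u(2)] u(1)] by (auto simp: eventually_sequentially)
  \<comment> \<open>The first \<open>N\<close> laws are not covered by the limit; being finitely
    many, they admit a common \<open>b\<close>.\<close>
  have "eventually (%b. 1 - ep < cdf (M n) b) at_top" for n
   using order_tendstoD(1)[OF M.cdf_lim_at_top_prob[of n], of "1 - ep"] ep by simp
  hence "eventually (%b. \<forall>n\<in>{..<N}. 1 - ep < cdf (M n) b) at_top"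
   by (intro eventually_ball_finite) auto
  moreover have "eventually (%b. b > max (1 / u) 0) at_top" by (rule eventually_gt_at_top)
  ultimately have "eventually (%b. (\<forall>n\<in>{..<N}. 1 - ep < cdf (M n) b) \<and> b > max (1 / u) 0) at_top"
   by (rule eventually_conj)
  then obtain b where "(\<forall>n\<in>{..<N}. 1 - ep < cdf (M n) b) \<and> b > max (1 / u) 0"
   using eventually_happens'[OF trivial_limit_at_top_linorder] by blast
  hence b: "!!n. n < N ==> 1 - ep < cdf (M n) b" "b > 1 / u" "b > 0"
   by auto
  have "1 - ep < cdf (M n) b" for n
  proof (cases "n < N")
   case False
   hence "1 - (LINT x|M n. exp (- (u * x))) < ep * k" using N[of n] by simp
   hence "(1 - (LINT x|M n. exp (- (u * x)))) / k < ep" using k by (simp add: pos_divide_less_eq)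
   hence "1 - ep < cdf (M n) (1 / u)" using tail[OF u(2), of n] by (simp add: k_def)
   also have "... <= cdf (M n) b" using b by (intro M.cdf_nondecreasing) auto
   finally show ?thesis .
  qed (use b in auto)
  moreover have "cdf (M n) b = measure (M n) {-1<..b}" for n
   unfolding cdf_def
  proof (rule M.finite_measure_eq_AE)
   show "AE x in M n. (x : {..b}) = (x : {-1<..b})"
    using M(2)[of n] by eventually_elim auto
  qed auto
  ultimately show "\<exists>a b. a < b \<and> (\<forall>n. 1 - ep < measure (M n) {a<..b})"
   using b by (intro exI[of _ "-1"] exI[of _ b]) auto
 qed
 obtain r Z where r: "strict_mono r" "real_distribution Z" "weak_conv_m (M \<circ> id \<circ> r) Z"
  using tight_imp_convergent_subsubsequence[OF tight strict_mono_id] by blast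
 interpret Z: real_distribution Z by (rule r)
 have conv: "(%n. \<integral>x. f x \<partial>M (r n)) ----> (LINT x|Z. f x)"
  if "!!x. isCont f x" "!!x. \<bar>f x\<bar> <= 1" for f :: "real => real"
  using weak_conv_imp_integral_bdd_continuous_conv[of "M \<circ> id \<circ> r" Z f 1] r M that by auto
 have nonneg: "AE z in Z. 0 <= z"
 proof -
  \<comment> \<open>A bounded continuous function that is positive exactly on the negative numbers;
    its integral passes to the weak limit.\<close>
  define f where "f z = max 0 (min 1 (- z))" for z :: real
  have [measurable]: "f : \<B> borel" unfolding f_def by measurable
  have "(%n. \<integral>x. f x \<partial>M (r n)) ----> (LINT x|Z. f x)"
   by (rule conv) (auto simp: f_def intro!: continuous_intros)
  moreover have "(LINT x|M (r n). f x) = 0" for n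
  proof (rule integral_eq_zero_AE)
   show "AE x in M (r n). f x = 0"
    using M(2)[of "r n"] by eventually_elim (simp add: f_def)
  qed
  ultimately have "(LINT x|Z. f x) = 0" by (simp add: LIMSEQ_const_iff)
  moreover have "integrable Z f"
   by (rule Z.integrable_const_bound[where B=1]) (auto simp: f_def)
  ultimately have "AE z in Z. f z = 0"
   by (subst (asm) integral_nonneg_eq_0_iff_AE) (auto simp: f_def)
  thus ?thesis by eventually_elim (auto simp: f_def max_def min_def split: if_splits)
 qed
 moreover have "(LINT z|Z. exp (- (u * z))) = \<Lambda> u" if u: "u > 0" for u
 proof -
  \<comment> \<open>Clamping at 0 changes nothing almost everywhere and makes the exponential
    bounded on the whole line, as weak convergence demands.\<close>
  have ex: "(LINT z|D. exp (- (u * z))) = (LINT z|D. exp (- (u * max 0 z)))"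
   if "real_distribution D" "AE z in D. 0 <= z" for D
  proof -
   interpret D: real_distribution D by fact
   have "AE z in D. exp (- (u * z)) = exp (- (u * max 0 z))"
    using that(2) by eventually_elim simp
   thus ?thesis by (intro integral_cong_AE) auto
  qed
  have "(%n. \<integral>x. exp (- (u * max 0 x)) \<partial>M (r n)) ----> (LINT x|Z. exp (- (u * max 0 x)))"
   using u by (intro conv) (auto intro!: continuous_intros)
  moreover have "(%n. \<integral>x. exp (- (u * x)) \<partial>M (r n)) ----> \<Lambda> u"
   using LIMSEQ_subseq_LIMSEQ[OF lim[OF u] r(1)] by (simp add: comp_def)
  ultimately show ?thesis
   unfolding ex[OF M] ex[OF r(2) nonneg] by (rule LIMSEQ_unique)
 qed
 ultimately show ?thesis using r(2) by blast
qed

section \<open>Kernels dominated by a product of two functions\<close>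

lemma ennreal_power2_le_imp_le:
 assumes "x^2 <= (ennreal r)^2" "0 <= r"
 shows "x <= ennreal r"
proof (cases x)
 case (real a)
 thus ?thesis
  using assms by (auto simp: ennreal_power intro!: ennreal_leI dest: power2_le_imp_le)
next
 case top
 thus ?thesis using assms by (simp add: ennreal_power top_unique)
qed

text \<open>Instances are the kernel of the motion with \<open>B = 0\<close>, the Feynman-Kac kernel
  with \<open>B\<close> a bound for the potential, and the transposes of both. In each of them
  \<open>g\<close> and \<open>h\<close> are the eigenfunctions of the motion, in one order or the
  other.\<close>

locale dominated_kernel =
 fixes m :: "'e::{metric_space, second_countable_topology} measure"
  and k :: "real => 'e => 'e => real" and B :: real and g h :: "'e => real"
 assumes sets_m [measurable_cong]: "sets m = sets borel"
  and sigma_finite: "sigma_finite_measure m"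
  and full_support: "!!U. open U ==> U ~= {} ==> 0 < emeasure m U"
  and nonneg: "!!t x y. 0 < t ==> 0 <= k t x y"
  and cont: "!!t. 0 < t ==> continuous_on UNIV (%(x, y). k t x y)"
  and row: "!!t x. 0 < t ==> (\<integral>\<^sup>+y. ennreal (k t x y) \<partial>m) <= ennreal (exp (B * t))"
  and col: "!!t y. 0 < t ==> (\<integral>\<^sup>+x. ennreal (k t x y) \<partial>m) <= ennreal (exp (B * t))"
  and chapman_kolmogorov:
   "!!s t x y. 0 < s ==> 0 < t ==>
    (\<integral>\<^sup>+z. ennreal (k s x z) * ennreal (k t z y) \<partial>m) = ennreal (k (s + t) x y)"
  and dom: "!!t. 0 < t ==> \<exists>c. \<forall>x y. k t x y <= c * g x * h y"
  and gh_cont: "continuous_on UNIV g" "continuous_on UNIV h"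
  and gh_pos: "!!x. 0 < g x" "!!x. 0 < h x"
  and gh_L2: "(\<integral>\<^sup>+x. (ennreal (g x))^2 \<partial>m) < \<infinity>" "(\<integral>\<^sup>+x. (ennreal (h x))^2 \<partial>m) < \<infinity>"
begin

sublocale sigma_finite_measure m by (rule sigma_finite)

sublocale pair: pair_sigma_finite m m ..

lemma space_m [simp]: "space m = UNIV"
 using sets_eq_imp_space_eq[OF sets_m] by simp

lemma k_measurable [measurable (raw)]:
 assumes t: "0 < t" and [measurable]: "f : M \<rightarrow>\<^sub>M borel" "f' : M \<rightarrow>\<^sub>M borel"
 shows "(%x. k t (f x) (f' x)) : \<B> M"
proof -
 have "(%z. k t (fst z) (snd z)) : \<B> (borel :: ('e \<times> 'e) measure)"
  using cont[OF t] by (intro borel_measurable_continuous_onI) (simp add: case_prod_beta)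
 hence [measurable]: "(%z. k t (fst z) (snd z)) : \<B> borel2"
  by (simp add: borel_prod)
 have "(%x. (%z. k t (fst z) (snd z)) (f x, f' x)) : \<B> M"
  by measurable
 thus ?thesis by simp
qed

lemma gh_measurable [measurable]: "g : \<B> borel" "h : \<B> borel"
 using gh_cont by (auto intro: borel_measurable_continuous_onI)

lemma dom':
 assumes "0 < t"
 obtains c where "0 < c" "!!x y. k t x y <= c * g x * h y"
proof -
 obtain c where c: "!!x y. k t x y <= c * g x * h y" using dom[OF assms] by blast
 have "k t x y <= (\<bar>c\<bar> + 1) * g x * h y" for x y
 proof -
  have "c * (g x * h y) <= (\<bar>c\<bar> + 1) * (g x * h y)"
   using gh_pos[of x] gh_pos[of y] by (intro mult_right_mono) auto
  thus ?thesis using c[of x y] by (simp add: mult.assoc)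
 qed
 thus ?thesis using that[of "\<bar>c\<bar> + 1"] by auto
qed

lemma transpose: "dominated_kernel m (%t x y. k t y x) B h g"
proof
 show "continuous_on UNIV (%(x, y). k t y x)" if "0 < t" for t
 proof -
  have "continuous_on UNIV (%z. (%(x, y). k t x y) (prod.swap z))"
   by (rule continuous_on_compose2[OF cont[OF that]]) (auto intro: continuous_on_swap)
  thus ?thesis by (simp add: case_prod_beta)
 qed
 show "(\<integral>\<^sup>+z. ennreal (k s z x) * ennreal (k t y z) \<partial>m) = ennreal (k (s + t) y x)"
  if "0 < s" "0 < t" for s t x y
  using chapman_kolmogorov[OF that(2,1), of y x] by (simp add: mult.commute add.commute)
 show "\<exists>c. \<forall>x y. k t y x <= c * h x * g y" if "0 < t" for t
  using dom[OF that] by (metis mult.assoc mult.commute)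
qed (use sets_m sigma_finite full_support nonneg row col gh_cont gh_pos gh_L2 in auto)

text \<open>The extended non-negative version composes and obeys Tonelli's theorem without
  integrability conditions; norm estimates are made for \<open>nnK\<close> and carried over to
  \<open>K\<close>.\<close>

definition nnK :: "real => ('e => ennreal) => 'e => ennreal" where
 "nnK t F x = (\<integral>\<^sup>+y. ennreal (k t x y) * F y \<partial>m)"

definition K :: "real => ('e => real) => 'e => real" where
 "K t f x = (LINT y|m. k t x y * f y)"

definition L2 :: "('e => real) set" where
 "L2 = {f : \<B> borel. (\<integral>\<^sup>+x. (ennreal \<bar>f x\<bar>)^2 \<partial>m) < \<infinity>}"

lemma nnK_measurable [measurable]:
 assumes [measurable]: "F : \<B> borel" and "0 < t"
 shows "nnK t F : \<B> borel"
 using \<open>0 < t\<close>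
 unfolding nnK_def by measurable

lemma K_measurable [measurable]:
 assumes [measurable]: "f : \<B> borel" and "0 < t"
 shows "K t f : \<B> borel"
 using \<open>0 < t\<close>
 unfolding K_def by measurable

lemma nnK_semigroup:
 assumes [simp]: "0 < s" "0 < t" and [measurable]: "F : \<B> borel"
 shows "nnK (s + t) F x = nnK s (nnK t F) x"
proof -
 have "nnK s (nnK t F) x = (\<integral>\<^sup>+z. \<integral>\<^sup>+y. ennreal (k s x z) * (ennreal (k t z y) * F y) \<partial>m \<partial>m)"
  unfolding nnK_def by (intro nn_integral_cong nn_integral_cmult[symmetric]) measurable
 also have "... = (\<integral>\<^sup>+y. \<integral>\<^sup>+z. ennreal (k s x z) * (ennreal (k t z y) * F y) \<partial>m \<partial>m)"
  by (rule pair.Fubini') measurable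
 also have "... = (\<integral>\<^sup>+y. \<integral>\<^sup>+z. (ennreal (k s x z) * ennreal (k t z y)) * F y \<partial>m \<partial>m)"
  by (simp add: mult.assoc)
 also have "... = (\<integral>\<^sup>+y. ennreal (k (s + t) x y) * F y \<partial>m)"
  by (subst nn_integral_multc) (auto simp: chapman_kolmogorov)
 finally show ?thesis by (simp add: nnK_def)
qed

text \<open>Schur's test: the kernel is split into two square roots for the Cauchy-Schwarz
  inequality; the row bound pays for one factor and, after Tonelli, the column bound for the
  other.\<close>

lemma nnK_L2:
 assumes t [simp]: "0 < t" and [measurable]: "F : \<B> borel"
 shows "(\<integral>\<^sup>+x. (nnK t F x)^2 \<partial>m) <= ennreal (exp (B * t)) * ennreal (exp (B * t)) * (\<integral>\<^sup>+x. (F x)^2 \<partial>m)"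
proof -
 have "(nnK t F x)^2 <= ennreal (exp (B * t)) * (\<integral>\<^sup>+y. ennreal (k t x y) * (F y)^2 \<partial>m)" for x
 proof -
  have sq: "ennreal (sqrt (k t x y)) * ennreal (sqrt (k t x y)) = ennreal (k t x y)" for y
   using nonneg[OF t] by (simp flip: ennreal_mult)
  have "nnK t F x = (\<integral>\<^sup>+y. ennreal (sqrt (k t x y)) * (ennreal (sqrt (k t x y)) * F y) \<partial>m)"
   unfolding nnK_def by (simp add: mult.assoc[symmetric] sq)
  also have "...^2 <= (\<integral>\<^sup>+y. (ennreal (sqrt (k t x y)))^2 \<partial>m) * (\<integral>\<^sup>+y. (ennreal (sqrt (k t x y)) * F y)^2 \<partial>m)"
   by (rule Cauchy_Schwarz_nn_integral) measurable
  also have "... = (\<integral>\<^sup>+y. ennreal (k t x y) \<partial>m) * (\<integral>\<^sup>+y. ennreal (k t x y) * (F y)^2 \<partial>m)"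
   by (simp add: power_mult_distrib) (simp add: power2_eq_square sq)
  also have "... <= ennreal (exp (B * t)) * (\<integral>\<^sup>+y. ennreal (k t x y) * (F y)^2 \<partial>m)"
   by (intro mult_right_mono row) auto
  finally show ?thesis .
 qed
 hence "(\<integral>\<^sup>+x. (nnK t F x)^2 \<partial>m) <= (\<integral>\<^sup>+x. ennreal (exp (B * t)) * (\<integral>\<^sup>+y. ennreal (k t x y) * (F y)^2 \<partial>m) \<partial>m)"
  by (intro nn_integral_mono)
 also have "... = ennreal (exp (B * t)) * (\<integral>\<^sup>+x. \<integral>\<^sup>+y. ennreal (k t x y) * (F y)^2 \<partial>m \<partial>m)"
  by (rule nn_integral_cmult) measurable
 also have "(\<integral>\<^sup>+x. \<integral>\<^sup>+y. ennreal (k t x y) * (F y)^2 \<partial>m \<partial>m) = (\<integral>\<^sup>+y. \<integral>\<^sup>+x. ennreal (k t x y) * (F y)^2 \<partial>m \<partial>m)"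
  by (rule pair.Fubini') measurable
 also have "... = (\<integral>\<^sup>+y. (\<integral>\<^sup>+x. ennreal (k t x y) \<partial>m) * (F y)^2 \<partial>m)"
  by (subst nn_integral_multc) auto
 also have "... <= (\<integral>\<^sup>+y. ennreal (exp (B * t)) * (F y)^2 \<partial>m)"
  by (intro nn_integral_mono mult_right_mono col) auto
 also have "... = ennreal (exp (B * t)) * (\<integral>\<^sup>+y. (F y)^2 \<partial>m)"
  by (rule nn_integral_cmult) measurable
 finally show ?thesis by (simp add: mult.assoc mult_left_mono)
qed

lemma L2_mult_integrable:
 assumes "f : L2" "f' : L2"
 shows "integrable m (%x. f x * f' x)"
proof (rule integrableI_bounded)
 show "(%x. f x * f' x) : \<B> m" using assms by (auto simp: L2_def)
 have "(\<integral>\<^sup>+x. ennreal \<bar>f x\<bar> * ennreal \<bar>f' x\<bar> \<partial>m)^2 <= (\<integral>\<^sup>+x. (ennreal \<bar>f x\<bar>)^2 \<partial>m) * (\<integral>\<^sup>+x. (ennreal \<bar>f' x\<bar>)^2 \<partial>m)"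
  using assms by (intro Cauchy_Schwarz_nn_integral) (auto simp: L2_def)
 also have "... < \<infinity>" using assms by (auto simp: L2_def ennreal_mult_less_top)
 finally show "(\<integral>\<^sup>+x. ennreal (norm (f x * f' x)) \<partial>m) < \<infinity>"
  by (simp add: abs_mult ennreal_mult power_less_top_ennreal)
qed

lemma gh_in_L2: "g : L2" "h : L2"
 using gh_L2 gh_pos by (auto simp: L2_def abs_of_pos)

lemma L2_integrable:
 assumes t [simp]: "0 < t" and f: "f : L2"
 shows "integrable m (%y. k t x y * f y)"
proof -
 obtain c where c: "0 < c" "!!x y. k t x y <= c * g x * h y" using dom'[OF t] by blast
 have [measurable]: "f : \<B> borel" using f by (auto simp: L2_def)
 show ?thesis
 proof (rule Bochner_Integration.integrable_bound)
  show "integrable m (%y. c * g x * (h y * f y))"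
   using L2_mult_integrable[OF gh_in_L2(2) f] by simp
  show "AE y in m. norm (k t x y * f y) <= norm (c * g x * (h y * f y))"
  proof (rule AE_I2)
   fix y
   have "\<bar>k t x y * f y\<bar> = k t x y * \<bar>f y\<bar>" using nonneg[OF t] by (simp add: abs_mult)
   also have "... <= (c * g x * h y) * \<bar>f y\<bar>" by (intro mult_right_mono c) auto
   also have "... = \<bar>c * g x * (h y * f y)\<bar>"
    using c gh_pos by (simp add: abs_mult less_imp_le)
   finally show "norm (k t x y * f y) <= norm (c * g x * (h y * f y))" by simp
  qed
 qed measurable
qed

lemma K_le_nnK:
 assumes t [simp]: "0 < t" and f: "f : L2"
 shows "ennreal \<bar>K t f x\<bar> <= nnK t (%y. ennreal \<bar>f y\<bar>) x"
proof -
 have "ennreal (norm (K t f x)) <= (\<integral>\<^sup>+y. ennreal (norm (k t x y * f y)) \<partial>m)"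
  unfolding K_def by (rule integral_norm_bound_ennreal[OF L2_integrable[OF t f]])
 thus ?thesis
  by (simp add: nnK_def abs_mult nonneg ennreal_mult)
qed

lemma K_L2:
 assumes t [simp]: "0 < t" and f: "f : L2"
 shows "K t f : L2"
proof -
 have [measurable]: "f : \<B> borel" using f by (auto simp: L2_def)
 have "(\<integral>\<^sup>+x. (ennreal \<bar>K t f x\<bar>)^2 \<partial>m) <= (\<integral>\<^sup>+x. (nnK t (%y. ennreal \<bar>f y\<bar>) x)^2 \<partial>m)"
  by (intro nn_integral_mono power_mono K_le_nnK f) auto
 also have "... <= ennreal (exp (B * t)) * ennreal (exp (B * t)) * (\<integral>\<^sup>+x. (ennreal \<bar>f x\<bar>)^2 \<partial>m)"
  by (rule nnK_L2) measurable
 also have "... < \<infinity>" using f by (auto simp: L2_def ennreal_mult_less_top)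
 finally show ?thesis by (simp add: L2_def)
qed

lemma K_semigroup:
 assumes st [simp]: "0 < s" "0 < t" and f: "f : L2"
 shows "K (s + t) f x = K s (K t f) x"
proof -
 have [measurable]: "f : \<B> borel" using f by (auto simp: L2_def)
 have [simp]: "0 < s + t" by (rule add_pos_pos[OF st])
 have ck: "(LINT z|m. k s x z * k t z y) = k (s + t) x y" for y
  using chapman_kolmogorov[of s t x y] nonneg nonneg[OF add_pos_pos[OF st], of x y]
  by (intro integral_eq_nn_integral[THEN trans]) (auto simp: ennreal_mult)
 have abs: "ennreal (norm (k s x z * (k t z y * f y))) = ennreal (k s x z) * (ennreal (k t z y) * ennreal \<bar>f y\<bar>)" for z y
  by (simp add: abs_mult nonneg ennreal_mult)
 have int: "integrable (m \<Otimes>\<^sub>M m) (%(z, y). k s x z * (k t z y * f y))"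
 proof (rule integrableI_bounded)
  have "(\<integral>\<^sup>+z. ennreal (norm (case z of (z, y) => k s x z * (k t z y * f y))) \<partial>(m \<Otimes>\<^sub>M m))
   = (\<integral>\<^sup>+z. \<integral>\<^sup>+y. ennreal (norm (k s x z * (k t z y * f y))) \<partial>m \<partial>m)"
   by (subst nn_integral_fst[symmetric]) (auto simp: case_prod_beta)
  also have "... = (\<integral>\<^sup>+z. \<integral>\<^sup>+y. ennreal (k s x z) * (ennreal (k t z y) * ennreal \<bar>f y\<bar>) \<partial>m \<partial>m)"
   unfolding abs ..
  also have "... = nnK s (nnK t (%y. ennreal \<bar>f y\<bar>)) x"
   unfolding nnK_def by (intro nn_integral_cong nn_integral_cmult) measurable
  also have "... = nnK (s + t) (%y. ennreal \<bar>f y\<bar>) x"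
   by (rule nnK_semigroup[symmetric]) auto
  also have "... = (\<integral>\<^sup>+y. ennreal (norm (k (s + t) x y * f y)) \<partial>m)"
   by (simp add: nnK_def abs_mult nonneg ennreal_mult)
  also have "... < \<infinity>"
   using L2_integrable[of "s + t" f x] f by (simp add: integrable_iff_bounded)
  finally show "(\<integral>\<^sup>+z. ennreal (norm (case z of (z, y) => k s x z * (k t z y * f y))) \<partial>(m \<Otimes>\<^sub>M m)) < \<infinity>" .
 qed measurable
 have "K s (K t f) x = (LINT z|m. \<integral>y. k s x z * (k t z y * f y) \<partial>m)"
  unfolding K_def by simp
 also have "... = (LINT y|m. \<integral>z. k s x z * (k t z y * f y) \<partial>m)"
  by (rule pair.Fubini_integral[OF int, symmetric])
 also have "... = (LINT y|m. \<integral>z. (k s x z * k t z y) * f y \<partial>m)"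
  by (simp add: mult.assoc)
 also have "... = K (s + t) f x"
  by (simp add: K_def ck)
 finally show ?thesis ..
qed

text \<open>By full support a null set contains no non-empty open set, in particular not the open
  set of points where two continuous functions differ.\<close>

lemma continuous_AE_eq:
 fixes f f' :: "'e => real"
 assumes "continuous_on UNIV f" "continuous_on UNIV f'" "AE x in m. f x = f' x"
 shows "f x = f' x"
proof (rule ccontr)
 assume ne: "f x ~= f' x"
 have op: "open {x. f x ~= f' x}" using assms(1,2) by (intro open_Collect_neq) auto
 hence "0 < emeasure m {x. f x ~= f' x}" using ne by (intro full_support) auto
 moreover have "emeasure m {x. f x ~= f' x} = 0"
  using assms(3) op by (subst (asm) AE_iff_measurable[OF _ refl]) (auto simp: sets_m)
 ultimately show False by simp
qed

lemma K_continuous: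
 assumes t [simp]: "0 < t" and f: "f : L2"
 shows "continuous_on UNIV (K t f)"
 unfolding continuous_on_sequentially
proof (intro allI ballI impI, elim conjE)
 fix X and a :: 'e assume X: "X ----> a"
 obtain c where c: "0 < c" "!!x y. k t x y <= c * g x * h y" using dom'[OF t] by blast
 have [measurable]: "f : \<B> borel" using f by (auto simp: L2_def)
 have "(%n. g (X n)) ----> g a"
  using gh_cont(1) X by (auto simp: continuous_on_sequentially comp_def)
 then obtain G where G: "!!n. \<bar>g (X n)\<bar> <= G"
  using convergent_imp_Bseq[of "%n. g (X n)"] by (auto simp: convergent_def Bseq_def)
 have "(%n. \<integral>y. k t (X n) y * f y \<partial>m) ----> (LINT y|m. k t a y * f y)"
 proof (rule integral_dominated_convergence)
  show "integrable m (%y. c * G * \<bar>h y * f y\<bar>)"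
   using L2_mult_integrable[OF gh_in_L2(2) f] by simp
  show "AE y in m. norm (k t (X n) y * f y) <= c * G * \<bar>h y * f y\<bar>" for n
  proof (rule AE_I2)
   fix y
   have "\<bar>k t (X n) y * f y\<bar> = k t (X n) y * \<bar>f y\<bar>" using nonneg[OF t] by (simp add: abs_mult)
   also have "... <= (c * g (X n) * h y) * \<bar>f y\<bar>" by (intro mult_right_mono c) auto
   also have "... <= (c * G * h y) * \<bar>f y\<bar>"
    using c(1) G[of n] gh_pos(2)[of y] by (intro mult_right_mono mult_left_mono) auto
   also have "... = c * G * \<bar>h y * f y\<bar>"
    using gh_pos(2)[of y] by (simp add: abs_mult)
   finally show "norm (k t (X n) y * f y) <= c * G * \<bar>h y * f y\<bar>" by simp
  qed
  show "AE y in m. (%n. k t (X n) y * f y) ----> k t a y * f y"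
  proof (intro AE_I2 tendsto_mult tendsto_const)
   fix y :: 'e
   have "(%n. (X n, y)) ----> (a, y)" using X by (intro tendsto_Pair tendsto_const)
   thus "(%n. k t (X n) y) ----> k t a y"
    using cont[OF t] by (force simp: continuous_on_sequentially comp_def)
  qed
 qed measurable
 thus "(K t f \<circ> X) ----> K t f a" by (simp add: K_def comp_def)
qed

text \<open>The generator gives information only in mean square and at time 0, whereas the identity
  is wanted at every point and time. For fixed \<open>x\<close> the function
  \<open>exp (- (l * t)) * K t ph x\<close> has increments of order o(s): the error
  \<open>D s\<close> is o(s) in \<open>L2\<close>, and evaluating \<open>K r\<close> at a point is
  bounded on \<open>L2\<close> as long as \<open>r\<close> stays away from 0. So the function is
  constant in \<open>t > 0\<close>; time 0 is then reached in mean square.\<close>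

lemma semigroup_eigenfunction:
 assumes phc: "continuous_on UNIV ph"
  and gen: "(%x. complex_of_real (ph x), %x. complex_of_real (l * ph x)) : generator m k"
 shows "ph : L2" "!!t x. 0 < t ==> K t ph x = exp (l * t) * ph x"
proof -
 have [measurable]: "ph : \<B> borel"
  using phc by (rule borel_measurable_continuous_onI)
 define n2 where "n2 f = (\<integral>\<^sup>+x. (ennreal \<bar>f x\<bar>)^2 \<partial>m)" for f :: "'e => real"
 have sq: "sqnorm_L2 m (%x. complex_of_real (f x)) = n2 f" for f
  by (simp add: sqnorm_L2_def n2_def ennreal_power)
 show L2: "ph : L2"
  using gen sq[of ph] by (simp add: generator_def L2_space_def L2_def n2_def)
 define d where "d s x = (K s ph x - ph x) / s - l * ph x" for s x
 have "((%s. sqnorm_L2 m (%x. complex_of_real (d s x))) ---> 0) (at_right 0)"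
  using gen unfolding generator_def d_def K_def by (simp flip: of_real_mult)
 hence D0: "((%s. n2 (d s)) ---> 0) (at_right 0)" unfolding sq .
 define e where "e s = (exp (l * s) - 1) / s - l" for s :: real
 have e0: "(e ---> 0) (at_right 0)"
 proof -
  have "((%s. exp (l * s)) has_real_derivative l * exp (l * 0)) (at 0)"
   by (auto intro!: derivative_eq_intros)
  hence "((%s. (exp (l * s) - 1) / s) ---> l) (at 0)"
   by (simp add: has_field_derivative_iff)
  hence "((%s. (exp (l * s) - 1) / s) ---> l) (at_right 0)"
   by (rule tendsto_within_subset) auto
  thus ?thesis unfolding e_def by (simp add: LIM_zero)
 qed
 have Ph: "n2 ph < \<infinity>" using L2 by (simp add: L2_def n2_def)
 \<comment> \<open>\<open>V s\<close> controls the squared norm of \<open>D s\<close> divided by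
   \<open>s^2\<close>: one term is the defect \<open>d s\<close> of the difference quotient, the
   other the defect \<open>e s\<close> of that of \<open>exp (l * s)\<close>.\<close>
 define V where "V s = 2 * n2 (d s) + n2 ph * ennreal (2 * (e s)^2)" for s
 have V0: "(V ---> 0) (at_right 0)"
 proof -
  have "((%s. 2 * n2 (d s) + n2 ph * ennreal (2 * (e s)^2)) ---> 2 * 0 + n2 ph * ennreal (2 * 0^2)) (at_right 0)"
   using Ph by (intro tendsto_add ennreal_tendsto_cmult tendsto_ennrealI tendsto_mult tendsto_power
     tendsto_const D0 e0) auto
  thus ?thesis unfolding V_def by simp
 qed
 define D where "D s x = K s ph x - exp (l * s) * ph x" for s x
 have Dm [measurable]: "D s : \<B> borel" if "0 < s" for s unfolding D_def using that by measurable
 have n2D: "n2 (D s) <= ennreal (s^2) * V s" if s [simp]: "0 < s" for s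
 proof -
  have "(ennreal \<bar>D s x\<bar>)^2 <= ennreal (s^2) * (2 * (ennreal \<bar>d s x\<bar>)^2 + (ennreal \<bar>ph x\<bar>)^2 * ennreal (2 * (e s)^2))" for x
  proof -
   have "s * (d s x - e s * ph x) = s * ((K s ph x - ph x) / s) - s * ((exp (l * s) - 1) / s) * ph x"
    by (simp add: d_def e_def algebra_simps)
   hence D: "D s x = s * (d s x - e s * ph x)" 
    using less_imp_neq[OF s] by (simp add: D_def left_diff_distrib)
   have "(d s x - e s * ph x)^2 <= 2 * (d s x)^2 + (ph x)^2 * (2 * (e s)^2)"
    using sum_squares_bound[of "d s x" "- e s * ph x"] by (simp add: power2_diff power_mult_distrib algebra_simps)
   hence "(D s x)^2 <= s^2 * (2 * (d s x)^2 + (ph x)^2 * (2 * (e s)^2))"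
    unfolding D power_mult_distrib by (intro mult_left_mono) auto
   thus ?thesis
    by (simp add: ennreal_power ennreal_mult[symmetric] ennreal_plus[symmetric] ennreal_numeral[symmetric]
      del: ennreal_plus ennreal_numeral)
  qed
  hence "n2 (D s) <= (\<integral>\<^sup>+x. ennreal (s^2) * (2 * (ennreal \<bar>d s x\<bar>)^2 + (ennreal \<bar>ph x\<bar>)^2 * ennreal (2 * (e s)^2)) \<partial>m)"
   unfolding n2_def by (rule nn_integral_mono)
  also have "... = ennreal (s^2) * V s"
  proof -
   have [measurable]: "d s : \<B> borel" unfolding d_def by measurable
   show ?thesis unfolding V_def n2_def by (simp add: nn_integral_cmult nn_integral_add nn_integral_multc)
  qed
  finally show ?thesis .
 qed
 define H where "H = (\<integral>\<^sup>+x. (ennreal (h x))^2 \<partial>m)"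
 have H: "H < \<infinity>" using gh_L2 by (simp add: H_def)
 have const: "exp (- (l * t)) * K t ph x = exp (- (l * u)) * K u ph x" if ut: "0 < u" "u <= t" for u t x
 proof (rule constant_of_small_increments[OF ut(2)])
  fix ep :: real assume ep: "0 < ep"
  \<comment> \<open>Half of the minimal time \<open>u\<close> is reserved for the domination
    \<open>k c x y <= C * g x * h y\<close>, which turns a bound in \<open>L2\<close> into one at
    the point \<open>x\<close>; the remaining time \<open>q = r - c\<close> is covered by Schur's
    bound.\<close>
  define c where "c = u / 2"
  have c: "0 < c" using ut by (simp add: c_def)
  obtain C where C: "0 < C" "!!x y. k c x y <= C * g x * h y" using dom'[OF c] by blast
  define A where "A = (C * g x)^2 * (enn2real H * (exp (\<bar>B\<bar> * t))^2)"
  have A: "0 <= A" by (simp add: A_def)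
  have incr: "\<bar>K (r + s) ph x - exp (l * s) * K r ph x\<bar> <= s * sqrt (A * enn2real (V s))"
   if r: "u <= r" "r <= t" and s [simp]: "0 < s" and Vs: "V s < \<infinity>" for r s
  proof -
   define q where "q = r - c"
   have r0 [simp]: "0 < r" "0 < q" and rq: "c + q = r" "q <= t" using r ut by (auto simp: c_def q_def)
   have pos: "0 <= s * sqrt (A * enn2real (V s))" by (rule mult_nonneg_nonneg[OF less_imp_le[OF s]]) (use A in simp)
   have "n2 (D s) < \<infinity>" using n2D[OF s] Vs by (auto simp: ennreal_mult_less_top order_le_less_trans)
   hence DL: "D s : L2" using Dm[OF s] by (simp add: L2_def n2_def)
   have "K (r + s) ph x - exp (l * s) * K r ph x = K r (D s) x"
   proof -
    have "K r (D s) x = (LINT y|m. k r x y * K s ph y - exp (l * s) * (k r x y * ph y))"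
     unfolding K_def[of r] D_def by (intro bochner_cong refl) (simp add: algebra_simps)
    also have "... = K r (K s ph) x - exp (l * s) * K r ph x"
     unfolding K_def[of r] using L2_integrable[OF r0(1) K_L2[OF s L2], of x] L2_integrable[OF r0(1) L2, of x]
     by (subst Bochner_Integration.integral_diff) auto
    finally show ?thesis using K_semigroup[OF r0(1) s L2] by simp
   qed
   moreover have "(ennreal \<bar>K r (D s) x\<bar>)^2 <= (ennreal (s * sqrt (A * enn2real (V s))))^2"
   proof -
    let ?F = "%y. ennreal \<bar>D s y\<bar>"
    define G where "G = nnK q ?F"
    have [measurable]: "G : \<B> borel" unfolding G_def using Dm[OF s] by measurable
    have "ennreal \<bar>K r (D s) x\<bar> <= nnK r ?F x" by (rule K_le_nnK[OF r0(1) DL])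
    also have "... = nnK c G x" unfolding G_def using nnK_semigroup[OF c r0(2), of ?F x] Dm[OF s] by (simp add: rq)
    also have "... <= (\<integral>\<^sup>+y. ennreal (C * g x) * (ennreal (h y) * G y) \<partial>m)"
     unfolding nnK_def mult.assoc[symmetric] using C gh_pos(1)[of x] gh_pos(2)
     by (intro nn_integral_mono mult_right_mono) (auto simp: ennreal_mult[symmetric] less_imp_le intro!: ennreal_leI)
    also have "... = ennreal (C * g x) * (\<integral>\<^sup>+y. ennreal (h y) * G y \<partial>m)" by (rule nn_integral_cmult) measurable
    finally have "(ennreal \<bar>K r (D s) x\<bar>)^2 <= (ennreal (C * g x))^2 * (\<integral>\<^sup>+y. ennreal (h y) * G y \<partial>m)^2"
     unfolding power_mult_distrib[symmetric] by (intro power_mono) auto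
    also have "(\<integral>\<^sup>+y. ennreal (h y) * G y \<partial>m)^2 <= H * (\<integral>\<^sup>+y. (G y)^2 \<partial>m)"
     unfolding H_def by (rule Cauchy_Schwarz_nn_integral) measurable
    also have "(\<integral>\<^sup>+y. (G y)^2 \<partial>m) <= ennreal (exp (B * q)) * ennreal (exp (B * q)) * n2 (D s)"
     unfolding G_def n2_def using Dm[OF s] by (intro nnK_L2[OF r0(2)]) measurable
    also have "... <= ennreal ((exp (\<bar>B\<bar> * t))^2) * (ennreal (s^2) * V s)"
    proof (rule mult_mono[OF _ n2D[OF s]])
     have "B * q <= \<bar>B\<bar> * t" using less_imp_le[OF r0(2)] rq(2) by (intro order_trans[OF mult_right_mono[OF abs_ge_self] mult_left_mono]) auto
     hence "exp (B * q) * exp (B * q) <= (exp (\<bar>B\<bar> * t))^2"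
      unfolding power2_eq_square by (intro mult_mono) auto
     thus "ennreal (exp (B * q)) * ennreal (exp (B * q)) <= ennreal ((exp (\<bar>B\<bar> * t))^2)"
      by (simp add: ennreal_mult[symmetric] ennreal_leI)
    qed auto
    finally have *: "(ennreal \<bar>K r (D s) x\<bar>)^2 <= (ennreal (C * g x))^2 * (H * (ennreal ((exp (\<bar>B\<bar> * t))^2) * (ennreal (s^2) * V s)))"
     by (simp add: mult_left_mono)
    have "H = ennreal (enn2real H)" "V s = ennreal (enn2real (V s))" using H Vs by simp_all
    hence "(ennreal (C * g x))^2 * (H * (ennreal ((exp (\<bar>B\<bar> * t))^2) * (ennreal (s^2) * V s))) =
     ennreal ((C * g x)^2) * (ennreal (enn2real H) * (ennreal ((exp (\<bar>B\<bar> * t))^2) * (ennreal (s^2) * ennreal (enn2real (V s)))))"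
     using C(1) gh_pos(1)[of x] by (simp add: ennreal_power)
    also have "... = ennreal ((s * sqrt (A * enn2real (V s)))^2)"
     using A by (simp add: ennreal_mult[symmetric] power_mult_distrib A_def mult_ac)
    also have "... = (ennreal (s * sqrt (A * enn2real (V s))))^2"  by (rule ennreal_power[OF pos, symmetric])
    finally show ?thesis using * by simp
   qed
   hence "ennreal \<bar>K r (D s) x\<bar> <= ennreal (s * sqrt (A * enn2real (V s)))"
    by (rule ennreal_power2_le_imp_le[OF _ pos])
   ultimately show ?thesis using ennreal_le_iff[OF pos] by simp
  qed
  have "((%s. exp (\<bar>l\<bar> * t) * sqrt (A * enn2real (V s))) ---> exp (\<bar>l\<bar> * t) * sqrt (A * enn2real 0)) (at_right 0)"
   by (intro tendsto_mult tendsto_const tendsto_real_sqrt tendsto_enn2real) (simp_all add: V0)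
  hence "eventually (%s. exp (\<bar>l\<bar> * t) * sqrt (A * enn2real (V s)) < ep \<and> V s < \<infinity>) (at_right 0)"
   using ep by (intro eventually_conj order_tendstoD(2)[OF V0] order_tendstoD(2)) auto
  then obtain de where de: "0 < de" "!!s. 0 < s ==> s < de ==> exp (\<bar>l\<bar> * t) * sqrt (A * enn2real (V s)) < ep \<and> V s < \<infinity>"
   unfolding eventually_at_right_field by blast
  have "\<bar>exp (- (l * y)) * K y ph x - exp (- (l * r)) * K r ph x\<bar> <= ep * (y - r)"
   if r: "u <= r" "r <= y" "y <= t" "y - r < de" for r y
  proof (cases "r = y")
   case False
   define s where "s = y - r"
   have s: "0 < s" "s < de" "y = r + s" using r False by (auto simp: s_def)
   have "exp (- (l * y)) * K y ph x - exp (- (l * r)) * K r ph x = exp (- (l * y)) * (K (r + s) ph x - exp (l * s) * K r ph x)"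
    unfolding s(3) by (simp add: algebra_simps exp_add[symmetric])
   also have "\<bar>...\<bar> <= exp (\<bar>l\<bar> * t) * (s * sqrt (A * enn2real (V s)))"
    unfolding abs_mult abs_exp_cancel
   proof (intro mult_mono incr)
    have "- l * y <= \<bar>l\<bar> * t" using r ut by (intro order_trans[OF mult_right_mono[OF abs_ge_minus_self] mult_left_mono]) auto
    thus "exp (- (l * y)) <= exp (\<bar>l\<bar> * t)" by simp
   qed (use r s de(2)[OF s(1,2)] in auto)
   also have "... <= s * ep" using de(2)[OF s(1,2)] s(1) by (simp add: mult.left_commute less_imp_le)
   finally show ?thesis by (simp add: s_def mult.commute)
  qed simp
  thus "\<exists>d>0. \<forall>r y. u <= r --> r <= y --> y <= t --> y - r < d -->
   \<bar>exp (- (l * y)) * K y ph x - exp (- (l * r)) * K r ph x\<bar> <= ep * (y - r)"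
   using de(1) by blast
 qed
 show "K t ph x = exp (l * t) * ph x" if t [simp]: "0 < t" for t x
 proof -
  \<comment> \<open>By constancy \<open>D t\<close> is a bounded multiple of \<open>D s\<close> for
    every \<open>s < t\<close>, and the norm of \<open>D s\<close> tends to 0 with
    \<open>s\<close>.\<close>
  have "n2 (D t) <= ennreal ((exp (\<bar>l\<bar> * t))^2) * (ennreal (s^2) * V s)" if s: "0 < s" "s < t" for s
  proof -
   have D: "D t y = exp (l * (t - s)) * D s y" for y
   proof -
    have "K t ph y = exp (l * t) * (exp (- (l * t)) * K t ph y)" by (simp add: exp_minus)
    also have "... = exp (l * (t - s)) * K s ph y"
     unfolding const[OF s(1) less_imp_le[OF s(2)]] by (simp add: algebra_simps exp_diff exp_minus divide_inverse)
    finally show ?thesis by (simp add: D_def algebra_simps exp_add[symmetric])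
   qed
   have "exp (l * (t - s)) <= exp (\<bar>l\<bar> * t)"
    using s t by (simp add: order_trans[OF mult_right_mono[OF abs_ge_self] mult_left_mono])
   hence "(exp (l * (t - s)))^2 <= (exp (\<bar>l\<bar> * t))^2" by (intro power_mono) auto
   moreover have "n2 (D t) = ennreal ((exp (l * (t - s)))^2) * n2 (D s)"
    unfolding n2_def D abs_mult using Dm[OF s(1)]
    by (simp add: ennreal_mult power_mult_distrib ennreal_power nn_integral_cmult)
   ultimately show ?thesis using n2D[OF s(1)] by (auto intro!: mult_mono ennreal_leI)
  qed
  hence "eventually (%s. n2 (D t) <= ennreal ((exp (\<bar>l\<bar> * t))^2) * (ennreal (s^2) * V s)) (at_right 0)"
   unfolding eventually_at_right_field using t by blast
  moreover have "((%s. ennreal ((exp (\<bar>l\<bar> * t))^2) * (ennreal (s^2) * V s)) ---> ennreal ((exp (\<bar>l\<bar> * t))^2) * (ennreal (0^2) * 0)) (at_right 0)"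
   by (intro ennreal_tendsto_cmult tendsto_mult_ennreal tendsto_ennrealI tendsto_power V0 tendsto_ident_at) auto
  ultimately have "n2 (D t) <= 0" by (intro tendsto_lowerbound) auto
  hence "AE x in m. D t x = 0"
   unfolding n2_def using Dm[OF t] by (subst (asm) le_zero_eq, subst (asm) nn_integral_0_iff_AE) auto
  hence "AE x in m. K t ph x = exp (l * t) * ph x" by eventually_elim (simp add: D_def)
  thus ?thesis
   using L2 phc by (intro continuous_AE_eq K_continuous continuous_on_mult_left) simp_all
 qed
qed

lemma nnK_of_eigenfunction:
 assumes t [simp]: "0 < t" and f: "f : L2" "!!x. 0 <= f x"
 shows "nnK t (%y. ennreal (f y)) x = ennreal (K t f x)"
 unfolding nnK_def K_def using f(2) nonneg[OF t]
 by (subst nn_integral_eq_integral[OF L2_integrable[OF t f(1)], symmetric]) (auto simp: ennreal_mult)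

lemma small_outside_compact:
 fixes C :: "nat => 'e set"
 assumes C: "!!n. compact (C n)" "incseq C" "(\<Union>n. C n) = UNIV"
  and [measurable]: "f : \<B> borel" and fin: "(\<integral>\<^sup>+x. f x \<partial>m) < \<infinity>" and e: "0 < e"
 shows "\<exists>n. (\<integral>\<^sup>+x. f x * indicator (- C n) x \<partial>m) < e"
proof -
 have [measurable]: "C n : sets borel" for n
  using C(1) by (simp add: borel_closed compact_imp_closed)
 have "(%n. \<integral>\<^sup>+x. f x * indicator (- C n) x \<partial>m) ----> (\<integral>\<^sup>+x. 0 \<partial>m)"
 proof (rule nn_integral_dominated_convergence[where w=f])
  show "AE x in m. (%n. f x * indicator (- C n) x) ----> 0"
  proof (rule AE_I2)
   fix x
   obtain N where "x : C N" using C(3) by blast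
   hence "!!n. n >= N ==> f x * indicator (- C n) x = 0"
    using incseqD[OF C(2)] by (auto simp: indicator_def)
   thus "(%n. f x * indicator (- C n) x) ----> 0"
    by (intro tendsto_eventually) (auto simp: eventually_sequentially)
  qed
 qed (use fin in \<open>auto simp: indicator_def\<close>)
 thus ?thesis
  using order_tendstoD(2)[of _ 0 sequentially e] e by (auto simp: eventually_sequentially)
qed

text \<open>The eigenfunction property fixes the total \<open>exp (l * t) * g x\<close>; the part
  outside \<open>C n\<close> is at most \<open>c * g x\<close> times a tail of the integral of
  \<open>g * h\<close>. Both carry the same factor \<open>g x\<close>, so one compact set keeps half
  of the total simultaneously for all \<open>x\<close>.\<close>

lemma compact_mass_lower_bound:
 fixes C :: "nat => 'e set"
 assumes C: "!!n. compact (C n)" "incseq C" "(\<Union>n. C n) = UNIV" and t [simp]: "0 < t"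
  and eig: "!!x. K t g x = exp (l * t) * g x"
 shows "\<exists>n0. \<forall>n\<ge>n0. \<forall>x. ennreal (exp (l * t) / 2 * g x) <= (\<integral>\<^sup>+z. ennreal (k t x z) * ennreal (g z) * indicator (C n) z \<partial>m)"
proof -
 have [measurable]: "C n : sets borel" for n
  using C(1) by (simp add: borel_closed compact_imp_closed)
 obtain c where c: "0 < c" "!!x y. k t x y <= c * g x * h y" using dom'[OF t] by blast
 have "(\<integral>\<^sup>+x. ennreal (g x * h x) \<partial>m) < \<infinity>"
  using L2_mult_integrable[OF gh_in_L2] gh_pos by (simp add: integrable_iff_bounded abs_mult abs_of_pos)
 then obtain n0 where n0: "(\<integral>\<^sup>+x. ennreal (g x * h x) * indicator (- C n0) x \<partial>m) < ennreal (exp (l * t) / (2 * c))"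
  using small_outside_compact[OF C, of "%x. ennreal (g x * h x)" "ennreal (exp (l * t) / (2 * c))"] c by auto
 show ?thesis
 proof (intro exI[of _ n0] allI impI)
  fix n x assume n: "n0 <= n"
  have "(\<integral>\<^sup>+z. ennreal (k t x z) * ennreal (g z) * indicator (- C n) z \<partial>m)
   <= (\<integral>\<^sup>+z. ennreal (c * g x) * (ennreal (g z * h z) * indicator (- C n0) z) \<partial>m)"
  proof (rule nn_integral_mono)
   fix z
   have "k t x z * g z <= c * g x * (g z * h z)"
    using mult_right_mono[OF c(2)[of x z], of "g z"] gh_pos(1)[of z] by (simp add: mult_ac)
   hence "ennreal (k t x z) * ennreal (g z) <= ennreal (c * g x) * ennreal (g z * h z)"
    using c gh_pos nonneg[OF t] by (simp add: ennreal_mult[symmetric] less_imp_le ennreal_leI)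
   moreover have "indicator (- C n) z <= (indicator (- C n0) z :: ennreal)"
    using incseqD[OF C(2) n] by (auto simp: indicator_def)
   ultimately show "ennreal (k t x z) * ennreal (g z) * indicator (- C n) z <= ennreal (c * g x) * (ennreal (g z * h z) * indicator (- C n0) z)"
    unfolding mult.assoc[symmetric, of "ennreal (c * g x)"] by (rule mult_mono) auto
  qed
  also have "... = ennreal (c * g x) * (\<integral>\<^sup>+z. ennreal (g z * h z) * indicator (- C n0) z \<partial>m)"
   by (rule nn_integral_cmult) measurable
  also have "... <= ennreal (c * g x) * ennreal (exp (l * t) / (2 * c))"
   using n0 by (intro mult_left_mono) auto
  also have "... = ennreal (exp (l * t) / 2 * g x)"
   using c gh_pos by (simp add: ennreal_mult[symmetric] less_imp_le)
  finally have out: "(\<integral>\<^sup>+z. ennreal (k t x z) * ennreal (g z) * indicator (- C n) z \<partial>m) <= ennreal (exp (l * t) / 2 * g x)" .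
  have "ennreal (exp (l * t) / 2 * g x) + ennreal (exp (l * t) / 2 * g x) = ennreal (K t g x)"
   unfolding eig using gh_pos by (simp add: ennreal_plus[symmetric] less_imp_le del: ennreal_plus)
  also have "... = (\<integral>\<^sup>+z. ennreal (k t x z) * ennreal (g z) \<partial>m)"
   using nnK_of_eigenfunction[OF t gh_in_L2(1), of x] gh_pos(1) by (simp add: nnK_def less_imp_le)
  also have "... = (\<integral>\<^sup>+z. ennreal (k t x z) * ennreal (g z) * indicator (C n) z + ennreal (k t x z) * ennreal (g z) * indicator (- C n) z \<partial>m)"
   by (intro nn_integral_cong) (auto simp: indicator_def)
  also have "... = (\<integral>\<^sup>+z. ennreal (k t x z) * ennreal (g z) * indicator (C n) z \<partial>m) + (\<integral>\<^sup>+z. ennreal (k t x z) * ennreal (g z) * indicator (- C n) z \<partial>m)"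
   by (rule nn_integral_add) measurable
  also have "... <= (\<integral>\<^sup>+z. ennreal (k t x z) * ennreal (g z) * indicator (C n) z \<partial>m) + ennreal (exp (l * t) / 2 * g x)"
   by (intro add_left_mono out)
  finally show "ennreal (exp (l * t) / 2 * g x) <= (\<integral>\<^sup>+z. ennreal (k t x z) * ennreal (g z) * indicator (C n) z \<partial>m)"
   by (simp add: ennreal_add_left_cancel_le add.commute)
 qed
qed

text \<open>Ultracontractivity bounds the kernel from above only. Here \<open>t\<close> is divided
  in three: the first and the last third move a fixed share of the weighted mass from
  \<open>x\<close> into a compact set and from there to \<open>y\<close>; the middle third crosses
  the compact set, where the positive continuous quotient of the kernel by \<open>g z * h w\<close>
  has a positive minimum.\<close>

lemma lower_bound:
 fixes C :: "nat => 'e set"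
 assumes C: "!!n. compact (C n)" "incseq C" "(\<Union>n. C n) = UNIV" and t: "0 < t"
  and pos: "!!t x y. 0 < t ==> 0 < k t x y"
  and eig: "!!t x. 0 < t ==> K t g x = exp (l * t) * g x"
   "!!t y. 0 < t ==> (LINT x|m. k t x y * h x) = exp (l * t) * h y"
 shows "\<exists>c>0. \<forall>x y. c * g x * h y <= k t x y"
proof -
 interpret T: dominated_kernel m "%t x y. k t y x" B h g by (rule transpose)
 define s where "s = t / 3"
 have s [simp]: "0 < s" and ts: "t = s + (s + s)" using t by (auto simp: s_def)
 obtain n1 where n1: "!!n x. n1 <= n ==> ennreal (exp (l * s) / 2 * g x) <= (\<integral>\<^sup>+z. ennreal (k s x z) * ennreal (g z) * indicator (C n) z \<partial>m)"
  using compact_mass_lower_bound[OF C s eig(1)[OF s]] by blast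
 obtain n2 where n2: "!!n y. n2 <= n ==> ennreal (exp (l * s) / 2 * h y) <= (\<integral>\<^sup>+z. ennreal (k s z y) * ennreal (h z) * indicator (C n) z \<partial>m)"
  using T.compact_mass_lower_bound[OF C s] eig(2)[OF s] unfolding T.K_def by blast
 define D where "D = C (max n1 n2)"
 have D: "compact D" and [measurable]: "D : sets borel"
  using C(1) by (simp_all add: D_def borel_closed compact_imp_closed)
 have "\<exists>c>0. \<forall>z\<in>D. \<forall>w\<in>D. c * (g z * h w) <= k s z w"
 proof (cases "D = {}")
  case True thus ?thesis by (intro exI[of _ 1]) auto
 next
  case False
  have "continuous_on (D \<times> D) (%(z, w). k s z w / (g z * h w))"
  proof -
   have "continuous_on (D \<times> D) (%z. g (fst z))" "continuous_on (D \<times> D) (%z. h (snd z))"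
    by (auto intro!: continuous_on_compose2[OF gh_cont(1)] continuous_on_compose2[OF gh_cont(2)] continuous_intros)
   moreover have "continuous_on (D \<times> D) (%z. k s (fst z) (snd z))"
    using continuous_on_subset[OF cont[OF s]] by (simp add: case_prod_beta)
   ultimately show ?thesis
    using gh_pos by (auto simp: case_prod_beta less_imp_neq[symmetric] intro!: continuous_on_divide continuous_on_mult)
  qed
  then obtain z0 w0 where "!!z w. z : D ==> w : D ==> k s z0 w0 / (g z0 * h w0) <= k s z w / (g z * h w)"
   using continuous_attains_inf[OF compact_Times[OF D D], of "%(z, w). k s z w / (g z * h w)"] False by fastforce
  thus ?thesis
   using gh_pos pos[OF s] by (intro exI[of _ "k s z0 w0 / (g z0 * h w0)"]) (auto simp: pos_le_divide_eq)
 qed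
 then obtain c where c: "0 < c" "!!z w. z : D ==> w : D ==> c * (g z * h w) <= k s z w" by blast
 have "c * (exp (l * s) / 2)^2 * g x * h y <= k t x y" for x y
 proof -
  have "ennreal (c * (exp (l * s) / 2)^2 * g x * h y) = ennreal c * ennreal (exp (l * s) / 2 * g x) * ennreal (exp (l * s) / 2 * h y)"
   using c gh_pos by (simp add: ennreal_mult[symmetric] less_imp_le power2_eq_square mult_ac)
  also have "... <= ennreal c * (\<integral>\<^sup>+z. ennreal (k s x z) * ennreal (g z) * indicator D z \<partial>m) * (\<integral>\<^sup>+w. ennreal (k s w y) * ennreal (h w) * indicator D w \<partial>m)"
   unfolding D_def by (intro mult_mono n1 n2) auto
  also have "... = (\<integral>\<^sup>+z. ennreal c * (\<integral>\<^sup>+w. ennreal (k s w y) * ennreal (h w) * indicator D w \<partial>m) * (ennreal (k s x z) * ennreal (g z) * indicator D z) \<partial>m)"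
   by (subst nn_integral_cmult) (auto simp: mult_ac)
  also have "... <= (\<integral>\<^sup>+z. ennreal (k s x z) * (\<integral>\<^sup>+w. ennreal (k s z w) * ennreal (k s w y) \<partial>m) \<partial>m)"
  proof (rule nn_integral_mono)
   fix z
   show "ennreal c * (\<integral>\<^sup>+w. ennreal (k s w y) * ennreal (h w) * indicator D w \<partial>m) * (ennreal (k s x z) * ennreal (g z) * indicator D z)
    <= ennreal (k s x z) * (\<integral>\<^sup>+w. ennreal (k s z w) * ennreal (k s w y) \<partial>m)"
   proof (cases "z : D")
    case True
    have "ennreal (c * g z) * (\<integral>\<^sup>+w. ennreal (k s w y) * ennreal (h w) * indicator D w \<partial>m)
     = (\<integral>\<^sup>+w. ennreal (c * g z) * (ennreal (k s w y) * ennreal (h w) * indicator D w) \<partial>m)"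
     by (rule nn_integral_cmult[symmetric]) measurable
    also have "... <= (\<integral>\<^sup>+w. ennreal (k s z w) * ennreal (k s w y) \<partial>m)"
    proof (rule nn_integral_mono)
     fix w
     show "ennreal (c * g z) * (ennreal (k s w y) * ennreal (h w) * indicator D w) <= ennreal (k s z w) * ennreal (k s w y)"
     proof (cases "w : D")
      case w: True
      have "c * g z * (k s w y * h w) <= k s z w * k s w y"
       using mult_right_mono[OF c(2)[OF True w] nonneg[OF s, of w y]] by (simp add: mult_ac)
      thus ?thesis
       using w c gh_pos nonneg[OF s] by (simp add: ennreal_mult[symmetric] less_imp_le ennreal_leI)
     qed auto
    qed
    finally have "ennreal (k s x z) * (ennreal (c * g z) * (\<integral>\<^sup>+w. ennreal (k s w y) * ennreal (h w) * indicator D w \<partial>m))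
     <= ennreal (k s x z) * (\<integral>\<^sup>+w. ennreal (k s z w) * ennreal (k s w y) \<partial>m)"
     by (intro mult_left_mono) auto
    thus ?thesis using True c gh_pos by (simp add: ennreal_mult less_imp_le mult_ac)
   qed auto
  qed
  also have "... = ennreal (k t x y)"
   by (simp add: chapman_kolmogorov ts)
  finally show ?thesis using nonneg[OF t] by simp
 qed
 thus ?thesis
  using c by (intro exI[of _ "c * (exp (l * s) / 2)^2"]) auto
qed

text \<open>The equation \<open>f = K 1 f\<close> inserted into the two-sided kernel bound gives
  both constants, with \<open>I\<close> the integral of \<open>h * f\<close>. In this way the
  eigenfunctions of the Feynman-Kac semigroup become comparable to those of the motion.\<close>

lemma positive_eigenfunction_comparable:
 assumes low: "0 < c" "!!x y. c * g x * h y <= k 1 x y"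
  and f: "f : L2" "!!x. 0 < f x" "!!x. K 1 f x = f x"
 shows "\<exists>c1>0. \<exists>c2>0. \<forall>x. c1 * g x <= f x \<and> f x <= c2 * g x"
proof -
 obtain C where C: "0 < C" "!!x y. k 1 x y <= C * g x * h y" using dom'[of 1] by auto
 define I where "I = (LINT y|m. h y * f y)"
 have int: "integrable m (%y. h y * f y)" by (rule L2_mult_integrable[OF gh_in_L2(2) f(1)])
 have up: "f x <= C * g x * I" for x
 proof -
  have "K 1 f x <= (LINT y|m. C * g x * (h y * f y))"
   unfolding K_def
  proof (rule integral_mono)
   show "integrable m (%y. k 1 x y * f y)" using L2_integrable[OF _ f(1), of 1 x] by simp
   show "k 1 x y * f y <= C * g x * (h y * f y)" for y
    using mult_right_mono[OF C(2)[of x y] less_imp_le[OF f(2)[of y]]] by (simp add: mult_ac)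
  qed (use int in auto)
  thus ?thesis using f(3) by (simp add: I_def)
 qed
 have lo: "c * g x * I <= f x" for x
 proof -
  have "(LINT y|m. c * g x * (h y * f y)) <= K 1 f x"
   unfolding K_def
  proof (rule integral_mono)
   show "integrable m (%y. k 1 x y * f y)" using L2_integrable[OF _ f(1), of 1 x] by simp
   show "c * g x * (h y * f y) <= k 1 x y * f y" for y
    using mult_right_mono[OF low(2)[of x y] less_imp_le[OF f(2)[of y]]] by (simp add: mult_ac)
  qed (use int in auto)
  thus ?thesis using f(3) by (simp add: I_def)
 qed
 have "0 < C * g undefined * I" using up[of undefined] f(2)[of undefined] by linarith
 hence "0 < I" by (rule zero_less_mult_pos) (use C(1) gh_pos(1) in auto)
 thus ?thesis
  using up lo C low by (intro exI[of _ "c * I"] exI[of _ "C * I"] conjI allI) (auto simp: mult_ac)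
qed

end

section \<open>Principal eigenfunctions and uniform convergence of the kernel\<close>

locale principal_kernel = dominated_kernel m k b g h
 for m :: "'e::{metric_space, second_countable_topology} measure"
  and k :: "real => 'e => 'e => real" and b :: real and g h :: "'e => real" +
 fixes ph ph' :: "'e => real"
 assumes lower: "!!t. 0 < t ==> \<exists>c>0. \<forall>x y. c * g x * h y <= k t x y"
  and g_bounded: "bounded (range g)"
  and ph_L2: "ph : L2" "ph' : L2"
  and ph_pos: "!!x. 0 < ph x" "!!x. 0 < ph' x"
  and ph_inv: "!!t x. 0 < t ==> K t ph x = ph x"
  and ph'_inv: "!!t y. 0 < t ==> (LINT x|m. k t x y * ph' x) = ph' y"
  and ph_norm: "(LINT x|m. ph x * ph' x) = 1"
begin

lemma ph_measurable [measurable]: "ph : \<B> borel" "ph' : \<B> borel"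
 using ph_L2 by (auto simp: L2_def)

lemma ph_comparable: "\<exists>c1>0. \<exists>c2>0. \<forall>x. c1 * g x <= ph x \<and> ph x <= c2 * g x"
proof -
 obtain c where "0 < c" "!!x y. c * g x * h y <= k 1 x y" using lower[of 1] by auto
 thus ?thesis
  by (rule positive_eigenfunction_comparable) (use ph_L2 ph_pos ph_inv in auto)
qed

lemma ph'_comparable: "\<exists>c1>0. \<exists>c2>0. \<forall>x. c1 * h x <= ph' x \<and> ph' x <= c2 * h x"
proof -
 interpret T: dominated_kernel m "%t x y. k t y x" b h g by (rule transpose)
 obtain c where c: "0 < c" "!!x y. c * g x * h y <= k 1 x y" using lower[of 1] by auto
 show ?thesis
  using c by (intro T.positive_eigenfunction_comparable[of c])
   (use ph_L2 ph_pos ph'_inv[of 1] in \<open>auto simp: T.K_def L2_def T.L2_def mult_ac\<close>)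
qed

lemma ph_bounded: "\<exists>C. \<forall>x. ph x <= C"
proof -
 obtain c2 where c2: "0 < c2" "!!x. ph x <= c2 * g x" using ph_comparable by blast
 obtain G where G: "!!x. g x <= G" using g_bounded by (auto simp: bounded_iff abs_le_iff)
 have "ph x <= c2 * G" for x
  using c2(2)[of x] mult_left_mono[OF G[of x], of c2] c2(1) by linarith
 thus ?thesis by blast
qed

lemma integrable_k: assumes "0 < t" shows "integrable m (k t x)"
proof (rule integrableI_bounded)
 show "(\<integral>\<^sup>+y. ennreal (norm (k t x y)) \<partial>m) < \<infinity>"
  using row[OF assms, of x] nonneg[OF assms] by (simp add: order_le_less_trans[of _ "ennreal (exp (b * t))"])
qed (use assms in measurable)

text \<open>The row \<open>k 1 x0\<close> of a single point is integrable and lies above a multiple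
  of \<open>h\<close>, which in turn lies above a multiple of \<open>ph'\<close>.\<close>

lemma ph'_integrable: "integrable m ph'"
proof -
 obtain c where c: "0 < c" "!!x y. c * g x * h y <= k 1 x y" using lower[of 1] by auto
 obtain c2 where c2: "0 < c2" "!!x. ph' x <= c2 * h x" using ph'_comparable by blast
 define x0 :: 'e where "x0 = undefined"
 have "integrable m (%y. c2 / (c * g x0) * k 1 x0 y)"
  using integrable_k[of 1 x0] by simp
 thus ?thesis
 proof (rule Bochner_Integration.integrable_bound)
  show "AE y in m. norm (ph' y) <= norm (c2 / (c * g x0) * k 1 x0 y)"
  proof (rule AE_I2)
   fix y
   have "ph' y <= c2 / (c * g x0) * (c * g x0 * h y)"
    using c2(2)[of y] c gh_pos(1)[of x0] by simp
   also have "... <= c2 / (c * g x0) * k 1 x0 y"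
    using c c2 gh_pos(1)[of x0] by (intro mult_left_mono) (auto simp: less_imp_le)
   finally show "norm (ph' y) <= norm (c2 / (c * g x0) * k 1 x0 y)"
    using ph_pos(2)[of y] abs_ge_self[of "c2 / (c * g x0) * k 1 x0 y"] unfolding real_norm_def by linarith
  qed
 qed measurable
qed

lemma phph'_integrable: "integrable m (%x. ph x * ph' x)"
 by (rule L2_mult_integrable[OF ph_L2])

lemma k_upper:
 assumes t: "0 < t"
 shows "\<exists>C>0. \<forall>x y. k t x y <= C * ph x * ph' y"
proof -
 obtain C where C: "0 < C" "!!x y. k t x y <= C * g x * h y" using dom'[OF t] by auto
 obtain a where a: "0 < a" "!!x. a * g x <= ph x" using ph_comparable by blast
 obtain a' where a': "0 < a'" "!!x. a' * h x <= ph' x" using ph'_comparable by blast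
 have "k t x y <= C / (a * a') * ph x * ph' y" for x y
 proof -
  have "k t x y <= C / (a * a') * ((a * g x) * (a' * h y))"
   using C(2)[of x y] a(1) a'(1) by (simp add: field_simps)
  also have "... <= C / (a * a') * (ph x * ph' y)"
   using C(1) a a' gh_pos ph_pos by (intro mult_left_mono mult_mono) (auto simp: less_imp_le)
  finally show ?thesis by (simp add: mult.assoc)
 qed
 thus ?thesis using C a a' by (intro exI[of _ "C / (a * a')"]) auto
qed

lemma k_lower:
 assumes t: "0 < t"
 shows "\<exists>c>0. \<forall>x y. c * ph x * ph' y <= k t x y"
proof -
 obtain C where C: "0 < C" "!!x y. C * g x * h y <= k t x y" using lower[OF t] by auto
 obtain a where a: "0 < a" "!!x. ph x <= a * g x" using ph_comparable by blast
 obtain a' where a': "0 < a'" "!!x. ph' x <= a' * h x" using ph'_comparable by blast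
 have "C / (a * a') * ph x * ph' y <= k t x y" for x y
 proof -
  have "C / (a * a') * (ph x * ph' y) <= C / (a * a') * ((a * g x) * (a' * h y))"
   using C(1) a a' gh_pos ph_pos by (intro mult_left_mono mult_mono) (auto simp: less_imp_le)
  also have "... <= k t x y"
   using C(2)[of x y] a(1) a'(1) by (simp add: field_simps)
  finally show ?thesis by (simp add: mult.assoc)
 qed
 thus ?thesis using C a a' by (intro exI[of _ "C / (a * a')"]) auto
qed

lemma k_semigroup:
 assumes st: "0 < s" "0 < t"
 shows "(LINT z|m. k s x z * k t z y) = k (s + t) x y" "integrable m (%z. k s x z * k t z y)"
proof -
 note st [simp]
 have n: "(\<integral>\<^sup>+z. ennreal (k s x z * k t z y) \<partial>m) = ennreal (k (s + t) x y)"
  using chapman_kolmogorov[of s t x y] nonneg by (simp add: ennreal_mult)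
 show "integrable m (%z. k s x z * k t z y)"
  by (rule integrableI_bounded) (use n nonneg in auto)
 show "(LINT z|m. k s x z * k t z y) = k (s + t) x y"
  using n nonneg nonneg[OF add_pos_pos[OF st], of x y] by (subst integral_eq_nn_integral) auto
qed

text \<open>Doeblin's argument: after subtracting the minorant \<open>c ph(x) ph'(y)\<close> from the kernel at time 1,
 one step contracts the distance to \<open>ph(x) ph'(y)\<close> by the factor \<open>1 - c\<close>.\<close>

theorem uniform_convergence:
 assumes e: "0 < e"
 shows "\<exists>s0>0. \<forall>t\<ge>s0. \<forall>x y. \<bar>k t x y - ph x * ph' y\<bar> <= e * ph x * ph' y"
proof -
 obtain C where C: "0 < C" "!!x y. k 1 x y <= C * ph x * ph' y" using k_upper[of 1] by auto
 obtain c where c: "0 < c" "!!x y. c * ph x * ph' y <= k 1 x y" using k_lower[of 1] by auto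
 have int1: "integrable m (%z. k t x z * ph z)" if "0 < t" for t x
  by (rule L2_integrable[OF that ph_L2(1)])
 \<comment> \<open>The constant of time 1 serves all later times, as \<open>ph\<close> is invariant
   under the first \<open>t - 1\<close> units.\<close>
 have up: "k t x y <= C * ph x * ph' y" if t: "1 < t" for t x y
 proof -
  define s where "s = t - 1"
  have s: "0 < s" and ts: "t = s + 1" using t by (auto simp: s_def)
  have "k t x y = (LINT z|m. k s x z * k 1 z y)" using k_semigroup(1)[OF s, of 1] ts by simp
  also have "... <= (LINT z|m. C * ph' y * (k s x z * ph z))"
  proof (rule integral_mono)
   show "k s x z * k 1 z y <= C * ph' y * (k s x z * ph z)" for z
    using mult_left_mono[OF C(2)[of z y] nonneg[OF s, of x z]] by (simp add: mult_ac)
  qed (use k_semigroup(2)[OF s] int1[OF s] in auto)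
  also have "... = C * ph x * ph' y" using ph_inv[OF s, of x] by (simp add: K_def)
  finally show ?thesis .
 qed
 \<comment> \<open>Integration against \<open>ph\<close> yields \<open>c * ph x\<close> for the
   minorant and \<open>ph x\<close> for the kernel.\<close>
 have c1: "c <= 1"
 proof -
  have "(LINT z|m. c * ph undefined * (ph z * ph' z)) <= (LINT z|m. k 1 undefined z * ph z)"
  proof (rule integral_mono)
   show "c * ph undefined * (ph z * ph' z) <= k 1 undefined z * ph z" for z
    using mult_right_mono[OF c(2)[of undefined z] less_imp_le[OF ph_pos(1)[of z]]] by (simp add: mult_ac)
  qed (use int1 phph'_integrable in auto)
  hence "c * ph undefined <= ph undefined" using ph_inv[of 1 undefined] ph_norm by (simp add: K_def)
  thus ?thesis using ph_pos(1)[of undefined] by simp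
 qed
 define d where "d t x y = k t x y - ph x * ph' y" for t x y
 have contract: "\<bar>d (t + 1) x y\<bar> <= (1 - c) * D * ph x * ph' y"
  if t: "0 < t" and D: "!!x y. \<bar>d t x y\<bar> <= D * ph x * ph' y" for t D x y
 proof -
  have i1: "integrable m (%z. k 1 x z * d t z y)"
   unfolding d_def right_diff_distrib using k_semigroup(2)[OF _ t, of 1] int1[of 1 x]
   by (auto simp: mult.assoc[symmetric])
  have i3: "integrable m (%z. k t z y * ph' z)"
  proof -
   interpret T: dominated_kernel m "%t x y. k t y x" b h g by (rule transpose)
   show ?thesis using T.L2_integrable[OF t, of ph' y] ph_L2 by (simp add: T.L2_def L2_def)
  qed
  have i2: "integrable m (%z. c * ph x * ph' z * d t z y)"
  proof -
   have "integrable m (%z. c * ph x * (k t z y * ph' z) - c * ph x * ph' y * (ph z * ph' z))"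
    using i3 phph'_integrable by auto
   thus ?thesis by (simp add: d_def algebra_simps)
  qed
  \<comment> \<open>Both terms of \<open>d\<close> have the same integral against
    \<open>ph'\<close>, so the minorant integrates to 0 against \<open>d\<close> and may be
    subtracted from the kernel before absolute values are taken. This is where the factor
    \<open>1 - c\<close> is gained.\<close>
  have z2: "(LINT z|m. c * ph x * ph' z * d t z y) = 0"
  proof -
   have "(LINT z|m. c * ph x * ph' z * d t z y) = (LINT z|m. c * ph x * (k t z y * ph' z) - c * ph x * ph' y * (ph z * ph' z))"
    by (simp add: d_def algebra_simps)
   also have "... = c * ph x * ph' y - c * ph x * ph' y * 1"
    using i3 phph'_integrable by (simp add: ph'_inv[OF t] ph_norm)
   finally show ?thesis by simp
  qed
  have "d (t + 1) x y = (LINT z|m. k 1 x z * d t z y)"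
  proof -
   have "(LINT z|m. k 1 x z * d t z y) = (LINT z|m. k 1 x z * k t z y - ph' y * (k 1 x z * ph z))"
    by (simp add: d_def algebra_simps)
   also have "... = k (1 + t) x y - ph' y * ph x"
    using k_semigroup[OF _ t, of 1 x y] int1[of 1 x] ph_inv[of 1 x] by (simp add: K_def)
   finally show ?thesis by (simp add: d_def add.commute mult.commute)
  qed
  also have "... = (LINT z|m. (k 1 x z - c * ph x * ph' z) * d t z y)"
   using i1 i2 z2 by (simp add: left_diff_distrib)
  also have "\<bar>...\<bar> <= (LINT z|m. \<bar>(k 1 x z - c * ph x * ph' z) * d t z y\<bar>)"
   by (rule integral_abs_bound)
  also have "... <= (LINT z|m. D * ph' y * (k 1 x z * ph z) - D * ph' y * (c * ph x * (ph z * ph' z)))"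
  proof (rule integral_mono)
   show "integrable m (%z. \<bar>(k 1 x z - c * ph x * ph' z) * d t z y\<bar>)"
    using i1 i2 by (simp add: left_diff_distrib)
   show "integrable m (%z. D * ph' y * (k 1 x z * ph z) - D * ph' y * (c * ph x * (ph z * ph' z)))"
    using int1[of 1 x] phph'_integrable by auto
   fix z
   have "\<bar>(k 1 x z - c * ph x * ph' z) * d t z y\<bar> = (k 1 x z - c * ph x * ph' z) * \<bar>d t z y\<bar>"
    using c(2)[of x z] by (simp add: abs_mult)
   also have "... <= (k 1 x z - c * ph x * ph' z) * (D * ph z * ph' y)"
    using c(2)[of x z] by (intro mult_left_mono D) auto
   finally show "\<bar>(k 1 x z - c * ph x * ph' z) * d t z y\<bar> <= D * ph' y * (k 1 x z * ph z) - D * ph' y * (c * ph x * (ph z * ph' z))"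
    by (simp add: algebra_simps)
  qed
  also have "... = D * ph' y * ph x - D * ph' y * (c * ph x)"
   using int1[of 1 x] phph'_integrable ph_inv[of 1 x] by (simp add: K_def ph_norm)
  finally show ?thesis by (simp add: algebra_simps)
 qed
 have it: "\<bar>d (t + real n) x y\<bar> <= (1 - c) ^ n * (C + 1) * ph x * ph' y" if t: "1 < t" for t n x y
 proof (induction n arbitrary: x y)
  case 0
  have "\<bar>d t x y\<bar> <= \<bar>k t x y\<bar> + \<bar>ph x * ph' y\<bar>" unfolding d_def by (rule abs_triangle_ineq4)
  also have "... <= C * ph x * ph' y + ph x * ph' y"
   using up[OF t, of x y] nonneg[of t x y] t ph_pos by (simp add: less_imp_le)
  finally show ?case by (simp add: algebra_simps)
 next
  case (Suc n)
  show ?case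
   using contract[of "t + real n" "(1 - c) ^ n * (C + 1)" x y] Suc t by (simp add: mult_ac add_ac)
 qed
 have "(%n. (1 - c) ^ n * (C + 1)) ----> 0 * (C + 1)"
  using c c1 by (intro tendsto_mult tendsto_const LIMSEQ_realpow_zero) auto
 then obtain n where n: "(1 - c) ^ n * (C + 1) < e"
  using order_tendstoD(2)[of _ "0 * (C + 1)" sequentially e] e by (auto simp: eventually_sequentially)
 show ?thesis
 proof (intro exI[of _ "real n + 2"] conjI allI impI)
  fix t x y assume t: "real n + 2 <= t"
  have "\<bar>d (t - real n + real n) x y\<bar> <= (1 - c) ^ n * (C + 1) * ph x * ph' y"
   using t by (intro it) auto
  also have "... <= e * ph x * ph' y"
   using n ph_pos by (intro mult_right_mono) (auto simp: less_imp_le)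
  finally show "\<bar>k t x y - ph x * ph' y\<bar> <= e * ph x * ph' y" by (simp add: d_def)
 qed auto
qed

end

section \<open>Bounded Borel functions, sections of measurable functions, antiderivatives\<close>

lemma bbI:
 "f : \<B> borel ==> (!!x. \<bar>f x\<bar> <= C) ==> f : bounded_borel"
 by (auto simp: bounded_borel_def bounded_iff)

lemma bbE:
 assumes "f : bounded_borel"
 obtains C where "0 <= C" "!!x. \<bar>f x\<bar> <= C"
 using assms by (auto simp: bounded_borel_def bounded_iff) (meson abs_ge_zero order_trans)

lemma cmult_bounded_borel:
 assumes "f : bounded_borel" shows "(%y. c * f y) : bounded_borel"
proof -
 obtain C where "0 <= C" "!!x. \<bar>f x\<bar> <= C" using bbE[OF assms] by blast
 thus ?thesis
  using assms by (intro bbI[where C="\<bar>c\<bar> * C"]) (auto simp: bounded_borel_def abs_mult intro!: mult_left_mono)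
qed

lemma bbD [measurable_dest]: "f : bounded_borel ==> f : \<B> borel"
 by (simp add: bounded_borel_def)

lemma section_right:
 assumes "(%(t, x). f t x) : M \<Otimes>\<^sub>M N \<rightarrow>\<^sub>M L" "t : space M"
 shows "f t : N \<rightarrow>\<^sub>M L"
 using measurable_compose[OF measurable_Pair1'[OF assms(2)] assms(1)] by simp

lemma section_left:
 assumes "(%(t, x). f t x) : M \<Otimes>\<^sub>M N \<rightarrow>\<^sub>M L" "x : space N"
 shows "(%t. f t x) : M \<rightarrow>\<^sub>M L"
 using measurable_compose[OF measurable_Pair2'[OF assms(2)] assms(1)] by simp

lemma curried_compose:
 assumes "(%(t, x). f t x) : M \<Otimes>\<^sub>M N \<rightarrow>\<^sub>M L" "g : R \<rightarrow>\<^sub>M M" "h : R \<rightarrow>\<^sub>M N"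
 shows "(%z. f (g z) (h z)) : R \<rightarrow>\<^sub>M L"
 using measurable_compose[OF measurable_Pair[OF assms(2,3)] assms(1)] by simp

lemma antiderivative_positive:
 fixes f :: "real => real"
 assumes f: "!!z. 0 < z ==> isCont f z"
 obtains Ph where "!!z. 0 < z ==> (Ph has_real_derivative f z) (at z)"
proof
 define c :: real where "c = 1"
 fix z :: real assume z: "0 < z"
 define a b where "a = min (z / 2) (1 / 2)" and "b = max (2 * z) 2"
 have ab: "0 < a" "a <= c" "c <= b" "a < z" "z < b" using z by (auto simp: a_def b_def min_def max_def c_def)
 have "((%u. LBINT y=c..u. f y) has_vector_derivative f z) (at z within {a..b})"
 proof (rule interval_integral_FTC2)
  show "continuous_on {a..b} f"
   using ab f by (intro continuous_at_imp_continuous_on) auto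
 qed (use ab in auto)
 thus "((%u. LBINT y=c..u. f y) has_real_derivative f z) (at z)"
  using ab at_within_interior[of z "{a..b}"] by (simp add: has_real_derivative_iff_has_vector_derivative)
qed

section \<open>Abstract critical semigroups, the interface between motion and equation\<close>

locale critical_semigroup =
 fixes m :: "'e::{metric_space, second_countable_topology} measure"
  and Q :: "real => ('e => real) => 'e => real"
  and ph ph' :: "'e => real"
 assumes sets_m [measurable_cong]: "sets m = sets borel"
  and sigma_finite: "sigma_finite_measure m"
  and Q_0: "!!f x. f : bounded_borel ==> Q 0 f x = f x"
  and Q_linear: "!!t f g a b x. 0 <= t ==> f : bounded_borel ==> g : bounded_borel ==>
    Q t (%y. a * f y + b * g y) x = a * Q t f x + b * Q t g x"
  and Q_mono: "!!t f g x. 0 <= t ==> f : bounded_borel ==> g : bounded_borel ==>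
    (!!y. f y <= g y) ==> Q t f x <= Q t g x"
  and Q_mono_AE: "!!t f g x. 0 < t ==> f : bounded_borel ==> g : bounded_borel ==>
    (AE y in m. f y <= g y) ==> Q t f x <= Q t g x"
  and Q_semigroup: "!!s t f x. 0 <= s ==> 0 <= t ==> f : bounded_borel ==> Q (s + t) f x = Q s (Q t f) x"
  and Q_measurable: "!!H. (%(r, y). H r y) : \<B> borel2 ==>
    (%(r, x). Q (max 0 r) (H r) x) : \<B> borel2"
  and Q_bounded: "\<exists>C\<ge>0. \<forall>t\<ge>0. \<forall>x. Q t (%_. 1) x <= C"
  and Q_convergence: "!!t f F C x. 0 <= t ==> (!!n. F n : bounded_borel) ==> f : bounded_borel ==>
    (!!n y. \<bar>F n y\<bar> <= C) ==> (!!y. (%n. F n y) ----> f y) ==> (%n. Q t (F n) x) ----> Q t f x"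
  and ph_measurable [measurable]: "ph : \<B> borel" "ph' : \<B> borel"
  and ph_pos: "!!x. 0 < ph x" "!!x. 0 < ph' x"
  and ph_bounded: "\<exists>C. \<forall>x. ph x <= C"
  and ph'_integrable: "integrable m ph'"
  and duality: "!!t f. 0 <= t ==> f : bounded_borel ==>
    (LINT x|m. Q t f x * ph' x) = (LINT x|m. f x * ph' x)"
  and invariant: "!!t x. 0 <= t ==> Q t ph x = ph x"
  and ultrabound: "!!t. 0 < t ==> \<exists>C>0. \<forall>f\<in>bounded_borel. \<forall>x. (\<forall>y. 0 <= f y) -->
    Q t f x <= C * ph x * (LINT y|m. f y * ph' y)"
  and ultralower: "!!t. 0 < t ==> \<exists>c>0. \<forall>f\<in>bounded_borel. \<forall>x. (\<forall>y. 0 <= f y) -->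
    c * ph x * (LINT y|m. f y * ph' y) <= Q t f x"
  and ergodic: "!!e. 0 < e ==> \<exists>s>0. \<forall>f\<in>bounded_borel. \<forall>x. (\<forall>y. 0 <= f y) -->
    \<bar>Q s f x - ph x * (LINT y|m. f y * ph' y)\<bar> <= e * ph x * (LINT y|m. f y * ph' y)"
  and m_pos: "emeasure m UNIV ~= 0"
begin

sublocale sigma_finite_measure m by (rule sigma_finite)

sublocale pair: pair_sigma_finite lborel m ..

lemma space_m [simp]: "space m = UNIV"
 using sets_eq_imp_space_eq[OF sets_m] by simp

lemma Q_measurable_x [measurable]:
 assumes f: "f : bounded_borel" and t: "0 <= t"
 shows "Q t f : \<B> borel"
proof -
 note [measurable] = bbD[OF f]
 have [measurable]: "(%(r, x). Q (max 0 r) f x) : \<B> borel2"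
  by (rule Q_measurable) measurable
 have "(%x. (%(r, x). Q (max 0 r) f x) (t, x)) : \<B> borel" by measurable
 thus ?thesis using t by (simp add: max_def)
qed

lemma Q_cmult:
 assumes "0 <= t" "f : bounded_borel"
 shows "Q t (%y. c * f y) x = c * Q t f x"
 using Q_linear[OF assms assms(2), of c 0 x] by simp

lemma const_bounded_borel [simp]: "(%_. c) : bounded_borel"
 by (rule bbI[where C="\<bar>c\<bar>"]) auto

lemma Q_abs_bound:
 obtains C where "0 <= C" "!!t f M x. 0 <= t ==> f : bounded_borel ==> (!!y. \<bar>f y\<bar> <= M) ==> \<bar>Q t f x\<bar> <= C * M"
proof -
 obtain C where C: "0 <= C" "!!t x. 0 <= t ==> Q t (%_. 1) x <= C" using Q_bounded by blast
 have "\<bar>Q t f x\<bar> <= C * M" if t: "0 <= t" and f: "f : bounded_borel" "!!y. \<bar>f y\<bar> <= M" for t f M x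
 proof -
  have M: "0 <= M" using f(2)[of undefined] by linarith
  have c: "Q t (%_. a) x = a * Q t (%_. 1) x" for a using Q_cmult[OF t, of "%_. 1" a x] by simp
  have "Q t f x <= Q t (%_. M) x" "Q t (%_. - M) x <= Q t f x"
   using t f by (auto intro!: Q_mono simp: abs_le_iff minus_le_iff)
  moreover have "M * Q t (%_. 1) x <= M * C" using M C(2)[OF t] by (intro mult_left_mono) auto
  ultimately show ?thesis unfolding c[of M] c[of "- M"] by (simp add: abs_le_iff mult.commute)
 qed
 thus ?thesis using C(1) that by blast
qed

lemma Q_bounded_borel:
 assumes f: "f : bounded_borel" and t: "0 <= t"
 shows "Q t f : bounded_borel"
proof -
 obtain M where M: "!!y. \<bar>f y\<bar> <= M" using bbE[OF f] by blast
 obtain C where "!!x. \<bar>Q t f x\<bar> <= C * M" using Q_abs_bound t f M by metis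
 thus ?thesis using f t by (intro bbI) auto
qed

lemma Q_nonneg:
 assumes "0 <= t" "f : bounded_borel" "!!y. 0 <= f y"
 shows "0 <= Q t f x"
 using Q_mono[of t "%_. 0" f x] Q_cmult[of t "%_. 0" 0 x] assms by simp

lemma integrable_mult_ph':
 assumes f: "f : bounded_borel"
 shows "integrable m (%x. f x * ph' x)"
proof -
 obtain M where M: "0 <= M" "!!y. \<bar>f y\<bar> <= M" using bbE[OF f] by blast
 note [measurable] = bbD[OF f]
 show ?thesis
 proof (rule Bochner_Integration.integrable_bound)
  show "integrable m (%x. M * ph' x)" using ph'_integrable by simp
  show "AE x in m. norm (f x * ph' x) <= norm (M * ph' x)"
   using M ph_pos(2) by (auto simp: abs_mult intro!: mult_right_mono)
 qed measurable
qed

lemma integral_pos: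
 fixes f :: "'e => real"
 assumes [measurable]: "f : \<B> borel" and i: "integrable m f" and nn: "!!x. 0 <= f x"
  and A: "emeasure m A ~= 0" "A : sets borel" "!!x. x : A ==> 0 < f x"
 shows "0 < (LINT x|m. f x)"
proof -
 have "(LINT x|m. f x) ~= 0"
 proof
  assume "(LINT x|m. f x) = 0"
  hence "AE x in m. f x = 0" using integral_nonneg_eq_0_iff_AE[OF i] nn by simp
  hence "AE x in m. x \<notin> A" by eventually_elim (use A(3) in force)
  hence "emeasure m A = 0" using A(2) by (subst (asm) AE_iff_measurable[of A]) (auto simp: sets_m)
  thus False using A(1) by simp
 qed
 moreover have "0 <= (LINT x|m. f x)" using nn by simp
 ultimately show ?thesis by simp
qed

definition mass' :: real where "mass' = (LINT x|m. ph' x)"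

lemma mass'_pos: "0 < mass'"
 unfolding mass'_def using ph'_integrable ph_pos m_pos
 by (intro integral_pos[where A=UNIV]) (auto intro: less_imp_le)

lemma ph_bounded_borel: "ph : bounded_borel"
 using ph_bounded ph_pos by (auto intro!: bbI simp: less_imp_le)

end

section \<open>The stable branching equation: decay, smallness and shape of solutions\<close>

locale stable_branching_semigroup = critical_semigroup +
 fixes ka ga :: "'a => real" and ka0 ga0 K :: real
 assumes ka_measurable [measurable]: "ka : \<B> borel" and ga_measurable [measurable]: "ga : \<B> borel"
  and ka: "!!x. 0 < ka x" "!!x. ka x <= K"
  and ga: "!!x. 1 < ga x" "!!x. ga x < 2"
  and ka0: "0 < ka0" "AE x in m. ka0 <= ka x"
  and ga0: "1 < ga0" "AE x in m. ga0 <= ga x" "!!e. 0 < e ==> emeasure m {x. ga x < ga0 + e} ~= 0"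
begin

definition N :: "(real => 'a => real) => real => 'a => real" where
 "N v t y = ka y * v t y powr ga y"

text \<open>The equation relates any two times, with the flow restarted from \<open>v t\<close>. In
  this form it survives time shifts and monotone limits, also when there is no initial value at time
  0. Boundedness is global in time, and \<open>max 0 t\<close> only serves to state joint
  measurability on all reals.\<close>

definition solution :: "(real => 'a => real) => bool" where
 "solution v \<longleftrightarrow>
  (%(t, x). v (max 0 t) x) : \<B> borel2 \<and>
  (\<forall>t\<ge>0. \<forall>x. 0 <= v t x) \<and> (\<exists>C. \<forall>t\<ge>0. \<forall>x. v t x <= C) \<and>
  (\<forall>s\<ge>0. \<forall>t\<ge>0. \<forall>x. v (t + s) x + (LBINT r:{0..s}. Q r (N v (t + s - r)) x) = Q s (v t) x)"

definition a :: "(real => 'a => real) => real => real" where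
 "a v t = (LINT x|m. v t x * ph' x)"

text \<open>Minus the time derivative of \<open>a v\<close>: pairing the equation with the invariant
  \<open>ph'\<close> leaves only the nonlinear term.\<close>

definition F :: "(real => 'a => real) => real => real" where
 "F v t = (LINT x|m. N v t x * ph' x)"

lemma K_pos: "0 < K" using ka[of undefined] by linarith

lemma powr_le_linear:
 assumes "0 <= z" "z <= M" "1 <= M"
 shows "ka y * z powr ga y <= K * M * z"
proof (cases "z = 0")
 case False
 hence z: "0 < z" using assms by simp
 have "z powr ga y = z powr (ga y - 1) * z" using z by (simp add: powr_diff)
 also have "... <= M powr (ga y - 1) * z" using assms z ga[of y] by (intro mult_right_mono powr_mono2) auto
 also have "... <= M powr 1 * z" using assms z ga[of y] by (intro mult_right_mono powr_mono) auto
 finally have "z powr ga y <= M * z" using assms by simp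
 hence "ka y * z powr ga y <= K * (M * z)"
  using ka[of y] z by (intro mult_mono) auto
 thus ?thesis by simp
qed simp

text \<open>For values below \<open>de\<close> the nonlinearity is at most a small multiple of the
  value itself. The exponent enters through \<open>ga0 <= ga y\<close>, known only almost
  everywhere, which is the reason for the almost everywhere hypotheses further on.\<close>

lemma powr_le_small:
 assumes "0 <= z" "z <= de" "de <= 1" "ga0 <= ga y"
 shows "ka y * z powr ga y <= K * de powr (ga0 - 1) * z"
proof (cases "z = 0")
 case False
 hence z: "0 < z" using assms by simp
 have "z powr ga y = z powr (ga y - 1) * z" using z by (simp add: powr_diff)
 also have "... <= de powr (ga y - 1) * z" using assms z ga[of y] by (intro mult_right_mono powr_mono2) auto
 also have "... <= de powr (ga0 - 1) * z"
  using assms z ga[of y] by (intro mult_right_mono powr_mono') auto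
 finally have "ka y * z powr ga y <= K * (de powr (ga0 - 1) * z)"
  using ka[of y] z K_pos by (intro mult_mono) auto
 thus ?thesis by simp
qed simp

context
 fixes v assumes v: "solution v"
begin

lemma v_measurable: "(%(t, x). v (max 0 t) x) : \<B> borel2"
 by (rule v[unfolded solution_def, THEN conjunct1])

lemma v_nonneg: "0 <= t ==> 0 <= v t x"
 by (rule v[unfolded solution_def, THEN conjunct2, THEN conjunct1, rule_format])

lemma v_bound: "\<exists>M\<ge>1. \<forall>t\<ge>0. \<forall>x. v t x <= M"
proof -
 obtain C where "\<forall>t\<ge>0. \<forall>x. v t x <= C"
  using v[unfolded solution_def, THEN conjunct2, THEN conjunct2, THEN conjunct1] by (rule exE)
 thus ?thesis by (intro exI[of _ "max 1 C"]) (auto intro: max.coboundedI2)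
qed

lemma v_eq: "0 <= s ==> 0 <= t ==> v (t + s) x + (LBINT r:{0..s}. Q r (N v (t + s - r)) x) = Q s (v t) x"
 by (rule v[unfolded solution_def, THEN conjunct2, THEN conjunct2, THEN conjunct2, rule_format])

lemma v_measurable_x [measurable]:
 assumes "0 <= t" shows "v t : \<B> borel"
 using section_right[OF v_measurable, of t] assms by (simp add: max_def)

lemma v_bounded_borel: assumes "0 <= t" shows "v t : bounded_borel"
proof -
 obtain M where "1 <= M" "!!t x. 0 <= t ==> v t x <= M" using v_bound by blast
 thus ?thesis using assms v_nonneg by (intro bbI[where C=M]) auto
qed

lemma N_nonneg: "0 <= N v t x"
 using ka(1)[of x] by (simp add: N_def less_imp_le)

lemma N_le:
 obtains M where "1 <= M" "!!t x. 0 <= t ==> v t x <= M" "!!t x. 0 <= t ==> N v t x <= K * M * v t x"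
  "!!t x. 0 <= t ==> N v t x <= K * M * M"
proof -
 obtain M where M: "1 <= M" "!!t x. 0 <= t ==> v t x <= M" using v_bound by blast
 have 1: "N v t x <= K * M * v t x" if "0 <= t" for t x
  unfolding N_def using that M v_nonneg by (intro powr_le_linear) auto
 have "N v t x <= K * M * M" if "0 <= t" for t x
 proof -
  have "K * M * v t x <= K * M * M" using M that K_pos by (intro mult_left_mono) auto
  thus ?thesis using 1[OF that, of x] by linarith
 qed
 thus ?thesis using that M 1 by blast
qed

lemma N_measurable: "(%(t, x). N v (max 0 t) x) : \<B> borel2"
proof -
 have [measurable]: "(%z. v (max 0 (fst z)) (snd z)) : \<B> borel2"
  by (rule curried_compose[OF v_measurable]) measurable
 show ?thesis unfolding N_def case_prod_beta' by measurable
qed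

lemma N_bounded_borel: assumes "0 <= t" shows "N v t : bounded_borel"
proof -
 obtain M where M: "!!t x. 0 <= t ==> N v t x <= K * M * M" by (rule N_le) blast
 have "N v t : \<B> borel"
  using section_right[OF N_measurable, of t] assms by (simp add: max_def)
 thus ?thesis using M[OF assms] N_nonneg by (intro bbI[where C="K * M * M"]) auto
qed

text \<open>The integrand of the equation with times clamped at 0, so that it is jointly measurable
  and bounded for all real \<open>r\<close>; on \<open>{0..T}\<close> nothing changes.\<close>

definition qN :: "real => real => 'a => real" where
 "qN T r x = Q (max 0 r) (N v (max 0 (T - r))) x"

lemma qN_measurable: "(%(r, x). qN T r x) : \<B> borel2"
proof -
 have "(%z. N v (max 0 (T - fst z)) (snd z)) : \<B> borel2"
  by (rule curried_compose[OF N_measurable]) measurable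
 hence "(%(r, y). N v (max 0 (T - r)) y) : \<B> borel2"
  by (simp add: case_prod_beta')
 from Q_measurable[OF this] show ?thesis by (simp add: qN_def)
qed

lemma qN_bound: obtains C where "0 <= C" "!!T r x. \<bar>qN T r x\<bar> <= C"
proof -
 obtain M where M: "1 <= M" "!!t x. 0 <= t ==> N v t x <= K * M * M" by (rule N_le) blast
 obtain C where C: "0 <= C" "!!t f M x. 0 <= t ==> f : bounded_borel ==> (!!y. \<bar>f y\<bar> <= M) ==> \<bar>Q t f x\<bar> <= C * M"
  by (rule Q_abs_bound) blast
 have "\<bar>qN T r x\<bar> <= C * (K * M * M)" for T r x
  unfolding qN_def using M N_nonneg by (intro C N_bounded_borel) auto
 moreover have "0 <= C * (K * M * M)" using C M K_pos by simp
 ultimately show ?thesis using that by blast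
qed

lemma qN_eq: "0 <= r ==> r <= T ==> qN T r = Q r (N v (T - r))"
 by (simp add: qN_def fun_eq_iff max_def)

lemma J_eq:
 assumes "0 <= s" "0 <= t"
 shows "(LBINT r:{0..s}. Q r (N v (t + s - r)) x) = (LBINT r:{0..s}. qN (t + s) r x)"
 using assms by (intro set_integral_cong) (auto simp: qN_eq)

lemma qN_measurable_r [measurable]: "(%r. qN T r x) : \<B> borel"
 by (rule section_left[OF qN_measurable]) simp

lemma v_le_Q:
 assumes "0 <= s" "0 <= t"
 shows "v (t + s) x <= Q s (v t) x"
proof -
 obtain C where C: "!!T r x. \<bar>qN T r x\<bar> <= C" by (rule qN_bound) blast
 have "0 * (s - 0) <= (LBINT r:{0..s}. qN (t + s) r x)"
 proof (rule set_integral_Icc_between(1))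
  show "0 <= qN (t + s) r x" for r
   unfolding qN_def by (intro Q_nonneg N_bounded_borel N_nonneg) auto
 qed (use assms C in auto)
 thus ?thesis using v_eq[OF assms, of x] J_eq[OF assms, of x] by simp
qed

text \<open>The loss integral is estimated by the linear flow itself: \<open>N v <= e * v\<close>
  and \<open>v <= Q v\<close> bound each integrand by \<open>e * Q s (v t) x\<close> through the
  semigroup property, so a time span \<open>s\<close> costs at most the share
  \<open>s * e\<close>.\<close>

lemma v_ge_Q:
 assumes st: "0 <= s" "0 <= t" and e: "0 <= e"
  and N: "!!r. t <= r ==> r <= t + s ==> AE y in m. N v r y <= e * v r y"
 shows "(1 - s * e) * Q s (v t) x <= v (t + s) x"
proof -
 obtain C where C: "!!T r x. \<bar>qN T r x\<bar> <= C" by (rule qN_bound) blast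
 have "(LBINT r:{0..s}. qN (t + s) r x) <= (e * Q s (v t) x) * (s - 0)"
 proof (rule set_integral_Icc_between(2))
  fix r assume r: "0 < r" "r <= s"
  have bb: "v (t + s - r) : bounded_borel" using r st by (intro v_bounded_borel) auto
  have bb2: "Q (s - r) (v t) : bounded_borel" using r st by (intro Q_bounded_borel v_bounded_borel) auto
  have "qN (t + s) r x = Q r (N v (t + s - r)) x" using r st by (simp add: qN_eq)
  also have "... <= Q r (%y. e * v (t + s - r) y) x"
   using r st bb by (intro Q_mono_AE N_bounded_borel N cmult_bounded_borel) auto
  also have "... = e * Q r (v (t + s - r)) x" using r by (intro Q_cmult bb) auto
  also have "... <= e * Q r (Q (s - r) (v t)) x"
  proof (intro mult_left_mono e Q_mono bb bb2)
   show "v (t + s - r) y <= Q (s - r) (v t) y" for y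
    using v_le_Q[of "s - r" t y] r st by (simp add: add_diff_eq)
  qed (use r in auto)
  also have "... = e * Q s (v t) x"
   using Q_semigroup[of r "s - r" "v t" x] v_bounded_borel[OF st(2)] r by simp
  finally show "qN (t + s) r x <= e * Q s (v t) x" .
 qed (use st C in auto)
 thus ?thesis using v_eq[OF st, of x] J_eq[OF st, of x] by (simp add: algebra_simps)
qed

lemma F_nonneg: "0 <= F v t"
 unfolding F_def using N_nonneg ph_pos(2) by (intro integral_nonneg_AE) (auto simp: less_imp_le)

lemma a_nonneg: "0 <= t ==> 0 <= a v t"
 unfolding a_def using v_nonneg ph_pos(2) by (intro integral_nonneg_AE) (auto simp: less_imp_le)

text \<open>Pairing with \<open>ph'\<close> and Fubini, after which duality erases
  \<open>Q r\<close>. The obtained \<open>f\<close> is a bounded measurable function on all reals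
  that agrees with the time-reversed \<open>F v\<close> on the interval.\<close>

lemma a_eq:
 assumes st: "0 <= s" "0 <= t"
 obtains f C where "f : \<B> borel" "!!r. \<bar>f r\<bar> <= C" "!!r. 0 <= r ==> r <= s ==> f r = F v (t + s - r)"
  "a v t - a v (t + s) = (LBINT r:{0..s}. f r)"
proof -
 obtain C where C: "0 <= C" "!!T r x. \<bar>qN T r x\<bar> <= C" by (rule qN_bound) blast
 define f where "f r = (LINT x|m. qN (t + s) r x * ph' x)" for r
 have qx [measurable]: "qN (t + s) r : \<B> borel" for r
  by (rule section_right[OF qN_measurable]) simp
 have qb: "qN (t + s) r : bounded_borel" for r using C by (intro bbI) auto
 have m1: "(%(r, x). qN (t + s) r x * ph' x) : \<B> (borel \<Otimes>\<^sub>M m)"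
  unfolding case_prod_beta'
  by (intro borel_measurable_times curried_compose[OF qN_measurable]) measurable
 have fm [measurable]: "f : \<B> borel"
  unfolding f_def by (rule borel_measurable_lebesgue_integral[OF m1])
 have fb: "\<bar>f r\<bar> <= C * mass'" for r
 proof -
  have "\<bar>f r\<bar> <= (LINT x|m. \<bar>qN (t + s) r x * ph' x\<bar>)" unfolding f_def by (rule integral_abs_bound)
  also have "... <= (LINT x|m. C * ph' x)"
  proof (rule integral_mono)
   show "integrable m (%x. \<bar>qN (t + s) r x * ph' x\<bar>)"
    by (rule integrable_abs[OF integrable_mult_ph'[OF qb]])
   show "\<bar>qN (t + s) r x * ph' x\<bar> <= C * ph' x" for x
    using C ph_pos(2)[of x] by (simp add: abs_mult)
  qed (use ph'_integrable in auto)
  finally show ?thesis by (simp add: mass'_def)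
 qed
 have ff: "f r = F v (t + s - r)" if "0 <= r" "r <= s" for r
 proof -
  have "f r = (LINT x|m. Q r (N v (t + s - r)) x * ph' x)" using that st by (simp add: f_def qN_eq)
  also have "... = F v (t + s - r)" unfolding F_def using that st by (intro duality N_bounded_borel) auto
  finally show ?thesis .
 qed
 have int: "integrable (lborel \<Otimes>\<^sub>M m) (%(r, x). indicator {0..s} r *\<^sub>R (qN (t + s) r x * ph' x))"
 proof (rule pair.Fubini_integrable)
  show "(%(r, x). indicator {0..s} r *\<^sub>R (qN (t + s) r x * ph' x)) : \<B> (lborel \<Otimes>\<^sub>M m)"
  proof -
   have "(%z. indicator {0..s} (fst z) *\<^sub>R (qN (t + s) (fst z) (snd z) * ph' (snd z))) : \<B> (borel \<Otimes>\<^sub>M m)"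
    using m1 by (intro borel_measurable_scaleR measurable_compose[OF measurable_fst borel_measurable_indicator]) (simp_all add: case_prod_beta')
   thus ?thesis by (simp add: case_prod_beta' cong: measurable_cong_sets)
  qed
  show "AE r in lborel. integrable m (%x. case (r, x) of (r, x) => indicator {0..s} r *\<^sub>R (qN (t + s) r x * ph' x))"
   using integrable_mult_ph'[OF qb] by auto
  have "(%r. \<integral>x. norm (case (r, x) of (r, x) => indicator {0..s} r *\<^sub>R (qN (t + s) r x * ph' x)) \<partial>m)
   = (%r. indicator {0..s} r *\<^sub>R (LINT x|m. \<bar>qN (t + s) r x\<bar> * ph' x))"
   using ph_pos(2) by (auto simp: fun_eq_iff abs_mult abs_of_pos indicator_def)
  moreover have "set_integrable lborel {0..s} (%r. \<integral>x. \<bar>qN (t + s) r x\<bar> * ph' x \<partial>m)"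
  proof (rule set_integrable_Icc_bounded)
   have m2: "(%(r, x). \<bar>qN (t + s) r x\<bar> * ph' x) : \<B> (borel \<Otimes>\<^sub>M m)"
    unfolding case_prod_beta'
    by (intro borel_measurable_times borel_measurable_abs curried_compose[OF qN_measurable]) measurable
   show "(%r. \<integral>x. \<bar>qN (t + s) r x\<bar> * ph' x \<partial>m) : \<B> borel"
    by (rule borel_measurable_lebesgue_integral[OF m2])
   fix r
   have ab: "(%x. \<bar>qN (t + s) r x\<bar>) : bounded_borel" using C by (intro bbI[where C=C]) auto
   have "(LINT x|m. \<bar>qN (t + s) r x\<bar> * ph' x) <= (LINT x|m. C * ph' x)"
    using C ph_pos(2) ph'_integrable integrable_mult_ph'[OF ab]
    by (intro integral_mono) (auto intro!: mult_right_mono less_imp_le)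
   moreover have "0 <= (LINT x|m. \<bar>qN (t + s) r x\<bar> * ph' x)"
    using ph_pos(2) by (intro integral_nonneg_AE) (auto simp: less_imp_le)
   ultimately show "\<bar>\<integral>x. \<bar>qN (t + s) r x\<bar> * ph' x \<partial>m\<bar> <= C * mass'" by (simp add: mass'_def)
  qed
  ultimately show "integrable lborel (%r. \<integral>x. norm (case (r, x) of (r, x) => indicator {0..s} r *\<^sub>R (qN (t + s) r x * ph' x)) \<partial>m)"
   by (simp add: set_integrable_def)
 qed
 have swap: "(LINT x|m. (LBINT r:{0..s}. qN (t + s) r x) * ph' x) = (LBINT r:{0..s}. f r)"
 proof -
  have "(LINT x|m. (LBINT r:{0..s}. qN (t + s) r x) * ph' x)
   = (LINT x|m. (LINT r|lborel. indicator {0..s} r *\<^sub>R (qN (t + s) r x * ph' x)))"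
   unfolding set_lebesgue_integral_def by (simp add: mult.assoc[symmetric])
  also have "... = (LINT r|lborel. (LINT x|m. indicator {0..s} r *\<^sub>R (qN (t + s) r x * ph' x)))"
   by (rule pair.Fubini_integral[OF int])
  finally show ?thesis unfolding f_def set_lebesgue_integral_def by simp
 qed
 have Jb: "(%x. LBINT r:{0..s}. qN (t + s) r x) : bounded_borel"
 proof (rule bbI)
  show "(%x. LBINT r:{0..s}. qN (t + s) r x) : \<B> borel"
  proof (rule borel_measurable_set_integral_Icc)
   have "(%z. qN (t + s) (snd z) (fst z)) : \<B> borel2"
    by (rule curried_compose[OF qN_measurable]) measurable
   thus "(%(x, r). qN (t + s) r x) : \<B> borel2"
    by (simp add: case_prod_beta')
  qed auto
  show "\<bar>LBINT r:{0..s}. qN (t + s) r x\<bar> <= C * (s - 0)" for x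
   using C st by (intro set_integral_Icc_bound) auto
 qed
 have "a v t = (LINT x|m. Q s (v t) x * ph' x)" unfolding a_def using st by (intro duality[symmetric] v_bounded_borel)
 also have "... = (LINT x|m. v (t + s) x * ph' x + (LBINT r:{0..s}. qN (t + s) r x) * ph' x)"
  using v_eq[OF st] J_eq[OF st] by (simp add: distrib_right[symmetric])
 also have "... = a v (t + s) + (LBINT r:{0..s}. f r)"
  unfolding a_def swap[symmetric]
  using st by (intro Bochner_Integration.integral_add integrable_mult_ph' Jb v_bounded_borel) auto
 finally have "a v t - a v (t + s) = (LBINT r:{0..s}. f r)" by simp
 thus ?thesis using that fm fb ff by blast
qed

lemma a_decrease_ge:
 assumes "0 <= t" "t <= u" "!!r. t <= r ==> r <= u ==> l <= F v r"
 shows "l * (u - t) <= a v t - a v u"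
proof -
 obtain f C where f: "f : \<B> borel" "!!r. \<bar>f r\<bar> <= C"
  "!!r. 0 <= r ==> r <= u - t ==> f r = F v (t + (u - t) - r)"
  "a v t - a v (t + (u - t)) = (LBINT r:{0..u - t}. f r)"
  by (rule a_eq[of "u - t" t]) (use assms in auto)
 have "l * (u - t - 0) <= (LBINT r:{0..u - t}. f r)"
 proof (rule set_integral_Icc_between(1)[OF f(1), where C=C])
  show "l <= f r" if "0 < r" "r <= u - t" for r
   using f(3)[of r] that assms by auto
 qed (rule f(2), use assms in auto)
 thus ?thesis using f(4) by simp
qed

lemma a_decrease_le:
 assumes "0 <= t" "t <= u" "!!r. t <= r ==> r <= u ==> F v r <= l"
 shows "a v t - a v u <= l * (u - t)"
proof -
 obtain f C where f: "f : \<B> borel" "!!r. \<bar>f r\<bar> <= C"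
  "!!r. 0 <= r ==> r <= u - t ==> f r = F v (t + (u - t) - r)"
  "a v t - a v (t + (u - t)) = (LBINT r:{0..u - t}. f r)"
  by (rule a_eq[of "u - t" t]) (use assms in auto)
 have "(LBINT r:{0..u - t}. f r) <= l * (u - t - 0)"
 proof (rule set_integral_Icc_between(2)[OF f(1), where C=C])
  show "f r <= l" if "0 < r" "r <= u - t" for r
   using f(3)[of r] that assms by auto
 qed (rule f(2), use assms in auto)
 thus ?thesis using f(4) by simp
qed

lemma a_antimono: "0 <= t ==> t <= u ==> a v u <= a v t"
 using a_decrease_ge[of t u 0] F_nonneg by simp

lemma F_le_a:
 assumes t: "0 <= t" and e: "AE y in m. N v t y <= e * v t y"
 shows "F v t <= e * a v t"
proof -
 have "F v t <= (LINT x|m. e * (v t x * ph' x))"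
  unfolding F_def
 proof (rule integral_mono_AE)
  show "AE x in m. N v t x * ph' x <= e * (v t x * ph' x)"
   using e by eventually_elim (use ph_pos(2) in \<open>simp add: mult.assoc[symmetric]\<close>)
 qed (use integrable_mult_ph'[OF N_bounded_borel[OF t]] integrable_mult_ph'[OF v_bounded_borel[OF t]] in auto)
 thus ?thesis by (simp add: a_def)
qed

text \<open>The loss rate is at most \<open>K * M\<close> times \<open>a v\<close>, so within a time
  \<open>1 / (2 * (K * M))\<close> at most half of \<open>a v\<close> is lost; iteration reaches
  every time.\<close>

lemma a_pos:
 assumes a0: "0 < a v 0" and t: "0 <= t"
 shows "0 < a v t"
proof -
 obtain M where M: "1 <= M" "!!t x. 0 <= t ==> N v t x <= K * M * v t x" by (rule N_le) blast
 have KM: "0 < K * M" using K_pos M by simp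
 define s where "s = 1 / (2 * (K * M))"
 have s: "0 < s" "K * M * s = 1 / 2" using K_pos M(1) by (simp_all add: s_def)
 have step: "a v r / 2 <= a v (r + s)" if r: "0 <= r" for r
 proof -
  have "a v r - a v (r + s) <= K * M * a v r * (r + s - r)"
  proof (rule a_decrease_le)
   fix r' assume r': "r <= r'" "r' <= r + s"
   have "F v r' <= K * M * a v r'" using r r' M by (intro F_le_a) auto
   also have "... <= K * M * a v r" using r r' KM by (intro mult_left_mono a_antimono) auto
   finally show "F v r' <= K * M * a v r" .
  qed (use r s in auto)
  also have "... = (K * M * s) * a v r" by simp
  finally show ?thesis unfolding s(2) by simp
 qed
 have n: "0 < a v (real n * s)" for n
 proof (induction n)
  case (Suc n)
  thus ?case using step[of "real n * s"] s by (simp add: algebra_simps)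
 qed (use a0 in simp)
 obtain n where "t / s <= real n" using real_arch_simple by blast
 hence "t <= real n * s" using s by (simp add: field_simps)
 thus ?thesis using a_antimono[OF t, of "real n * s"] n[of n] by linarith
qed

lemma a_le:
 assumes t: "0 <= t" and b: "!!x. v t x <= b"
 shows "a v t <= b * mass'"
proof -
 have "a v t <= (LINT x|m. b * ph' x)" unfolding a_def
  using integrable_mult_ph'[OF v_bounded_borel[OF t]] ph'_integrable b ph_pos(2)
  by (intro integral_mono) (auto intro!: mult_right_mono less_imp_le)
 thus ?thesis by (simp add: mass'_def)
qed

text \<open>Values up to \<open>M\<close> and exponents below 2 give
  \<open>N v >= ka0 / M * v^2\<close> almost everywhere, and Jensen's inequality for the weight
  \<open>ph'\<close> turns this into \<open>F v >= c * (a v)^2\<close>. Since \<open>a v\<close>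
  decreases, \<open>c * (a v t)^2 * t <= a v 0\<close>. The rate is crude, but only convergence is
  wanted here.\<close>

lemma a_tendsto_0: "(a v ---> 0) at_top"
proof -
 obtain M where M: "1 <= M" "!!t x. 0 <= t ==> v t x <= M" using v_bound by blast
 define c where "c = ka0 / (M * mass')"
 have c: "0 < c" using ka0 M mass'_pos by (simp add: c_def)
 have Fl: "c * (a v t)^2 <= F v t" if t: "0 <= t" for t
 proof -
  have bb: "(%x. (v t x)^2) : bounded_borel"
  proof (rule bbI)
   show "\<bar>(v t x)^2\<bar> <= M^2" for x using M(2)[OF t] v_nonneg[OF t] by (simp add: power_mono)
  qed (use t in measurable)
  have i: "integrable m (%x. v t x * ph' x)" "integrable m (%x. (v t x)^2 * ph' x)"
   "integrable m (%x. N v t x * ph' x)"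
   by (intro integrable_mult_ph' v_bounded_borel N_bounded_borel bb t)+
  \<comment> \<open>The mean of \<open>v t\<close> under the normalised weight; non-negativity of
    the variance is Jensen's inequality.\<close>
  define b where "b = a v t / mass'"
  have "0 <= (LINT x|m. (v t x - b)^2 * ph' x)"
   using ph_pos(2) by (intro integral_nonneg_AE) (auto simp: less_imp_le)
  also have "... = (LINT x|m. (v t x)^2 * ph' x - 2 * b * (v t x * ph' x) + b^2 * ph' x)"
   by (simp add: power2_diff algebra_simps)
  also have "... = (LINT x|m. (v t x)^2 * ph' x) - 2 * b * a v t + b^2 * mass'"
   using i ph'_integrable by (simp add: a_def mass'_def)
  also have "... = (LINT x|m. (v t x)^2 * ph' x) - (a v t)^2 / mass'"
   using mass'_pos by (simp add: b_def power2_eq_square field_simps)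
  finally have cs: "(a v t)^2 / mass' <= (LINT x|m. (v t x)^2 * ph' x)" by simp
  have "c * (a v t)^2 = ka0 / M * ((a v t)^2 / mass')" by (simp add: c_def)
  also have "... <= ka0 / M * (LINT x|m. (v t x)^2 * ph' x)"
   using cs ka0 M by (intro mult_left_mono) auto
  also have "... = (LINT x|m. ka0 / M * ((v t x)^2 * ph' x))" by simp
  also have "... <= F v t"
   unfolding F_def
  proof (rule integral_mono_AE)
   show "AE x in m. ka0 / M * ((v t x)^2 * ph' x) <= N v t x * ph' x"
    using ka0(2)
   proof eventually_elim
    case (elim x)
    have "(v t x)^2 / M <= v t x powr ga x"
    proof (cases "v t x = 0")
     case False
     hence z: "0 < v t x" using v_nonneg[OF t, of x] by simp
     have "v t x powr (2 - ga x) <= M powr (2 - ga x)"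
      using z M(2)[OF t, of x] ga[of x] by (intro powr_mono2) auto
     also have "... <= M powr 1" using M(1) ga[of x] by (intro powr_mono) auto
     finally have "v t x powr (2 - ga x) <= M" using M(1) by simp
     hence "v t x powr ga x * v t x powr (2 - ga x) <= v t x powr ga x * M"
      by (intro mult_left_mono) auto
     moreover have "v t x powr ga x * v t x powr (2 - ga x) = (v t x)^2"
      using z by (simp add: powr_add[symmetric])
     ultimately show ?thesis using M(1) by (simp add: field_simps)
    qed simp
    hence "ka0 * ((v t x)^2 / M) <= ka x * v t x powr ga x"
     using elim ka0(1) M(1) by (intro mult_mono) auto
    from mult_right_mono[OF this less_imp_le[OF ph_pos(2)[of x]]] show ?case by (simp add: N_def mult_ac)
   qed
  qed (use i in auto)
  finally show ?thesis .
 qed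
 have le: "a v t <= sqrt (a v 0 / (c * t))" if t: "0 < t" for t
 proof -
  have "c * (a v t)^2 * (t - 0) <= a v 0 - a v t"
  proof (rule a_decrease_ge)
   fix r assume r: "0 <= r" "r <= t"
   have "c * (a v t)^2 <= c * (a v r)^2"
    using c r a_antimono[of r t] a_nonneg[of t] by (intro mult_left_mono power_mono) auto
   thus "c * (a v t)^2 <= F v r" using Fl[of r] r by linarith
  qed (use t in auto)
  hence "c * (a v t)^2 * t <= a v 0" using a_nonneg[of t] t by simp
  hence "(a v t)^2 <= a v 0 / (c * t)" using c t by (simp add: field_simps)
  thus ?thesis by (rule real_le_rsqrt)
 qed
 show ?thesis
 proof (rule tendsto_sandwich[OF _ _ tendsto_const])
  show "eventually (%t. 0 <= a v t) at_top"
   using eventually_ge_at_top[of 0] by eventually_elim (rule a_nonneg)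
  show "eventually (%t. a v t <= sqrt (a v 0 / (c * t))) at_top"
   using eventually_gt_at_top[of 0] by eventually_elim (rule le)
  have "((%t. a v 0 / (c * t)) ---> 0) at_top"
   using c by (intro tendsto_divide_0[OF tendsto_const] filterlim_at_top_imp_at_infinity
    filterlim_tendsto_pos_mult_at_top[OF tendsto_const] filterlim_ident)
  thus "((%t. sqrt (a v 0 / (c * t))) ---> 0) at_top"
   using tendsto_real_sqrt[of _ 0] by simp
 qed
qed

text \<open>One unit of time turns the decay of the integral \<open>a v\<close> into decay of the
  supremum: \<open>v t <= Q 1 (v (t - 1)) <= C * ph * a v (t - 1)\<close>.\<close>

lemma eventually_small:
 assumes "0 < de"
 shows "\<exists>T\<ge>0. \<forall>t\<ge>T. \<forall>x. v t x <= de"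
proof -
 obtain C where C: "0 < C" "!!f x. f : bounded_borel ==> (!!y. 0 <= f y) ==> Q 1 f x <= C * ph x * (LINT y|m. f y * ph' y)"
  using ultrabound[of 1] by auto
 obtain c where c: "!!x. ph x <= c" using ph_bounded by blast
 have c0: "0 < c" using c[of undefined] ph_pos(1)[of undefined] by linarith
 have "eventually (%t. a v t < de / (C * c)) at_top"
  using order_tendstoD(2)[OF a_tendsto_0] assms C c0 by simp
 then obtain T where T: "!!t. T <= t ==> a v t < de / (C * c)" by (auto simp: eventually_at_top_linorder)
 show ?thesis
 proof (intro exI[of _ "max 0 T + 1"] conjI allI impI)
  fix t x assume t: "max 0 T + 1 <= t"
  hence t1: "0 <= t - 1" "T <= t - 1" by auto
  have "v (t - 1 + 1) x <= Q 1 (v (t - 1)) x" using t1 by (intro v_le_Q) auto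
  also have "... <= C * ph x * a v (t - 1)"
   unfolding a_def using t1 by (intro C v_bounded_borel v_nonneg)
  also have "... <= C * c * (de / (C * c))"
   using C c[of x] ph_pos(1)[of x] T[OF t1(2)] a_nonneg[OF t1(1)] c0 by (intro mult_mono) auto
  also have "... = de" using C c0 by simp
  finally show "v t x <= de" by simp
 qed auto
qed

lemma shift_solution:
 assumes T: "0 <= T"
 shows "solution (%t. v (T + t))"
proof -
 obtain M where M: "1 <= M" "!!t x. 0 <= t ==> v t x <= M" using v_bound by blast
 have "(%z. v (max 0 (T + max 0 (fst z))) (snd z)) : \<B> borel2"
  by (rule curried_compose[OF v_measurable]) measurable
 moreover have "v (T + (t + s)) x + (LBINT r:{0..s}. Q r (N (%t. v (T + t)) (t + s - r)) x) = Q s (v (T + t)) x"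
  if "0 <= s" "0 <= t" for s t x
 proof -
  have N: "N (%t. v (T + t)) (t + s - r) = N v (T + t + s - r)" for r
   by (simp add: N_def fun_eq_iff algebra_simps)
  show ?thesis
   using v_eq[of s "T + t" x] that T unfolding N by (simp add: add.assoc)
 qed
 ultimately show ?thesis
  unfolding solution_def using T v_nonneg M(2)
  by (intro conjI allI impI exI[of _ M]) (auto simp: case_prod_beta' max_def)
qed

end

lemma a_shift: "a (%t. v (T + t)) t = a v (T + t)"
 by (simp add: a_def)

lemma small_N:
 assumes "solution v" "de <= 1" "0 <= r" "!!x. v r x <= de"
 shows "AE y in m. N v r y <= K * de powr (ga0 - 1) * v r y"
 using ga0(2) by eventually_elim (use assms v_nonneg in \<open>auto simp: N_def intro!: powr_le_small\<close>)

text \<open>Over a window of the mixing time \<open>s\<close> the linear flow already brings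
  \<open>v\<close> close to \<open>a v * ph\<close>, while for values below \<open>de\<close> the
  nonlinearity removes only a small share. Both \<open>s\<close> and \<open>de\<close> depend on
  \<open>et\<close> alone; the limit theorem with varying initial values rests on this uniformity
  over solutions.\<close>

lemma uniform_shape:
 assumes et: "0 < et" "et < 1"
 shows "\<exists>s>0. \<exists>de>0. \<forall>v. solution v --> (\<forall>t\<ge>0. \<forall>x. v t x <= de) -->
  (\<forall>t\<ge>s. \<forall>x. (1 - et) * a v t * ph x <= v t x \<and> v t x <= (1 + et) * a v t * ph x) \<and> (1 - et) * a v 0 <= a v s"
proof -
 \<comment> \<open>Two errors of size \<open>e\<close> meet, one from mixing and one from the loss;
   a quarter of \<open>et\<close> leaves room for their product and for passing from
   \<open>a v u\<close> to \<open>a v t\<close>.\<close>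
 define e where "e = et / 4"
 have e: "0 < e" "e < 1 / 4" "et = 4 * e" using et by (auto simp: e_def)
 obtain s where s: "0 < s" "!!f x. f : bounded_borel ==> (!!y. 0 <= f y) ==>
    \<bar>Q s f x - ph x * (LINT y|m. f y * ph' y)\<bar> <= e * ph x * (LINT y|m. f y * ph' y)"
  using ergodic[OF e(1)] by blast
 \<comment> \<open>The second entry solves \<open>s * K * de powr (ga0 - 1) = e\<close>; the minimum
   with 1 is what \<open>small_N\<close> requires.\<close>
 define de where "de = min 1 ((e / (s * K)) powr (1 / (ga0 - 1)))"
 have de: "0 < de" "de <= 1" using e s K_pos by (auto simp: de_def)
 define ep where "ep = K * de powr (ga0 - 1)"
 have "de powr (ga0 - 1) <= ((e / (s * K)) powr (1 / (ga0 - 1))) powr (ga0 - 1)"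
  using de ga0(1) by (intro powr_mono2) (auto simp: de_def)
 also have "... = e / (s * K)" using ga0(1) e s K_pos by (simp add: powr_powr)
 finally have ep: "0 <= ep" "s * ep <= e" using s K_pos by (auto simp: ep_def field_simps)
 show ?thesis
 proof (rule exI[of _ s], rule conjI[OF s(1)], rule exI[of _ de], rule conjI[OF de(1)], intro allI impI conjI)
  fix v assume v: "solution v" and small: "\<forall>t\<ge>0. \<forall>x. v t x <= de"
  have N: "AE y in m. N v r y <= ep * v r y" if "0 <= r" for r
   unfolding ep_def using that small de by (intro small_N v) auto
  have as: "(1 - e) * a v t <= a v (t + s)" if t: "0 <= t" for t
  proof -
   have "a v t - a v (t + s) <= ep * a v t * (t + s - t)"
   proof (rule a_decrease_le[OF v])
    fix r assume r: "t <= r" "r <= t + s"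
    have "F v r <= ep * a v r" using r t by (intro F_le_a v N) auto
    also have "... <= ep * a v t" using r t ep by (intro mult_left_mono a_antimono v) auto
    finally show "F v r <= ep * a v t" .
   qed (use t s in auto)
   also have "... = (s * ep) * a v t" by simp
   also have "... <= e * a v t" using ep a_nonneg[OF v t] by (intro mult_right_mono) auto
   finally show ?thesis by (simp add: algebra_simps)
  qed
  have "(1 - et) * a v 0 <= (1 - e) * a v 0"
   using e a_nonneg[OF v, of 0] by (intro mult_right_mono) auto
  thus "(1 - et) * a v 0 <= a v s" using as[of 0] by simp
  fix t x assume t: "s <= t"
  define u where "u = t - s"
  have u: "0 <= u" "t = u + s" using t by (auto simp: u_def)
  have vu: "v u : bounded_borel" "!!y. 0 <= v u y" using v_bounded_borel[OF v] v_nonneg[OF v] u by auto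
  have q: "\<bar>Q s (v u) x - ph x * a v u\<bar> <= e * ph x * a v u"
   using s(2)[OF vu, of x] by (simp add: a_def)
  have au: "0 <= a v u" "a v t <= a v u" "(1 - e) * a v u <= a v t" "0 <= a v t"
   using a_nonneg[OF v] a_antimono[OF v, of u t] as[OF u(1)] u s by auto
  have ph: "0 < ph x" by (rule ph_pos)
  have "(1 - et) * a v t * ph x <= (1 - e) * ((1 - e) * (a v t * ph x))"
  proof -
   have "1 - et <= (1 - e) * (1 - e)" using e by (simp add: algebra_simps)
   from mult_right_mono[OF this, of "a v t * ph x"] show ?thesis using au ph by (simp add: mult.assoc)
  qed
  also have "... <= (1 - s * ep) * ((1 - e) * (a v u * ph x))"
   using ep e au ph by (intro mult_mono) auto
  also have "... <= (1 - s * ep) * Q s (v u) x"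
   using q ep e by (intro mult_left_mono) (auto simp: abs_le_iff algebra_simps)
  also have "... <= v (u + s) x"
   using u s ep N by (intro v_ge_Q[OF v]) auto
  finally show "(1 - et) * a v t * ph x <= v t x" using u by simp
  have "v (u + s) x <= Q s (v u) x" using u s by (intro v_le_Q[OF v]) auto
  also have "... <= (1 + e) * a v u * ph x" using q by (simp add: abs_le_iff algebra_simps)
  also have "... <= (1 + et) * (1 - e) * a v u * ph x"
  proof -
   have "2 * e * e <= 1 * e" using e by (intro mult_right_mono) auto
   hence "1 + e <= (1 + et) * (1 - e)" using e by (simp add: algebra_simps)
   thus ?thesis using au ph by (intro mult_right_mono) auto
  qed
  also have "... = (1 + et) * ((1 - e) * a v u) * ph x" by simp
  also have "... <= (1 + et) * a v t * ph x"
   using au ph et by (intro mult_right_mono mult_left_mono) auto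
  finally show "v t x <= (1 + et) * a v t * ph x" using u by simp
 qed
qed

section \<open>The function of the scalar equation and its regular variation\<close>

definition G :: "real => real" where
 "G z = (LINT y|m. ka y * (z * ph y) powr ga y * ph' y)"

lemma G_bounded_borel:
 assumes z: "0 <= z"
 shows "(%y. ka y * (z * ph y) powr ga y) : bounded_borel"
proof -
 obtain c where c: "!!x. ph x <= c" using ph_bounded by blast
 define M where "M = max 1 (z * c)"
 have M: "1 <= M" "0 <= z * ph y" "z * ph y <= M" for y
  using mult_left_mono[OF c[of y] z] z ph_pos(1)[of y] by (auto simp: M_def)
 show ?thesis
 proof (rule bbI)
  fix y
  have "ka y * (z * ph y) powr ga y <= K * M * (z * ph y)" using M by (intro powr_le_linear) auto
  also have "... <= K * M * M" using M K_pos by (intro mult_left_mono) auto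
  finally show "\<bar>ka y * (z * ph y) powr ga y\<bar> <= K * M * M" using ka(1)[of y] by simp
 qed measurable
qed

text \<open>The exponents lie between 1 and 2, whence \<open>c powr ga y >= c^2\<close> for
  \<open>c <= 1\<close> and \<open>d powr ga y <= d^2\<close> for \<open>d >= 1\<close>; a shape
  error enters \<open>F\<close> at most squared.\<close>

lemma F_shape:
 assumes v: "solution v" and t: "0 <= t" and c: "0 <= c" "c <= 1" "1 <= d"
  and sh: "!!x. c * a v t * ph x <= v t x" "!!x. v t x <= d * a v t * ph x"
 shows "c^2 * G (a v t) <= F v t" "F v t <= d^2 * G (a v t)"
proof -
 have a0: "0 <= a v t" by (rule a_nonneg[OF v t])
 have i: "integrable m (%y. ka y * (a v t * ph y) powr ga y * ph' y)" "integrable m (%y. N v t y * ph' y)"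
  by (intro integrable_mult_ph' G_bounded_borel N_bounded_borel a0 v t)+
 have "c^2 * G (a v t) = (LINT y|m. c^2 * (ka y * (a v t * ph y) powr ga y * ph' y))" by (simp add: G_def)
 also have "... <= F v t"
  unfolding F_def
 proof (rule integral_mono)
  fix y
  have p: "0 <= a v t * ph y" using a0 ph_pos(1)[of y] by simp
  have "c^2 * (a v t * ph y) powr ga y <= (c * (a v t * ph y)) powr ga y"
  proof (cases "c = 0")
   case False
   have "c powr 2 <= c powr ga y" using c False ga[of y] by (intro powr_mono') auto
   hence "c^2 * (a v t * ph y) powr ga y <= c powr ga y * (a v t * ph y) powr ga y"
    using c False by (intro mult_right_mono) auto
   thus ?thesis using c p by (simp add: powr_mult)
  qed simp
  also have "... <= v t y powr ga y" using sh(1)[of y] c p ga[of y] by (intro powr_mono2) (auto simp: mult.assoc)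
  finally have "ka y * (c^2 * (a v t * ph y) powr ga y) * ph' y <= N v t y * ph' y"
   unfolding N_def using ka(1)[of y] ph_pos(2)[of y] by (intro mult_right_mono mult_left_mono) auto
  thus "c^2 * (ka y * (a v t * ph y) powr ga y * ph' y) <= N v t y * ph' y" by (simp add: mult_ac)
 qed (use i in auto)
 finally show "c^2 * G (a v t) <= F v t" .
 have "F v t <= (LINT y|m. d^2 * (ka y * (a v t * ph y) powr ga y * ph' y))"
  unfolding F_def
 proof (rule integral_mono)
  fix y
  have p: "0 <= a v t * ph y" using a0 ph_pos(1)[of y] by simp
  have "v t y powr ga y <= (d * (a v t * ph y)) powr ga y"
   using sh(2)[of y] v_nonneg[OF v t, of y] ga[of y] by (intro powr_mono2) (auto simp: mult.assoc)
  also have "... = d powr ga y * (a v t * ph y) powr ga y" using c p by (simp add: powr_mult)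
  also have "... <= d powr 2 * (a v t * ph y) powr ga y"
   using c ga[of y] by (intro mult_right_mono powr_mono) auto
  finally have "N v t y * ph' y <= ka y * (d powr 2 * (a v t * ph y) powr ga y) * ph' y"
   unfolding N_def using ka(1)[of y] ph_pos(2)[of y] by (intro mult_right_mono mult_left_mono) auto
  moreover have "d powr 2 = d^2" using c by simp
  ultimately show "N v t y * ph' y <= d^2 * (ka y * (a v t * ph y) powr ga y * ph' y)" by (simp add: mult_ac)
 qed (use i in auto)
 thus "F v t <= d^2 * G (a v t)" by (simp add: G_def)
qed

lemma G_integrable: "0 <= z ==> integrable m (%y. ka y * (z * ph y) powr ga y * ph' y)"
 by (intro integrable_mult_ph' G_bounded_borel)

lemma G_pos: "0 < z ==> 0 < G z"
 unfolding G_def using m_pos ka(1) ph_pos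
 by (intro integral_pos[where A=UNIV] G_integrable) (auto simp: less_imp_le mult_pos_pos less_imp_neq[symmetric])

lemma G_mono: "0 < y ==> y <= z ==> G y <= G z"
 unfolding G_def
proof (intro integral_mono G_integrable)
 fix x assume yz: "0 < y" "y <= z"
 have "(y * ph x) powr ga x <= (z * ph x) powr ga x"
  using yz ph_pos(1)[of x] ga[of x] by (intro powr_mono2 mult_right_mono) auto
 thus "ka x * (y * ph x) powr ga x * ph' x <= ka x * (z * ph x) powr ga x * ph' x"
  using ka(1)[of x] ph_pos(2)[of x] by (intro mult_right_mono mult_left_mono) auto
qed auto

lemma G_cont: assumes z: "0 < z" shows "isCont G z"
proof -
 have "continuous_on {0<..} G"
  unfolding continuous_on_sequentially
 proof (intro allI ballI impI, elim conjE)
  fix u :: "nat => real" and a :: real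
  assume u: "\<forall>n. u n : {0<..}" "u ----> a" and a: "a : {0<..}"
  obtain Z where Z: "0 < Z" "!!n. u n <= Z"
   using convergent_imp_Bseq[of u] u(2) by (auto simp: convergent_def Bseq_def abs_le_iff)
  have "(%n. \<integral>y. ka y * (u n * ph y) powr ga y * ph' y \<partial>m) ----> (LINT y|m. ka y * (a * ph y) powr ga y * ph' y)"
  proof (rule integral_dominated_convergence)
   show "integrable m (%y. ka y * (Z * ph y) powr ga y * ph' y)" using Z by (intro G_integrable) auto
   show "AE y in m. norm (ka y * (u n * ph y) powr ga y * ph' y) <= ka y * (Z * ph y) powr ga y * ph' y" for n
   proof (rule AE_I2)
    fix y
    have "(u n * ph y) powr ga y <= (Z * ph y) powr ga y"
     using u(1) Z(2)[of n] ph_pos(1)[of y] ga[of y] by (intro powr_mono2 mult_right_mono) (auto simp: less_imp_le)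
    thus "norm (ka y * (u n * ph y) powr ga y * ph' y) <= ka y * (Z * ph y) powr ga y * ph' y"
     using ka(1)[of y] ph_pos(2)[of y] by (auto simp: abs_mult intro!: mult_right_mono mult_left_mono)
   qed
   show "AE y in m. (%n. ka y * (u n * ph y) powr ga y * ph' y) ----> ka y * (a * ph y) powr ga y * ph' y"
    using u(2) a ph_pos(1) by (intro AE_I2 tendsto_mult tendsto_const tendsto_powr) (auto simp: less_imp_neq[symmetric])
  qed measurable
  thus "(G \<circ> u) ----> G a" by (simp add: G_def comp_def)
 qed
 thus ?thesis using z by (simp add: continuous_on_eq_continuous_at)
qed

lemma ga0_less_2: "ga0 < 2"
proof (rule ccontr)
 assume "\<not> ga0 < 2"
 hence "AE x in m. False" using ga0(2) ga(2) by (auto elim!: eventually_mono) (meson dual_order.trans not_le)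
 thus False using m_pos by (simp add: AE_iff_measurable[OF _ refl] sets_m)
qed

lemma G_scale: "0 < u ==> 0 < z ==> G (u * z) = (LINT y|m. u powr ga y * (ka y * (z * ph y) powr ga y * ph' y))"
 unfolding G_def using ph_pos(1) by (intro bochner_cong refl) (simp add: powr_mult less_imp_le mult_ac)

text \<open>\<open>G\<close> mixes the powers \<open>z powr ga y\<close>. Exponents near
  \<open>ga0\<close> produce factors near \<open>u powr ga0\<close>; those above
  \<open>ga0 + d\<close> contribute at most the order \<open>z powr (ga0 + d)\<close>, which is
  beaten by the exponents below \<open>ga0 + d / 2\<close>, a set of positive measure by the choice
  of \<open>ga0\<close>. Pure power behaviour of \<open>G\<close> cannot be expected, since
  \<open>ga = ga0\<close> may hold on a null set only.\<close>

lemma G_regularly_varying: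
 assumes u: "0 < u"
 shows "((%z. G (u * z) / G z) ---> u powr ga0) (at_right 0)"
proof (rule tendstoI)
 fix e :: real assume e: "0 < e"
 have "isCont (%g. u powr g) ga0" using u by (auto intro!: continuous_intros)
 then obtain d where d: "0 < d" "!!g. \<bar>g - ga0\<bar> < d ==> \<bar>u powr g - u powr ga0\<bar> < e / 2"
  using e unfolding continuous_at_eps_delta dist_real_def by (metis half_gt_zero)
 \<comment> \<open>Bounds \<open>u powr g\<close> for all exponents between 1 and 2, whether
   \<open>u\<close> is below or above 1.\<close>
 define C where "C = 1 + u^2"
 have C: "\<bar>u powr g - u powr ga0\<bar> <= C" if "1 < g" "g < 2" for g
 proof -
  have "0 <= u powr g \<and> u powr g <= C" if "1 < g" "g < 2" for g
  proof (cases "u <= 1")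
   case True
   hence "u powr g <= 1 powr g" using u that by (intro powr_mono2) auto
   hence "u powr g <= 1" by simp
   thus ?thesis unfolding C_def using zero_le_power2[of u] powr_ge_zero[of u g] by linarith
  next
   case False
   hence "u powr g <= u powr 2" using that by (intro powr_mono) auto
   thus ?thesis using u by (simp add: C_def)
  qed
  from this[OF that] this[OF ga0(1) ga0_less_2] show ?thesis by linarith
 qed
 define w where "w z y = ka y * (z * ph y) powr ga y * ph' y" for z y
 have w: "0 < w z y" if "0 < z" for z y using that ka(1)[of y] ph_pos[of y] by (simp add: w_def)
 have w1: "w z y = z powr ga y * w 1 y" if "0 < z" for z y
  using that ph_pos(1)[of y] by (simp add: w_def powr_mult)
 have wi: "integrable m (w z)" if "0 <= z" for z
  unfolding w_def using that by (rule G_integrable)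
 have [measurable]: "w z : \<B> borel" for z unfolding w_def by measurable
 define c where "c = (LINT y|m. indicator {x. ga x < ga0 + d / 2} y * w 1 y)"
 have indi: "integrable m (%y. indicator A y * w z y)" if "A : sets borel" "0 <= z" for A z
  using integrable_mult_indicator[OF _ wi[of z], of A] that by (simp add: sets_m)
 have c: "0 < c"
  unfolding c_def
 proof (rule integral_pos)
  show "integrable m (%y. indicator {x. ga x < ga0 + d / 2} y * w 1 y)" by (rule indi) auto
  show "emeasure m {x. ga x < ga0 + d / 2} ~= 0" using d by (intro ga0(3)) auto
  show "0 <= indicator {x. ga x < ga0 + d / 2} y * w 1 y" for y using w[of 1 y] by simp
  show "0 < indicator {x. ga x < ga0 + d / 2} y * w 1 y" if "y : {x. ga x < ga0 + d / 2}" for y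
   using that w[of 1 y] by simp
 qed measurable
 have est: "dist (G (u * z) / G z) (u powr ga0) <= e / 2 + C * G 1 / c * z powr (d / 2)" if z: "0 < z" "z < 1" for z
 proof -
  have Gw: "G z = (LINT y|m. w z y)" for z by (simp add: G_def w_def)
  have i1: "integrable m (%y. u powr ga y * w z y)"
  proof (rule Bochner_Integration.integrable_bound)
   show "integrable m (%y. (C + u powr ga0) * w z y)" using wi[of z] z by simp
   show "AE y in m. norm (u powr ga y * w z y) <= norm ((C + u powr ga0) * w z y)"
   proof (rule AE_I2)
    fix y
    have "u powr ga y <= C + u powr ga0" using C[OF ga[of y]] by linarith
    thus "norm (u powr ga y * w z y) <= norm ((C + u powr ga0) * w z y)"
     using w[OF z(1), of y] by (simp add: abs_mult mult_right_mono)
   qed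
  qed measurable
  have "G (u * z) - u powr ga0 * G z = (LINT y|m. u powr ga y * w z y - u powr ga0 * w z y)"
  proof -
   have "G (u * z) = (LINT y|m. u powr ga y * w z y)" using G_scale[OF u z(1)] by (simp add: w_def)
   thus ?thesis using i1 wi[of z] z by (simp add: Gw)
  qed
  also have "\<bar>...\<bar> <= (LINT y|m. \<bar>u powr ga y * w z y - u powr ga0 * w z y\<bar>)" by (rule integral_abs_bound)
  also have "... <= (LINT y|m. e / 2 * w z y + C * z powr (ga0 + d) * w 1 y)"
  proof (rule integral_mono_AE)
   show "AE y in m. \<bar>u powr ga y * w z y - u powr ga0 * w z y\<bar> <= e / 2 * w z y + C * z powr (ga0 + d) * w 1 y"
    using ga0(2)
   proof eventually_elim
    case (elim y)
    have p: "0 <= C * z powr (ga0 + d) * w 1 y" "0 <= e / 2 * w z y"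
     using w[of 1 y] w[OF z(1), of y] e by (auto simp: C_def add_nonneg_nonneg)
    have eq: "\<bar>u powr ga y * w z y - u powr ga0 * w z y\<bar> = \<bar>u powr ga y - u powr ga0\<bar> * w z y"
     using w[OF z(1), of y] by (simp add: abs_mult[symmetric] left_diff_distrib[symmetric] abs_of_pos)
      (simp add: abs_mult)
    show ?case
    proof (cases "ga y < ga0 + d")
     case True
     hence "\<bar>u powr ga y - u powr ga0\<bar> <= e / 2" using d(2)[of "ga y"] elim by (simp add: less_imp_le)
     hence "\<bar>u powr ga y - u powr ga0\<bar> * w z y <= e / 2 * w z y"
      using w[OF z(1), of y] by (intro mult_right_mono) auto
     thus ?thesis using p eq by linarith
    next
     case False
     have "\<bar>u powr ga y - u powr ga0\<bar> * w z y <= C * (z powr (ga0 + d) * w 1 y)"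
      unfolding w1[OF z(1)]
     proof (intro mult_mono C[OF ga])
      show "z powr ga y <= z powr (ga0 + d)" using False z by (intro powr_mono') auto
     qed (use w[of 1 y] in \<open>auto simp: C_def add_nonneg_nonneg\<close>)
     thus ?thesis using p eq by linarith
    qed
   qed
  qed (use i1 wi[of z] wi[of 1] z in auto)
  also have "... = e / 2 * G z + C * z powr (ga0 + d) * G 1"
   using wi[of z] wi[of 1] z by (simp add: Gw)
  finally have num: "\<bar>G (u * z) - u powr ga0 * G z\<bar> <= e / 2 * G z + C * z powr (ga0 + d) * G 1" .
  \<comment> \<open>The gap of \<open>d / 2\<close> between the exponent of this lower bound and
    that of the remainder is the power that tends to 0.\<close>
  have den: "c * z powr (ga0 + d / 2) <= G z"
  proof -
   have "c * z powr (ga0 + d / 2) = (LINT y|m. z powr (ga0 + d / 2) * (indicator {x. ga x < ga0 + d / 2} y * w 1 y))"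
    by (simp add: c_def)
   also have "... <= (LINT y|m. w z y)"
   proof (rule integral_mono)
    fix y
    show "z powr (ga0 + d / 2) * (indicator {x. ga x < ga0 + d / 2} y * w 1 y) <= w z y"
    proof (cases "ga y < ga0 + d / 2")
     case True
     hence "z powr (ga0 + d / 2) <= z powr ga y" using z by (intro powr_mono') auto
     thus ?thesis unfolding w1[OF z(1)] using True w[of 1 y] by (simp add: mult_right_mono)
    qed (use w[OF z(1), of y] in simp)
   qed (use indi[of "{x. ga x < ga0 + d / 2}" 1] wi[of z] z in auto)
   finally show ?thesis by (simp add: Gw)
  qed
  have Gz: "0 < G z" by (rule G_pos[OF z(1)])
  have C0: "0 < C" by (simp add: C_def add_pos_nonneg)
  have "dist (G (u * z) / G z) (u powr ga0) = \<bar>G (u * z) - u powr ga0 * G z\<bar> / G z"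
   using Gz by (simp add: dist_real_def field_simps abs_divide)
  also have "... <= (e / 2 * G z + C * z powr (ga0 + d) * G 1) / G z"
   using num Gz by (intro divide_right_mono) auto
  also have "... = e / 2 + C * G 1 * z powr (ga0 + d) / G z" using Gz by (simp add: field_simps)
  also have "... <= e / 2 + C * G 1 * z powr (ga0 + d) / (c * z powr (ga0 + d / 2))"
   using den Gz C0 G_pos[of 1] c z by (intro add_left_mono divide_left_mono) auto
  also have "z powr (ga0 + d) = z powr (ga0 + d / 2) * z powr (d / 2)"
  proof -
   have e: "ga0 + d = (ga0 + d / 2) + d / 2" by simp
   show ?thesis by (subst e) (rule powr_add)
  qed
  finally show ?thesis using z c by simp
 qed
 have "((%z::real. z powr (d / 2)) ---> 0) (at_right 0)"
 proof (rule tendsto_zero_powrI[OF tendsto_ident_at tendsto_const])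
  show "eventually (%z::real. 0 <= z) (at_right 0)"
   by (rule eventually_mono[OF eventually_at_right_less]) simp
 qed (use d in simp)
 hence "((%z. e / 2 + C * G 1 / c * z powr (d / 2)) ---> e / 2 + C * G 1 / c * 0) (at_right 0)"
  by (intro tendsto_intros)
 from order_tendstoD(2)[OF this, of e]
 have "eventually (%z. e / 2 + C * G 1 / c * z powr (d / 2) < e) (at_right 0)"
  using e by simp
 moreover have "eventually (%z::real. z : {0<..<1}) (at_right 0)"
  by (rule eventually_at_right_real) simp
 ultimately show "eventually (%z. dist (G (u * z) / G z) (u powr ga0) < e) (at_right 0)"
  by eventually_elim (use est in force)
qed

definition CX :: real where
 "CX = (LINT x|m. indicator {x. ga x = ga0} x * ka x * ph x powr ga0 * ph' x)"

text \<open>After division the integrand carries \<open>z powr (ga y - ga0)\<close>, which tends to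
  the indicator of \<open>ga y = ga0\<close>; domination holds because this exponent lies between 0
  and 1 almost everywhere. If the indicated set is null, the limit \<open>CX\<close> is 0.\<close>

lemma G_asymptotics: "((%z. G z / z powr ga0) ---> CX) (at_right 0)"
 unfolding tendsto_at_iff_sequentially
proof (intro allI impI)
 fix z :: "nat => real" assume z: "\<forall>n. z n : {0<..} - {0}" "z ----> 0"
 have zp: "0 < z n" for n using z(1) by auto
 obtain Z where Z: "1 <= Z" "!!n. z n <= Z"
 proof -
  obtain Z where "!!n. z n <= Z"
   using convergent_imp_Bseq[of z] z(2) by (auto simp: convergent_def Bseq_def abs_le_iff)
  thus ?thesis using that[of "max 1 Z"] by (simp add: max.coboundedI2)
 qed
 define w where "w y = ka y * ph y powr ga y * ph' y" for y
 have w: "0 < w y" for y using ka(1)[of y] ph_pos[of y] by (simp add: w_def)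
 have wi: "integrable m w" unfolding w_def using G_integrable[of 1] by simp
 have [measurable]: "w : \<B> borel" unfolding w_def by measurable
 have eq: "G (z n) / z n powr ga0 = (LINT y|m. z n powr (ga y - ga0) * w y)" for n
 proof -
  have "G (z n) / z n powr ga0 = (LINT y|m. ka y * (z n * ph y) powr ga y * ph' y / z n powr ga0)"
   by (simp add: G_def)
  also have "... = (LINT y|m. z n powr (ga y - ga0) * w y)"
   using zp[of n] ph_pos(1) by (intro bochner_cong refl) (simp add: w_def powr_mult powr_diff less_imp_le)
  finally show ?thesis .
 qed
 have lim: "CX = (LINT y|m. indicator {x. ga x = ga0} y * w y)"
  unfolding CX_def w_def by (intro bochner_cong refl) (auto simp: indicator_def)
 have "(%n. \<integral>y. z n powr (ga y - ga0) * w y \<partial>m) ----> CX"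
  unfolding lim
 proof (rule integral_dominated_convergence)
  show "integrable m (%y. Z * w y)" using wi by simp
  show "AE y in m. norm (z n powr (ga y - ga0) * w y) <= Z * w y" for n
   using ga0(2)
  proof eventually_elim
   case (elim y)
   have "z n powr (ga y - ga0) <= Z powr (ga y - ga0)" using elim zp[of n] Z(2)[of n] by (intro powr_mono2) auto
   also have "... <= Z powr 1" using Z(1) ga(2)[of y] ga0(1) by (intro powr_mono) auto
   finally show ?case using Z(1) w[of y] by (simp add: abs_mult mult_right_mono)
  qed
  show "AE y in m. (%n. z n powr (ga y - ga0) * w y) ----> indicator {x. ga x = ga0} y * w y"
   using ga0(2)
  proof eventually_elim
   case (elim y)
   show ?case
   proof (cases "ga y = ga0")
    case True
    thus ?thesis using zp by (simp add: less_imp_neq[symmetric])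
   next
    case False
    hence "(%n. z n powr (ga y - ga0)) ----> 0"
     using elim zp by (intro tendsto_zero_powrI[OF z(2) tendsto_const]) (auto intro: always_eventually less_imp_le)
    thus ?thesis using False by (auto intro: tendsto_mult_left_zero)
   qed
  qed
 qed measurable
 thus "((%z. G z / z powr ga0) \<circ> z) ----> CX" by (simp add: comp_def eq)
qed

text \<open>Past the time \<open>T0\<close> from which \<open>v\<close> is below the threshold, the
  uniform statement applies to the shifted solution.\<close>

lemma eventually_shape:
 assumes v: "solution v" and et: "0 < et" "et < 1"
 obtains T where "0 < T" "!!t x. T <= t ==> (1 - et) * a v t * ph x <= v t x"
  "!!t x. T <= t ==> v t x <= (1 + et) * a v t * ph x"
proof -
 obtain s de where s: "0 < s" "0 < de" and sh: "\<forall>v. solution v --> (\<forall>t\<ge>0. \<forall>x. v t x <= de) -->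
  (\<forall>t\<ge>s. \<forall>x. (1 - et) * a v t * ph x <= v t x \<and> v t x <= (1 + et) * a v t * ph x) \<and> (1 - et) * a v 0 <= a v s"
  using uniform_shape[OF et] by (elim exE conjE) (rule that)
 obtain T0 where T0: "0 <= T0" "!!t x. T0 <= t ==> v t x <= de"
  using eventually_small[OF v s(2)] by blast
 have "\<forall>t\<ge>s. \<forall>x. (1 - et) * a (%t. v (T0 + t)) t * ph x <= v (T0 + t) x \<and> v (T0 + t) x <= (1 + et) * a (%t. v (T0 + t)) t * ph x"
  using sh[rule_format, OF shift_solution[OF v T0(1)]] T0 by simp
 hence *: "\<forall>t\<ge>s. \<forall>x. (1 - et) * a v (T0 + t) * ph x <= v (T0 + t) x \<and> v (T0 + t) x <= (1 + et) * a v (T0 + t) * ph x"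
  unfolding a_shift .
 show ?thesis
 proof (rule that[of "T0 + s"])
  fix t x assume "T0 + s <= t"
  thus "(1 - et) * a v t * ph x <= v t x" "v t x <= (1 + et) * a v t * ph x"
   using *[rule_format, of "t - T0" x] by auto
 qed (use T0 s in auto)
qed

text \<open>With the shape known from some time on, \<open>F v\<close> is \<open>G (a v)\<close> up
  to the squares of \<open>1 - et\<close> and \<open>1 + et\<close>, and
  \<open>decrease_rate\<close> shows that the primitive \<open>Ph\<close> along \<open>a v\<close>
  grows with asymptotic slope 1.\<close>

lemma a_regularly_varying:
 assumes v: "solution v" and a0: "0 < a v 0" and u: "0 < u"
 shows "((%t. a v (u * t) / a v t) ---> u powr - (1 / (ga0 - 1))) at_top"
proof -
 obtain Ph where Ph: "!!z. 0 < z ==> (Ph has_real_derivative - (1 / G z)) (at z)"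
  using antiderivative_positive[of "%z. - (1 / G z)"] G_cont G_pos by (auto intro!: continuous_intros simp: less_imp_neq[symmetric])
 have ap: "0 < a v t" if "0 <= t" for t by (rule a_pos[OF v a0 that])
 have "((%t. Ph (a v t) / t) ---> 1) at_top"
 proof (rule tendstoI)
  fix e :: real assume e: "0 < e"
  \<comment> \<open>The slopes deviate from 1 by at most \<open>3 * et\<close>; the bound
    \<open>e / 8\<close> keeps this, multiplied by \<open>t\<close>, below
    \<open>e * t / 2\<close>.\<close>
  define et where "et = min (1 / 2) (e / 8)"
  have et: "0 < et" "et < 1" "et <= e / 8" using e by (auto simp: et_def)
  obtain T where T: "0 < T" "!!t x. T <= t ==> (1 - et) * a v t * ph x <= v t x"
   "!!t x. T <= t ==> v t x <= (1 + et) * a v t * ph x"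
   using eventually_shape[OF v et(1,2)] by blast
  have Fb: "(1 - et)^2 * G (a v r) <= F v r" "F v r <= (1 + et)^2 * G (a v r)" if "T <= r" for r
   using F_shape[OF v, of r "1 - et" "1 + et"] T that et by auto
  have rate: "(1 - et)^2 * (t - T) <= Ph (a v t) - Ph (a v T)" "Ph (a v t) - Ph (a v T) <= (1 + et)^2 * (t - T)"
   if t: "T <= t" for t
  proof -
   have lo: "(1 - et)^2 * (y - x) * G (a v y) <= a v x - a v y" if "T <= x" "x <= y" "y <= t" for x y
   proof -
    have "(1 - et)^2 * G (a v y) * (y - x) <= a v x - a v y"
    proof (rule a_decrease_ge[OF v])
     fix r assume r: "x <= r" "r <= y"
     have "(1 - et)^2 * G (a v y) <= (1 - et)^2 * G (a v r)"
      using r that T by (intro mult_left_mono G_mono a_antimono[OF v] ap) auto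
     thus "(1 - et)^2 * G (a v y) <= F v r" using Fb(1)[of r] r that by linarith
    qed (use that T in auto)
    thus ?thesis by (simp add: mult_ac)
   qed
   have up: "a v x - a v y <= (1 + et)^2 * (y - x) * G (a v x)" if "T <= x" "x <= y" "y <= t" for x y
   proof -
    have "a v x - a v y <= (1 + et)^2 * G (a v x) * (y - x)"
    proof (rule a_decrease_le[OF v])
     fix r assume r: "x <= r" "r <= y"
     have "(1 + et)^2 * G (a v r) <= (1 + et)^2 * G (a v x)"
      using r that T by (intro mult_left_mono G_mono a_antimono[OF v] ap) auto
     thus "F v r <= (1 + et)^2 * G (a v x)" using Fb(2)[of r] r that by linarith
    qed (use that T in auto)
    thus ?thesis by (simp add: mult_ac)
   qed
   note * = decrease_rate[OF t, of "a v" G Ph "(1 - et)^2" "(1 + et)^2", OF _ G_pos G_mono G_cont Ph _ _ lo up]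
   show "(1 - et)^2 * (t - T) <= Ph (a v t) - Ph (a v T)" by (rule *(1)) (use T ap in auto)
   show "Ph (a v t) - Ph (a v T) <= (1 + et)^2 * (t - T)" by (rule *(2)) (use T ap in auto)
  qed
  \<comment> \<open>From \<open>R\<close> on, all terms stemming from the starting time
    \<open>T\<close> stay below the other half of \<open>e * t\<close>.\<close>
  define R where "R = (\<bar>Ph (a v T)\<bar> + 4 * T + 1) * (2 / e)"
  have "eventually (%t. t >= T \<and> t > R) at_top"
   using eventually_ge_at_top[of T] eventually_gt_at_top[of R] by eventually_elim auto
  thus "eventually (%t. dist (Ph (a v t) / t) 1 < e) at_top"
  proof eventually_elim
   case (elim t)
   hence t: "T <= t" "R < t" "0 < t" using T by auto
   have Re: "\<bar>Ph (a v T)\<bar> + 4 * T + 1 < t * (e / 2)"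
    using t(2) e by (simp add: R_def field_simps)
   have sq: "1 - 2 * et <= (1 - et)^2" "(1 + et)^2 <= 1 + 3 * et" "(1 - et)^2 <= 1"
   proof -
    have "et * et <= 1 * et" using et by (intro mult_right_mono) auto
    thus "(1 + et)^2 <= 1 + 3 * et" by (simp add: power2_eq_square algebra_simps)
    show "1 - 2 * et <= (1 - et)^2" by (simp add: power2_eq_square algebra_simps)
    show "(1 - et)^2 <= 1" using et by (simp add: power_le_one)
   qed
   have "(1 - 2 * et) * (t - T) <= (1 - et)^2 * (t - T)" "(1 + et)^2 * (t - T) <= (1 + 3 * et) * (t - T)"
    using sq t by (auto intro!: mult_right_mono)
   hence b: "Ph (a v T) + (1 - 2 * et) * (t - T) <= Ph (a v t)" "Ph (a v t) <= Ph (a v T) + (1 + 3 * et) * (t - T)"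
    using rate[OF t(1)] by auto
   have et: "et * t <= e / 8 * t" "0 <= et * T" "et * T <= 1 * T" "0 <= et * t"
    using et t T by (auto intro!: mult_right_mono)
   have "\<bar>Ph (a v t) - t\<bar> < e * t"
   proof -
    have b': "Ph (a v T) + t - T - 2 * (et * t) + 2 * (et * T) <= Ph (a v t)"
     "Ph (a v t) <= Ph (a v T) + t - T + 3 * (et * t) - 3 * (et * T)"
     using b by (simp_all add: algebra_simps)
    have e': "2 * (e / 8 * t) <= e * t / 2" "3 * (e / 8 * t) <= e * t / 2" "t * (e / 2) = e * t / 2" "e * t = e * t / 2 + e * t / 2"
     using e t by (auto simp: field_simps)
    show ?thesis
     unfolding abs_less_iff
     using b' e' et Re T(1) abs_ge_self[of "Ph (a v T)"] abs_ge_minus_self[of "Ph (a v T)"] by linarith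
   qed
   hence "\<bar>Ph (a v t) - t\<bar> / t < e" using t by (simp add: divide_less_eq)
   moreover have "\<bar>Ph (a v t) - t\<bar> / t = dist (Ph (a v t) / t) 1"
    using t by (simp add: dist_real_def field_simps abs_divide)
   ultimately show ?case by simp
  qed
 qed
 thus ?thesis
  using regularly_varying_inverse[of ga0 G Ph "a v" u] ga0(1) G_pos G_regularly_varying Ph ap a_tendsto_0[OF v] u by auto
qed

text \<open>The primitive \<open>Ph\<close> for the pure power \<open>z powr ga0\<close>, normalised
  to vanish at infinity.\<close>

definition Ps :: "real => real" where
 "Ps z = z powr - (ga0 - 1) / (ga0 - 1)"

lemma Ps_deriv: "0 < z ==> (Ps has_real_derivative - (1 / z powr ga0)) (at z)"
proof -
 assume z: "0 < z"
 have "(Ps has_real_derivative - (ga0 - 1) * z powr (- (ga0 - 1) - 1) / (ga0 - 1)) (at z)"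
  unfolding Ps_def by (intro DERIV_cdivide has_real_derivative_powr z)
 moreover have "- (ga0 - 1) * z powr (- (ga0 - 1) - 1) / (ga0 - 1) = - (1 / z powr ga0)"
  using ga0(1) by (simp add: divide_simps powr_minus)
 ultimately show ?thesis by simp
qed

lemma power_rate:
 assumes v: "solution v" and a0: "0 < a v 0" and st: "0 <= s" "s <= t" and lL: "0 <= l" "0 <= L"
  and lo: "!!r. s <= r ==> r <= t ==> l * a v r powr ga0 <= F v r"
  and up: "!!r. s <= r ==> r <= t ==> F v r <= L * a v r powr ga0"
 shows "l * (t - s) <= Ps (a v t) - Ps (a v s)" "Ps (a v t) - Ps (a v s) <= L * (t - s)"
proof -
 have ap: "0 < a v t" if "0 <= t" for t by (rule a_pos[OF v a0 that])
 have mono: "y powr ga0 <= z powr ga0" if "0 < y" "y <= z" for y z :: real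
  using that ga0(1) by (intro powr_mono2) auto
 have lo': "l * (y - x) * (a v y powr ga0) <= a v x - a v y" if "s <= x" "x <= y" "y <= t" for x y
 proof -
  have "l * (a v y powr ga0) * (y - x) <= a v x - a v y"
  proof (rule a_decrease_ge[OF v])
   fix r assume r: "x <= r" "r <= y"
   have "l * a v y powr ga0 <= l * a v r powr ga0"
    using r that st lL by (intro mult_left_mono mono a_antimono[OF v] ap) auto
   thus "l * a v y powr ga0 <= F v r" using lo[of r] r that by linarith
  qed (use that st in auto)
  thus ?thesis by (simp add: mult_ac)
 qed
 have up': "a v x - a v y <= L * (y - x) * (a v x powr ga0)" if "s <= x" "x <= y" "y <= t" for x y
 proof -
  have "a v x - a v y <= L * (a v x powr ga0) * (y - x)"
  proof (rule a_decrease_le[OF v])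
   fix r assume r: "x <= r" "r <= y"
   have "L * a v r powr ga0 <= L * a v x powr ga0"
    using r that st lL by (intro mult_left_mono mono a_antimono[OF v] ap) auto
   thus "F v r <= L * a v x powr ga0" using up[of r] r that by linarith
  qed (use that st in auto)
  thus ?thesis by (simp add: mult_ac)
 qed
 have cont: "isCont (%z. z powr ga0) z" if "0 < z" for z :: real
  using that by (auto intro!: continuous_intros)
 note * = decrease_rate[OF st(2), of "a v" "%z. z powr ga0" Ps l L, OF _ _ mono cont Ps_deriv lL lo' up']
 show "l * (t - s) <= Ps (a v t) - Ps (a v s)" by (rule *(1)) (use st ap in auto)
 show "Ps (a v t) - Ps (a v s) <= L * (t - s)" by (rule *(2)) (use st ap in auto)
qed

text \<open>Coming down from infinity: while \<open>a v\<close> is large, the loss is at least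
  \<open>l * a v powr ga0\<close> with \<open>l\<close> independent of the solution, so
  \<open>Ps (a v)\<close> gains \<open>l * s\<close> up to time \<open>s\<close> whatever the
  initial value. The other half of the time turns the bound on \<open>a v\<close> into one on the
  supremum. Hence solutions with growing constant initial values stay bounded at every positive
  time.\<close>

lemma uniform_upper_bound:
 assumes t: "0 < t"
 shows "\<exists>C>0. \<forall>v. solution v --> 0 < a v 0 --> (\<forall>x. v t x <= C)"
proof -
 define d where "d = ga0 - 1"
 have d: "0 < d" "d < 1" using ga0(1) ga0_less_2 by (auto simp: d_def)
 \<comment> \<open>For \<open>z = a v r / (2 * mass')\<close> one has
   \<open>z powr d = b * a v r powr d\<close>, and the integral of \<open>v r - z\<close> against
   \<open>ph'\<close> is half of \<open>a v r\<close>. The additional \<open>mass'\<close> comes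
   from replacing \<open>ga\<close> by \<open>ga0\<close> where \<open>v r < 1\<close>;
   \<open>A\<close> is large enough to absorb it.\<close>
 define b where "b = (1 / (2 * mass')) powr d"
 have b: "0 < b" using mass'_pos by (simp add: b_def)
 define l where "l = ka0 * b / 4"
 have l: "0 < l" using ka0(1) b by (simp add: l_def)
 define A where "A = (4 * mass' / b) powr (1 / ga0) + 1"
 have A: "1 <= A" by (simp add: A_def)
 have A2: "mass' <= b * A powr ga0 / 4"
 proof -
  have "4 * mass' / b = ((4 * mass' / b) powr (1 / ga0)) powr ga0"
   using ga0(1) mass'_pos b by (simp add: powr_powr)
  also have "... <= A powr ga0" using ga0(1) by (intro powr_mono2) (auto simp: A_def)
  finally show ?thesis using b by (simp add: field_simps)
 qed
 have Fl: "l * a v r powr ga0 <= F v r" if v: "solution v" and r: "0 <= r" and big: "A <= a v r" for v r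
 proof -
  define z where "z = a v r / (2 * mass')"
  have z: "0 < z" using big A mass'_pos by (simp add: z_def)
  have i: "integrable m (%x. v r x * ph' x)" "integrable m (%x. N v r x * ph' x)"
   by (intro integrable_mult_ph' v_bounded_borel[OF v] N_bounded_borel[OF v] r)+
  have "(LINT x|m. ka0 * (z powr d * (v r x * ph' x - z * ph' x) - ph' x)) <= F v r"
   unfolding F_def
  proof (rule integral_mono_AE)
   show "AE x in m. ka0 * (z powr d * (v r x * ph' x - z * ph' x) - ph' x) <= N v r x * ph' x"
    using ka0(2) ga0(2)
   proof eventually_elim
    case (elim x)
    have vx: "0 <= v r x" by (rule v_nonneg[OF v r])
    have 1: "z powr d * (v r x - z) <= v r x powr ga0"
    proof (cases "z <= v r x")
     case True
     hence "z powr d * (v r x - z) <= v r x powr d * v r x"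
      using z d by (intro mult_mono powr_mono2) auto
     also have "... = v r x powr ga0" using True z by (simp add: d_def powr_diff)
     finally show ?thesis .
    next
     case False
     hence "z powr d * (v r x - z) <= 0" by (intro mult_nonneg_nonpos) auto
     thus ?thesis using powr_ge_zero[of "v r x" ga0] by linarith
    qed
    have 2: "v r x powr ga0 - 1 <= v r x powr ga x"
    proof (cases "1 <= v r x")
     case True
     hence "v r x powr ga0 <= v r x powr ga x" using elim by (intro powr_mono) auto
     thus ?thesis by simp
    next
     case False
     hence "v r x powr ga0 <= 1 powr ga0" using vx ga0(1) by (intro powr_mono2) auto
     hence "v r x powr ga0 <= 1" by simp
     thus ?thesis using powr_ge_zero[of "v r x" "ga x"] by linarith
    qed
    have "ka0 * (z powr d * (v r x - z) - 1) <= ka0 * v r x powr ga x"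
     using 1 2 ka0(1) by (intro mult_left_mono) auto
    also have "... <= N v r x" unfolding N_def using elim by (intro mult_right_mono) auto
    finally have "ka0 * (z powr d * (v r x - z) - 1) * ph' x <= N v r x * ph' x"
     using ph_pos(2)[of x] by (intro mult_right_mono) auto
    thus ?case by (simp add: algebra_simps)
   qed
  qed (use i ph'_integrable in auto)
  also have "(LINT x|m. ka0 * (z powr d * (v r x * ph' x - z * ph' x) - ph' x))
   = ka0 * (z powr d * (a v r - z * mass') - mass')"
   using i ph'_integrable by (simp add: a_def mass'_def)
  also have "z * mass' = a v r / 2" using mass'_pos by (simp add: z_def)
  also have "z powr d = b * a v r powr d"
  proof -
   have "z = 1 / (2 * mass') * a v r" by (simp add: z_def)
   thus ?thesis using mass'_pos big A by (simp only: b_def powr_mult)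
  qed
  also have "b * a v r powr d * (a v r - a v r / 2) = b * a v r powr ga0 / 2"
   using big A by (simp add: d_def powr_diff)
  finally have "ka0 * (b * a v r powr ga0 / 2 - mass') <= F v r" .
  moreover have "l * a v r powr ga0 <= ka0 * (b * a v r powr ga0 / 2 - mass')"
  proof -
   have "b * A powr ga0 / 4 <= b * a v r powr ga0 / 4"
    using b big A ga0(1) by (intro divide_right_mono mult_left_mono powr_mono2) auto
   hence "ka0 * (b * a v r powr ga0 / 4) <= ka0 * (b * a v r powr ga0 / 2 - mass')"
    using A2 ka0(1) by (intro mult_left_mono) auto
   thus ?thesis by (simp add: l_def)
  qed
  ultimately show ?thesis by linarith
 qed
 define s where "s = t / 2"
 have s: "0 < s" using t by (simp add: s_def)
 \<comment> \<open>Either \<open>a v\<close> has fallen to \<open>A\<close> by time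
   \<open>s\<close>, or it exceeded \<open>A\<close> throughout and the bound on \<open>Ps\<close>
   can be inverted.\<close>
 define D where "D = max A ((d * (l * s)) powr (- 1 / d))"
 have D: "0 < D" using A by (simp add: D_def)
 have aD: "a v s <= D" if v: "solution v" and a0: "0 < a v 0" for v
 proof (cases "a v s <= A")
  case True thus ?thesis by (simp add: D_def)
 next
  case False
  have ap: "0 < a v t" if "0 <= t" for t by (rule a_pos[OF v a0 that])
  have ar: "A <= a v r" if "0 <= r" "r <= s" for r using a_antimono[OF v that] False by linarith
  obtain M where M: "1 <= M" "!!t x. 0 <= t ==> N v t x <= K * M * v t x" by (rule N_le[OF v]) blast
  have "l * (s - 0) <= Ps (a v s) - Ps (a v 0)"
  proof (rule power_rate(1)[OF v a0, where L="K * M"])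
   show "l * a v r powr ga0 <= F v r" if "0 <= r" "r <= s" for r using that by (intro Fl v ar)
   show "F v r <= K * M * a v r powr ga0" if r: "0 <= r" "r <= s" for r
   proof -
    have "F v r <= K * M * a v r" using r M by (intro F_le_a v) auto
    also have "... <= K * M * a v r powr ga0"
    proof (rule mult_left_mono)
     have "a v r powr 1 <= a v r powr ga0" using ar[OF r] A ga0(1) by (intro powr_mono) auto
     thus "a v r <= a v r powr ga0" using ap[OF r(1)] by simp
    qed (use K_pos M in auto)
    finally show ?thesis .
   qed
  qed (use s l K_pos M in auto)
  hence "d * (l * s) + a v 0 powr - d <= a v s powr - d"
   using d by (simp add: Ps_def d_def[symmetric] field_simps)
  hence "d * (l * s) <= a v s powr - d" using powr_ge_zero[of "a v 0" "- d"] by linarith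
  hence "(a v s powr - d) powr (- 1 / d) <= (d * (l * s)) powr (- 1 / d)"
   using d l s by (intro powr_mono2') auto
  hence "a v s <= (d * (l * s)) powr (- 1 / d)"
   using d ap[of s] s by (simp add: powr_powr)
  thus ?thesis by (simp add: D_def)
 qed
 obtain C where C: "0 < C" "!!f x. f : bounded_borel ==> (!!y. 0 <= f y) ==> Q s f x <= C * ph x * (LINT y|m. f y * ph' y)"
  using ultrabound[OF s] by auto
 obtain c where c: "!!x. ph x <= c" using ph_bounded by blast
 have c0: "0 < c" using c[of undefined] ph_pos(1)[of undefined] by linarith
 show ?thesis
 proof (rule exI[of _ "C * c * D"], intro conjI allI impI)
  show "0 < C * c * D" using C c0 D by simp
  fix v x assume v: "solution v" and a0: "0 < a v 0"
  have "v (s + s) x <= Q s (v s) x" using s by (intro v_le_Q[OF v]) auto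
  also have "... <= C * ph x * a v s"
   unfolding a_def using s by (intro C v_bounded_borel[OF v] v_nonneg[OF v]) auto
  also have "... <= C * c * D"
   using C c[of x] ph_pos(1)[of x] aD[OF v a0] a_nonneg[OF v, of s] s c0 by (intro mult_mono) auto
  finally show "v t x <= C * c * D" by (simp add: s_def)
 qed
qed

end

section \<open>Uniform rates for small solutions and their scaling limit\<close>

context stable_branching_semigroup
begin

definition shape :: "real => (real => 'a => real) => real => bool" where
 "shape et v t \<longleftrightarrow> (\<forall>x. (1 - et) * a v t * ph x <= v t x \<and> v t x <= (1 + et) * a v t * ph x)"

lemma shapeD: "shape et v t ==> (1 - et) * a v t * ph x <= v t x" "shape et v t ==> v t x <= (1 + et) * a v t * ph x"
 by (simp_all add: shape_def)

lemma eventually_shape':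
 assumes "solution v" "0 < et" "et < 1"
 shows "\<exists>T>0. \<forall>t\<ge>T. shape et v t"
proof (rule eventually_shape[OF assms])
 fix T assume T: "0 < T" "!!t x. T <= t ==> (1 - et) * a v t * ph x <= v t x"
  "!!t x. T <= t ==> v t x <= (1 + et) * a v t * ph x"
 show ?thesis by (intro exI[of _ T] conjI T(1)) (simp add: shape_def T)
qed

lemma shape_mono:
 assumes "shape et v t" "solution v" "0 <= t" "et <= et'"
 shows "shape et' v t"
 unfolding shape_def
proof (intro allI conjI)
 fix x
 have p: "0 <= a v t * ph x" using a_nonneg[OF assms(2,3)] ph_pos(1)[of x] by simp
 have "(1 - et') * (a v t * ph x) <= (1 - et) * (a v t * ph x)" using p assms(4) by (intro mult_right_mono) auto
 thus "(1 - et') * a v t * ph x <= v t x" using shapeD(1)[OF assms(1), of x] by (simp add: mult.assoc)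
 have "(1 + et) * (a v t * ph x) <= (1 + et') * (a v t * ph x)" using p assms(4) by (intro mult_right_mono) auto
 thus "v t x <= (1 + et') * a v t * ph x" using shapeD(2)[OF assms(1), of x] by (simp add: mult.assoc)
qed

text \<open>A last step so short that \<open>s * (K * M) <= 1 / 2\<close> costs at most half of the
  linear flow, which the lower kernel bound makes positive at every point.\<close>

lemma v_pos:
 assumes v: "solution v" and a0: "0 < a v 0" and t: "0 < t"
 shows "0 < v t x"
proof -
 obtain M where M: "1 <= M" "!!t x. 0 <= t ==> N v t x <= K * M * v t x" by (rule N_le[OF v]) blast
 have KM: "0 < K * M" using K_pos M(1) by simp
 define s where "s = min t (1 / (2 * (K * M)))"
 have s: "0 < s" "s <= t" "s * (K * M) <= 1 / 2"
 proof -
  show "0 < s" "s <= t" using t KM by (auto simp: s_def)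
  have "s * (K * M) <= 1 / (2 * (K * M)) * (K * M)" using KM by (intro mult_right_mono) (auto simp: s_def)
  thus "s * (K * M) <= 1 / 2" using K_pos M(1) by simp
 qed
 obtain c where c: "0 < c" "!!f x. f : bounded_borel ==> (!!y. 0 <= f y) ==> c * ph x * (LINT y|m. f y * ph' y) <= Q s f x"
  using ultralower[OF s(1)] by auto
 have ts: "0 <= t - s" using s by simp
 have "0 < c * ph x * a v (t - s)" using c ph_pos(1) a_pos[OF v a0 ts] by simp
 also have "... <= Q s (v (t - s)) x"
  unfolding a_def using ts by (intro c(2) v_bounded_borel[OF v] v_nonneg[OF v])
 finally have q: "0 < Q s (v (t - s)) x" .
 have "(1 - s * (K * M)) * Q s (v (t - s)) x <= v (t - s + s) x"
  using s ts KM M(2) by (intro v_ge_Q[OF v]) auto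
 moreover have "0 < (1 - s * (K * M)) * Q s (v (t - s)) x" using q s by simp
 ultimately show ?thesis by simp
qed

lemma uniform_shape':
 assumes "0 < et" "et < 1"
 shows "\<exists>s de. 0 < s \<and> 0 < de \<and> (\<forall>v. solution v --> (\<forall>t\<ge>0. \<forall>x. v t x <= de) -->
  (\<forall>t\<ge>s. shape et v t) \<and> (1 - et) * a v 0 <= a v s)"
proof -
 obtain s de where s: "0 < s" "0 < de" and sh: "\<forall>v. solution v --> (\<forall>t\<ge>0. \<forall>x. v t x <= de) -->
  (\<forall>t\<ge>s. \<forall>x. (1 - et) * a v t * ph x <= v t x \<and> v t x <= (1 + et) * a v t * ph x) \<and> (1 - et) * a v 0 <= a v s"
  using uniform_shape[OF assms] by (elim exE conjE) (rule that)
 thus ?thesis unfolding shape_def by (intro exI conjI)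
qed

text \<open>For the pure power the primitive \<open>Ps\<close> is explicit and the slope is
  \<open>CX\<close>. Again \<open>s\<close> and \<open>de\<close> are found before the solution;
  \<open>de\<close> has to be so small that \<open>a v\<close> stays where \<open>G z\<close> and
  \<open>CX * z powr ga0\<close> are close.\<close>

lemma uniform_rate:
 assumes et: "0 < et" "et < 1" and CX: "0 < CX"
 shows "\<exists>s de. 0 < s \<and> 0 < de \<and> (\<forall>v. solution v --> 0 < a v 0 --> (\<forall>t\<ge>0. \<forall>x. v t x <= de) -->
  (1 - et) * a v 0 <= a v s \<and> (\<forall>t\<ge>s. shape et v t \<and>
   (1 - et) * CX * (t - s) <= Ps (a v t) - Ps (a v s) \<and> Ps (a v t) - Ps (a v s) <= (1 + et) * CX * (t - s)))"
proof -
 \<comment> \<open>Three factors \<open>1 - e\<close> or \<open>1 + e\<close> meet, two from the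
   squared shape error and one from the asymptotics of \<open>G\<close>; an eighth of
   \<open>et\<close> covers their product.\<close>
 define e where "e = et / 8"
 have e: "0 < e" "e < 1 / 8" "e <= et" "et = 8 * e" using et by (auto simp: e_def)
 have e1: "e < 1" using e by simp
 obtain s de1 where s: "0 < s" "0 < de1" and sh1: "\<forall>v. solution v --> (\<forall>t\<ge>0. \<forall>x. v t x <= de1) -->
  (\<forall>t\<ge>s. shape e v t) \<and> (1 - e) * a v 0 <= a v s"
  using uniform_shape'[OF e(1) e1] by (elim exE conjE) (rule that)
 have "eventually (%z. (1 - e) * CX < G z / z powr ga0 \<and> G z / z powr ga0 < (1 + e) * CX) (at_right 0)"
  using CX e by (intro eventually_conj order_tendstoD[OF G_asymptotics]) auto
 then obtain z1 where z1: "0 < z1" "!!z. 0 < z ==> z < z1 ==> (1 - e) * CX < G z / z powr ga0 \<and> G z / z powr ga0 < (1 + e) * CX"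
  unfolding eventually_at_right_field by auto
 have Gz: "(1 - e) * CX * z powr ga0 <= G z" "G z <= (1 + e) * CX * z powr ga0" if "0 < z" "z < z1" for z
  using z1(2)[OF that] that by (auto simp: pos_less_divide_eq pos_divide_less_eq)
 define de where "de = min de1 (z1 / (2 * mass'))"
 have de: "0 < de" "de <= de1" "de * mass' < z1"
 proof -
  show "0 < de" "de <= de1" using s z1 mass'_pos by (auto simp: de_def)
  have "de * mass' <= z1 / (2 * mass') * mass'" using mass'_pos by (intro mult_right_mono) (auto simp: de_def)
  thus "de * mass' < z1" using mass'_pos z1(1) by simp
 qed
 have pw: "1 - et <= (1 - e)^2 * (1 - e)" "(1 + e)^2 * (1 + e) <= 1 + et"
 proof -
  have ee: "0 <= e * e" "e * e <= 1 * e" "0 <= e * (e * e)" "e * (e * e) <= 1 * (e * e)"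
   using e by (auto intro!: mult_right_mono mult_nonneg_nonneg)
  have "(1 - e)^2 * (1 - e) = 1 - 3 * e + 3 * (e * e) - e * (e * e)"
   "(1 + e)^2 * (1 + e) = 1 + 3 * e + 3 * (e * e) + e * (e * e)"
   by (simp_all add: power2_eq_square algebra_simps)
  thus "1 - et <= (1 - e)^2 * (1 - e)" "(1 + e)^2 * (1 + e) <= 1 + et"
   using ee e by linarith+
 qed
 show ?thesis
 proof (rule exI[of _ s], rule exI[of _ de], intro conjI allI impI s(1) de(1))
  fix v assume v: "solution v" and a0: "0 < a v 0" and small: "\<forall>t\<ge>0. \<forall>x. v t x <= de"
  have small1: "\<forall>t\<ge>0. \<forall>x. v t x <= de1" using small de(2) by (auto intro: order_trans)
  note sh = sh1[rule_format, OF v small1[rule_format]]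
  have "(1 - et) * a v 0 <= (1 - e) * a v 0" using e a_nonneg[OF v, of 0] by (intro mult_right_mono) auto
  thus "(1 - et) * a v 0 <= a v s" using sh by linarith
  have ap: "0 < a v r" if "0 <= r" for r by (rule a_pos[OF v a0 that])
  have al: "a v r < z1" if "0 <= r" for r using a_le[OF v that, of de] small that de(3) by fastforce
  have sh': "shape e v r" if "s <= r" for r using sh that by blast
  have Fb: "(1 - e)^2 * G (a v r) <= F v r" "F v r <= (1 + e)^2 * G (a v r)" if "s <= r" for r
   using F_shape[OF v, of r "1 - e" "1 + e"] shapeD[OF sh'[OF that]] that s e by auto
  fix t assume t: "s <= t"
  have lo: "(1 - et) * CX * a v r powr ga0 <= F v r" if r: "s <= r" "r <= t" for r
  proof -
   have r0: "0 <= r" using r s by simp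
   have "(1 - et) * (CX * a v r powr ga0) <= ((1 - e)^2 * (1 - e)) * (CX * a v r powr ga0)"
    using CX by (intro mult_right_mono pw) auto
   also have "... = (1 - e)^2 * ((1 - e) * CX * a v r powr ga0)" by (simp only: mult.assoc)
   also have "... <= (1 - e)^2 * G (a v r)" using ap[OF r0] al[OF r0] by (intro mult_left_mono Gz) auto
   also have "... <= F v r" by (rule Fb[OF r(1)])
   finally show ?thesis by (simp only: mult.assoc)
  qed
  have up: "F v r <= (1 + et) * CX * a v r powr ga0" if r: "s <= r" "r <= t" for r
  proof -
   have r0: "0 <= r" using r s by simp
   have "F v r <= (1 + e)^2 * G (a v r)" by (rule Fb[OF r(1)])
   also have "... <= (1 + e)^2 * ((1 + e) * CX * a v r powr ga0)" using ap[OF r0] al[OF r0] by (intro mult_left_mono Gz) auto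
   also have "... = ((1 + e)^2 * (1 + e)) * (CX * a v r powr ga0)" by (simp only: mult.assoc)
   also have "... <= (1 + et) * (CX * a v r powr ga0)" using CX by (intro mult_right_mono pw) auto
   finally show ?thesis by (simp only: mult.assoc)
  qed
  show "shape et v t" using shape_mono[OF sh'[OF t] v] t s e by simp
  show "(1 - et) * CX * (t - s) <= Ps (a v t) - Ps (a v s)"
   by (rule power_rate(1)[OF v a0 _ t _ _ lo up]) (use s et CX in auto)
  show "Ps (a v t) - Ps (a v s) <= (1 + et) * CX * (t - s)"
   by (rule power_rate(2)[OF v a0 _ t _ _ lo up]) (use s et CX in auto)
 qed
qed

text \<open>The normalisation \<open>eta\<close> of the theorem; for \<open>CX > 0\<close> it is the
  solution of \<open>Ps (et' t) = CX * t\<close>.\<close>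

definition et' :: "real => real" where
 "et' t = (CX * (ga0 - 1) * t) powr (- 1 / (ga0 - 1))"

lemma div_et':
 assumes "0 < CX" "0 < z" "0 < t"
 shows "z / et' t = (Ps z / (CX * t)) powr (- 1 / (ga0 - 1))"
proof -
 have d: "0 < ga0 - 1" using ga0(1) by simp
 have "Ps z / (CX * t) = z powr - (ga0 - 1) / (CX * (ga0 - 1) * t)"
  by (simp add: Ps_def mult_ac)
 also have "... powr (- 1 / (ga0 - 1)) = (z powr - (ga0 - 1)) powr (- 1 / (ga0 - 1)) / et' t"
  unfolding et'_def using assms d by (simp add: powr_divide)
 also have "(z powr - (ga0 - 1)) powr (- 1 / (ga0 - 1)) = z"
 proof -
  have "- (ga0 - 1) * (- 1 / (ga0 - 1)) = 1" using d by (simp add: divide_simps)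
  thus ?thesis unfolding powr_powr using assms by simp
 qed
 finally show ?thesis by simp
qed

lemma Ps_scaled_et':
 assumes "0 < CX" "0 < c" "0 < t"
 shows "Ps (c * et' t) = c powr - (ga0 - 1) * (CX * t)"
proof -
 have d: "0 < ga0 - 1" using ga0(1) by simp
 have "et' t powr - (ga0 - 1) = CX * (ga0 - 1) * t"
 proof -
  have "- 1 / (ga0 - 1) * - (ga0 - 1) = 1" using d by (simp add: divide_simps)
  thus ?thesis unfolding et'_def powr_powr using assms d by simp
 qed
 thus ?thesis using assms d by (simp add: Ps_def powr_mult et'_def)
qed

lemma et'_pos: "0 < CX ==> 0 < t ==> 0 < et' t"
 using ga0(1) by (simp add: et'_def)

text \<open>Once the values are small, \<open>Ps\<close> along \<open>a v\<close> has slope close to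
  \<open>CX\<close>; what was accumulated before is negligible against \<open>CX * t\<close>, and
  \<open>div_et'\<close> inverts \<open>Ps\<close>.\<close>

lemma a_et':
 assumes v: "solution v" and a0: "0 < a v 0" and CX: "0 < CX"
 shows "((%t. a v t / et' t) ---> 1) at_top"
proof -
 have ap: "0 < a v t" if "0 <= t" for t by (rule a_pos[OF v a0 that])
 have "((%t. Ps (a v t) / (CX * t)) ---> 1) at_top"
 proof (rule tendstoI)
  fix e :: real assume e: "0 < e"
  define et where "et = min (1 / 2) (e / 2)"
  have et: "0 < et" "et < 1" "et <= e / 2" using e by (auto simp: et_def)
  obtain s de where s: "0 < s" "0 < de" and ur: "\<forall>v. solution v --> 0 < a v 0 --> (\<forall>t\<ge>0. \<forall>x. v t x <= de) -->
   (1 - et) * a v 0 <= a v s \<and> (\<forall>t\<ge>s. shape et v t \<and>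
    (1 - et) * CX * (t - s) <= Ps (a v t) - Ps (a v s) \<and> Ps (a v t) - Ps (a v s) <= (1 + et) * CX * (t - s))"
   using uniform_rate[OF et(1,2) CX] by (elim exE conjE) (rule that)
  obtain T0 where T0: "0 <= T0" "!!t x. T0 <= t ==> v t x <= de"
   using eventually_small[OF v s(2)] by blast
  define T where "T = T0 + s"
  define c where "c = Ps (a v T)"
  have rate: "(1 - et) * CX * (t - T) <= Ps (a v t) - c" "Ps (a v t) - c <= (1 + et) * CX * (t - T)" if "T <= t" for t
   using ur[rule_format, OF shift_solution[OF v T0(1)], THEN conjunct2, rule_format, of "t - T0"] that T0 ap[OF T0(1)]
   by (auto simp: a_shift T_def c_def diff_diff_eq)
  define R where "R = (\<bar>c\<bar> + 2 * CX * T + 1) * (2 / (e * CX))"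
  have T: "0 < T" using T0 s by (simp add: T_def)
  have "eventually (%t. t >= T \<and> t > R) at_top"
   using eventually_ge_at_top[of T] eventually_gt_at_top[of R] by eventually_elim auto
  thus "eventually (%t. dist (Ps (a v t) / (CX * t)) 1 < e) at_top"
  proof eventually_elim
   case (elim t)
   hence t: "T <= t" "R < t" "0 < t" using T by auto
   have Re: "\<bar>c\<bar> + 2 * CX * T + 1 < e * (CX * t) / 2"
    using t(2) e CX by (simp add: R_def field_simps)
   have lo: "c + (CX * t - CX * T - et * (CX * t) + et * (CX * T)) <= Ps (a v t)"
    using rate(1)[OF t(1)] by (simp add: algebra_simps)
   have up: "Ps (a v t) <= c + (CX * t - CX * T + et * (CX * t) - et * (CX * T))"
    using rate(2)[OF t(1)] by (simp add: algebra_simps)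
   have x: "et * (CX * t) <= e / 2 * (CX * t)" "0 <= et * (CX * T)" "et * (CX * T) <= 1 * (CX * T)" "0 < CX * T"
    using et CX t T by (auto intro!: mult_right_mono)
   have "\<bar>Ps (a v t) - CX * t\<bar> < e * (CX * t)"
    unfolding abs_less_iff using lo up x Re abs_ge_self[of c] abs_ge_minus_self[of c] by linarith
   hence "\<bar>Ps (a v t) - CX * t\<bar> / (CX * t) < e" using t CX by (simp add: divide_less_eq)
   moreover have "\<bar>Ps (a v t) - CX * t\<bar> / (CX * t) = dist (Ps (a v t) / (CX * t)) 1"
    using t CX by (simp add: dist_real_def abs_divide diff_divide_distrib[symmetric] abs_mult flip: abs_divide)
     (simp add: field_simps)
   ultimately show ?case by simp
  qed
 qed
 hence "((%t. (Ps (a v t) / (CX * t)) powr (- 1 / (ga0 - 1))) ---> 1 powr (- 1 / (ga0 - 1))) at_top"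
  by (intro tendsto_powr tendsto_const) auto
 moreover have "eventually (%t. (Ps (a v t) / (CX * t)) powr (- 1 / (ga0 - 1)) = a v t / et' t) at_top"
  using eventually_gt_at_top[of 0] by eventually_elim (use div_et'[OF CX] ap in \<open>simp add: less_imp_le\<close>)
 ultimately show ?thesis by (auto intro: Lim_transform_eventually)
qed

lemma integral_shape:
 assumes mu: "sets mu = sets borel" "finite_measure mu" and v: "solution v" and t: "0 <= t" and sh: "shape et v t"
 shows "\<bar>(LINT x|mu. v t x) - a v t * (LINT x|mu. ph x)\<bar> <= et * a v t * (LINT x|mu. ph x)"
proof -
 interpret mu: finite_measure mu by fact
 note [measurable_cong] = mu(1)
 have bi: "integrable mu f" if f: "f : bounded_borel" for f :: "'a => real"
 proof -
  obtain C where "0 <= C" "!!x. \<bar>f x\<bar> <= C" using bbE[OF f] by blast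
  thus ?thesis using bbD[OF f] by (intro mu.integrable_const_bound[where B=C]) auto
 qed
 have i: "integrable mu (v t)" "integrable mu ph"
  using bi v_bounded_borel[OF v t] ph_bounded_borel by auto
 have "(LINT x|mu. v t x) - a v t * (LINT x|mu. ph x) = (LINT x|mu. v t x - a v t * ph x)" using i by simp
 also have "\<bar>...\<bar> <= (LINT x|mu. \<bar>v t x - a v t * ph x\<bar>)" by (rule integral_abs_bound)
 also have "... <= (LINT x|mu. et * a v t * ph x)"
 proof (rule integral_mono)
  show "\<bar>v t x - a v t * ph x\<bar> <= et * a v t * ph x" for x
   using shapeD[OF sh, of x] by (simp add: abs_le_iff algebra_simps)
 qed (use i in auto)
 finally show ?thesis by simp
qed

lemma integral_ph_nonneg: "0 <= (LINT x|mu. ph x)"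
 using ph_pos(1) by (intro integral_nonneg_AE) (auto simp: less_imp_le)

lemma integral_v_over_a:
 assumes mu: "sets mu = sets borel" "finite_measure mu" and v: "solution v" and a0: "0 < a v 0"
 shows "((%t. (LINT x|mu. v t x) / a v t) ---> (LINT x|mu. ph x)) at_top"
proof (rule tendstoI)
 fix e :: real assume e: "0 < e"
 define I where "I = (LINT x|mu. ph x)"
 have I: "0 <= I" unfolding I_def by (rule integral_ph_nonneg)
 define et where "et = min (1 / 2) (e / (2 * (I + 1)))"
 have et: "0 < et" "et < 1" "et * I < e"
 proof -
  show "0 < et" "et < 1" using e I by (auto simp: et_def)
  have "et * I <= e / (2 * (I + 1)) * (I + 1)" using e I by (intro mult_mono) (auto simp: et_def)
  also have "... = e / 2" using I by (simp add: field_simps)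
  finally show "et * I < e" using e by simp
 qed
 obtain T where T: "0 < T" "!!t. T <= t ==> shape et v t"
  using eventually_shape'[OF v et(1,2)] by blast
 show "eventually (%t. dist ((LINT x|mu. v t x) / a v t) (LINT x|mu. ph x) < e) at_top"
  using eventually_ge_at_top[of T]
 proof eventually_elim
  case (elim t)
  hence t: "0 <= t" using T by simp
  have ap: "0 < a v t" by (rule a_pos[OF v a0 t])
  have "dist ((LINT x|mu. v t x) / a v t) I = \<bar>(LINT x|mu. v t x) - a v t * I\<bar> / a v t"
   using ap by (simp add: dist_real_def field_simps abs_divide)
  also have "... <= (et * a v t * I) / a v t"
   using integral_shape[OF mu v t T(2)[OF elim]] ap by (intro divide_right_mono) (auto simp: I_def)
  also have "... = et * I" using ap by simp
  finally show ?case using et(3) by (simp add: I_def)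
 qed
qed

text \<open>\<open>Ps\<close> adds up: in units of \<open>CX * t\<close> the initial value
  \<open>c * et' t\<close> contributes \<open>c powr - (ga0 - 1)\<close> and the elapsed time
  contributes 1. Inverting \<open>Ps\<close> yields the expression in the limiting Laplace
  transform. As the solution changes with \<open>n\<close>, the rate must come from
  \<open>uniform_rate\<close>.\<close>

lemma scaled_family_limit:
 fixes w :: "nat => real => 'a => real"
 assumes mu: "sets mu = sets borel" "finite_measure mu"
  and CX: "0 < CX" and w: "!!n. solution (w n)" and t: "!!n. 0 < t n" "filterlim t at_top sequentially"
  and small: "!!n r x. 0 <= r ==> w n r x <= de n" "de ----> 0"
  and c: "0 < c" "!!n. a (w n) 0 = c * et' (t n)"
 shows "(%n. (LINT x|mu. w n (t n) x) / et' (t n)) ---->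
  (LINT x|mu. ph x) * (1 + c powr - (ga0 - 1)) powr (- 1 / (ga0 - 1))"
proof -
 define d where "d = ga0 - 1"
 have d: "0 < d" "d < 1" using ga0(1) ga0_less_2 by (auto simp: d_def)
 define q where "q = c powr - d"
 have q: "0 < q" using c by (simp add: q_def)
 have a0: "0 < a (w n) 0" for n using c et'_pos[OF CX t(1)] by simp
 have ap: "0 < a (w n) r" if "0 <= r" for n r by (rule a_pos[OF w a0 that])
 have main: "eventually (%n. shape et (w n) (t n) \<and> \<bar>Ps (a (w n) (t n)) / (CX * t n) - (1 + q)\<bar> <= et * (2 + 2 * q)) sequentially"
  if et: "0 < et" "et <= 1 / 2" for et
 proof -
  have et1: "et < 1" using et by simp
  obtain s de0 where s: "0 < s" "0 < de0" and ur: "\<forall>v. solution v --> 0 < a v 0 --> (\<forall>t\<ge>0. \<forall>x. v t x <= de0) -->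
   (1 - et) * a v 0 <= a v s \<and> (\<forall>t\<ge>s. shape et v t \<and>
    (1 - et) * CX * (t - s) <= Ps (a v t) - Ps (a v s) \<and> Ps (a v t) - Ps (a v s) <= (1 + et) * CX * (t - s))"
   using uniform_rate[OF et(1) et1 CX] by (elim exE conjE) (rule that)
  have "eventually (%n. de n < de0) sequentially" using order_tendstoD(2)[OF small(2) s(2)] .
  moreover have "eventually (%n. s / et + s <= t n) sequentially"
   using t(2) by (simp add: filterlim_at_top)
  ultimately show ?thesis
  proof eventually_elim
   case (elim n)
   have sn: "w n r x <= de0" if "0 <= r" for r x using small(1)[OF that, of n x] elim by linarith
   have "0 <= s / et" using s et by simp
   hence "s <= t n" "s / et <= t n" using elim s(1) by linarith+
   hence st: "s <= t n" "s <= et * t n" using et(1) by (simp_all add: pos_divide_le_eq mult.commute)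
   note ur' = ur[rule_format, OF w a0 sn]
   have r: "shape et (w n) (t n) \<and> (1 - et) * CX * (t n - s) <= Ps (a (w n) (t n)) - Ps (a (w n) s) \<and>
    Ps (a (w n) (t n)) - Ps (a (w n) s) <= (1 + et) * CX * (t n - s)"
    using ur' st(1) by blast
   have as: "(1 - et) * a (w n) 0 <= a (w n) s" "a (w n) s <= a (w n) 0"
    using ur' a_antimono[OF w, of 0 s] s by auto
   have P0: "Ps (a (w n) 0) = q * (CX * t n)"
    unfolding c(2) q_def d_def by (rule Ps_scaled_et'[OF CX c(1) t(1)])
   have P1: "Ps (a (w n) 0) <= Ps (a (w n) s)"
    unfolding Ps_def d_def[symmetric] using as ap[of s n] s d by (intro divide_right_mono powr_mono2') auto
   \<comment> \<open>During the initial window of length \<open>s\<close> no slope is available, but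
     \<open>a\<close> keeps at least the share \<open>1 - et\<close>, so \<open>Ps\<close> grows at
     most by the factor \<open>1 + 2 * et\<close>.\<close>
   have P2: "Ps (a (w n) s) <= (1 + 2 * et) * Ps (a (w n) 0)"
   proof -
    have "a (w n) s powr - d <= ((1 - et) * a (w n) 0) powr - d"
     using as a0 et d by (intro powr_mono2') auto
    also have "... = (1 - et) powr - d * a (w n) 0 powr - d" using et a0[of n] by (simp add: powr_mult)
    also have "... <= (1 + 2 * et) * a (w n) 0 powr - d"
    proof (rule mult_right_mono)
     have "(1 - et) powr - d <= (1 - et) powr - 1" using et d by (intro powr_mono') auto
     also have "... = 1 / (1 - et)" using et by (simp add: powr_minus_divide)
     also have "... <= 1 + 2 * et"
     proof -
      have "2 * et * et <= 1 * et" using et by (intro mult_right_mono) auto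
      hence "1 <= (1 + 2 * et) * (1 - et)" by (simp add: algebra_simps)
      thus ?thesis using et by (simp add: pos_divide_le_eq)
     qed
     finally show "(1 - et) powr - d <= 1 + 2 * et" .
    qed simp
    finally show ?thesis unfolding Ps_def d_def[symmetric] using d by (simp add: divide_right_mono)
   qed
   define Y where "Y = CX * t n"
   have Y: "0 < Y" using CX t(1) by (simp add: Y_def)
   have sY: "CX * s <= et * Y" "0 <= CX * s" using mult_left_mono[OF st(2), of CX] CX s by (auto simp: Y_def mult_ac)
   have lo: "q * Y + (Y - CX * s - et * Y + et * (CX * s)) <= Ps (a (w n) (t n))"
    using r P1 P0 by (simp add: Y_def algebra_simps)
   have up: "Ps (a (w n) (t n)) <= q * Y + 2 * (et * (q * Y)) + (Y + et * Y - CX * s - et * (CX * s))"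
    using r P2 P0 by (simp add: Y_def algebra_simps)
   have nn: "0 <= et * (CX * s)" "0 <= et * (q * Y)" "0 <= et * Y" using et sY q Y by auto
   have "\<bar>Ps (a (w n) (t n)) - (1 + q) * Y\<bar> <= et * (2 + 2 * q) * Y"
   proof -
    have "(1 + q) * Y = Y + q * Y" "et * (2 + 2 * q) * Y = 2 * (et * Y) + 2 * (et * (q * Y))"
     by (simp_all add: algebra_simps)
    thus ?thesis unfolding abs_le_iff using lo up sY nn by linarith
   qed
   hence "\<bar>Ps (a (w n) (t n)) - (1 + q) * Y\<bar> / Y <= et * (2 + 2 * q)"
    using Y by (simp add: pos_divide_le_eq)
   moreover have "\<bar>Ps (a (w n) (t n)) - (1 + q) * Y\<bar> / Y = \<bar>Ps (a (w n) (t n)) / Y - (1 + q)\<bar>"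
   proof -
    have "Ps (a (w n) (t n)) / Y - (1 + q) = (Ps (a (w n) (t n)) - (1 + q) * Y) / Y"
     using Y by (simp add: diff_divide_distrib)
    thus ?thesis using Y by (simp only: abs_divide abs_of_pos)
   qed
   ultimately show ?case using r by (simp add: Y_def)
  qed
 qed
 have X: "(%n. Ps (a (w n) (t n)) / (CX * t n)) ----> 1 + q"
 proof (rule tendstoI)
  fix e :: real assume e: "0 < e"
  define et where "et = min (1 / 2) (e / (2 * (2 + 2 * q)))"
  have et: "0 < et" using e q by (auto simp: et_def)
  have et2: "et <= 1 / 2" unfolding et_def by (rule min.cobounded1)
  have "et * (2 + 2 * q) <= e / (2 * (2 + 2 * q)) * (2 + 2 * q)" using q by (intro mult_right_mono) (auto simp: et_def)
  also have "... = e / 2" using q by (simp add: field_simps)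
  finally have lt: "et * (2 + 2 * q) < e" using e by simp
  show "eventually (%n. dist (Ps (a (w n) (t n)) / (CX * t n)) (1 + q) < e) sequentially"
   using main[OF et et2] by eventually_elim (use lt in \<open>auto simp: dist_real_def\<close>)
 qed
 have "(%n. (Ps (a (w n) (t n)) / (CX * t n)) powr (- 1 / (ga0 - 1))) ----> (1 + q) powr (- 1 / (ga0 - 1))"
  using q by (intro tendsto_powr X tendsto_const) auto
 hence A: "(%n. a (w n) (t n) / et' (t n)) ----> (1 + q) powr (- 1 / (ga0 - 1))"
  using div_et'[OF CX ap t(1)] t(1) by (simp add: less_imp_le)
 define I where "I = (LINT x|mu. ph x)"
 have I: "0 <= I" unfolding I_def by (rule integral_ph_nonneg)
 have "(%n. (LINT x|mu. w n (t n) x) / a (w n) (t n)) ----> I"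
 proof (rule tendstoI)
  fix e :: real assume e: "0 < e"
  define et where "et = min (1 / 2) (e / (2 * (I + 1)))"
  have et: "0 < et" "et <= 1 / 2" "et * I < e"
  proof -
   show "0 < et" using e I by (auto simp: et_def)
   show "et <= 1 / 2" unfolding et_def by (rule min.cobounded1)
   have "et * I <= e / (2 * (I + 1)) * (I + 1)" using e I by (intro mult_mono) (auto simp: et_def)
   also have "... = e / 2" using I by (simp add: field_simps)
   finally show "et * I < e" using e by simp
  qed
  show "eventually (%n. dist ((LINT x|mu. w n (t n) x) / a (w n) (t n)) I < e) sequentially"
   using main[OF et(1,2)]
  proof eventually_elim
   case (elim n)
   have t0: "0 <= t n" using t(1)[of n] by simp
   have p: "0 < a (w n) (t n)" by (rule ap[OF t0])
   have "dist ((LINT x|mu. w n (t n) x) / a (w n) (t n)) I = \<bar>(LINT x|mu. w n (t n) x) - a (w n) (t n) * I\<bar> / a (w n) (t n)"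
    using p by (simp add: dist_real_def field_simps abs_divide)
   also have "... <= (et * a (w n) (t n) * I) / a (w n) (t n)"
    using integral_shape[OF mu w t0, of et n] elim p by (intro divide_right_mono) (auto simp: I_def)
   also have "... = et * I" using p by simp
   finally show ?case using et(3) by simp
  qed
 qed
 from tendsto_mult[OF this A]
 have L: "(%n. (LINT x|mu. w n (t n) x) / a (w n) (t n) * (a (w n) (t n) / et' (t n))) ----> I * (1 + q) powr (- 1 / (ga0 - 1))" .
 have eq: "(LINT x|mu. w n (t n) x) / a (w n) (t n) * (a (w n) (t n) / et' (t n)) = (LINT x|mu. w n (t n) x) / et' (t n)" for n
  using ap[of "t n" n] t(1)[of n] by simp
 show ?thesis using L unfolding eq unfolding I_def q_def d_def .
qed

section \<open>Increasing limits of solutions\<close>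

context
 fixes v :: "nat => real => 'a => real" and w :: "real => 'a => real"
 assumes v: "!!n. solution (v n)" and a0: "!!n. 0 < a (v n) 0"
  and mono: "!!n t x. 0 <= t ==> v n t x <= v (Suc n) t x"
  and w_def: "!!t x. w t x = (SUP n. v n t x)"
begin

text \<open>The bound at time \<open>T\<close> is uniform over initial values; afterwards the linear
  flow preserves it up to the constant of \<open>Q_abs_bound\<close>.\<close>

lemma family_bound:
 assumes T: "0 < T"
 shows "\<exists>C>0. \<forall>n. \<forall>t\<ge>T. \<forall>x. v n t x <= C"
proof -
 obtain C where C: "0 < C" "!!n x. v n T x <= C" using uniform_upper_bound[OF T] v a0 by blast
 obtain c where c: "0 <= c" "!!t f M x. 0 <= t ==> f : bounded_borel ==> (!!y. \<bar>f y\<bar> <= M) ==> \<bar>Q t f x\<bar> <= c * M"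
  by (rule Q_abs_bound) blast
 have "v n t x <= c * C + 1" if t: "T <= t" for n t x
 proof -
  have "v n (T + (t - T)) x <= Q (t - T) (v n T) x" using t T by (intro v_le_Q[OF v]) auto
  also have "... <= \<bar>Q (t - T) (v n T) x\<bar>" by simp
  also have "... <= c * C"
   using t T C v_nonneg[OF v, of T n] by (intro c v_bounded_borel[OF v]) (auto simp: abs_le_iff intro: order_trans[of _ 0])
  finally show ?thesis by simp
 qed
 moreover have "0 < c * C + 1" using c(1) C(1) by (simp add: add_nonneg_pos)
 ultimately show ?thesis by blast
qed

lemma family_limit: "0 < t ==> (%n. v n t x) ----> w t x"
 unfolding w_def
proof (rule LIMSEQ_incseq_SUP)
 assume t: "0 < t"
 obtain C where "!!n x. v n t x <= C" using family_bound[OF t] by blast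
 thus "bdd_above (range (%n. v n t x))" by (auto intro!: bdd_aboveI)
 show "incseq (%n. v n t x)" using mono t by (intro incseq_SucI) auto
qed

lemma family_le: "0 < t ==> v n t x <= w t x"
proof -
 assume t: "0 < t"
 have "incseq (%n. v n t x)" using mono t by (intro incseq_SucI) auto
 thus ?thesis by (rule incseq_le[OF _ family_limit[OF t]])
qed

text \<open>At positive times the whole family is bounded, so each term of the equation passes to
  the limit by dominated convergence. At time 0 the family may be unbounded, hence the shift by
  \<open>T\<close>.\<close>

lemma limit_solution:
 assumes T: "0 < T"
 shows "solution (%t. w (T + t))"
proof -
 obtain C0 where C0: "0 < C0" "!!n t x. T <= t ==> v n t x <= C0" using family_bound[OF T] by blast
 define C where "C = max 1 C0"
 have C: "1 <= C" "!!n t x. T <= t ==> v n t x <= C" using C0(2) by (auto simp: C_def intro: max.coboundedI2)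
 have wC: "w t x <= C" if "T <= t" for t x
  using family_limit[of t x] T that C(2) by (intro LIMSEQ_le_const2[OF family_limit]) auto
 have w0: "0 <= w t x" if "T <= t" for t x
  using family_le[of t 0 x] v_nonneg[OF v, of t 0 x] T that by simp
 have meas: "(%z. w (T + max 0 (fst z)) (snd z)) : \<B> borel2"
 proof (rule borel_measurable_LIMSEQ_metric)
  show "(%z. v n (T + max 0 (fst z)) (snd z)) : \<B> borel2" for n
  proof -
   have "(%z. v n (max 0 (T + max 0 (fst z))) (snd z)) : \<B> borel2"
    by (rule curried_compose[OF v_measurable[OF v]]) measurable
   thus ?thesis using T by (simp add: max_def)
  qed
  show "(%n. v n (T + max 0 (fst z)) (snd z)) ----> w (T + max 0 (fst z)) (snd z)" for z
   using T by (intro family_limit) (auto simp: max_def)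
 qed
 have wbb: "w t : bounded_borel" if t: "T <= t" for t
 proof (rule bbI[where C=C])
  have "(%(r, x). w (T + max 0 r) x) : \<B> borel2" using meas by (simp add: case_prod_beta')
  from section_right[OF this, of "t - T"] show "w t : \<B> borel" using t by simp
  show "\<bar>w t x\<bar> <= C" for x using wC[OF t, of x] w0[OF t, of x] by simp
 qed
 have Nb: "N u t x <= K * C * C" if "0 <= u t x" "u t x <= C" for u t x
 proof -
  have "N u t x <= K * C * u t x" unfolding N_def using that C(1) by (rule powr_le_linear)
  also have "... <= K * C * C" using that C(1) K_pos by (intro mult_left_mono) auto
  finally show ?thesis .
 qed
 have N0: "0 <= N u t x" for u t x using ka(1)[of x] by (simp add: N_def)
 have Nbb: "N w t : bounded_borel" if t: "T <= t" for t
 proof (rule bbI[where C="K * C * C"])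
  have [measurable]: "w t : \<B> borel" using wbb[OF t] by (rule bbD)
  show "N w t : \<B> borel" unfolding N_def by measurable
  show "\<bar>N w t x\<bar> <= K * C * C" for x using Nb[of w t x] w0[OF t, of x] wC[OF t, of x] N0[of w t x] by simp
 qed
 have Nlim: "(%n. N (v n) t x) ----> N w t x" if t: "T <= t" for t x
  unfolding N_def
 proof (intro tendsto_mult tendsto_const tendsto_powr2 family_limit)
  show "eventually (%n. 0 <= v n t x) sequentially" using v_nonneg[OF v] T t by (intro always_eventually) auto
 qed (use T t ga(1)[of x] in auto)
 obtain c where c: "0 <= c" "!!t f M x. 0 <= t ==> f : bounded_borel ==> (!!y. \<bar>f y\<bar> <= M) ==> \<bar>Q t f x\<bar> <= c * M"
  by (rule Q_abs_bound) blast
 have eq: "w (T + (t + s)) x + (LBINT r:{0..s}. Q r (N (%t. w (T + t)) (t + s - r)) x) = Q s (w (T + t)) x"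
  if st: "0 <= s" "0 <= t" for s t x
 proof -
  have Nw: "N (%t. w (T + t)) (t + s - r) = N w (T + t + s - r)" for r
   by (simp add: N_def fun_eq_iff algebra_simps)
  have QN: "(%n. Q r (N (v n) (T + t + s - r)) x) ----> Q r (N w (T + t + s - r)) x" if r: "0 <= r" "r <= s" for r
  proof (rule Q_convergence[where C="K * C * C"])
   show "N (v n) (T + t + s - r) : bounded_borel" for n using T r st by (intro N_bounded_borel[OF v]) auto
   show "\<bar>N (v n) (T + t + s - r) y\<bar> <= K * C * C" for n y
    using T r st Nb[of "v n" "T + t + s - r" y] N0[of "v n" "T + t + s - r" y] v_nonneg[OF v, of "T + t + s - r" n y] C(2)[of "T + t + s - r" n y] by simp
  qed (use T r st in \<open>auto intro!: Nbb Nlim\<close>)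
  have J: "(%n. LBINT r:{0..s}. qN (v n) (T + t + s) r x) ----> (LBINT r:{0..s}. Q r (N w (T + t + s - r)) x)"
   unfolding set_lebesgue_integral_def
  proof (rule integral_dominated_convergence)
   have pw: "(%n. indicator {0..s} r *\<^sub>R qN (v n) (T + t + s) r x) ----> indicator {0..s} r *\<^sub>R Q r (N w (T + t + s - r)) x" for r
   proof (cases "r : {0..s}")
    case True
    thus ?thesis using QN[of r] T st qN_eq[OF v, of r "T + t + s"] by simp
   qed simp
   thus "AE r in lborel. (%n. indicator {0..s} r *\<^sub>R qN (v n) (T + t + s) r x) ----> indicator {0..s} r *\<^sub>R Q r (N w (T + t + s - r)) x"
    by simp
   show m1: "(%r. indicator {0..s} r *\<^sub>R qN (v n) (T + t + s) r x) : \<B> lborel" for n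
    using qN_measurable_r[OF v, of n "T + t + s" x] by measurable
   show "(%r. indicator {0..s} r *\<^sub>R Q r (N w (T + t + s - r)) x) : \<B> lborel"
    by (rule borel_measurable_LIMSEQ_metric[OF m1 pw])
   show "integrable lborel (%r. indicator {0..s} r *\<^sub>R (c * (K * C * C)))"
    using set_integrable_Icc_bounded[of "%_. c * (K * C * C)" 0 s "\<bar>c * (K * C * C)\<bar>"] by (simp add: set_integrable_def)
   show "AE r in lborel. norm (indicator {0..s} r *\<^sub>R qN (v n) (T + t + s) r x) <= indicator {0..s} r *\<^sub>R (c * (K * C * C))" for n
   proof (rule AE_I2)
    fix r
    have "\<bar>Q r (N (v n) (T + t + s - r)) x\<bar> <= c * (K * C * C)" if r: "0 <= r" "r <= s"
    proof (rule c(2)[OF r(1)])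
     show "N (v n) (T + t + s - r) : bounded_borel" using T r st by (intro N_bounded_borel[OF v]) auto
     show "\<bar>N (v n) (T + t + s - r) y\<bar> <= K * C * C" for y
      using T r st Nb[of "v n" "T + t + s - r" y] N0[of "v n" "T + t + s - r" y] v_nonneg[OF v, of "T + t + s - r" n y] C(2)[of "T + t + s - r" n y] by simp
    qed
    thus "norm (indicator {0..s} r *\<^sub>R qN (v n) (T + t + s) r x) <= indicator {0..s} r *\<^sub>R (c * (K * C * C))"
     using T st qN_eq[OF v, of r "T + t + s"] by (auto simp: indicator_def)
   qed
  qed
  have L: "(%n. v n (T + t + s) x + (LBINT r:{0..s}. qN (v n) (T + t + s) r x)) ---->
    w (T + t + s) x + (LBINT r:{0..s}. Q r (N w (T + t + s - r)) x)"
   using T st by (intro tendsto_add J family_limit) auto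
  have "v n (T + t + s) x + (LBINT r:{0..s}. qN (v n) (T + t + s) r x) = Q s (v n (T + t)) x" for n
   using v_eq[OF v, of s "T + t" n x] J_eq[OF v, of s "T + t" n x] T st by simp
  hence "(%n. Q s (v n (T + t)) x) ----> w (T + t + s) x + (LBINT r:{0..s}. Q r (N w (T + t + s - r)) x)"
   using L by simp
  moreover have "(%n. Q s (v n (T + t)) x) ----> Q s (w (T + t)) x"
  proof (rule Q_convergence[where C=C])
   show "\<bar>v n (T + t) y\<bar> <= C" for n y using C(2)[of "T + t" n y] v_nonneg[OF v, of "T + t" n y] T st by simp
  qed (use T st in \<open>auto intro!: v_bounded_borel[OF v] wbb family_limit\<close>)
  ultimately show ?thesis unfolding Nw using LIMSEQ_unique by (simp add: add.assoc)
 qed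
 show ?thesis
  unfolding solution_def
 proof (intro conjI allI impI)
  show "(%(t, x). w (T + max 0 t) x) : \<B> borel2" using meas by (simp add: case_prod_beta')
  show "\<exists>C. \<forall>t\<ge>0. \<forall>x. w (T + t) x <= C" using wC by (intro exI[of _ C]) auto
 qed (use w0 eq in auto)
qed

lemma limit_a_pos:
 assumes T: "0 < T"
 shows "0 < a (%t. w (T + t)) 0"
proof -
 have "a (v 0) T <= a (%t. w (T + t)) 0"
  unfolding a_def
 proof (rule integral_mono)
  show "integrable m (%x. v 0 T x * ph' x)" using T by (intro integrable_mult_ph' v_bounded_borel[OF v]) simp
  show "integrable m (%x. w (T + 0) x * ph' x)" by (intro integrable_mult_ph' v_bounded_borel[OF limit_solution[OF T]]) simp
  show "v 0 T x * ph' x <= w (T + 0) x * ph' x" for x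
   using family_le[OF T, of 0 x] ph_pos(2)[of x] by (simp add: mult_right_mono)
 qed
 moreover have "0 < a (v 0) T" using T by (intro a_pos[OF v a0]) simp
 ultimately show ?thesis by linarith
qed

end

end

section \<open>Exhaustion by compact sets and the one-point compactification\<close>

lemma relatively_compact_exhaustion:
 fixes U :: "'e::{metric_space, second_countable_topology} set"
 assumes lc: "locally_compact_space (euclidean :: 'e topology)" and U: "open U"
 obtains V :: "nat => 'e set" where "!!k. open (V k)" "!!k. compact (closure (V k))"
  "!!k. closure (V k) \<subseteq> U" "(\<Union>k. V k) = U"
proof -
 define F where "F = {V. open V \<and> compact (closure V) \<and> closure V \<subseteq> U}"
 have "\<Union>F = U"
 proof
  show "\<Union>F \<subseteq> U" using closure_subset by (auto simp: F_def)
  show "U \<subseteq> \<Union>F"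
  proof
   fix x assume x: "x : U"
   have "\<forall>x::'e. \<exists>U. open U \<and> (\<exists>K. compact K \<and> x : U \<and> U \<subseteq> K)"
    using lc unfolding locally_compact_space_def by simp
   from this[rule_format, of x] obtain O' K where K: "open O'" "compact K" "x : O'" "O' \<subseteq> K"
    by blast
   have "open (U \<inter> O')" "x : U \<inter> O'" using U K x by auto
   then obtain e where e: "0 < e" "cball x e \<subseteq> U \<inter> O'" using open_contains_cball[of "U \<inter> O'"] by blast
   have c: "closure (ball x e) \<subseteq> cball x e" by (simp add: closure_minimal)
   have "compact (K \<inter> closure (ball x e))" using K by (intro compact_Int_closed) auto
   moreover have "K \<inter> closure (ball x e) = closure (ball x e)" using c e K by auto
   ultimately have "ball x e : F" using c e by (auto simp: F_def)
   thus "x : \<Union>F" using e(1) by (auto intro: centre_in_ball[THEN iffD2])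
  qed
 qed
 moreover obtain F' where F': "F' \<subseteq> F" "countable F'" "\<Union>F' = \<Union>F"
  using Lindelof_openin[of F UNIV] by (auto simp: F_def)
 \<comment> \<open>The empty set is added because only a non-empty countable set is the range of its
   enumeration.\<close>
 moreover define V where "V = from_nat_into (insert {} F')"
 have r: "range V = insert {} F'" unfolding V_def using F' by (intro range_from_nat_into) auto
 hence "V k : F" for k
  using F'(1) rangeI[of V k] by (auto simp: F_def)
 moreover have "(\<Union>k. V k) = \<Union>F'" using r by auto
 ultimately show ?thesis using that[of V] by (auto simp: F_def)
qed

lemma compact_exhaustion:
 assumes lc: "locally_compact_space (euclidean :: 'e::{metric_space, second_countable_topology} topology)"
 obtains C :: "nat => 'e::{metric_space, second_countable_topology} set" where "!!n. compact (C n)" "incseq C" "(\<Union>n. C n) = UNIV"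
proof -
 obtain V :: "nat => 'e set" where V: "!!k. open (V k)" "!!k. compact (closure (V k))"
  "!!k. closure (V k) \<subseteq> UNIV" "(\<Union>k. V k) = UNIV"
  using relatively_compact_exhaustion[OF lc open_UNIV] by metis
 show ?thesis
 proof (rule that[of "%n. \<Union>k\<le>n. closure (V k)"])
  show "compact (\<Union>k\<le>n. closure (V k))" for n using V(2) by (intro compact_UN) auto
  show "incseq (%n. \<Union>k\<le>n. closure (V k))" by (intro incseq_SucI) (auto simp: atMost_Suc)
  show "(\<Union>n. \<Union>k\<le>n. closure (V k)) = UNIV"
  proof (intro set_eqI iffI UNIV_I)
   fix x :: 'e
   obtain k where "x : V k" using V(4) by blast
   thus "x : (\<Union>n. \<Union>k\<le>n. closure (V k))" using closure_subset by blast
  qed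
 qed
qed

abbreviation onepoint :: "'e::{metric_space, second_countable_topology} option topology" where
 "onepoint \<equiv> Alexandroff_compactification (euclidean :: 'e topology)"

lemma topspace_onepoint: "topspace (onepoint :: 'a::{metric_space, second_countable_topology} option topology) = UNIV"
proof (rule set_eqI)
 show "x : topspace onepoint \<longleftrightarrow> x : UNIV" for x :: "'a option" by (cases x) auto
qed

lemma space_borel_of: "space (borel_of S) = topspace S"
 unfolding borel_of_def by (rule space_measure_of) (auto dest: openin_subset)

lemma openin_borel_of: "openin S U ==> U : sets (borel_of S)"
 unfolding borel_of_def using openin_subset by (subst sets_measure_of) auto

lemma space_onepoint [simp]: "space (borel_of onepoint) = UNIV"
 unfolding space_borel_of topspace_onepoint ..

text \<open>Open sets of the compactification are images of open sets or complements of images of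
  closed ones, so preimages of images of open sets decide everything.\<close>

lemma measurable_onepointI:
 fixes f :: "'a => 'e::{metric_space, second_countable_topology} option"
 assumes f: "!!U. open U ==> {x : space M. f x : Some ` U} : sets M"
 shows "f : M \<rightarrow>\<^sub>M borel_of onepoint"
 unfolding borel_of_def
proof (rule measurable_measure_of)
 show "{U. openin onepoint U} \<subseteq> Pow (topspace (onepoint :: 'e option topology))" unfolding topspace_onepoint by simp
 show "f : space M \<rightarrow> topspace onepoint" unfolding topspace_onepoint by simp
 fix V :: "'e option set" assume "V : {U. openin onepoint U}"
 then consider U where "open U" "V = Some ` U" | C where "closed C" "V = insert None (Some ` (UNIV - C))"
  by (auto simp: openin_Alexandroff_compactification open_openin[symmetric] closed_closedin[symmetric])
 thus "f -` V \<inter> space M : sets M"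
 proof cases
  case 1
  hence "f -` V \<inter> space M = {x : space M. f x : Some ` U}" by auto
  thus ?thesis using f[OF 1(1)] by simp
 next
  case 2
  have "f -` V \<inter> space M = (space M - {x : space M. f x : Some ` UNIV}) \<union> {x : space M. f x : Some ` (- C)}"
  proof (rule set_eqI)
   show "x : f -` V \<inter> space M \<longleftrightarrow> x : (space M - {x : space M. f x : Some ` UNIV}) \<union> {x : space M. f x : Some ` (- C)}" for x
    by (cases "f x") (use 2 in auto)
  qed
  thus ?thesis using f[of "- C"] f[of UNIV] 2 by auto
 qed
qed

lemma Some_image_sets: "open U ==> Some ` U : sets (borel_of onepoint)"
 by (intro openin_borel_of) (simp add: open_openin[symmetric])

lemma measurable_Some [measurable]: "Some : borel \<rightarrow>\<^sub>M borel_of onepoint"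
proof (rule measurable_onepointI)
 fix U :: "'a set" assume "open U"
 moreover have "{x : space borel. Some x : Some ` U} = U" by auto
 ultimately show "{x : space borel. Some x : Some ` U} : sets borel" by simp
qed

text \<open>The value \<open>the None\<close> is some fixed but unknown point; since
  \<open>{None}\<close> is a Borel set, it does no harm.\<close>

lemma measurable_the: "the : borel_of onepoint \<rightarrow>\<^sub>M borel"
proof (rule borel_measurableI)
 fix U :: "'a set" assume U: "open U"
 have n: "{None} : sets (borel_of (onepoint :: 'a option topology))"
 proof -
  have "UNIV - Some ` UNIV : sets (borel_of (onepoint :: 'a option topology))"
   using Some_image_sets[OF open_UNIV] sets.compl_sets[of _ "borel_of (onepoint :: 'a option topology)"] by auto
  moreover have "UNIV - Some ` UNIV = {None :: 'a option}" by (auto simp: UNIV_option_conv)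
  ultimately show ?thesis by simp
 qed
 have "the -` U \<inter> space (borel_of onepoint) = Some ` U \<union> (if the None : U then {None} else {})"
  by (auto simp: image_iff) (metis option.collapse)+
 moreover have "Some ` U \<union> (if the None : U then {None} else {}) : sets (borel_of onepoint)"
  by (rule sets.Un) (use Some_image_sets[OF U] n in auto)
 ultimately show "the -` U \<inter> space (borel_of onepoint) : sets (borel_of onepoint)" by (simp only:)
qed

lemma measurable_at_alive:
 fixes f :: "'a => 'e::{metric_space, second_countable_topology} => real"
 assumes f: "(%(a, y). f a y) : \<B> (M \<Otimes>\<^sub>M borel)"
  and g: "g : R \<rightarrow>\<^sub>M M" and X: "X : R \<rightarrow>\<^sub>M borel_of onepoint"
 shows "(%om. at_alive (f (g om)) (X om)) : \<B> R"
proof -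
 have "(%om. f (g om) (the (X om))) : \<B> R"
  by (rule curried_compose[OF f g measurable_compose[OF X measurable_the]])
 moreover have "{om : space R. X om : Some ` UNIV} : sets R"
  using measurable_sets[OF X Some_image_sets[OF open_UNIV]] by (simp add: vimage_def Int_def conj_commute)
 ultimately have "(%om. if X om : Some ` UNIV then f (g om) (the (X om)) else 0) : \<B> R"
  by (intro measurable_If) auto
 moreover have "(if X om : Some ` UNIV then f (g om) (the (X om)) else 0) = at_alive (f (g om)) (X om)" for om
  by (cases "X om") (auto simp: at_alive_def)
 ultimately show ?thesis by simp
qed

lemma measurable_at_alive':
 assumes "f : \<B> borel" "X : R \<rightarrow>\<^sub>M borel_of onepoint"
 shows "(%om. at_alive f (X om)) : \<B> R"
proof (rule measurable_at_alive[where f="%_. f" and M=R and g="%x. x"])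
 show "(%(a, y). f y) : \<B> (R \<Otimes>\<^sub>M borel)"
  using measurable_compose[OF measurable_snd assms(1)] by (simp add: case_prod_beta')
qed (use assms(2) in simp_all)

lemma at_alive_bound: "(!!y. \<bar>f y\<bar> <= C) ==> 0 <= C ==> \<bar>at_alive f z\<bar> <= C"
 by (cases z) (auto simp: at_alive_def)

text \<open>The parameter is carried along by pushing each law forward to the product space; the
  integrand is then one fixed function, to which measurability of integration over subprobabilities
  applies.\<close>

lemma borel_measurable_kernel_integral:
 fixes F :: "'a => 'b => real"
 assumes F: "(%(a, om). F a om) : \<B> (M \<Otimes>\<^sub>M N)" and L: "L : M \<rightarrow>\<^sub>M subprob_algebra N"
 shows "(%a. \<integral>om. F a om \<partial>L a) : \<B> M"
proof -
 have "(%a. distr (L a) (M \<Otimes>\<^sub>M N) (%om. (a, om))) : M \<rightarrow>\<^sub>M subprob_algebra (M \<Otimes>\<^sub>M N)"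
  by (rule measurable_distr2[OF _ L]) simp
 from measurable_compose[OF this integral_measurable_subprob_algebra[OF F]] show ?thesis
 proof (rule measurable_cong[THEN iffD1, rotated])
  fix a assume a: "a : space M"
  have "(%om. (a, om)) : L a \<rightarrow>\<^sub>M M \<Otimes>\<^sub>M N"
   using measurable_Pair1'[OF a] by (simp add: measurable_cong_sets[OF sets_kernel[OF L a] refl])
  from integral_distr[OF this F] show "(\<integral>z. (case z of (a, om) => F a om) \<partial>distr (L a) (M \<Otimes>\<^sub>M N) (%om. (a, om))) = (LINT om|L a. F a om)"
   by simp
 qed
qed

section \<open>The motion: joint measurability of paths, Feynman-Kac operators, Markov
  property\<close>

locale motion = killed_hunt_process W xi Pr
 for W :: "'w measure" and xi :: "real => 'w => 'e::{metric_space, second_countable_topology} option"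
  and Pr :: "'e option => 'w measure" +
 assumes lc: "locally_compact_space (euclidean :: 'e topology)"
begin

definition Nf :: "ennreal => 'w measure" where
 "Nf u = natural_filtration onepoint W xi u"

lemma space_Nf [simp]: "space (Nf u) = space W"
 unfolding Nf_def natural_filtration_def by (rule space_measure_of) auto

lemma sets_Nf: "sets (Nf u) = sigma_sets (space W)
  {xi s -` B \<inter> space W | s B. 0 <= s \<and> ennreal s <= u \<and> B : sets (borel_of onepoint)}"
 unfolding Nf_def natural_filtration_def by (rule sets_measure_of) auto

lemma xi_measurable:
 assumes "0 <= s" "ennreal s <= u"
 shows "xi s : Nf u \<rightarrow>\<^sub>M borel_of onepoint"
proof (rule measurableI)
 fix B :: "'e option set" assume "B : sets (borel_of onepoint)"
 thus "xi s -` B \<inter> space (Nf u) : sets (Nf u)"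
  unfolding sets_Nf space_Nf using assms by (intro sigma_sets.Basic) auto
qed simp

lemma sets_Nf_subset: "sets (Nf u) \<subseteq> sets W"
 unfolding sets_Nf
proof (rule sets.sigma_sets_subset, safe)
 fix s :: real and B :: "'e option set" assume "0 <= s" "B : sets (borel_of onepoint)"
 thus "xi s -` B \<inter> space W : sets W" using measurable_sets[OF measurable_process] by blast
qed

lemma sets_Nf_mono: "u <= u' ==> sets (Nf u) \<subseteq> sets (Nf u')"
 unfolding sets_Nf by (rule sigma_sets_mono') (auto intro: order_trans)

lemma law: "prob_space (Pr z)" "sets (Pr z) = sets W" "space (Pr z) = space W"
proof -
 have z: "z : topspace onepoint" unfolding topspace_onepoint by simp
 show "prob_space (Pr z)" "sets (Pr z) = sets W" by (rule prob_law[OF z], rule sets_law[OF z])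
 thus "space (Pr z) = space W" by (intro sets_eq_imp_space_eq)
qed

lemma measurable_Nf_law: "f : Nf u \<rightarrow>\<^sub>M M ==> f : Pr z \<rightarrow>\<^sub>M M"
 using sets_Nf_subset[of u] by (auto simp: measurable_def law)

text \<open>Projection of the real line onto the finite times in \<open>[0, u]\<close>. With it path
  functionals up to time \<open>u\<close> are defined for all reals and measurable with respect to
  the past \<open>Nf u\<close>.\<close>

definition clamp :: "ennreal => real => real" where
 "clamp u s = (if u = \<infinity> then max 0 s else max 0 (min (enn2real u) s))"

lemma clamp: "0 <= clamp u s" "ennreal (clamp u s) <= u"
 by (cases u; auto simp: clamp_def max_def min_def ennreal_leI)+

lemma clamp_mono: "r <= s ==> clamp u r <= clamp u s"
 by (auto simp: clamp_def max_def min_def)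

lemma clamp_eq: "0 <= s ==> ennreal s <= u ==> clamp u s = s"
 by (cases u) (auto simp: clamp_def max_def min_def)

lemma clamp_top: "clamp \<infinity> s = max 0 s" "clamp \<top> s = max 0 s"
 by (simp_all add: clamp_def)

lemma clamp_tendsto: "(f ---> s) F' ==> ((%n. clamp u (f n)) ---> clamp u s) F'"
 unfolding clamp_def by (auto intro!: tendsto_intros)

text \<open>Despite the name the grid has mesh \<open>1 / (n + 1)\<close>. Points are rounded
  upwards, since paths are continuous from the right.\<close>

definition dyadic :: "nat => real => real" where
 "dyadic n s = real_of_int (\<lfloor>(real n + 1) * s\<rfloor> + 1) / (real n + 1)"

lemma dyadic: "s <= dyadic n s" "dyadic n s <= s + 1 / (real n + 1)"
proof -
 have n: "0 < real n + 1" by simp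
 have "(real n + 1) * s <= real_of_int (\<lfloor>(real n + 1) * s\<rfloor> + 1)" by linarith
 thus "s <= dyadic n s" using n by (simp add: dyadic_def pos_le_divide_eq mult.commute)
 have "real_of_int (\<lfloor>(real n + 1) * s\<rfloor> + 1) <= (real n + 1) * s + 1" by linarith
 thus "dyadic n s <= s + 1 / (real n + 1)"
 proof -
  have "(s + 1 / (real n + 1)) * (real n + 1) = (real n + 1) * s + 1" using n by (simp add: field_simps)
  thus ?thesis using n \<open>real_of_int (\<lfloor>(real n + 1) * s\<rfloor> + 1) <= (real n + 1) * s + 1\<close>
   unfolding dyadic_def by (simp only: pos_divide_le_eq)
 qed
qed

lemma dyadic_tendsto: "(%n. dyadic n s) ----> s"
proof (rule tendsto_sandwich[OF _ _ tendsto_const])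
 have "(%n. s + inverse (real (Suc n))) ----> s + 0"
  by (intro tendsto_add tendsto_const LIMSEQ_inverse_real_of_nat)
 thus "(%n. s + 1 / (real n + 1)) ----> s" by (simp add: inverse_eq_divide add.commute)
qed (use dyadic in auto)

lemma eventually_dyadic:
 assumes om: "om : space W" and U: "openin onepoint U" "xi (clamp u s) om : U"
 shows "eventually (%n. xi (clamp u (dyadic n s)) om : U) sequentially"
proof -
 have "eventually (%r. xi r om : U) (at_right (clamp u s))"
  using right_continuous_paths[OF om clamp(1)] U unfolding limitin_def by blast
 then obtain b where b: "clamp u s < b" "!!r. clamp u s < r ==> r < b ==> xi r om : U"
  unfolding eventually_at_right_field by blast
 have "eventually (%n. clamp u (dyadic n s) < b) sequentially"
  using order_tendstoD(2)[OF clamp_tendsto[OF dyadic_tendsto] b(1)] .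
 thus ?thesis
 proof eventually_elim
  case (elim n)
  thus ?case using b(2)[of "clamp u (dyadic n s)"] clamp_mono[OF dyadic(1), of u s n] U(2)
   by (cases "clamp u (dyadic n s) = clamp u s") auto
 qed
qed

text \<open>The grid approximations are measurable because they use countably many times, but their
  limit is taken in an abstract topology. So \<open>U\<close> is exhausted by sets
  \<open>V k\<close> with compact closure inside \<open>U\<close>: the path is in \<open>U\<close>
  exactly if for some \<open>k\<close> its approximations finally stay in \<open>V k\<close>, by
  right continuity applied to \<open>V k\<close> and to the complement of its closure.\<close>

lemma xi_jointly_measurable: "(%(s, om). xi (clamp u s) om) : borel \<Otimes>\<^sub>M Nf u \<rightarrow>\<^sub>M borel_of onepoint"
proof (rule measurable_onepointI)
 fix U :: "'e set" assume U: "open U"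
 obtain V :: "nat => 'e set" where V: "!!k. open (V k)" "!!k. compact (closure (V k))"
  "!!k. closure (V k) \<subseteq> U" "(\<Union>k. V k) = U"
  using relatively_compact_exhaustion[OF lc U] by metis
 have "(%z. (%i om. xi (clamp u (real_of_int (i + 1) / (real n + 1))) om) \<lfloor>(real n + 1) * fst z\<rfloor> (snd z))
   : borel \<Otimes>\<^sub>M Nf u \<rightarrow>\<^sub>M borel_of onepoint" for n
 proof (rule measurable_compose_countable[where f="%i z. xi (clamp u (real_of_int (i + 1) / (real n + 1))) (snd z)"
    and g="%z. \<lfloor>(real n + 1) * fst z\<rfloor>"])
  show "(%z. xi (clamp u (real_of_int (i + 1) / (real n + 1))) (snd z)) : borel \<Otimes>\<^sub>M Nf u \<rightarrow>\<^sub>M borel_of onepoint" for i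
   by (rule measurable_compose[OF measurable_snd xi_measurable[OF clamp]])
  show "(%z. \<lfloor>(real n + 1) * fst z\<rfloor>) : borel \<Otimes>\<^sub>M Nf u \<rightarrow>\<^sub>M count_space UNIV" by measurable
 qed
 hence d: "(%z. xi (clamp u (dyadic n (fst z))) (snd z)) : borel \<Otimes>\<^sub>M Nf u \<rightarrow>\<^sub>M borel_of onepoint" for n
  by (simp add: dyadic_def)
 have "{z : space (borel \<Otimes>\<^sub>M Nf u). xi (clamp u (dyadic n (fst z))) (snd z) : Some ` V k} : sets (borel \<Otimes>\<^sub>M Nf u)" for n k
  using measurable_sets[OF d Some_image_sets[OF V(1)], of n k] by (simp add: vimage_def Int_def conj_commute)
 hence [measurable]: "Measurable.pred (borel \<Otimes>\<^sub>M Nf u) (%z. xi (clamp u (dyadic n (fst z))) (snd z) : Some ` V k)" for n k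
  by (simp add: pred_def)
 have "{z : space (borel \<Otimes>\<^sub>M Nf u). (case z of (s, om) => xi (clamp u s) om) : Some ` U} =
  {z : space (borel \<Otimes>\<^sub>M Nf u). \<exists>k N. \<forall>n\<in>{N..}. xi (clamp u (dyadic n (fst z))) (snd z) : Some ` V k}"
 proof (intro Collect_cong conj_cong refl)
  fix z :: "real \<times> 'w" assume "z : space (borel \<Otimes>\<^sub>M Nf u)"
  then obtain s om where z: "z = (s, om)" "om : space W" by (auto simp: space_pair_measure)
  show "(case z of (s, om) => xi (clamp u s) om) : Some ` U \<longleftrightarrow>
   (\<exists>k N. \<forall>n\<in>{N..}. xi (clamp u (dyadic n (fst z))) (snd z) : Some ` V k)"
  proof
   assume "(case z of (s, om) => xi (clamp u s) om) : Some ` U"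
   then obtain k where k: "xi (clamp u s) om : Some ` V k" using V(4) z by auto
   have "openin onepoint (Some ` V k)" using V(1) by (simp add: open_openin[symmetric])
   from eventually_dyadic[OF z(2) this k] show "\<exists>k N. \<forall>n\<in>{N..}. xi (clamp u (dyadic n (fst z))) (snd z) : Some ` V k"
    unfolding z by (auto simp: eventually_sequentially)
  next
   assume "\<exists>k N. \<forall>n\<in>{N..}. xi (clamp u (dyadic n (fst z))) (snd z) : Some ` V k"
   then obtain k N where kN: "!!n. N <= n ==> xi (clamp u (dyadic n s)) om : Some ` V k" unfolding z by auto
   show "(case z of (s, om) => xi (clamp u s) om) : Some ` U"
   proof (rule ccontr)
    assume n: "(case z of (s, om) => xi (clamp u s) om) \<notin> Some ` U"
    define O' where "O' = topspace onepoint - Some ` closure (V k)"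
    have "closedin onepoint (Some ` closure (V k))"
     using V(2)[of k] by (simp add: closed_closedin[symmetric])
    hence O': "openin onepoint O'" unfolding O'_def by (rule openin_diff[OF openin_topspace])
    have "xi (clamp u s) om : O'" using n V(3)[of k] z by (auto simp: O'_def topspace_onepoint)
    from eventually_dyadic[OF z(2) O' this] obtain N' where "!!n. N' <= n ==> xi (clamp u (dyadic n s)) om : O'"
     by (auto simp: eventually_sequentially)
    from this[of "max N N'"] kN[of "max N N'"] show False using closure_subset[of "V k"] by (auto simp: O'_def)
   qed
  qed
 qed
 also have "... : sets (borel \<Otimes>\<^sub>M Nf u)" by measurable
 finally show "{z : space (borel \<Otimes>\<^sub>M Nf u). (case z of (s, om) => xi (clamp u s) om) : Some ` U} : sets (borel \<Otimes>\<^sub>M Nf u)" .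
qed

lemma measurable_xi:
 assumes "g : \<B> R" "h : R \<rightarrow>\<^sub>M Nf u"
 shows "(%z. xi (clamp u (g z)) (h z)) : R \<rightarrow>\<^sub>M borel_of onepoint"
 by (rule curried_compose[OF xi_jointly_measurable assms])

definition A :: "('e => real) => real => 'w => real" where
 "A b t om = (LBINT r:{0..t}. at_alive b (xi r om))"

lemma A_clamp: "ennreal t <= u ==> A b t om = (LBINT r:{0..t}. at_alive b (xi (clamp u r) om))"
 unfolding A_def by (intro set_integral_cong) (auto simp: clamp_eq order_trans[OF ennreal_leI])

lemma A_measurable:
 assumes b: "b : \<B> borel" and g: "g : \<B> R" "!!z. z : space R ==> ennreal (g z) <= u"
  and h: "h : R \<rightarrow>\<^sub>M Nf u"
 shows "(%z. A b (g z) (h z)) : \<B> R"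
proof -
 have "(%z. LBINT r:{0..g z}. at_alive b (xi (clamp u r) (h z))) : \<B> R"
 proof (rule borel_measurable_set_integral_Icc[OF _ _ g(1)])
  have "(%z. at_alive b (xi (clamp u (snd z)) (h (fst z)))) : \<B> (R \<Otimes>\<^sub>M borel)"
   by (intro measurable_at_alive' b measurable_xi measurable_compose[OF measurable_fst h]) measurable
  thus "(%(z, r). at_alive b (xi (clamp u r) (h z))) : \<B> (R \<Otimes>\<^sub>M borel)"
   by (simp add: case_prod_beta')
 qed simp
 thus ?thesis by (subst measurable_cong[OF A_clamp[OF g(2)]])
qed

lemma at_alive_path_measurable:
 assumes b: "b : \<B> borel" and om: "om : space W"
 shows "(%r. at_alive b (xi (max 0 r) om)) : \<B> borel"
 using measurable_at_alive'[OF b measurable_xi[of "%r. r" borel "%_. om" \<infinity>]] om by (simp add: clamp_top)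

lemma A_bound:
 assumes b: "b : \<B> borel" "!!y. \<bar>b y\<bar> <= B" and om: "om : space W" and t: "0 <= t"
 shows "\<bar>A b t om\<bar> <= B * t"
proof -
 have "0 <= B" using b(2)[of undefined] by linarith
 have "\<bar>LBINT r:{0..t}. at_alive b (xi (clamp \<infinity> r) om)\<bar> <= B * (t - 0)"
  using at_alive_path_measurable[OF b(1) om] t b \<open>0 <= B\<close>
  by (intro set_integral_Icc_bound at_alive_bound) (auto simp: clamp_top)
 thus ?thesis by (subst A_clamp[of _ \<infinity>]) auto
qed

abbreviation FK :: "('e => real) => real => ('e => real) => 'e => real" where
 "FK \<equiv> feynman_kac xi Pr"

lemma FK_eq: "FK b t f x = (LINT om|Pr (Some x). exp (A b t om) * at_alive f (xi t om))"
 by (simp add: feynman_kac_def A_def)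

text \<open>Measurable dependence on the starting point is assumed on the sigma-algebra of the paths
  only, hence the restriction of every law to \<open>Nf \<infinity>\<close>.\<close>

lemma law_kernel: "(%z. distr (Pr z) (Nf \<infinity>) (%om. om)) : borel_of onepoint \<rightarrow>\<^sub>M subprob_algebra (Nf \<infinity>)"
proof (rule measurable_subprob_algebra)
 fix z
 have id: "(%om. om) : Pr z \<rightarrow>\<^sub>M Nf \<infinity>" by (rule measurable_Nf_law[of _ \<infinity>]) simp
 show "subprob_space (distr (Pr z) (Nf \<infinity>) (%om. om))"
  by (intro prob_space_imp_subprob_space prob_space.prob_space_distr law id)
next
 fix B assume B: "B : sets (Nf \<infinity>)"
 have "(%z. measure (Pr z) B) : \<B> (borel_of onepoint)"
  using measurable_law B by (simp add: Nf_def)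
 hence "(%z. ennreal (measure (Pr z) B)) : \<B> (borel_of onepoint)" by simp
 moreover have "emeasure (distr (Pr z) (Nf \<infinity>) (%om. om)) B = ennreal (measure (Pr z) B)" for z
 proof -
  interpret prob_space "Pr z" by (rule law)
  have id: "(%om. om) : Pr z \<rightarrow>\<^sub>M Nf \<infinity>" by (rule measurable_Nf_law[of _ \<infinity>]) simp
  have "(%om. om) -` B \<inter> space (Pr z) = B" using sets.sets_into_space[OF B] by (auto simp: law)
  thus ?thesis using emeasure_distr[OF id B] by (simp add: emeasure_eq_measure)
 qed
 ultimately show "(%z. emeasure (distr (Pr z) (Nf \<infinity>) (%om. om)) B) : \<B> (borel_of onepoint)" by simp
qed simp

text \<open>Time, integrand and starting point may all depend on a parameter: nested and
  time-shifted applications of the semigroup in the Duhamel expansions call for this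
  generality.\<close>

lemma FK_measurable:
 assumes b: "b : \<B> borel" and \<tau>: "\<tau> : \<B> M"
  and H: "(%(a, y). H a y) : \<B> (M \<Otimes>\<^sub>M borel)" and X: "X : M \<rightarrow>\<^sub>M borel"
 shows "(%a. FK b (max 0 (\<tau> a)) (H a) (X a)) : \<B> M"
proof -
 define F where "F a om = exp (A b (max 0 (\<tau> a)) om) * at_alive (H a) (xi (clamp \<infinity> (\<tau> a)) om)" for a om
 have t: "(%z. \<tau> (fst z)) : \<B> (M \<Otimes>\<^sub>M Nf \<infinity>)" by (rule measurable_compose[OF measurable_fst \<tau>])
 have "(%z. F (fst z) (snd z)) : \<B> (M \<Otimes>\<^sub>M Nf \<infinity>)"
  unfolding F_def
 proof (intro borel_measurable_times measurable_compose[OF _ borel_measurable_exp])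
  show "(%z. A b (max 0 (\<tau> (fst z))) (snd z)) : \<B> (M \<Otimes>\<^sub>M Nf \<infinity>)"
   by (rule A_measurable[OF b, where u=\<infinity>]) (use t in simp_all)
  show "(%z. at_alive (H (fst z)) (xi (clamp \<infinity> (\<tau> (fst z))) (snd z))) : \<B> (M \<Otimes>\<^sub>M Nf \<infinity>)"
   by (rule measurable_at_alive[OF H measurable_fst measurable_xi[OF t measurable_snd]])
 qed
 hence Fm: "(%(a, om). F a om) : \<B> (M \<Otimes>\<^sub>M Nf \<infinity>)" by (simp add: case_prod_beta')
 have "(%a. \<integral>om. F a om \<partial>distr (Pr (Some (X a))) (Nf \<infinity>) (%om. om)) : \<B> M"
  by (rule borel_measurable_kernel_integral[OF Fm measurable_compose[OF measurable_compose[OF X measurable_Some] law_kernel]])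
 moreover have "(LINT om|distr (Pr (Some (X a))) (Nf \<infinity>) (%om. om). F a om) = FK b (max 0 (\<tau> a)) (H a) (X a)" if "a : space M" for a
 proof -
  have "(LINT om|distr (Pr (Some (X a))) (Nf \<infinity>) (%om. om). F a om) = (LINT om|Pr (Some (X a)). F a om)"
   by (rule integral_distr[OF measurable_Nf_law[of _ \<infinity>] section_right[OF Fm that]]) simp
  thus ?thesis by (simp add: FK_eq F_def clamp_top)
 qed
 ultimately show ?thesis by (subst measurable_cong) auto
qed

text \<open>The finite measure behind the operator: weight \<open>exp (A b t om)\<close> on the
  event of survival, carried by the position at time \<open>t\<close>. Linearity, monotonicity,
  dominated convergence and Fubini for \<open>FK\<close> become instances of measure theory.\<close>

definition FKm :: "('e => real) => real => 'e => 'e measure" where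
 "FKm b t x = distr (density (Pr (Some x)) (%om. ennreal (exp (A b t om) * (if xi t om = None then 0 else 1)))) borel (%om. the (xi t om))"

lemma sets_FKm [simp, measurable_cong]: "sets (FKm b t x) = sets borel"
 by (simp add: FKm_def)

lemma space_FKm [simp]: "space (FKm b t x) = UNIV"
 by (simp add: FKm_def)

lemma path_measurable:
 assumes "0 <= t"
 shows "xi t : Pr z \<rightarrow>\<^sub>M borel_of onepoint"
 by (rule measurable_Nf_law[OF xi_measurable[OF assms order_refl]])

lemma A_law_measurable:
 assumes "b : \<B> borel"
 shows "A b t : \<B> (Pr z)"
proof (rule measurable_Nf_law[of _ "ennreal t"])
 show "A b t : \<B> (Nf (ennreal t))"
  using A_measurable[OF assms, of "%_. t" "Nf (ennreal t)" "ennreal t" "%om. om"] by simp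
qed

lemma weight_measurable:
 assumes b: "b : \<B> borel" and t: "0 <= t"
 shows "(%om. exp (A b t om) * (if xi t om = None then 0 else 1)) : \<B> (Pr z)"
proof -
 have "(%om. at_alive (%_. 1) (xi t om)) : \<B> (Pr z)"
  by (rule measurable_at_alive'[OF _ path_measurable[OF t]]) simp
 moreover have "at_alive (%_. 1) y = (if y = None then 0 else 1)" for y :: "'e option"
  by (cases y) (auto simp: at_alive_def)
 ultimately have [measurable]: "(%om. if xi t om = None then 0 else 1 :: real) : \<B> (Pr z)" by simp
 note [measurable] = A_law_measurable[OF b]
 show ?thesis by measurable
qed

lemma FK_FKm:
 assumes b: "b : \<B> borel" and t: "0 <= t" and f: "f : \<B> borel"
 shows "FK b t f x = (LINT y|FKm b t x. f y)"
proof -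
 have m: "(%om. the (xi t om)) : Pr (Some x) \<rightarrow>\<^sub>M borel"
  by (rule measurable_compose[OF path_measurable[OF t] measurable_the])
 have "(LINT y|FKm b t x. f y) = (\<integral>om. f (the (xi t om)) \<partial>density (Pr (Some x)) (%om. ennreal (exp (A b t om) * (if xi t om = None then 0 else 1))))"
  unfolding FKm_def using m by (intro integral_distr f) simp
 also have "... = (LINT om|Pr (Some x). (exp (A b t om) * (if xi t om = None then 0 else 1)) *\<^sub>R f (the (xi t om)))"
  by (intro integral_density measurable_compose[OF m f] weight_measurable b t) simp
 also have "... = FK b t f x"
  unfolding FK_eq by (intro bochner_cong refl) (auto simp: at_alive_def split: option.split)
 finally show ?thesis ..
qed

lemma FKm_finite:
 assumes b: "b : \<B> borel" "!!y. \<bar>b y\<bar> <= B" and t: "0 <= t"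
 shows "finite_measure (FKm b t x)" "measure (FKm b t x) UNIV <= exp (B * t)"
proof -
 interpret P: prob_space "Pr (Some x)" by (rule law)
 have m: "(%om. the (xi t om)) : Pr (Some x) \<rightarrow>\<^sub>M borel"
  by (rule measurable_compose[OF path_measurable[OF t] measurable_the])
 have "emeasure (FKm b t x) UNIV = (\<integral>\<^sup>+om. ennreal (exp (A b t om) * (if xi t om = None then 0 else 1)) \<partial>Pr (Some x))"
  unfolding FKm_def using m weight_measurable[OF b(1) t, of "Some x"]
  by (subst emeasure_distr) (auto simp: emeasure_density cong: nn_integral_cong)
 also have "... <= (\<integral>\<^sup>+om. ennreal (exp (B * t)) \<partial>Pr (Some x))"
 proof (intro nn_integral_mono ennreal_leI)
  fix om assume "om : space (Pr (Some x))"
  hence "\<bar>A b t om\<bar> <= B * t" using A_bound[OF b _ t] by (simp add: law)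
  thus "exp (A b t om) * (if xi t om = None then 0 else 1) <= exp (B * t)" by auto
 qed
 also have "... = ennreal (exp (B * t))" by (simp add: P.emeasure_space_1)
 finally have le: "emeasure (FKm b t x) UNIV <= ennreal (exp (B * t))" .
 thus "finite_measure (FKm b t x)" by (intro finite_measureI) (auto simp: top_unique)
 show "measure (FKm b t x) UNIV <= exp (B * t)" unfolding measure_def using le by (intro enn2real_leI) auto
qed

text \<open>A deterministic time is a stopping time, and the past \<open>Nf s\<close> lies in the
  stopped right-continuous filtration. Only one future position is involved, not a functional of the
  future path.\<close>

lemma strong_markov_at:
 assumes s: "0 <= s" and t: "0 <= t" and D: "D : sets (Nf (ennreal s))" and B: "B : sets (borel_of onepoint)"
 shows "emeasure (Pr z) {om : D. xi (s + t) om : B} =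
  (\<integral>\<^sup>+om. emeasure (Pr (xi s om)) {om' : space W. xi t om' : B} * indicator D om \<partial>Pr z)"
proof -
 have z: "z : topspace onepoint" unfolding topspace_onepoint by simp
 have sp: "space (natural_filtration onepoint W xi v) = space W" for v using space_Nf[of v] by (simp add: Nf_def)
 have DW: "D \<subseteq> space W" using sets.sets_into_space[OF D] by simp
 have sub: "(\<Inter>u\<in>{u. i < u \<or> u = \<infinity>}. sets (natural_filtration onepoint W xi u)) \<subseteq> Pow (space W)" for i
  using sets.sets_into_space[of _ "natural_filtration onepoint W xi \<infinity>"] by (auto simp: sp)
 have Dr: "D : sets (right_cont_filtration onepoint W xi v)" if "ennreal s <= v" for v
 proof -
  have "D : sets (natural_filtration onepoint W xi u)" if "v < u \<or> u = \<infinity>" for u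
  proof -
   have "ennreal s <= u" using that \<open>ennreal s <= v\<close> by (auto intro: order_trans less_imp_le)
   from sets_Nf_mono[OF this] show ?thesis using D by (auto simp: Nf_def)
  qed
  thus ?thesis
   unfolding right_cont_filtration_def sets_measure_of[OF sub] by (intro sigma_sets.Basic) auto
 qed
 have "D : sets (filtration.pre_sigma (space W) (right_cont_filtration onepoint W xi) (%_. ennreal s))"
 proof -
  have F: "filtration (space W) (right_cont_filtration onepoint W xi)"
  proof
   show "space (right_cont_filtration onepoint W xi i) = space W" for i
    unfolding right_cont_filtration_def using sub by (rule space_measure_of)
   show "sets (right_cont_filtration onepoint W xi i) <= sets (right_cont_filtration onepoint W xi j)" if "i <= j" for i j
    unfolding right_cont_filtration_def sets_measure_of[OF sub] using that by (intro sigma_sets_mono') auto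
  qed
  show ?thesis
  proof (rule filtration.sets_pre_sigmaI[OF F stopping_time_const])
   fix v
   show "{om : D. ennreal s <= v} : sets (right_cont_filtration onepoint W xi v)"
    using Dr[of v] by (cases "ennreal s <= v") auto
  qed
 qed
 from strong_markov[OF z stopping_time_const this t B] s DW
 show ?thesis by (simp add: enn2real_ennreal)
qed

lemma transition_measurable:
 assumes h: "h : \<B> (borel_of onepoint)" and t: "0 <= t"
 shows "(%z. \<integral>\<^sup>+om. h (xi t om) \<partial>Pr z) : \<B> (borel_of onepoint)"
proof -
 have ht: "(%om. h (xi t om)) : \<B> (Nf \<infinity>)"
  by (rule measurable_compose[OF xi_measurable[OF t] h]) simp
 have "(%z. \<integral>\<^sup>+om. h (xi t om) \<partial>distr (Pr z) (Nf \<infinity>) (%om. om)) : \<B> (borel_of onepoint)"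
  by (rule measurable_compose[OF law_kernel nn_integral_measurable_subprob_algebra[OF ht]])
 moreover have "(\<integral>\<^sup>+om. h (xi t om) \<partial>distr (Pr z) (Nf \<infinity>) (%om. om)) = (\<integral>\<^sup>+om. h (xi t om) \<partial>Pr z)" for z
  by (rule nn_integral_distr[OF measurable_Nf_law[of _ \<infinity>]]) (use ht in simp_all)
 ultimately show ?thesis by simp
qed

text \<open>Two equalities of measures in succession: for a fixed past event \<open>D\<close> the
  law of the position on \<open>D\<close> is a mixture of transition laws, which allows general
  \<open>h\<close>; for fixed \<open>h\<close> two weighted measures on the past coincide, which
  allows general \<open>Y\<close>.\<close>

lemma markov_nn:
 assumes s: "0 <= s" and t: "0 <= t" and Y: "Y : \<B> (Nf (ennreal s))"
  and h: "h : \<B> (borel_of onepoint)"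
 shows "(\<integral>\<^sup>+om. Y om * h (xi (s + t) om) \<partial>Pr z) = (\<integral>\<^sup>+om. Y om * (\<integral>\<^sup>+om'. h (xi t om') \<partial>Pr (xi s om)) \<partial>Pr z)"
proof -
 let ?S = "borel_of onepoint :: 'e option measure" and ?N = "Nf (ennreal s)"
 define L where "L y = distr (Pr y) ?S (xi t)" for y
 have id: "(%om. om) : Pr y \<rightarrow>\<^sub>M Nf u" for y u by (rule measurable_Nf_law[of _ u]) simp
 have "L y = distr (distr (Pr y) (Nf \<infinity>) (%om. om)) ?S (xi t)" for y
  unfolding L_def using distr_distr[OF xi_measurable[OF t, of \<infinity>] id[of y \<infinity>]] by (simp add: comp_def)
 hence Lk: "L : ?S \<rightarrow>\<^sub>M subprob_algebra ?S"
  using measurable_compose[OF law_kernel measurable_distr[OF xi_measurable[OF t, of \<infinity>]]] by (simp add: L_def[abs_def])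
 have Ls: "(%om. L (xi s om)) : Pr z \<rightarrow>\<^sub>M subprob_algebra ?S" by (rule measurable_compose[OF path_measurable[OF s] Lk])
 have pst: "xi (s + t) : Pr z \<rightarrow>\<^sub>M ?S" using s t by (intro path_measurable) auto
 have Lh: "(\<integral>\<^sup>+om'. h (xi t om') \<partial>Pr y) = (\<integral>\<^sup>+x. h x \<partial>L y)" for y
  unfolding L_def by (rule nn_integral_distr[OF path_measurable[OF t], symmetric]) (use h in simp)
 define k1 k2 where "k1 om = h (xi (s + t) om)" and "k2 om = (\<integral>\<^sup>+x. h x \<partial>L (xi s om))" for om
 have km: "k1 : \<B> (Pr z)" "k2 : \<B> (Pr z)"
  unfolding k1_def k2_def by (rule measurable_compose[OF pst h], rule measurable_compose[OF Ls nn_integral_measurable_subprob_algebra[OF h]])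
 have D: "(\<integral>\<^sup>+om. indicator D om * k1 om \<partial>Pr z) = (\<integral>\<^sup>+om. indicator D om * k2 om \<partial>Pr z)" if D: "D : sets ?N" for D
 proof -
  have DW: "D \<subseteq> space W" and Dp: "D : sets (Pr z)"
   using sets.sets_into_space[OF D] sets_Nf_subset[of "ennreal s"] D by (auto simp: law)
  let ?M = "density (Pr z) (indicator D)"
  have Lm: "(%om. L (xi s om)) : ?M \<rightarrow>\<^sub>M subprob_algebra ?S" using Ls by simp
  have ne: "space ?M ~= {}" using prob_space.not_empty[OF law(1)] by simp
  have "distr ?M ?S (xi (s + t)) = ?M \<bind> (%om. L (xi s om))"
  proof (rule measure_eqI)
   show "sets (distr ?M ?S (xi (s + t))) = sets (?M \<bind> (%om. L (xi s om)))"
    using ne by (subst sets_bind[where N="?S"]) (auto simp: L_def)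
   fix B assume "B : sets (distr ?M ?S (xi (s + t)))"
   hence B: "B : sets ?S" by simp
   have pB: "xi (s + t) -` B \<inter> space (Pr z) : sets (Pr z)" by (rule measurable_sets[OF pst B])
   have "emeasure (distr ?M ?S (xi (s + t))) B = (\<integral>\<^sup>+om. indicator D om * indicator (xi (s + t) -` B \<inter> space (Pr z)) om \<partial>Pr z)"
    using pst B pB Dp by (simp add: emeasure_distr emeasure_density)
   also have "... = (\<integral>\<^sup>+om. indicator (D \<inter> (xi (s + t) -` B \<inter> space (Pr z))) om \<partial>Pr z)"
    by (simp add: indicator_inter_arith)
   also have "... = emeasure (Pr z) (D \<inter> (xi (s + t) -` B \<inter> space (Pr z)))"
    by (rule nn_integral_indicator[OF sets.Int[OF Dp pB]])
   also have "D \<inter> (xi (s + t) -` B \<inter> space (Pr z)) = {om : D. xi (s + t) om : B}" using DW by (auto simp: law)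
   also have "emeasure (Pr z) ... = (\<integral>\<^sup>+om. emeasure (Pr (xi s om)) {om' : space W. xi t om' : B} * indicator D om \<partial>Pr z)"
    by (rule strong_markov_at[OF s t D B])
   also have "... = (\<integral>\<^sup>+om. indicator D om * emeasure (L (xi s om)) B \<partial>Pr z)"
    unfolding L_def emeasure_distr[OF path_measurable[OF t] B]
    by (intro nn_integral_cong) (simp add: law vimage_def Int_def conj_commute mult.commute)
   also have "... = emeasure (?M \<bind> (%om. L (xi s om))) B"
    unfolding emeasure_bind[OF ne Lm B] using Dp measurable_compose[OF Ls measurable_emeasure_subprob_algebra[OF B]]
    by (subst nn_integral_density) auto
   finally show "emeasure (distr ?M ?S (xi (s + t))) B = emeasure (?M \<bind> (%om. L (xi s om))) B" .
  qed
  hence "(\<integral>\<^sup>+x. h x \<partial>distr ?M ?S (xi (s + t))) = (\<integral>\<^sup>+x. h x \<partial>(?M \<bind> (%om. L (xi s om))))" by (rule arg_cong)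
  moreover have "(\<integral>\<^sup>+x. h x \<partial>distr ?M ?S (xi (s + t))) = (\<integral>\<^sup>+om. indicator D om * k1 om \<partial>Pr z)"
   unfolding k1_def using pst h Dp km(1)[unfolded k1_def] by (subst nn_integral_distr) (auto simp: nn_integral_density)
  moreover have "(\<integral>\<^sup>+x. h x \<partial>(?M \<bind> (%om. L (xi s om)))) = (\<integral>\<^sup>+om. indicator D om * k2 om \<partial>Pr z)"
   unfolding nn_integral_bind[OF h Lm] using Dp km(2)[unfolded k2_def] by (subst nn_integral_density) (auto simp: k2_def)
  ultimately show ?thesis by simp
 qed
 define R where "R k = distr (density (Pr z) k) ?N (%om. om)" for k
 have Re: "emeasure (R k) D = (\<integral>\<^sup>+om. indicator D om * k om \<partial>Pr z)" if "k : \<B> (Pr z)" "D : sets ?N" for k D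
 proof -
  have "D : sets (Pr z)" "D \<inter> space (Pr z) = D"
   using sets.sets_into_space[OF that(2)] sets_Nf_subset[of "ennreal s"] that(2) by (auto simp: law)
  thus ?thesis unfolding R_def using that id[of z "ennreal s"] by (simp add: emeasure_distr emeasure_density mult.commute)
 qed
 have Ri: "(\<integral>\<^sup>+om. Y om \<partial>R k) = (\<integral>\<^sup>+om. Y om * k om \<partial>Pr z)" if "k : \<B> (Pr z)" for k
  unfolding R_def using that id[of z "ennreal s"] Y measurable_Nf_law[OF Y, of z]
  by (subst nn_integral_distr) (auto simp: nn_integral_density mult.commute)
 have "R k1 = R k2" by (rule measure_eqI) (auto simp: R_def[abs_def] Re[unfolded R_def] km D)
 thus ?thesis using Ri[OF km(1)] Ri[OF km(2)] unfolding Lh k1_def k2_def by simp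
qed

lemma bounded_integrable:
 assumes "f : \<B> (Pr z)" "!!om. om : space W ==> \<bar>f om\<bar> <= (C :: real)"
 shows "integrable (Pr z) f"
proof -
 interpret prob_space "Pr z" by (rule law)
 show ?thesis using assms by (intro integrable_const_bound[where B=C]) (auto simp: law)
qed

lemma markov_nonneg:
 assumes s: "0 <= s" and t: "0 <= t" and Y: "Y : \<B> (Nf (ennreal s))" "!!om. om : space W ==> 0 <= Y om \<and> Y om <= C"
  and h: "h : \<B> (borel_of onepoint)" "!!y. 0 <= h y \<and> h y <= (c::real)"
 shows "(LINT om|Pr z. Y om * h (xi (s + t) om)) = (LINT om|Pr z. Y om * (LINT om'|Pr (xi s om). h (xi t om')))"
proof -
 define H where "H y = (LINT om'|Pr y. h (xi t om'))" for y
 have ht: "(%om'. h (xi t om')) : \<B> (Pr y)" for y by (rule measurable_compose[OF path_measurable[OF t] h(1)])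
 have H0: "0 <= H y" for y unfolding H_def using h(2) by (intro integral_nonneg_AE) auto
 have Hn: "(\<integral>\<^sup>+om'. ennreal (h (xi t om')) \<partial>Pr y) = ennreal (H y)" for y
  unfolding H_def using h(2) by (intro nn_integral_eq_integral bounded_integrable[OF ht, where C=c]) auto
 have "(%y. enn2real (\<integral>\<^sup>+om'. ennreal (h (xi t om')) \<partial>Pr y)) : \<B> (borel_of onepoint)"
  using transition_measurable[of "%y. ennreal (h y)" t] h(1) t by simp
 hence Hm: "H : \<B> (borel_of onepoint)" unfolding Hn using H0 by simp
 have Ym: "Y : \<B> (Pr z)" by (rule measurable_Nf_law[OF Y(1)])
 have m1: "(%om. Y om * h (xi (s + t) om)) : \<B> (Pr z)"
  using s t by (intro borel_measurable_times Ym measurable_compose[OF path_measurable h(1)]) auto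
 have m2: "(%om. Y om * H (xi s om)) : \<B> (Pr z)"
  by (intro borel_measurable_times Ym measurable_compose[OF path_measurable[OF s] Hm])
 have "(\<integral>\<^sup>+om. ennreal (Y om * h (xi (s + t) om)) \<partial>Pr z) = (\<integral>\<^sup>+om. ennreal (Y om) * ennreal (h (xi (s + t) om)) \<partial>Pr z)"
  using Y(2) h(2) by (intro nn_integral_cong) (simp add: ennreal_mult law)
 also have "... = (\<integral>\<^sup>+om. ennreal (Y om) * (\<integral>\<^sup>+om'. ennreal (h (xi t om')) \<partial>Pr (xi s om)) \<partial>Pr z)"
  using Y(1) h(1) by (intro markov_nn s t) auto
 also have "... = (\<integral>\<^sup>+om. ennreal (Y om * H (xi s om)) \<partial>Pr z)"
  unfolding Hn using Y(2) H0 by (intro nn_integral_cong) (simp add: ennreal_mult law)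
 finally have "enn2real (\<integral>\<^sup>+om. ennreal (Y om * h (xi (s + t) om)) \<partial>Pr z) = enn2real (\<integral>\<^sup>+om. ennreal (Y om * H (xi s om)) \<partial>Pr z)" by simp
 thus ?thesis
  unfolding H_def[symmetric] using m1 m2 Y(2) h(2) H0
  by (subst (1 2) integral_eq_nn_integral) (auto simp: law)
qed

lemma integral_law_1: "(LINT om|Pr z. c) = (c :: real)"
proof -
 interpret prob_space "Pr z" by (rule law)
 show ?thesis by (simp add: prob_space)
qed

text \<open>Adding constants makes \<open>Y\<close> and \<open>h\<close> non-negative; the terms so
  introduced agree on both sides and cancel.\<close>

lemma markov_signed:
 assumes s: "0 <= s" and t: "0 <= t" and Y: "Y : \<B> (Nf (ennreal s))" "!!om. om : space W ==> \<bar>Y om\<bar> <= C"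
  and h: "h : \<B> (borel_of onepoint)" "!!y. \<bar>h y\<bar> <= (c::real)"
 shows "(LINT om|Pr z. Y om * h (xi (s + t) om)) = (LINT om|Pr z. Y om * (LINT om'|Pr (xi s om). h (xi t om')))"
proof -
 define H where "H y = (LINT om'|Pr y. h (xi t om'))" for y
 have c: "0 <= c" using h(2)[of undefined] by linarith
 have ht: "(%om'. h (xi t om')) : \<B> (Pr y)" for y by (rule measurable_compose[OF path_measurable[OF t] h(1)])
 have hc0: "0 <= h y + c" for y using h(2)[of y] by linarith
 have hi: "integrable (Pr y) (%om'. h (xi t om'))" for y using h(2) by (intro bounded_integrable[OF ht])
 have Hc: "(LINT om'|Pr y. h (xi t om') + c) = H y + c" for y
  using hi[of y] bounded_integrable[of "%_. c" y c] c prob_space.prob_space[OF law(1)[of y]] by (simp add: H_def)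
 have Hb: "\<bar>H y\<bar> <= c" for y
 proof -
  have "\<bar>H y\<bar> <= (LINT om'|Pr y. \<bar>h (xi t om')\<bar>)" unfolding H_def by (rule integral_abs_bound)
  also have "... <= (LINT om'|Pr y. c)" using hi[of y] bounded_integrable[of "%_. c" y c] c h(2) by (intro integral_mono) auto
  finally show ?thesis unfolding integral_law_1 .
 qed
 have "(%y. enn2real (\<integral>\<^sup>+om'. ennreal (h (xi t om') + c) \<partial>Pr y) - c) : \<B> (borel_of onepoint)"
  using transition_measurable[of "%y. ennreal (h y + c)" t] h(1) t by simp
 moreover have "enn2real (\<integral>\<^sup>+om'. ennreal (h (xi t om') + c) \<partial>Pr y) - c = H y" for y
 proof -
  have "(\<integral>\<^sup>+om'. ennreal (h (xi t om') + c) \<partial>Pr y) = ennreal (H y + c)"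
   unfolding Hc[symmetric] using hi[of y] bounded_integrable[of "%_. c" y c] c h(2)
   by (intro nn_integral_eq_integral) (auto simp: hc0)
  moreover have "0 <= H y + c" using Hb[of y] by (simp add: abs_le_iff)
  ultimately show ?thesis by simp
 qed
 ultimately have Hm: "H : \<B> (borel_of onepoint)" by simp
 have Ym: "Y : \<B> (Pr z)" by (rule measurable_Nf_law[OF Y(1)])
 have Hsm: "(%om. H (xi s om)) : \<B> (Pr z)" by (rule measurable_compose[OF path_measurable[OF s] Hm])
 have hsm: "(%om. h (xi (s + t) om)) : \<B> (Pr z)" using s t by (intro measurable_compose[OF path_measurable h(1)]) auto
 have core: "(LINT om|Pr z. Z om * h (xi (s + t) om)) = (LINT om|Pr z. Z om * H (xi s om))"
  if Z: "Z : \<B> (Nf (ennreal s))" "!!om. om : space W ==> 0 <= Z om \<and> Z om <= D" for Z D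
 proof -
  have Zm: "Z : \<B> (Pr z)" by (rule measurable_Nf_law[OF Z(1)])
  have Zb: "\<bar>Z om\<bar> <= \<bar>D\<bar>" if "om : space W" for om using Z(2)[OF that] by linarith
  have i: "integrable (Pr z) Z" using Zb by (intro bounded_integrable[OF Zm])
  have i1: "integrable (Pr z) (%om. Z om * h (xi (s + t) om))"
   by (rule bounded_integrable[where C="\<bar>D\<bar> * c"]) (use Zm hsm Zb h(2) in \<open>auto simp: abs_mult intro!: mult_mono\<close>)
  have i2: "integrable (Pr z) (%om. Z om * H (xi s om))"
   by (rule bounded_integrable[where C="\<bar>D\<bar> * c"]) (use Zm Hsm Zb Hb in \<open>auto simp: abs_mult intro!: mult_mono\<close>)
  have hc: "0 <= h y + c \<and> h y + c <= 2 * c" for y using h(2)[of y] by (auto simp: abs_le_iff)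
  have "(LINT om|Pr z. Z om * (h (xi (s + t) om) + c)) = (LINT om|Pr z. Z om * (LINT om'|Pr (xi s om). h (xi t om') + c))"
   by (rule markov_nonneg[OF s t Z(1), where c="2 * c"]) (use Z(2) h(1) hc in auto)
  thus ?thesis unfolding Hc distrib_left using i i1 i2 by simp
 qed
 have C: "0 <= Y om + C \<and> Y om + C <= 2 * C" if "om : space W" for om using Y(2)[OF that] by (auto simp: abs_le_iff)
 obtain om0 where "om0 : space W" using prob_space.not_empty[OF law(1)[of z]] by (auto simp: law)
 hence C0: "0 <= C" using Y(2) by force
 have 1: "(LINT om|Pr z. (Y om + C) * h (xi (s + t) om)) = (LINT om|Pr z. (Y om + C) * H (xi s om))"
  by (rule core[where D="2 * C"]) (use Y(1) C in auto)
 have 2: "(LINT om|Pr z. C * h (xi (s + t) om)) = (LINT om|Pr z. C * H (xi s om))"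
  by (rule core[where D=C]) (use C0 in auto)
 have "integrable (Pr z) (%om. Y om * h (xi (s + t) om))" "integrable (Pr z) (%om. C * h (xi (s + t) om))"
  "integrable (Pr z) (%om. Y om * H (xi s om))" "integrable (Pr z) (%om. C * H (xi s om))"
  using Ym hsm Hsm Y(2) Hb h(2) C0
  by (intro bounded_integrable[where C="C * c"]; auto simp: abs_mult intro!: mult_mono)+
 thus ?thesis using 1 2 unfolding H_def[symmetric] distrib_right by auto
qed

abbreviation P :: "real => ('e => real) => 'e => real" where
 "P \<equiv> FK (%_. 0)"

lemma A_zero: "A (%_. 0) t om = 0"
proof -
 have "at_alive (%_. 0) y = 0" for y :: "'e option" by (cases y) (auto simp: at_alive_def)
 thus ?thesis by (simp add: A_def set_lebesgue_integral_def)
qed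

lemma P_eq: "P t f x = (LINT om|Pr (Some x). at_alive f (xi t om))"
 by (simp add: FK_eq A_zero)

lemma P_motion: "P t f x = motion_semigroup xi Pr t f x"
 by (simp add: P_eq motion_semigroup_def)

text \<open>Started in the cemetery, the path stays there almost surely, so both sides are
  0.\<close>

lemma at_alive_P:
 assumes t: "0 <= t"
 shows "(LINT om|Pr z. at_alive f (xi t om)) = at_alive (P t f) z"
proof (cases z)
 case None
 have "None : topspace onepoint" unfolding topspace_onepoint by simp
 from initial_state[OF this] have "AE om in Pr None. at_alive f (xi t om) = 0"
  using AE_space
 proof eventually_elim
  case (elim om)
  hence "xi t om = None" using cemetery_trap[of om 0 t] t by (auto simp: law)
  thus ?case by (simp add: at_alive_def)
 qed
 hence "(LINT om|Pr None. at_alive f (xi t om)) = 0" by (rule integral_eq_zero_AE)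
 thus ?thesis using None by (simp add: at_alive_def)
qed (simp add: P_eq, simp add: at_alive_def P_eq)

lemma markov:
 assumes s: "0 <= s" and t: "0 <= t" and Y: "Y : \<B> (Nf (ennreal s))" "!!om. om : space W ==> \<bar>Y om\<bar> <= C"
  and f: "f : bounded_borel"
 shows "(LINT om|Pr z. Y om * at_alive f (xi (s + t) om)) = (LINT om|Pr z. Y om * at_alive (P t f) (xi s om))"
proof -
 obtain c where c: "0 <= c" "!!x. \<bar>f x\<bar> <= c" using bbE[OF f] by blast
 have "(LINT om|Pr z. Y om * at_alive f (xi (s + t) om)) = (LINT om|Pr z. Y om * (LINT om'|Pr (xi s om). at_alive f (xi t om')))"
 proof (rule markov_signed[OF s t Y])
  show "at_alive f : \<B> (borel_of onepoint)"
   using measurable_at_alive'[OF bbD[OF f], of "%y. y" "borel_of onepoint"] by simp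
  show "\<bar>at_alive f y\<bar> <= c" for y by (rule at_alive_bound[OF c(2,1)])
 qed
 thus ?thesis by (simp add: at_alive_P[OF t])
qed

lemma P_semigroup:
 assumes "0 <= s" "0 <= t" "f : bounded_borel"
 shows "P (s + t) f x = P s (P t f) x"
 using markov[OF assms(1,2), of "%_. 1" 1 f "Some x"] assms(3) by (simp add: P_eq)

end

section \<open>Duhamel formula and semigroup property of the Feynman-Kac operators\<close>

lemma finite_Fubini_Icc:
 fixes h :: "'a => real => real"
 assumes M: "finite_measure M" and h [measurable]: "(%(y, r). h y r) : \<B> (M \<Otimes>\<^sub>M borel)"
  and bd: "!!y r. y : space M ==> 0 <= r ==> r <= t ==> \<bar>h y r\<bar> <= C"
 shows "(LINT y|M. (LBINT r:{0..t}. h y r)) = (LBINT r:{0..t}. (LINT y|M. h y r))"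
proof -
 interpret M: finite_measure M by (rule M)
 interpret P: pair_sigma_finite M lborel ..
 have S: "\<B> (M \<Otimes>\<^sub>M lborel) = (\<B> (M \<Otimes>\<^sub>M borel) :: ('a \<times> real => real) set)"
  by (intro measurable_cong_sets sets_pair_measure_cong) auto
 have "integrable (M \<Otimes>\<^sub>M lborel) (%(y, r). indicator {0..t} r * h y r)"
 proof (rule integrableI_bounded_set[where A="space M \<times> {0..t}" and B=C])
  show "space M \<times> {0..t} : sets (M \<Otimes>\<^sub>M lborel)" by auto
  show "(%(y, r). indicator {0..t} r * h y r) : \<B> (M \<Otimes>\<^sub>M lborel)"
   unfolding S by measurable
  have "emeasure (M \<Otimes>\<^sub>M lborel) (space M \<times> {0..t}) = emeasure M (space M) * emeasure lborel {0..t}"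
   by (rule lborel.emeasure_pair_measure_Times) auto
  also have "... < \<infinity>" using M.emeasure_finite[of "space M"]
   by (cases "0 <= t") (auto simp: ennreal_mult_eq_top_iff less_top[symmetric])
  finally show "emeasure (M \<Otimes>\<^sub>M lborel) (space M \<times> {0..t}) < \<infinity>" .
  show "AE z\<in>space M \<times> {0..t} in M \<Otimes>\<^sub>M lborel. norm (case z of (y, r) => indicator {0..t} r * h y r) <= C"
   using bd by auto
  show "AE z in M \<Otimes>\<^sub>M lborel. z \<notin> space M \<times> {0..t} --> (case z of (y, r) => indicator {0..t} r * h y r) = 0"
   by (intro AE_I2) (auto simp: space_pair_measure indicator_def)
 qed
 from P.Fubini_integral[OF this] show ?thesis
  by (simp add: set_lebesgue_integral_def)
qed

text \<open>Fubini on the triangle \<open>r <= s\<close>, followed by the substitution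
  \<open>s = r + u\<close>.\<close>

lemma triangle_Fubini:
 fixes g :: "real => real => real"
 assumes g [measurable]: "(%(r, u). g r u) : \<B> borel2"
  and bd: "!!r u. 0 <= r ==> 0 <= u ==> r + u <= t ==> \<bar>g r u\<bar> <= C"
 shows "(LBINT s:{0..t}. (LBINT r:{0..s}. g r (s - r))) =
  (LBINT r:{0..t}. (LBINT u:{0..t - r}. g r u))"
proof -
 define f where "f r s = (if 0 <= r \<and> r <= s \<and> s <= t then g r (s - r) else 0)" for r s
 have S: "\<B> (lborel \<Otimes>\<^sub>M lborel) = (\<B> borel2 :: (real \<times> real => real) set)"
  by (intro measurable_cong_sets sets_pair_measure_cong) auto
 have gm: "(%z. g (fst z) (snd z - fst z)) : \<B> borel2"
  by (rule curried_compose[OF g]) measurable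
 have "(%z. if 0 <= fst z \<and> fst z <= snd z \<and> snd z <= t then g (fst z) (snd z - fst z) else 0) : \<B> borel2"
  using gm by measurable
 hence fm: "(%(r, s). f r s) : \<B> (lborel \<Otimes>\<^sub>M lborel)"
  unfolding S by (simp add: f_def case_prod_beta')
 have "integrable (lborel \<Otimes>\<^sub>M lborel) (%(r, s). f r s)"
 proof (rule integrableI_bounded_set[where A="{0..t} \<times> {0..t}" and B=C])
  have "emeasure (lborel \<Otimes>\<^sub>M lborel) ({0..t} \<times> {0..t}) = emeasure lborel {0..t} * emeasure lborel {0..t}"
   by (rule lborel.emeasure_pair_measure_Times) auto
  also have "... < \<infinity>" by (cases "0 <= t") (auto simp: ennreal_mult_less_top)
  finally show "emeasure (lborel \<Otimes>\<^sub>M lborel) ({0..t} \<times> {0..t}) < \<infinity>" .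
  have "\<bar>f r s\<bar> <= C" if "0 <= r" "0 <= s" "r <= t" "s <= t" for r s
   using bd[of r "s - r"] bd[of 0 0] that unfolding f_def by auto
  thus "AE z\<in>{0..t} \<times> {0..t} in lborel \<Otimes>\<^sub>M lborel. norm (case z of (r, s) => f r s) <= C"
   by auto
  show "AE z in lborel \<Otimes>\<^sub>M lborel. z \<notin> {0..t} \<times> {0..t} --> (case z of (r, s) => f r s) = 0"
   by (intro AE_I2) (auto simp: f_def split: if_splits)
 qed (use fm in auto)
 from lborel_pair.Fubini_integral[OF this]
 have "(LINT s|lborel. \<integral>r. f r s \<partial>lborel) = (LINT r|lborel. \<integral>s. f r s \<partial>lborel)" .
 moreover have "(LINT r|lborel. f r s) = indicator {0..t} s *\<^sub>R (LBINT r:{0..s}. g r (s - r))" for s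
  unfolding set_lebesgue_integral_def scaleR_conv_of_real of_real_eq_id id_apply
  by (cases "s : {0..t}") (auto simp: f_def indicator_def intro!: bochner_cong integral_eq_zero_AE)
 moreover have "(LINT s|lborel. f r s) = indicator {0..t} r *\<^sub>R (LBINT u:{0..t - r}. g r u)" for r
 proof -
  have "(LINT s|lborel. f r s) = (LINT u|lborel. f r (r + 1 * u))"
   using lborel_integral_real_affine[of 1 "f r" r] by simp
  also have "... = indicator {0..t} r *\<^sub>R (LBINT u:{0..t - r}. g r u)"
   unfolding set_lebesgue_integral_def scaleR_conv_of_real of_real_eq_id id_apply
   by (cases "r : {0..t}") (auto simp: f_def indicator_def intro!: bochner_cong integral_eq_zero_AE)
  finally show ?thesis .
 qed
 ultimately show ?thesis by (simp add: set_lebesgue_integral_def)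
qed

lemma set_integral_Icc_shift:
 fixes f :: "real => real"
 shows "(LBINT r:{s..s + t}. f r) = (LBINT r:{0..t}. f (s + r))"
proof -
 have "(LBINT r:{s..s + t}. f r) = (LINT r|lborel. indicator {s..s + t} (s + 1 * r) *\<^sub>R f (s + 1 * r))"
  unfolding set_lebesgue_integral_def
  using lborel_integral_real_affine[of 1 "%r. indicator {s..s + t} r *\<^sub>R f r" s] by simp
 also have "... = (LBINT r:{0..t}. f (s + r))"
  unfolding set_lebesgue_integral_def by (intro bochner_cong) (auto simp: indicator_def)
 finally show ?thesis .
qed

context motion
begin

lemma FKm_integrable:
 assumes b: "b : bounded_borel" and t: "0 <= t" and f: "f : bounded_borel"
 shows "integrable (FKm b t x) f"
proof -
 obtain B where B: "0 <= B" "!!y. \<bar>b y\<bar> <= B" using bbE[OF b] by blast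
 obtain c where c: "0 <= c" "!!y. \<bar>f y\<bar> <= c" using bbE[OF f] by blast
 interpret finite_measure "FKm b t x" by (rule FKm_finite(1)[OF bbD[OF b] B(2) t])
 show ?thesis using c bbD[OF f] by (intro integrable_const_bound[where B=c]) auto
qed

lemma FK_bound:
 assumes b: "b : \<B> borel" "!!y. \<bar>b y\<bar> <= B" and t: "0 <= t"
  and f: "f : \<B> borel" "!!y. \<bar>f y\<bar> <= c"
 shows "\<bar>FK b t f x\<bar> <= exp (B * t) * c"
proof -
 interpret finite_measure "FKm b t x" by (rule FKm_finite(1)[OF b t])
 have c: "0 <= c" using f(2)[of undefined] by linarith
 have "\<bar>FK b t f x\<bar> <= (LINT y|FKm b t x. \<bar>f y\<bar>)" unfolding FK_FKm[OF b(1) t f(1)] by (rule integral_abs_bound)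
 also have "... <= (LINT y|FKm b t x. c)"
  using f c by (intro integral_mono integrable_const_bound[where B=c]) auto
 also have "... = measure (FKm b t x) UNIV * c" by simp
 also have "... <= exp (B * t) * c" using FKm_finite(2)[OF b t] c by (intro mult_right_mono)
 finally show ?thesis .
qed

lemma P_bound:
 assumes "0 <= t" "f : \<B> borel" "!!y. \<bar>f y\<bar> <= c"
 shows "\<bar>P t f x\<bar> <= c"
 using FK_bound[of "%_. 0" 0 t f c x] assms by simp

lemma FK_time_measurable:
 assumes b: "b : \<B> borel" and H: "(%(r, y). H r y) : \<B> borel2"
 shows "(%(r, x). FK b (max 0 r) (H r) x) : \<B> borel2"
proof -
 have "(%z. H (fst (fst z)) (snd z)) : \<B> (borel2 \<Otimes>\<^sub>M borel)"
  by (rule curried_compose[OF H]) measurable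
 hence "(%z. FK b (max 0 (fst z)) (H (fst z)) (snd z)) : \<B> borel2"
  by (intro FK_measurable[OF b, where H="%z. H (fst z)"]) (simp_all add: case_prod_beta')
 thus ?thesis by (simp add: case_prod_beta')
qed

lemma FK_bounded_borel:
 assumes b: "b : bounded_borel" and t: "0 <= t" and f: "f : bounded_borel"
 shows "FK b t f : bounded_borel"
proof -
 obtain B where B: "0 <= B" "!!y. \<bar>b y\<bar> <= B" using bbE[OF b] by blast
 obtain c where c: "0 <= c" "!!y. \<bar>f y\<bar> <= c" using bbE[OF f] by blast
 have "(%(r, y). f y) : \<B> (borel \<Otimes>\<^sub>M (borel :: 'e measure))"
  using bbD[OF f] by measurable
 from section_right[OF FK_time_measurable[OF bbD[OF b] this], of t]
 have "FK b t f : \<B> borel" using t by (simp add: max_def)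
 thus ?thesis
  by (rule bbI) (rule FK_bound[OF bbD[OF b] B(2) t bbD[OF f] c(2)])
qed

lemma FK_linear:
 assumes b: "b : bounded_borel" and t: "0 <= t" and f: "f : bounded_borel" and g: "g : bounded_borel"
 shows "FK b t (%y. c * f y + d * g y) x = c * FK b t f x + d * FK b t g x"
 using FKm_integrable[OF b t f, of x] FKm_integrable[OF b t g, of x] bbD[OF f] bbD[OF g]
 by (simp add: FK_FKm[OF bbD[OF b] t])

lemma FK_mono:
 assumes b: "b : bounded_borel" and t: "0 <= t" and f: "f : bounded_borel" and g: "g : bounded_borel"
  and le: "!!y. f y <= g y"
 shows "FK b t f x <= FK b t g x"
 unfolding FK_FKm[OF bbD[OF b] t bbD[OF f]] FK_FKm[OF bbD[OF b] t bbD[OF g]]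
 by (intro integral_mono FKm_integrable b t f g le)

lemma FK_convergence:
 assumes b: "b : bounded_borel" and t: "0 <= t" and F: "!!n. F n : bounded_borel" and f: "f : bounded_borel"
  and bd: "!!n y. \<bar>F n y\<bar> <= C" and lim: "!!y. (%n. F n y) ----> f y"
 shows "(%n. FK b t (F n) x) ----> FK b t f x"
proof -
 obtain B where B: "0 <= B" "!!y. \<bar>b y\<bar> <= B" using bbE[OF b] by blast
 interpret finite_measure "FKm b t x" by (rule FKm_finite(1)[OF bbD[OF b] B(2) t])
 show ?thesis
  unfolding FK_FKm[OF bbD[OF b] t bbD[OF f]] FK_FKm[OF bbD[OF b] t bbD[OF F]]
  using bbD[OF F] bbD[OF f] bd lim
  by (intro integral_dominated_convergence[where w="%_. C"]) auto
qed

lemma FK_Fubini: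
 fixes h :: "'e => real => real"
 assumes b: "b : bounded_borel" and t: "0 <= t"
  and h: "(%(y, r). h y r) : \<B> borel2"
  and bd: "!!y r. 0 <= r ==> r <= s ==> \<bar>h y r\<bar> <= C"
 shows "FK b t (%y. LBINT r:{0..s}. h y r) x = (LBINT r:{0..s}. FK b t (%y. h y r) x)"
proof -
 obtain B where B: "0 <= B" "!!y. \<bar>b y\<bar> <= B" using bbE[OF b] by blast
 have S: "\<B> (FKm b t x \<Otimes>\<^sub>M borel) = (\<B> borel2 :: ('e \<times> real => real) set)"
  by (intro measurable_cong_sets sets_pair_measure_cong) auto
 have m: "(%y. LBINT r:{0..s}. h y r) : \<B> borel"
  by (rule borel_measurable_set_integral_Icc[OF h]) auto
 have "(%y. h y r) : \<B> borel" for r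
  by (rule section_left[OF h]) simp
 hence "FK b t (%y. h y r) x = (LINT y|FKm b t x. h y r)" for r
  by (rule FK_FKm[OF bbD[OF b] t])
 thus ?thesis
  unfolding FK_FKm[OF bbD[OF b] t m]
  by (simp only:) (rule finite_Fubini_Icc[OF FKm_finite(1)[OF bbD[OF b] B(2) t, of x], unfolded S, OF h bd])
qed

text \<open>Along each path \<open>exp_set_integral\<close> expands the weight, \<open>Y s\<close>
  being the formal derivative of \<open>exp (A b s)\<close>; after Fubini the Markov property at
  time \<open>s\<close> replaces the position at time \<open>t\<close> by
  \<open>P (t - s) f\<close>.\<close>

lemma FK_duhamel:
 assumes b: "b : bounded_borel" and t: "0 <= t" and f: "f : bounded_borel"
 shows "FK b t f x = P t f x + (LBINT s:{0..t}. FK b s (%y. b y * P (t - s) f y) x)"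
proof -
 obtain B where B: "0 <= B" "!!y. \<bar>b y\<bar> <= B" using bbE[OF b] by blast
 obtain c where c: "0 <= c" "!!y. \<bar>f y\<bar> <= c" using bbE[OF f] by blast
 note bm = bbD[OF b] and fm = bbD[OF f]
 let ?M = "Pr (Some x)"
 interpret M: prob_space ?M by (rule law)
 define Y where "Y s om = at_alive b (xi (max 0 s) om) * exp (A b s om)" for s om
 define E where "E om = at_alive f (xi t om)" for om
 have id: "fst : ?M \<Otimes>\<^sub>M (borel :: real measure) \<rightarrow>\<^sub>M Nf \<infinity>"
  by (rule measurable_compose[OF measurable_fst measurable_Nf_law[of "%om. om" \<infinity>]]) simp
 have "(%z. at_alive b (xi (clamp \<infinity> (snd z)) (fst z))) : \<B> (?M \<Otimes>\<^sub>M borel)"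
  by (rule measurable_at_alive'[OF bm measurable_xi[OF measurable_snd id]])
 moreover have "(%z. A b (snd z) (fst z)) : \<B> (?M \<Otimes>\<^sub>M borel)"
  by (rule A_measurable[OF bm measurable_snd _ id]) simp
 moreover have Em: "E : \<B> ?M"
  unfolding E_def by (rule measurable_at_alive'[OF fm path_measurable[OF t]])
 ultimately have m: "(%(om, s). Y s om * E om) : \<B> (?M \<Otimes>\<^sub>M borel)"
  unfolding Y_def case_prod_beta' clamp_top
  by (intro borel_measurable_times measurable_compose[OF _ borel_measurable_exp] measurable_compose[OF measurable_fst]) simp_all
 have Yb: "\<bar>Y s om\<bar> <= B * exp (B * t)" if "0 <= s" "s <= t" "om : space W" for s om
 proof -
  have "\<bar>A b s om\<bar> <= B * s" by (rule A_bound[OF bm B(2) that(3,1)])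
  also have "... <= B * t" using that B by (intro mult_left_mono)
  finally have "exp (A b s om) <= exp (B * t)" by simp
  thus ?thesis unfolding Y_def abs_mult using at_alive_bound[of b B, OF B(2,1)] B(1)
   by (intro mult_mono) auto
 qed
 have Eb: "\<bar>E om\<bar> <= c" for om unfolding E_def by (rule at_alive_bound[OF c(2,1)])
 have e: "exp (A b t om) = 1 + (LBINT s:{0..t}. Y s om)" if om: "om : space W" for om
 proof -
  define b' where "b' s = at_alive b (xi (max 0 s) om)" for s
  have A: "A b s om = (LBINT r:{0..s}. b' r)" for s
   unfolding A_def b'_def by (intro set_integral_cong) auto
  show ?thesis
   unfolding Y_def A b'_def[symmetric]
   by (rule exp_set_integral[of b' B, OF _ _ t])
    (use at_alive_path_measurable[OF bm om] at_alive_bound[of b B, OF B(2,1)] in \<open>auto simp: b'_def[abs_def]\<close>)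
 qed
 have iE: "integrable ?M E" using Em Eb by (intro bounded_integrable)
 have YE: "\<bar>Y s om * E om\<bar> <= B * exp (B * t) * c" if "0 <= s" "s <= t" "om : space W" for s om
  unfolding abs_mult using Yb[OF that] Eb B(1) by (intro mult_mono) auto
 have iI: "integrable ?M (%om. LBINT s:{0..t}. Y s om * E om)"
 proof (rule bounded_integrable)
  show "(%om. LBINT s:{0..t}. Y s om * E om) : \<B> ?M"
   by (rule borel_measurable_set_integral_Icc[OF m]) auto
  show "\<bar>LBINT s:{0..t}. Y s om * E om\<bar> <= B * exp (B * t) * c * (t - 0)" if "om : space W" for om
   using that YE t section_right[OF m, of om] by (intro set_integral_Icc_bound) (auto simp: law)
 qed
 have "FK b t f x = (LINT om|?M. E om + (LBINT s:{0..t}. Y s om * E om))"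
  unfolding FK_eq E_def[symmetric]
  by (intro bochner_cong refl) (simp add: e law distrib_right)
 also have "... = P t f x + (LINT om|?M. (LBINT s:{0..t}. Y s om * E om))"
  by (simp only: P_eq E_def[symmetric] Bochner_Integration.integral_add[OF iE iI])
 also have "(LINT om|?M. (LBINT s:{0..t}. Y s om * E om)) = (LBINT s:{0..t}. (LINT om|?M. Y s om * E om))"
  using YE by (intro finite_Fubini_Icc[OF _ m, where C="B * exp (B * t) * c"]) (auto simp: law M.finite_measure_axioms)
 also have "... = (LBINT s:{0..t}. FK b s (%y. b y * P (t - s) f y) x)"
 proof (intro set_integral_cong allI impI)
  fix s assume "s : {0..t}"
  hence s: "0 <= s" "0 <= t - s" by auto
  have "Y s : \<B> (Nf (ennreal s))"
   unfolding Y_def using s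
   by (intro borel_measurable_times measurable_compose[OF _ borel_measurable_exp] measurable_at_alive'[OF bm]
     A_measurable[OF bm, of "%_. s", OF _ _ measurable_ident_sets[OF refl]]) (auto intro!: xi_measurable)
  from markov[OF s this Yb f, of "Some x"] s
  have "(LINT om|?M. Y s om * E om) = (LINT om|?M. Y s om * at_alive (P (t - s) f) (xi s om))"
   by (simp add: E_def)
  also have "... = FK b s (%y. b y * P (t - s) f y) x"
   unfolding FK_eq using s
   by (intro bochner_cong refl) (auto simp: Y_def at_alive_def split: option.split)
  finally show "(LINT om|?M. Y s om * E om) = FK b s (%y. b y * P (t - s) f y) x" .
 qed auto
 finally show ?thesis .
qed


lemma FK_0:
 assumes f: "f : \<B> borel"
 shows "FK b 0 f x = f x"
proof -
 have "Some x : topspace onepoint" unfolding topspace_onepoint by simp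
 from initial_state[OF this] have "AE om in Pr (Some x). at_alive f (xi 0 om) = f x"
  by eventually_elim (simp add: at_alive_def)
 hence "(LINT om|Pr (Some x). at_alive f (xi 0 om)) = (LINT om|Pr (Some x). f x)"
  by (intro integral_cong_AE measurable_at_alive'[OF f path_measurable]) auto
 moreover have "A b 0 om = 0" for om
  unfolding A_def set_lebesgue_integral_def
  using AE_lborel_singleton[of "0::real"] by (intro integral_eq_zero_AE) (auto elim!: eventually_mono)
 ultimately show ?thesis unfolding integral_law_1 by (simp add: FK_eq)
qed

lemma b_P_measurable:
 assumes b: "b : bounded_borel" and f: "f : bounded_borel"
 shows "(%(r, y). b y * P (max 0 (T - r)) f y) : \<B> borel2"
proof -
 have "(%z. P (max 0 (T - fst z)) f (snd z)) : \<B> borel2"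
  by (intro FK_measurable[where H="%_. f"]) (simp_all add: case_prod_beta' measurable_compose[OF measurable_snd bbD[OF f]])
 thus ?thesis using bbD[OF b] by (simp add: case_prod_beta')
qed

text \<open>The Markov property at hand concerns a single future position, not the additive
  functional of the future, so it does not yield the semigroup property at once. Duhamel's formula
  instead expresses the defect of \<open>f\<close> through the defects of the functions
  \<open>b * P (s - r) f\<close> at times \<open>r <= s\<close>.\<close>

lemma FK_semigroup_step:
 assumes b: "b : bounded_borel" and f: "f : bounded_borel" and s: "0 <= s" and t: "0 <= t"
 shows "FK b (t + s) f x - FK b t (FK b s f) x =
  (LBINT r:{0..s}. FK b (t + r) (%y. b y * P (s - r) f y) x - FK b t (FK b r (%y. b y * P (s - r) f y)) x)"
proof -
 obtain B where B: "0 <= B" "!!y. \<bar>b y\<bar> <= B" using bbE[OF b] by blast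
 obtain c where c: "0 <= c" "!!y. \<bar>f y\<bar> <= c" using bbE[OF f] by blast
 note bm = bbD[OF b] and fm = bbD[OF f]
 define g where "g T r y = b y * P (max 0 (T - r)) f y" for T r y
 have gm: "(%(r, y). g T r y) : \<B> borel2" for T
  unfolding g_def by (rule b_P_measurable[OF b f])
 have gmx: "g T r : \<B> borel" for T r by (rule section_right[OF gm]) simp
 have gb: "\<bar>g T r y\<bar> <= B * c" for T r y
  unfolding g_def abs_mult using B P_bound[OF _ fm c(2), of "max 0 (T - r)"] by (intro mult_mono) auto
 have gB: "g T r : bounded_borel" for T r by (rule bbI[OF gmx gb])
 have exp_le: "exp (B * r) <= exp (B * r')" if "r <= r'" for r r' using that B by (simp add: mult_left_mono)
 have Qg: "(%(r, x). FK b (max 0 r) (g T r) x) : \<B> borel2" for T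
  by (rule FK_time_measurable[OF bm gm])
 define E where "E = exp (B * (t + s)) * (B * c)"
 have Bc: "0 <= B * c" using B c by simp
 have QgE: "\<bar>FK b r (g T r') y\<bar> <= E" if "0 <= r" "r <= t + s" for r r' T y
  using FK_bound[OF bm B(2) that(1) gmx gb] exp_le[OF that(2)] Bc unfolding E_def
  by (meson mult_right_mono order_trans)
 have Qgr: "(%r. FK b (max 0 r) (g T r) y) : \<B> borel" for T y
  by (rule section_left[OF Qg]) simp
 have "FK b (t + s) f x = P (t + s) f x + (LBINT r:{0..t + s}. FK b (max 0 r) (g (t + s) r) x)"
  unfolding FK_duhamel[OF b add_nonneg_nonneg[OF t s] f, of x]
  by (intro arg_cong2[where f="(+)"] refl set_integral_cong) (auto simp: g_def[abs_def] max_def)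
 also have "(LBINT r:{0..t + s}. FK b (max 0 r) (g (t + s) r) x) =
  (LBINT r:{0..t}. FK b (max 0 r) (g (t + s) r) x) + (LBINT r:{t..t + s}. FK b (max 0 r) (g (t + s) r) x)"
  using s t QgE by (intro set_integral_Icc_split[OF Qgr, where C=E]) auto
 also have "(LBINT r:{t..t + s}. FK b (max 0 r) (g (t + s) r) x) = (LBINT r:{0..s}. FK b (t + r) (g s r) x)"
  unfolding set_integral_Icc_shift using t by (intro set_integral_cong) (auto simp: g_def[abs_def])
 finally have 1: "FK b (t + s) f x = P (t + s) f x + ((LBINT r:{0..t}. FK b (max 0 r) (g (t + s) r) x) + (LBINT r:{0..s}. FK b (t + r) (g s r) x))" .
 have P_s: "P s f : bounded_borel" by (rule FK_bounded_borel[OF _ s f]) (auto intro: bbI[of _ 0])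
 define I where "I y = (LBINT r:{0..s}. FK b (max 0 r) (g s r) y)" for y
 have Iy: "FK b s f y = 1 * P s f y + 1 * I y" for y
  unfolding I_def FK_duhamel[OF b s f, of y] mult_1
  by (intro arg_cong2[where f="(+)"] refl set_integral_cong) (auto simp: g_def[abs_def])
 have Qgs: "(%(y, r). FK b (max 0 r) (g s r) y) : \<B> borel2"
  using measurable_pair_swap[OF Qg[of s]] by (simp add: case_prod_beta')
 have IB: "I : bounded_borel"
 proof (rule bbI)
  show "I : \<B> borel" unfolding I_def by (rule borel_measurable_set_integral_Icc[OF Qgs]) auto
  show "\<bar>I y\<bar> <= E * (s - 0)" for y unfolding I_def using QgE s t by (intro set_integral_Icc_bound Qgr) auto
 qed
 have "FK b t (FK b s f) x = FK b t (P s f) x + FK b t I x"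
  unfolding Iy[abs_def] FK_linear[OF b t P_s IB] by simp
 also have "FK b t I x = (LBINT r:{0..s}. FK b t (FK b (max 0 r) (g s r)) x)"
  unfolding I_def using QgE t by (intro FK_Fubini[OF b t Qgs, where C=E]) auto
 also have "... = (LBINT r:{0..s}. FK b t (FK b r (g s r)) x)"
  by (intro set_integral_cong) auto
 also have "FK b t (P s f) x = P (t + s) f x + (LBINT r:{0..t}. FK b (max 0 r) (g (t + s) r) x)"
  unfolding FK_duhamel[OF b t P_s, of x] P_semigroup[OF t s f]
 proof (intro arg_cong2[where f="(+)"] refl set_integral_cong allI impI)
  fix r assume "r : {0..t}"
  hence r: "0 <= r" "0 <= t - r" by auto
  have "P (t - r) (P s f) y = P (t + s - r) f y" for y
   using P_semigroup[OF r(2) s f, of y] by (simp add: algebra_simps)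
  thus "FK b r (%y. b y * P (t - r) (P s f) y) x = FK b (max 0 r) (g (t + s) r) x"
   using r s by (simp add: g_def[abs_def])
 qed auto
 finally have 2: "FK b t (FK b s f) x = P (t + s) f x + (LBINT r:{0..t}. FK b (max 0 r) (g (t + s) r) x) + (LBINT r:{0..s}. FK b t (FK b r (g s r)) x)" .
 have "FK b (t + s) f x - FK b t (FK b s f) x = (LBINT r:{0..s}. FK b (t + r) (g s r) x) - (LBINT r:{0..s}. FK b t (FK b r (g s r)) x)"
  using 1 2 by simp
 also have "... = (LBINT r:{0..s}. FK b (t + r) (g s r) x - FK b t (FK b r (g s r)) x)"
 proof (rule set_integral_diff(2)[symmetric])
  have "(%r. FK b (max 0 (t + max 0 r)) (g s r) x) : \<B> borel"
   by (rule FK_measurable[OF bm _ gm]) auto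
  hence "set_integrable lborel {0..s} (%r. FK b (max 0 (t + max 0 r)) (g s r) x)"
  proof (rule set_integrable_Icc_bounded)
   show "\<bar>FK b (max 0 (t + max 0 r)) (g s r) x\<bar> <= E" if "0 <= r" "r <= s" for r
    using QgE[of "t + r" s r x] that t by (simp add: max_def)
  qed
  thus "set_integrable lborel {0..s} (%r. FK b (t + r) (g s r) x)"
   by (rule set_integrable_cong[THEN iffD1, rotated -1]) (use t in auto)
  have "(%r. FK b (max 0 t) (FK b (max 0 r) (g s r)) x) : \<B> borel"
   by (rule FK_measurable[OF bm _ Qg]) auto
  hence "set_integrable lborel {0..s} (%r. FK b (max 0 t) (FK b (max 0 r) (g s r)) x)"
  proof (rule set_integrable_Icc_bounded)
   show "\<bar>FK b (max 0 t) (FK b (max 0 r) (g s r)) x\<bar> <= exp (B * t) * E" if "0 <= r" "r <= s" for r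
    using FK_bound[OF bm B(2) t, of "FK b r (g s r)" E x] QgE[of r s] that t bbD[OF FK_bounded_borel[OF b that(1) gB]]
    by (simp add: max_def)
  qed
  thus "set_integrable lborel {0..s} (%r. FK b t (FK b r (g s r)) x)"
   by (rule set_integrable_cong[THEN iffD1, rotated -1]) (use t in auto)
 qed
 also have "... = (LBINT r:{0..s}. FK b (t + r) (%y. b y * P (s - r) f y) x - FK b t (FK b r (%y. b y * P (s - r) f y)) x)"
  by (intro set_integral_cong) (auto simp: g_def[abs_def])
 finally show ?thesis .
qed


text \<open>Each use of the defect identity gains the factor \<open>B * s\<close>, so for
  \<open>B * s < 1\<close> iteration forces the defect to vanish.\<close>

lemma FK_semigroup_small:
 assumes b: "b : bounded_borel" "!!y. \<bar>b y\<bar> <= B" and s: "0 <= s" "B * s < 1" and t: "0 <= t" and f: "f : bounded_borel"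
 shows "FK b (t + s) f x = FK b t (FK b s f) x"
proof -
 note bm = bbD[OF b(1)]
 have B: "0 <= B" using b(2)[of undefined] by linarith
 define C where "C = 2 * exp (B * (t + s))"
 have it: "\<bar>FK b (t + r) g x - FK b t (FK b r g) x\<bar> <= (B * s) ^ n * C * c"
  if "0 <= r" "r <= s" "g : bounded_borel" "!!y. \<bar>g y\<bar> <= c" for n r g c
  using that
 proof (induction n arbitrary: r g c)
  case 0
  note gm = bbD[OF 0(3)]
  have c: "0 <= c" using 0(4)[of undefined] by linarith
  have e: "exp (B * (t + r)) * c <= exp (B * (t + s)) * c"
   using B 0 c by (intro mult_right_mono) (auto intro: mult_left_mono)
  have "\<bar>FK b (t + r) g x\<bar> <= exp (B * (t + r)) * c"
   using t 0 by (intro FK_bound[OF bm b(2) _ gm 0(4)]) auto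
  moreover have "\<bar>FK b t (FK b r g) x\<bar> <= exp (B * t) * (exp (B * r) * c)"
   by (intro FK_bound[OF bm b(2) t] bbD[OF FK_bounded_borel[OF b(1) 0(1,3)]] FK_bound[OF bm b(2) 0(1) gm 0(4)])
  moreover have "exp (B * t) * (exp (B * r) * c) = exp (B * (t + r)) * c"
   by (simp add: distrib_left exp_add)
  ultimately show ?case using e unfolding C_def by (simp add: abs_le_iff)
 next
  case (Suc n)
  note gm = bbD[OF Suc.prems(3)]
  have c: "0 <= c" using Suc.prems(4)[of undefined] by linarith
  define g' where "g' u y = b y * P (max 0 (r - u)) g y" for u y
  have g'm: "(%(u, y). g' u y) : \<B> borel2"
   unfolding g'_def by (rule b_P_measurable[OF b(1) Suc.prems(3)])
  have g'b: "\<bar>g' u y\<bar> <= B * c" for u y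
   unfolding g'_def abs_mult using B b(2) P_bound[OF _ gm Suc.prems(4), of "max 0 (r - u)"] by (intro mult_mono) auto
  have g'B: "g' u : bounded_borel" for u
   by (rule bbI[OF _ g'b]) (rule section_right[OF g'm], simp)
  have "(%u. FK b (max 0 (t + max 0 u)) (g' u) x) : \<B> borel"
   by (rule FK_measurable[OF bm _ g'm]) auto
  moreover have "(%u. FK b (max 0 t) (FK b (max 0 u) (g' u)) x) : \<B> borel"
   by (rule FK_measurable[OF bm _ FK_time_measurable[OF bm g'm]]) auto
  ultimately have m: "(%u. FK b (max 0 (t + max 0 u)) (g' u) x - FK b (max 0 t) (FK b (max 0 u) (g' u)) x) : \<B> borel"
   by (rule borel_measurable_diff)
  have "FK b (t + r) g x - FK b t (FK b r g) x =
   (LBINT u:{0..r}. FK b (max 0 (t + max 0 u)) (g' u) x - FK b (max 0 t) (FK b (max 0 u) (g' u)) x)"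
   unfolding FK_semigroup_step[OF b(1) Suc.prems(3,1) t] using t
   by (intro set_integral_cong) (auto simp: g'_def[abs_def] max_def)
  moreover have "\<bar>LBINT u:{0..r}. FK b (max 0 (t + max 0 u)) (g' u) x - FK b (max 0 t) (FK b (max 0 u) (g' u)) x\<bar>
   <= ((B * s) ^ n * C * (B * c)) * (r - 0)"
  proof (rule set_integral_Icc_bound[OF m])
   show "\<bar>FK b (max 0 (t + max 0 u)) (g' u) x - FK b (max 0 t) (FK b (max 0 u) (g' u)) x\<bar> <= (B * s) ^ n * C * (B * c)"
    if "0 <= u" "u <= r" for u
    using Suc.IH[OF that(1) _ g'B g'b, of u] that Suc.prems(2) t by (simp add: max_def)
  qed (use Suc.prems in simp)
  moreover have "((B * s) ^ n * C * (B * c)) * (r - 0) <= ((B * s) ^ n * C * (B * c)) * s"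
   using B c s Suc.prems(2) by (intro mult_left_mono) (auto simp: C_def)
  ultimately show ?case by (simp add: mult_ac)
 qed
 obtain c where c: "0 <= c" "!!y. \<bar>f y\<bar> <= c" using bbE[OF f] by blast
 have "(%n. (B * s) ^ n * C * c) ----> 0 * C * c"
  using B s by (intro tendsto_mult tendsto_const LIMSEQ_power_zero) auto
 moreover have "\<bar>FK b (t + s) f x - FK b t (FK b s f) x\<bar> <= (B * s) ^ n * C * c" for n
  using it[OF s(1) order_refl f c(2)] .
 ultimately have "\<bar>FK b (t + s) f x - FK b t (FK b s f) x\<bar> <= 0 * C * c"
  by (intro LIMSEQ_le_const) auto
 thus ?thesis by simp
qed

text \<open>A long time is cut into pieces that are short enough for
  \<open>FK_semigroup_small\<close>.\<close>

lemma FK_semigroup: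
 assumes b: "b : bounded_borel" and s: "0 <= s" and t: "0 <= t" and f: "f : bounded_borel"
 shows "FK b (t + s) f x = FK b t (FK b s f) x"
proof -
 obtain B where B: "0 <= B" "!!y. \<bar>b y\<bar> <= B" using bbE[OF b] by blast
 obtain N :: nat where N: "B * s < real N" using reals_Archimedean2 by blast
 hence N0: "0 < real N" using B s by (intro le_less_trans[OF _ N]) auto
 define d where "d = s / real N"
 have d: "0 <= d" "B * d < 1" using N N0 s by (auto simp: d_def field_simps)
 have "FK b (t + real k * d) f x = FK b t (FK b (real k * d) f) x" if "0 <= t" "f : bounded_borel" for k t f x
  using that
 proof (induction k arbitrary: f)
  case 0
  have "FK b 0 f = f" using FK_0[OF bbD[OF 0(2)]] by (rule ext)
  thus ?case by simp
 next
  case (Suc k)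
  have kd: "0 <= real k * d" using d by simp
  have 1: "FK b d f : bounded_borel" by (rule FK_bounded_borel[OF b d(1) Suc.prems(2)])
  have "FK b (t + real k * d + d) f x = FK b (t + real k * d) (FK b d f) x"
   using Suc.prems kd by (intro FK_semigroup_small[OF b B(2) d]) auto
  also have "... = FK b t (FK b (real k * d) (FK b d f)) x" by (rule Suc.IH[OF Suc.prems(1) 1])
  also have "FK b (real k * d) (FK b d f) = FK b (real k * d + d) f"
   by (intro ext FK_semigroup_small[symmetric, OF b B(2) d kd Suc.prems(2)])
  finally show ?case by (simp add: algebra_simps)
 qed
 from this[OF t f, of N x] show ?thesis using N0 by (simp add: d_def)
qed

text \<open>Change of the reference semigroup: moving the potential into the semigroup subtracts
  \<open>b * v\<close> from the source. It is applied to a source that contains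
  \<open>b * v\<close>, which then disappears. The source is a given bounded function of time and
  place, so the statement is a linear one.\<close>

lemma duhamel_transfer:
 fixes h :: "real => 'e => real"
 assumes b: "b : bounded_borel" and f: "f : bounded_borel" and t: "0 <= t"
  and h: "(%(r, y). h r y) : \<B> borel2" "!!r y. \<bar>h r y\<bar> <= C"
  and v: "!!u y. 0 <= u ==> u <= t ==> v u y = P u f y + (LBINT s:{0..u}. P s (h (u - s)) y)"
 shows "v t x = FK b t f x + (LBINT s:{0..t}. FK b s (%y. h (t - s) y - b y * v (t - s) y) x)"
proof -
 obtain B where B: "0 <= B" "!!y. \<bar>b y\<bar> <= B" using bbE[OF b] by blast
 note bm = bbD[OF b] and fm = bbD[OF f]
 have C: "0 <= C" using h(2)[of undefined undefined] by linarith
 have z: "(%_. 0) : bounded_borel" by (auto intro: bbI[of _ 0])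
 have hm: "h r : \<B> borel" for r by (rule section_right[OF h(1)]) simp
 have hB: "h r : bounded_borel" for r by (rule bbI[OF hm h(2)])
 define k where "k r u y = b y * P (max 0 u) (h (t - r - u)) y" for r u y
 have "(%z. h (t - fst (fst (fst z)) - snd (fst (fst z))) (snd z)) : \<B> ((borel2 \<Otimes>\<^sub>M borel) \<Otimes>\<^sub>M borel)"
  by (rule curried_compose[OF h(1)]) measurable
 hence Pm: "(%z. P (max 0 (snd (fst z))) (h (t - fst (fst z) - snd (fst z))) (snd z)) : \<B> (borel2 \<Otimes>\<^sub>M borel)"
  by (intro FK_measurable[where H="%z. h (t - fst (fst z) - snd (fst z))"]) (simp_all add: case_prod_beta')
 hence km: "(%z. k (fst (fst z)) (snd (fst z)) (snd z)) : \<B> (borel2 \<Otimes>\<^sub>M borel)"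
  unfolding k_def by (intro borel_measurable_times measurable_compose[OF measurable_snd bm])
 have kb: "\<bar>k r u y\<bar> <= B * C" for r u y
  unfolding k_def abs_mult using B P_bound[OF _ hm h(2), of "max 0 u"] C by (intro mult_mono) auto
 have kmx: "k r u : \<B> borel" for r u
  using measurable_compose[OF measurable_Pair1'[of "(r, u)" "borel \<Otimes>\<^sub>M borel"] km] by (simp add: space_pair_measure)
 have kB: "k r u : bounded_borel" for r u by (rule bbI[OF kmx kb])
 define E where "E = exp (B * t)"
 have Eb: "\<bar>FK b r g y\<bar> <= E * c" if "0 <= r" "r <= t" "g : bounded_borel" "!!y. \<bar>g y\<bar> <= c" for r g c y
 proof -
  have "0 <= c" using that(4)[of undefined] by linarith
  hence "exp (B * r) * c <= E * c" unfolding E_def using B that by (intro mult_right_mono) (auto intro: mult_left_mono)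
  thus ?thesis using FK_bound[OF bm B(2) that(1) bbD[OF that(3)] that(4), of y] by linarith
 qed
 define g where "g r u = FK b (max 0 r) (k r u) x" for r u
 have gm: "(%(r, u). g r u) : \<B> borel2"
  using FK_measurable[OF bm, of fst "borel \<Otimes>\<^sub>M borel" "%z. k (fst z) (snd z)" "%_. x"] km
  by (simp add: g_def case_prod_beta')
 have gb: "\<bar>g r u\<bar> <= E * (B * C)" if "0 <= r" "r <= t" for r u
  unfolding g_def using Eb[OF that kB kb] that by (simp add: max_def)
 \<comment> \<open>\<open>J1\<close> and \<open>J2\<close> are the source under \<open>FK\<close>
   and \<open>P\<close>, related by Duhamel's formula with the remainder \<open>J3\<close>;
   \<open>J4\<close> is the remainder for \<open>f\<close>, and \<open>J5\<close> is
   \<open>J3\<close> with the triangle traversed in the other order.\<close>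
 define J1 J2 J3 J4 J5 where
  "J1 s = FK b (max 0 s) (h (t - s)) x" and "J2 s = P (max 0 s) (h (t - s)) x"
  and "J3 s = (LBINT r:{0..s}. g r (s - r))"
  and "J4 s = FK b (max 0 s) (%y. b y * P (max 0 (t - s)) f y) x"
  and "J5 s = (LBINT u:{0..t - s}. g s u)" for s
 have htm: "(%(r, y). h (t - r) y) : \<B> borel2"
  unfolding case_prod_beta' by (rule curried_compose[OF h(1)]) measurable
 have i1: "set_integrable lborel {0..t} J1"
 proof (rule set_integrable_Icc_bounded)
  show "J1 : \<B> borel" unfolding J1_def by (rule section_left[OF FK_time_measurable[OF bm htm]]) simp
  show "\<bar>J1 s\<bar> <= E * C" if "0 <= s" "s <= t" for s unfolding J1_def using Eb[OF that hB h(2)] that by (simp add: max_def)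
 qed
 have i2: "set_integrable lborel {0..t} J2"
 proof (rule set_integrable_Icc_bounded)
  show "J2 : \<B> borel" unfolding J2_def by (rule section_left[OF FK_time_measurable[OF _ htm]]) simp_all
  show "\<bar>J2 s\<bar> <= C" for s unfolding J2_def by (rule P_bound[OF _ hm h(2)]) simp
 qed
 have i3: "set_integrable lborel {0..t} J3"
 proof (rule set_integrable_Icc_bounded)
  have "(%(s, r). g r (s - r)) : \<B> borel2"
   unfolding case_prod_beta' by (rule curried_compose[OF gm]) measurable
  thus "J3 : \<B> borel" unfolding J3_def by (rule borel_measurable_set_integral_Icc) auto
  show "\<bar>J3 s\<bar> <= E * (B * C) * t" if "0 <= s" "s <= t" for s
  proof -
   have "(%r. g r (s - r)) : \<B> borel" by (rule curried_compose[OF gm]) measurable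
   hence "\<bar>J3 s\<bar> <= E * (B * C) * (s - 0)" unfolding J3_def using gb that by (intro set_integral_Icc_bound) auto
   also have "... <= E * (B * C) * t" using that B C by (intro mult_left_mono) (auto simp: E_def)
   finally show ?thesis .
  qed
 qed
 have bPb: "\<bar>b y * P (max 0 (t - s)) f y\<bar> <= B * c" if "!!y. \<bar>f y\<bar> <= c" for c s y
  unfolding abs_mult using B P_bound[OF _ fm that, of "max 0 (t - s)"] by (intro mult_mono) auto
 have bPB: "(%y. b y * P (max 0 (t - s)) f y) : bounded_borel" for s
 proof -
  obtain c where c: "0 <= c" "!!y. \<bar>f y\<bar> <= c" using bbE[OF f] by blast
  show ?thesis by (rule bbI[OF _ bPb[OF c(2)]]) (rule section_right[OF b_P_measurable[OF b f]], simp)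
 qed
 have i4: "set_integrable lborel {0..t} J4"
 proof -
  obtain c where c: "0 <= c" "!!y. \<bar>f y\<bar> <= c" using bbE[OF f] by blast
  show ?thesis
  proof (rule set_integrable_Icc_bounded)
   show "J4 : \<B> borel" unfolding J4_def
    by (rule section_left[OF FK_time_measurable[OF bm b_P_measurable[OF b f]]]) simp
   show "\<bar>J4 s\<bar> <= E * (B * c)" if "0 <= s" "s <= t" for s
    unfolding J4_def using Eb[OF that bPB[of s] bPb[OF c(2)], of x] that by (simp add: max_def)
  qed
 qed
 have i5: "set_integrable lborel {0..t} J5"
 proof (rule set_integrable_Icc_bounded)
  show "J5 : \<B> borel" unfolding J5_def by (rule borel_measurable_set_integral_Icc[OF gm]) auto
  show "\<bar>J5 s\<bar> <= E * (B * C) * t" if "0 <= s" "s <= t" for s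
  proof -
   have "g s : \<B> borel" by (rule section_right[OF gm]) simp
   hence "\<bar>J5 s\<bar> <= E * (B * C) * (t - s - 0)" unfolding J5_def using gb that by (intro set_integral_Icc_bound) auto
   also have "... <= E * (B * C) * t" using that B C by (intro mult_left_mono) (auto simp: E_def)
   finally show ?thesis .
  qed
 qed
 have 1: "J1 s = J2 s + J3 s" if "0 <= s" "s <= t" for s
  unfolding J1_def J2_def J3_def g_def k_def using that
  by (simp add: FK_duhamel[OF b that(1) hB]) (intro set_integral_cong, auto)
 have "(LBINT s:{0..t}. J1 s) = (LBINT s:{0..t}. J2 s + J3 s)"
  by (intro set_integral_cong) (auto simp: 1)
 also have "... = (LBINT s:{0..t}. J2 s) + (LBINT s:{0..t}. J3 s)" by (rule set_integral_add(2)[OF i2 i3])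
 also have "(LBINT s:{0..t}. J3 s) = (LBINT s:{0..t}. J5 s)"
  unfolding J3_def J5_def by (rule triangle_Fubini[OF gm, where C="E * (B * C)"]) (intro gb, auto)
 finally have A1: "(LBINT s:{0..t}. J1 s) = (LBINT s:{0..t}. J2 s) + (LBINT s:{0..t}. J5 s)" .
 have A2: "(LBINT s:{0..t}. J2 s) = v t x - P t f x"
  unfolding v[OF t order_refl] J2_def by (simp, intro set_integral_cong) auto
 have A3: "FK b t f x = P t f x + (LBINT s:{0..t}. J4 s)"
  unfolding FK_duhamel[OF b t f, of x] J4_def
  by (intro arg_cong2[where f="(+)"] refl set_integral_cong) auto
 have eq: "FK b s (%y. h (t - s) y - b y * v (t - s) y) x = J1 s - (J4 s + J5 s)" if "0 <= s" "s <= t" for s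
 proof -
  define I where "I y = (LBINT u:{0..t - s}. k s u y)" for y
  have kys: "(%(y, u). k s u y) : \<B> borel2"
  proof -
   have "(%z. ((s, snd z), fst z)) : (borel :: 'e measure) \<Otimes>\<^sub>M borel \<rightarrow>\<^sub>M (borel2 \<Otimes>\<^sub>M borel)" by measurable
   from measurable_compose[OF this km] show ?thesis by (simp add: case_prod_beta')
  qed
  have IB: "I : bounded_borel"
  proof (rule bbI)
   show "I : \<B> borel" unfolding I_def by (rule borel_measurable_set_integral_Icc[OF kys]) auto
   have "(%u. k s u y) : \<B> borel" for y by (rule section_right[OF kys]) simp
   thus "\<bar>I y\<bar> <= B * C * (t - s - 0)" for y unfolding I_def using kb that by (intro set_integral_Icc_bound) auto
  qed
  have Iy: "b y * v (t - s) y = b y * P (max 0 (t - s)) f y + I y" for y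
  proof -
   have "b y * (LBINT u:{0..t - s}. P u (h (t - s - u)) y) = I y"
    unfolding I_def k_def set_integral_mult_right[symmetric] by (intro set_integral_cong) auto
   moreover have "0 <= t - s" "t - s <= t" using that by auto
   ultimately show ?thesis using that by (simp add: v distrib_left)
  qed
  have "FK b s (%y. h (t - s) y - b y * v (t - s) y) x =
   FK b s (%y. 1 * h (t - s) y + (- 1) * (1 * (b y * P (max 0 (t - s)) f y) + 1 * I y)) x"
  proof (intro arg_cong[where f="%g. FK b s g x"] ext)
   show "h (t - s) y - b y * v (t - s) y = 1 * h (t - s) y + (- 1) * (1 * (b y * P (max 0 (t - s)) f y) + 1 * I y)" for y
    unfolding Iy mult_1 mult_minus1 by (rule diff_conv_add_uminus)
  qed
  also have "... = 1 * FK b s (h (t - s)) x + (- 1) * FK b s (%y. 1 * (b y * P (max 0 (t - s)) f y) + 1 * I y) x"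
  proof (rule FK_linear[OF b that(1) hB])
   obtain c where c: "0 <= c" "!!y. \<bar>b y * P (max 0 (t - s)) f y\<bar> <= c" using bbE[OF bPB] by blast
   obtain d where d: "0 <= d" "!!y. \<bar>I y\<bar> <= d" using bbE[OF IB] by blast
   show "(%y. 1 * (b y * P (max 0 (t - s)) f y) + 1 * I y) : bounded_borel"
   proof (rule bbI[where C="c + d"])
    show "(%y. 1 * (b y * P (max 0 (t - s)) f y) + 1 * I y) : \<B> borel"
     using bbD[OF bPB[of s]] bbD[OF IB] by simp
    show "\<bar>1 * (b y * P (max 0 (t - s)) f y) + 1 * I y\<bar> <= c + d" for y
     using c(2)[of y] d(2)[of y] by linarith
   qed
  qed
  also have "FK b s (%y. 1 * (b y * P (max 0 (t - s)) f y) + 1 * I y) x = 1 * J4 s + 1 * FK b s I x"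
   unfolding FK_linear[OF b that(1) bPB IB] J4_def using that by (simp add: max_def)
  also have "FK b s I x = J5 s"
   unfolding I_def J5_def g_def using that by (subst FK_Fubini[OF b that(1) kys kb]) (simp add: max_def)
  finally show ?thesis using that by (simp add: J1_def)
 qed
 have "(LBINT s:{0..t}. FK b s (%y. h (t - s) y - b y * v (t - s) y) x) = (LBINT s:{0..t}. J1 s - (J4 s + J5 s))"
  by (intro set_integral_cong) (auto simp: eq)
 also have "... = (LBINT s:{0..t}. J1 s) - ((LBINT s:{0..t}. J4 s) + (LBINT s:{0..t}. J5 s))"
  unfolding set_integral_diff(2)[OF i1 set_integral_add(1)[OF i4 i5]] set_integral_add(2)[OF i4 i5] ..
 finally show ?thesis using A1 A2 A3 by simp
qed

end

section \<open>Mild solutions rewritten with the Feynman-Kac semigroup\<close>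

context motion
begin

context
 fixes b ka ga f :: "'e => real" and v :: "real => 'e => real"
 assumes b: "b : bounded_borel" and ka: "ka : bounded_borel" "!!y. 0 <= ka y"
  and ga: "ga : \<B> borel" "!!y. 1 < ga y" "!!y. ga y < 2"
  and f: "f : bounded_borel"
  and mild: "mild_solution xi Pr (stable_branching b ka ga) f v"
begin

lemma mild_measurable: "(%(t, x). v (max 0 t) x) : \<B> borel2"
proof -
 have v: "(%(t, x). v t x) : \<B> (restrict_space borel {0..} \<Otimes>\<^sub>M borel)"
  using mild unfolding mild_solution_def by (rule conjunct1)
 have "(%z. max 0 (fst z)) : (borel \<Otimes>\<^sub>M (borel :: 'e measure)) \<rightarrow>\<^sub>M restrict_space borel {0::real..}"
  by (rule measurable_restrict_space2) auto
 from curried_compose[OF v this measurable_snd] show ?thesis by (simp add: case_prod_beta')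
qed

lemma mild_nonneg: "0 <= t ==> 0 <= v t x"
 using mild unfolding mild_solution_def by blast

lemma mild_locally_bounded:
 assumes "0 <= T"
 obtains C where "1 <= C" "!!t x. 0 <= t ==> t <= T ==> v t x <= C"
proof -
 obtain C where "\<forall>t\<in>{0..T}. \<forall>x. v t x <= C"
  using mild assms unfolding mild_solution_def by blast
 thus ?thesis by (intro that[of "max 1 C"]) (auto intro: max.coboundedI2)
qed

lemma mild_eq:
 "0 <= t ==> v t x + (LINT om|Pr (Some x). (LBINT s:{0..t}. at_alive (%y. stable_branching b ka ga y (v (t - s) y)) (xi s om))) = P t f x"
 using mild unfolding mild_solution_def P_motion by blast

text \<open>Mild solutions are bounded on bounded time intervals only; freezing time outside
  \<open>[0, T]\<close> gives a bounded, jointly measurable function on all reals.\<close>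

definition cut :: "real => real => 'e => real" where
 "cut T r y = v (max 0 (min T r)) y"

lemma cut_eq: "0 <= r ==> r <= T ==> cut T r y = v r y"
 by (simp add: cut_def)

lemma cut_measurable: "(%(r, y). cut T r y) : \<B> borel2"
proof -
 have "(%z. v (max 0 (min T (fst z))) (snd z)) : \<B> borel2"
  by (rule curried_compose[OF mild_measurable]) measurable
 thus ?thesis by (simp add: cut_def case_prod_beta')
qed

lemma cut_bound:
 assumes "0 <= T"
 obtains C where "1 <= C" "!!r y. 0 <= cut T r y \<and> cut T r y <= C"
proof -
 obtain C where C: "1 <= C" "!!t x. 0 <= t ==> t <= T ==> v t x <= C" using mild_locally_bounded[OF assms] by blast
 show ?thesis by (rule that[OF C(1)]) (use assms C(2) mild_nonneg in \<open>auto simp: cut_def\<close>)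
qed

definition cutN :: "real => real => 'e => real" where
 "cutN T r y = ka y * cut T r y powr ga y"

lemma cutN_measurable: "(%(r, y). cutN T r y) : \<B> borel2"
proof -
 have [measurable]: "(%z. cut T (fst z) (snd z)) : \<B> (borel \<Otimes>\<^sub>M (borel :: 'e measure))"
  using cut_measurable by (simp add: case_prod_beta')
 have [measurable]: "(%z. ka (snd z)) : \<B> (borel \<Otimes>\<^sub>M (borel :: 'e measure))"
  "(%z. ga (snd z)) : \<B> (borel \<Otimes>\<^sub>M (borel :: 'e measure))"
  by (rule measurable_compose[OF measurable_snd bbD[OF ka(1)]], rule measurable_compose[OF measurable_snd ga(1)])
 show ?thesis unfolding cutN_def case_prod_beta' by measurable
qed

lemma cutN_bound:
 assumes "0 <= T"
 obtains C where "0 <= C" "!!r y. 0 <= cutN T r y" "!!r y. cutN T r y <= C"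
proof -
 obtain C where C: "1 <= C" "!!r y. 0 <= cut T r y \<and> cut T r y <= C" using cut_bound[OF assms] by blast
 obtain K where K: "0 <= K" "!!y. \<bar>ka y\<bar> <= K" using bbE[OF ka(1)] by blast
 have "cut T r y powr ga y <= C powr 2" for r y
 proof -
  have "cut T r y powr ga y <= C powr ga y" using C ga(2)[of y] by (intro powr_mono2) auto
  also have "... <= C powr 2" using C ga(3)[of y] by (intro powr_mono) auto
  finally show ?thesis .
 qed
 moreover have "ka y <= K" for y using K(2)[of y] by linarith
 ultimately have "cutN T r y <= K * C powr 2" for r y
  unfolding cutN_def using ka(2) K by (intro mult_mono) auto
 thus ?thesis using ka(2) K by (intro that[of "K * C powr 2"]) (auto simp: cutN_def)
qed

text \<open>The mild equation is one for the motion with source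
  \<open>b * v - ka * v powr ga\<close>; \<open>duhamel_transfer\<close> removes the linear part,
  and \<open>cut\<close> supplies a bounded source up to time \<open>t\<close>.\<close>

lemma mild_feynman_kac:
 assumes t: "0 <= t"
 shows "v t x + (LBINT s:{0..t}. FK b s (%y. ka y * v (t - s) y powr ga y) x) = FK b t f x"
proof -
 obtain B where B: "0 <= B" "!!y. \<bar>b y\<bar> <= B" using bbE[OF b] by blast
 obtain C where C: "1 <= C" "!!r y. 0 <= cut t r y \<and> cut t r y <= C" using cut_bound[OF t] by blast
 obtain D where D: "0 <= D" "!!r y. 0 <= cutN t r y" "!!r y. cutN t r y <= D" using cutN_bound[OF t] by blast
 define h where "h r y = b y * cut t r y - cutN t r y" for r y
 have hm: "(%(r, y). h r y) : \<B> borel2"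
  unfolding h_def case_prod_beta'
  using cut_measurable cutN_measurable measurable_compose[OF measurable_snd bbD[OF b]]
  by (intro borel_measurable_diff borel_measurable_times) (simp_all add: case_prod_beta')
 have hb: "\<bar>h r y\<bar> <= B * C + D" for r y
 proof -
  have "\<bar>b y * cut t r y\<bar> <= B * C" unfolding abs_mult using B C by (intro mult_mono) auto
  thus ?thesis unfolding h_def using D(2,3)[of r y] by linarith
 qed
 have v: "v u y = P u f y + (LBINT s:{0..u}. P s (h (u - s)) y)" if u: "0 <= u" "u <= t" for u y
 proof -
  interpret Pr: prob_space "Pr (Some y)" by (rule law)
  have id: "fst : Pr (Some y) \<Otimes>\<^sub>M (borel :: real measure) \<rightarrow>\<^sub>M Nf \<infinity>"
   by (rule measurable_compose[OF measurable_fst measurable_Nf_law[of "%om. om" \<infinity>]]) simp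
  have "(%z. h (u - snd (fst z)) (snd z)) : \<B> ((Pr (Some y) \<Otimes>\<^sub>M borel) \<Otimes>\<^sub>M borel)"
   by (rule curried_compose[OF hm]) measurable
  hence "(%z. at_alive (h (u - snd z)) (xi (clamp \<infinity> (snd z)) (fst z))) : \<B> (Pr (Some y) \<Otimes>\<^sub>M borel)"
   by (intro measurable_at_alive[where f="%z. h (u - snd z)" and g="%z. z", OF _ measurable_ident_sets[OF refl] measurable_xi[OF measurable_snd id]])
    (simp add: case_prod_beta')
  hence m: "(%(om, s). at_alive (h (u - s)) (xi (max 0 s) om)) : \<B> (Pr (Some y) \<Otimes>\<^sub>M borel)"
   by (simp add: clamp_top case_prod_beta')
  have "(LINT om|Pr (Some y). (LBINT s:{0..u}. at_alive (%y. stable_branching b ka ga y (v (u - s) y)) (xi s om)))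
   = (LINT om|Pr (Some y). - (LBINT s:{0..u}. at_alive (h (u - s)) (xi (max 0 s) om)))"
  proof (intro bochner_cong refl)
   fix om
   have "at_alive (%y. stable_branching b ka ga y (v (u - s) y)) (xi s om) = - at_alive (h (u - s)) (xi (max 0 s) om)" if "s : {0..u}" for s
    using that u by (cases "xi s om") (auto simp: at_alive_def stable_branching_def h_def cutN_def cut_eq)
   hence "(LBINT s:{0..u}. at_alive (%y. stable_branching b ka ga y (v (u - s) y)) (xi s om)) =
    (LBINT s:{0..u}. - at_alive (h (u - s)) (xi (max 0 s) om))"
    by (intro set_integral_cong) auto
   thus "(LBINT s:{0..u}. at_alive (%y. stable_branching b ka ga y (v (u - s) y)) (xi s om)) =
    - (LBINT s:{0..u}. at_alive (h (u - s)) (xi (max 0 s) om))"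
    by (simp add: set_lebesgue_integral_def)
  qed
  also have "... = - (LINT om|Pr (Some y). (LBINT s:{0..u}. at_alive (h (u - s)) (xi (max 0 s) om)))" by simp
  also have "(LINT om|Pr (Some y). (LBINT s:{0..u}. at_alive (h (u - s)) (xi (max 0 s) om))) =
   (LBINT s:{0..u}. (LINT om|Pr (Some y). at_alive (h (u - s)) (xi (max 0 s) om)))"
  proof (rule finite_Fubini_Icc[OF Pr.finite_measure_axioms m])
   have "0 <= B * C + D" using B C D by simp
   thus "\<bar>at_alive (h (u - r)) (xi (max 0 r) om)\<bar> <= B * C + D" for om r by (intro at_alive_bound hb)
  qed
  also have "... = (LBINT s:{0..u}. P s (h (u - s)) y)"
   by (intro set_integral_cong) (auto simp: P_eq)
  finally show ?thesis using mild_eq[OF u(1), of y] by linarith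
 qed
 have "v t x = FK b t f x + (LBINT s:{0..t}. FK b s (%y. h (t - s) y - b y * v (t - s) y) x)"
  by (rule duhamel_transfer[OF b f t hm hb v])
 also have "(LBINT s:{0..t}. FK b s (%y. h (t - s) y - b y * v (t - s) y) x) =
  (LBINT s:{0..t}. - FK b s (%y. ka y * v (t - s) y powr ga y) x)"
 proof (intro set_integral_cong allI impI)
  fix s assume s: "s : {0..t}"
  hence "(%y. h (t - s) y - b y * v (t - s) y) = (%y. - (ka y * v (t - s) y powr ga y))"
   by (auto simp: h_def cutN_def cut_eq)
  thus "FK b s (%y. h (t - s) y - b y * v (t - s) y) x = - FK b s (%y. ka y * v (t - s) y powr ga y) x"
  proof -
   have "at_alive (%y. - F y) z = - at_alive F z" for F and z :: "'e option" by (cases z) (auto simp: at_alive_def)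
   thus ?thesis unfolding FK_eq \<open>(%y. h (t - s) y - b y * v (t - s) y) = _\<close> by simp
  qed
 qed auto
 finally show ?thesis by (simp add: set_lebesgue_integral_def)
qed

lemma mild_le:
 assumes t: "0 <= t"
 shows "v t x <= FK b t f x"
proof -
 have "0 <= (LBINT s:{0..t}. FK b s (%y. ka y * v (t - s) y powr ga y) x)"
  unfolding set_lebesgue_integral_def FK_eq using ka(2)
  by (intro integral_nonneg_AE AE_I2) (auto simp: at_alive_def indicator_def split: option.split intro!: integral_nonneg_AE AE_I2)
 thus ?thesis using mild_feynman_kac[OF t, of x] by linarith
qed

text \<open>Applying \<open>FK b s\<close> to the equation on \<open>[0, t]\<close> reproduces, by
  the semigroup property, the part \<open>[s, s + t]\<close> of the integral in the equation on
  \<open>[0, t + s]\<close>; their difference is the equation started at \<open>t\<close>, the form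
  demanded by \<open>solution\<close>.\<close>

lemma mild_shift:
 assumes s: "0 <= s" and t: "0 <= t"
 shows "v (t + s) x + (LBINT r:{0..s}. FK b r (%y. ka y * v (t + s - r) y powr ga y) x) = FK b s (v t) x"
proof -
 define T where "T = t + s"
 have T: "0 <= T" "t <= T" "s <= T" using s t by (auto simp: T_def)
 obtain B where B: "0 <= B" "!!y. \<bar>b y\<bar> <= B" using bbE[OF b] by blast
 obtain C where C: "1 <= C" "!!r y. 0 <= cut T r y \<and> cut T r y <= C" using cut_bound[OF T(1)] by blast
 obtain D where D: "0 <= D" "!!r y. 0 <= cutN T r y" "!!r y. cutN T r y <= D" using cutN_bound[OF T(1)] by blast
 note bm = bbD[OF b]
 have NB: "cutN T r : bounded_borel" for r
  by (rule bbI[OF section_right[OF cutN_measurable], of _ _ D]) (use D in auto)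
 have Nm: "(%(r, y). cutN T (c - r) y) : \<B> borel2" for c
  unfolding case_prod_beta' by (rule curried_compose[OF cutN_measurable]) measurable
 define E where "E = exp (B * T) * D"
 have FKb: "\<bar>FK b r (cutN T c) y\<bar> <= E" if "0 <= r" "r <= T" for r c y
 proof -
  have "\<bar>FK b r (cutN T c) y\<bar> <= exp (B * r) * D"
   using D by (intro FK_bound[OF bm B(2) that(1) bbD[OF NB]]) auto
  also have "... <= E" unfolding E_def using B D that by (intro mult_right_mono) (auto intro: mult_left_mono)
  finally show ?thesis .
 qed
 have Q: "(%(r, x). FK b (max 0 r) (cutN T (c - r)) x) : \<B> borel2" for c
  by (rule FK_time_measurable[OF bm Nm])
 have Qr: "(%r. FK b (max 0 r) (cutN T (c - r)) y) : \<B> borel" for c y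
  by (rule section_left[OF Q]) simp
 have N: "cutN T r = (%y. ka y * v r y powr ga y)" if "0 <= r" "r <= T" for r
  using that by (simp add: cutN_def[abs_def] cut_eq)
 have e: "v u y + (LBINT r:{0..u}. FK b (max 0 r) (cutN T (u - r)) y) = FK b u f y" if "0 <= u" "u <= T" for u y
 proof -
  have "(LBINT r:{0..u}. FK b (max 0 r) (cutN T (u - r)) y) = (LBINT r:{0..u}. FK b r (%y. ka y * v (u - r) y powr ga y) y)"
   using that by (intro set_integral_cong) (auto simp: N)
  thus ?thesis using mild_feynman_kac[OF that(1), of y] by simp
 qed
 define I where "I y = (LBINT r:{0..t}. FK b (max 0 r) (cutN T (t - r)) y)" for y
 have Qs: "(%(y, r). FK b (max 0 r) (cutN T (t - r)) y) : \<B> borel2"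
  using measurable_pair_swap[OF Q[of t]] by (simp add: case_prod_beta')
 have IB: "I : bounded_borel"
 proof (rule bbI)
  show "I : \<B> borel" unfolding I_def by (rule borel_measurable_set_integral_Icc[OF Qs]) auto
  show "\<bar>I y\<bar> <= E * (t - 0)" for y unfolding I_def using FKb T t by (intro set_integral_Icc_bound Qr) auto
 qed
 have vt: "v t y = 1 * FK b t f y + (- 1) * I y" for y
  using e[OF t T(2), of y] by (simp add: I_def)
 have "FK b s (v t) x = FK b s (FK b t f) x - FK b s I x"
  unfolding vt[abs_def] FK_linear[OF b s FK_bounded_borel[OF b t f] IB] by simp
 also have "FK b s (FK b t f) x = FK b T f x"
  unfolding T_def using FK_semigroup[OF b t s f, of x] by (simp add: add.commute)
 also have "FK b s I x = (LBINT r:{0..t}. FK b s (FK b (max 0 r) (cutN T (t - r))) x)"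
  unfolding I_def using FKb T by (intro FK_Fubini[OF b s Qs, where C=E]) auto
 also have "... = (LBINT r:{0..t}. FK b (max 0 (s + r)) (cutN T (T - (s + r))) x)"
 proof (intro set_integral_cong allI impI)
  fix r assume "r : {0..t}"
  hence r: "0 <= r" by simp
  show "FK b s (FK b (max 0 r) (cutN T (t - r))) x = FK b (max 0 (s + r)) (cutN T (T - (s + r))) x"
   using FK_semigroup[OF b r s NB, of "t - r" x] r s by (simp add: T_def max_def algebra_simps)
 qed auto
 also have "... = (LBINT r:{s..s + t}. FK b (max 0 r) (cutN T (T - r)) x)"
  by (rule set_integral_Icc_shift[symmetric])
 finally have 1: "FK b s (v t) x = FK b T f x - (LBINT r:{s..T}. FK b (max 0 r) (cutN T (T - r)) x)"
  by (simp add: T_def add.commute)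
 have "(LBINT r:{0..T}. FK b (max 0 r) (cutN T (T - r)) x) =
  (LBINT r:{0..s}. FK b (max 0 r) (cutN T (T - r)) x) + (LBINT r:{s..T}. FK b (max 0 r) (cutN T (T - r)) x)"
  using FKb T s by (intro set_integral_Icc_split[OF Qr, where C=E]) auto
 moreover have "(LBINT r:{0..s}. FK b (max 0 r) (cutN T (T - r)) x) =
  (LBINT r:{0..s}. FK b r (%y. ka y * v (T - r) y powr ga y) x)"
  using T by (intro set_integral_cong) (auto simp: N)
 ultimately show ?thesis using 1 e[OF T(1) order_refl, of x] by (simp add: T_def)
qed

end

end

section \<open>Essential infima and continuous densities\<close>

lemma ess_inf_between:
 assumes f [measurable]: "f : \<B> m" and bd: "!!x. c <= f x" "!!x. f x <= C" and m: "emeasure m (space m) ~= 0"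
 shows "AE x in m. ess_inf m f <= f x"
  and "0 < e ==> emeasure m {x : space m. f x < ess_inf m f + e} ~= 0"
proof -
 let ?S = "esssup m (%x. - ereal (f x))"
 \<comment> \<open>Two-sided bounds make the essential supremum finite, so that
   \<open>real_of_ereal\<close> in \<open>ess_inf\<close> does not fall back on its default
   value.\<close>
 have "?S <= ereal (- c)" using bd(1) by (intro esssup_I) auto
 moreover have "ereal (- C) <= ?S"
 proof -
  have "ereal (- C) = esssup m (%_. ereal (- C))" by (rule esssup_const[OF m, symmetric])
  also have "... <= ?S" using bd(2) by (intro esssup_mono) auto
  finally show ?thesis .
 qed
 ultimately obtain s where s: "?S = ereal s" by (cases ?S) auto
 have e: "ess_inf m f = - s" unfolding ess_inf_def s by simp
 show "AE x in m. ess_inf m f <= f x"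
  using esssup_AE[of "%x. - ereal (f x)" m] unfolding s e by eventually_elim auto
 show "emeasure m {x : space m. f x < ess_inf m f + e} ~= 0" if "0 < e"
 proof
  assume "emeasure m {x : space m. f x < ess_inf m f + e} = 0"
  hence "AE x in m. \<not> f x < ess_inf m f + e" by (subst AE_iff_measurable[OF _ refl]) auto
  hence "AE x in m. - ereal (f x) <= ereal (s - e)" by eventually_elim (auto simp: e)
  hence "?S <= ereal (s - e)" by (intro esssup_I) auto
  hence "ereal s <= ereal (s - e)" unfolding s .
  thus False using that by simp
 qed
qed

text \<open>The indicator of the open set on which the inequality fails is itself a test function;
  by full support that set can be null only if it is empty.\<close>

lemma continuous_density_mono:
 fixes k k' :: "'e::topological_space => real"
 assumes sets: "sets m = sets borel" and supp: "!!U. open U ==> U ~= {} ==> 0 < emeasure m U"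
  and k: "continuous_on UNIV k" "integrable m k" and k': "continuous_on UNIV k'" "integrable m k'"
  and le: "!!f. f : bounded_borel ==> (!!y. 0 <= f y) ==> (LINT y|m. k y * f y) <= (LINT y|m. k' y * f y)"
 shows "k y <= k' y"
proof (rule ccontr)
 assume n: "\<not> k y <= k' y"
 define U where "U = {y. k' y < k y}"
 have U: "open U" unfolding U_def using k(1) k'(1) by (rule open_Collect_less[rotated])
 have Ub: "indicator U : (bounded_borel :: ('e => real) set)"
  using U by (intro bbI[of _ 1]) (auto simp: indicator_def)
 have Um: "U : sets m" using U by (simp add: sets)
 have i: "integrable m (%y. k y * indicator U y)" "integrable m (%y. k' y * indicator U y)"
  using k(2) k'(2) Um by (auto intro: integrable_real_mult_indicator)
 have "(LINT y|m. (k y - k' y) * indicator U y) <= 0"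
  using le[OF Ub] i by (simp add: left_diff_distrib)
 moreover have nn: "AE y in m. 0 <= (k y - k' y) * indicator U y" by (auto simp: U_def indicator_def)
 ultimately have "(LINT y|m. (k y - k' y) * indicator U y) = 0"
  using integral_nonneg_AE[OF nn] by linarith
 hence "AE y in m. (k y - k' y) * indicator U y = 0"
  using i nn by (subst (asm) integral_nonneg_eq_0_iff_AE) (auto simp: left_diff_distrib)
 hence "AE y in m. y \<notin> U" by eventually_elim (auto simp: U_def indicator_def)
 hence "emeasure m U = 0" using Um sets_eq_imp_space_eq[OF sets] by (subst (asm) AE_iff_measurable[OF _ refl]) auto
 moreover have "0 < emeasure m U" using n by (intro supp U) (auto simp: U_def not_le)
 ultimately show False by simp
qed

lemma continuous_density_unique:
 fixes k k' :: "'e::topological_space => real"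
 assumes "sets m = sets borel" "!!U. open U ==> U ~= {} ==> 0 < emeasure m U"
  and "continuous_on UNIV k" "integrable m k" "continuous_on UNIV k'" "integrable m k'"
  and "!!f. f : bounded_borel ==> (!!y. 0 <= f y) ==> (LINT y|m. k y * f y) = (LINT y|m. k' y * f y)"
 shows "k y = k' y"
 by (rule antisym; rule continuous_density_mono[of m]) (use assms in auto)

text \<open>Turns an operator semigroup with a continuous density into a
  \<open>dominated_kernel\<close>. It is used for the motion and for the Feynman-Kac semigroup, with
  the same \<open>g\<close> and \<open>h\<close>.\<close>

locale density_semigroup =
 fixes m :: "'e::{metric_space, second_countable_topology} measure"
  and R :: "real => ('e => real) => 'e => real"
  and k :: "real => 'e => 'e => real" and B :: real and g h :: "'e => real"
 assumes sets_m [measurable_cong]: "sets m = sets borel"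
  and sigma_finite: "sigma_finite_measure m"
  and full_support: "!!U. open U ==> U ~= {} ==> 0 < emeasure m U"
  and density: "continuous_density m R k"
  and nonneg: "!!t x y. 0 < t ==> 0 <= k t x y"
  and R_1: "!!t x. 0 < t ==> R t (%_. 1) x <= exp (B * t)"
  and col: "!!t y. 0 < t ==> (\<integral>\<^sup>+x. ennreal (k t x y) \<partial>m) <= ennreal (exp (B * t))"
  and R_bounded_borel: "!!t f. 0 < t ==> f : bounded_borel ==> R t f : bounded_borel"
  and semigroup: "!!s t f x. 0 < s ==> 0 < t ==> f : bounded_borel ==> R (s + t) f x = R s (R t f) x"
  and dom: "!!t. 0 < t ==> \<exists>c. \<forall>x y. k t x y <= c * g x * h y"
  and gh_cont: "continuous_on UNIV g" "continuous_on UNIV h"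
  and gh_pos: "!!x. 0 < g x" "!!x. 0 < h x"
  and gh_L2: "(\<integral>\<^sup>+x. (ennreal (g x))^2 \<partial>m) < \<infinity>" "(\<integral>\<^sup>+x. (ennreal (h x))^2 \<partial>m) < \<infinity>"
begin

lemma cont: "0 < t ==> continuous_on UNIV (%(x, y). k t x y)"
 and integrable: "0 < t ==> integrable m (k t x)"
 and R_eq: "0 < t ==> f : bounded_borel ==> R t f x = (LINT y|m. k t x y * f y)"
 using density unfolding continuous_density_def by auto

sublocale sigma_finite_measure m by (rule sigma_finite)

sublocale pair: pair_sigma_finite m m ..

lemma k_measurable [measurable (raw)]:
 assumes t: "0 < t" and [measurable]: "f : M \<rightarrow>\<^sub>M borel" "f' : M \<rightarrow>\<^sub>M borel"
 shows "(%x. k t (f x) (f' x)) : \<B> M"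
proof -
 have "(%z. k t (fst z) (snd z)) : \<B> (borel :: ('e \<times> 'e) measure)"
  using cont[OF t] by (intro borel_measurable_continuous_onI) (simp add: case_prod_beta)
 hence [measurable]: "(%z. k t (fst z) (snd z)) : \<B> borel2"
  by (simp add: borel_prod)
 have "(%x. (%z. k t (fst z) (snd z)) (f x, f' x)) : \<B> M"
  by measurable
 thus ?thesis by simp
qed

lemma cont_section:
 assumes t: "0 < t"
 shows "continuous_on UNIV (k t x)" "continuous_on UNIV (%x. k t x y)"
proof -
 have "continuous_on UNIV (%y. case (x, y) of (x, y) => k t x y)" "continuous_on UNIV (%x. case (x, y) of (x, y) => k t x y)"
  by (rule continuous_on_compose2[OF cont[OF t]]; auto intro!: continuous_intros)+
 thus "continuous_on UNIV (k t x)" "continuous_on UNIV (%x. k t x y)" by simp_all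
qed

lemma R_nonneg: "0 < t ==> f : bounded_borel ==> (!!y. 0 <= f y) ==> 0 <= R t f x"
 by (simp add: R_eq nonneg)

lemma nn_R:
 assumes t: "0 < t" and f: "f : bounded_borel" "!!y. 0 <= f y"
 shows "(\<integral>\<^sup>+y. ennreal (k t x y) * ennreal (f y) \<partial>m) = ennreal (R t f x)"
proof -
 obtain c where c: "0 <= c" "!!x. \<bar>f x\<bar> <= c" using bbE[OF f(1)] by blast
 have "integrable m (%y. k t x y * f y)"
 proof (rule Bochner_Integration.integrable_bound)
  show "integrable m (%y. c * k t x y)" using integrable[OF t] by simp
  show "AE y in m. norm (k t x y * f y) <= norm (c * k t x y)"
   using c nonneg[OF t] by (auto simp: abs_mult mult.commute intro!: mult_right_mono)
 qed (use t f bbD[OF f(1)] in measurable)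
 thus ?thesis
  unfolding R_eq[OF t f(1)] using nonneg[OF t] f(2)
  by (subst nn_integral_eq_integral[symmetric]) (auto simp: ennreal_mult)
qed

lemma const_1_bounded_borel: "(%_. 1 :: real) : (bounded_borel :: ('e => real) set)"
 by (auto intro: bbI[of _ 1])

lemma row:
 assumes t: "0 < t"
 shows "(\<integral>\<^sup>+y. ennreal (k t x y) \<partial>m) <= ennreal (exp (B * t))"
 using nn_R[OF t const_1_bounded_borel] R_1[OF t] by (simp add: ennreal_leI)

lemma gh_product_integrable: "integrable m (%z. h z * g z)"
proof (rule integrableI_bounded)
 have gm [measurable]: "g : \<B> borel" "h : \<B> borel"
  using gh_cont by (auto intro: borel_measurable_continuous_onI)
 show "(%z. h z * g z) : \<B> m" by measurable
 have "(\<integral>\<^sup>+x. ennreal (h x) * ennreal (g x) \<partial>m)^2 <= (\<integral>\<^sup>+x. (ennreal (h x))^2 \<partial>m) * (\<integral>\<^sup>+x. (ennreal (g x))^2 \<partial>m)"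
  by (intro Cauchy_Schwarz_nn_integral) auto
 also have "... < \<infinity>" using gh_L2 by (auto simp: ennreal_mult_less_top)
 finally show "(\<integral>\<^sup>+z. ennreal (norm (h z * g z)) \<partial>m) < \<infinity>"
  using gh_pos by (simp add: abs_mult abs_of_pos ennreal_mult less_imp_le power_less_top_ennreal)
qed

text \<open>The semigroup property identifies the composed kernel \<open>j\<close> only as a
  density. Domination by \<open>g\<close> and \<open>h\<close> makes \<open>j\<close> continuous in
  \<open>y\<close>, and continuous densities are unique at every point.\<close>

lemma chapman_kolmogorov:
 assumes s: "0 < s" and t: "0 < t"
 shows "(\<integral>\<^sup>+z. ennreal (k s x z) * ennreal (k t z y) \<partial>m) = ennreal (k (s + t) x y)"
proof -
 note [simp] = s t
 have st: "0 < s + t" by (rule add_pos_pos[OF s t])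
 obtain c where c: "!!x y. k s x y <= c * g x * h y" using dom[OF s] by blast
 obtain d where d: "!!x y. k t x y <= d * g x * h y" using dom[OF t] by blast
 define j where "j y = (LINT z|m. k s x z * k t z y)" for y
 have c0: "0 < c * g x * h y" if "0 < k s x y" for y using c[of x y] that by linarith
 define w where "w M z = \<bar>c * g x\<bar> * \<bar>d\<bar> * M * (h z * g z)" for M z
 have w: "integrable m (w M)" for M unfolding w_def using gh_product_integrable by simp
 have bd: "\<bar>k s x z * k t z y\<bar> <= w M z" if "h y <= M" for y z M
 proof -
  have 1: "k s x z <= \<bar>c * g x\<bar> * h z" using c[of x z] mult_right_mono[OF abs_ge_self[of "c * g x"], of "h z"] gh_pos(2)[of z] by linarith
  have "d * (g z * h y) <= \<bar>d\<bar> * (g z * h y)" using gh_pos(1)[of z] gh_pos(2)[of y] by (intro mult_right_mono) auto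
  also have "... <= \<bar>d\<bar> * (g z * M)" using that gh_pos(1)[of z] by (intro mult_left_mono) (auto simp: less_imp_le)
  finally have 2: "k t z y <= \<bar>d\<bar> * (g z * M)" using d[of z y] by (simp add: mult_ac)
  have "k s x z * k t z y <= (\<bar>c * g x\<bar> * h z) * (\<bar>d\<bar> * (g z * M))"
   using 1 2 nonneg[OF s, of x z] nonneg[OF t, of z y] gh_pos(2)[of z] by (intro mult_mono) (auto simp: less_imp_le)
  thus ?thesis using nonneg[OF s, of x z] nonneg[OF t, of z y] by (simp add: w_def mult_ac)
 qed
 have int: "integrable m (%z. k s x z * k t z y)" for y
  by (rule Bochner_Integration.integrable_bound[OF w[of "h y"]]) (use bd[OF order_refl] in \<open>auto intro!: AE_I2 order_trans[OF _ abs_ge_self]\<close>)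
 have nj: "(\<integral>\<^sup>+z. ennreal (k s x z) * ennreal (k t z y) \<partial>m) = ennreal (j y)" for y
  unfolding j_def using nonneg[OF s] nonneg[OF t]
  by (subst nn_integral_eq_integral[OF int, symmetric]) (auto simp: ennreal_mult)
 have j0: "0 <= j y" for y unfolding j_def using nonneg[OF s] nonneg[OF t] by simp
 have jc: "continuous_on UNIV j"
 proof (rule continuous_on_sequentiallyI)
  fix u and a :: 'e assume u: "u ----> a"
  have "(%n. h (u n)) ----> h a"
   using gh_cont(2) u by (auto simp: continuous_on_sequentially comp_def)
  then obtain M where M: "!!n. \<bar>h (u n)\<bar> <= M"
   using convergent_imp_Bseq[of "%n. h (u n)"] by (auto simp: convergent_def Bseq_def)
  show "(%n. j (u n)) ----> j a"
   unfolding j_def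
  proof (rule integral_dominated_convergence[OF _ _ w[of M]])
   show "AE z in m. (%n. k s x z * k t z (u n)) ----> k s x z * k t z a"
    using cont_section(1)[OF t] u by (intro AE_I2 tendsto_mult tendsto_const) (auto simp: continuous_on_sequentially comp_def)
   show "AE z in m. norm (k s x z * k t z (u n)) <= w M z" for n
    using bd[OF order_trans[OF abs_ge_self M[of n]]] by auto
  qed auto
 qed
 hence jm [measurable]: "j : \<B> borel" by (rule borel_measurable_continuous_onI)
 have "(\<integral>\<^sup>+y. ennreal (j y) \<partial>m) = (\<integral>\<^sup>+y. (\<integral>\<^sup>+z. ennreal (k s x z) * ennreal (k t z y) \<partial>m) \<partial>m)" by (simp add: nj)
 also have "... = (\<integral>\<^sup>+z. (\<integral>\<^sup>+y. ennreal (k s x z) * ennreal (k t z y) \<partial>m) \<partial>m)"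
  by (rule pair.Fubini') measurable
 also have "... <= (\<integral>\<^sup>+z. ennreal (k s x z) * ennreal (exp (B * t)) \<partial>m)"
  using row[OF t] by (intro nn_integral_mono) (simp add: nn_integral_cmult mult_left_mono)
 also have "... <= ennreal (exp (B * s)) * ennreal (exp (B * t))"
  using row[OF s] by (simp add: nn_integral_multc mult_right_mono)
 also have "... < \<infinity>" by (simp add: ennreal_mult_less_top)
 finally have ji: "integrable m j" using j0 by (intro integrableI_nonneg) auto
 have "k (s + t) x y = j y"
 proof (rule continuous_density_unique[OF sets_m full_support cont_section(1)[OF st] integrable[OF st] jc ji])
  fix f :: "'e => real" assume f: "f : bounded_borel" "!!y. 0 <= f y"
  have [measurable]: "f : \<B> borel" by (rule bbD[OF f(1)])
  have "(\<integral>\<^sup>+y. ennreal (j y) * ennreal (f y) \<partial>m) = (\<integral>\<^sup>+y. (\<integral>\<^sup>+z. ennreal (k s x z) * (ennreal (k t z y) * ennreal (f y)) \<partial>m) \<partial>m)"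
   unfolding nj[symmetric] by (intro nn_integral_cong) (simp add: nn_integral_multc[symmetric] mult.assoc)
  also have "... = (\<integral>\<^sup>+z. (\<integral>\<^sup>+y. ennreal (k s x z) * (ennreal (k t z y) * ennreal (f y)) \<partial>m) \<partial>m)"
   by (rule pair.Fubini') measurable
  also have "... = (\<integral>\<^sup>+z. ennreal (k s x z) * ennreal (R t f z) \<partial>m)"
   by (simp add: nn_integral_cmult nn_R[OF t f])
  also have "... = ennreal (R s (R t f) x)"
   by (rule nn_R[OF s R_bounded_borel[OF t f(1)] R_nonneg[OF t f]])
  finally have "(\<integral>\<^sup>+y. ennreal (j y * f y) \<partial>m) = ennreal (R (s + t) f x)"
   using j0 f(2) by (simp add: ennreal_mult semigroup[OF s t f(1)])
  hence "(LINT y|m. j y * f y) = R (s + t) f x"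
   using j0 f R_nonneg[OF st f] by (subst integral_eq_nn_integral) auto
  thus "(LINT y|m. k (s + t) x y * f y) = (LINT y|m. j y * f y)" by (simp add: R_eq[OF st f(1)])
 qed
 thus ?thesis by (simp add: nj)
qed

lemma dominated_kernel: "dominated_kernel m k B g h"
 by unfold_locales (fact sets_m sigma_finite full_support nonneg cont row col chapman_kolmogorov dom gh_cont gh_pos gh_L2)+

end

section \<open>From the kernel to the critical semigroup\<close>

context motion
begin

lemma FK_between:
 assumes b: "b : \<B> borel" "!!y. \<bar>b y\<bar> <= B" and t: "0 <= t" and f: "f : bounded_borel" "!!y. 0 <= f y"
 shows "exp (- B * t) * P t f x <= FK b t f x" "FK b t f x <= exp (B * t) * P t f x"
proof -
 obtain c where c: "0 <= c" "!!y. \<bar>f y\<bar> <= c" using bbE[OF f(1)] by blast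
 define E where "E om = at_alive f (xi t om)" for om
 have Em: "E : \<B> (Pr (Some x))"
  unfolding E_def by (rule measurable_at_alive'[OF bbD[OF f(1)] path_measurable[OF t]])
 have E: "0 <= E om" "E om <= c" for om
  using at_alive_bound[of f c, OF c(2,1), of "xi t om"] f(2) unfolding E_def
  by (auto simp: at_alive_def split: option.splits)
 have Ab: "\<bar>A b t om\<bar> <= B * t" if "om : space (Pr (Some x))" for om
  using A_bound[OF b _ t] that by (simp add: law)
 have i: "integrable (Pr (Some x)) (%om. exp (A b t om) * E om)"
 proof (rule bounded_integrable)
  show "(%om. exp (A b t om) * E om) : \<B> (Pr (Some x))"
   by (intro borel_measurable_times Em measurable_compose[OF A_law_measurable[OF b(1)] borel_measurable_exp])
  show "\<bar>exp (A b t om) * E om\<bar> <= exp (B * t) * c" if "om : space W" for om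
   using Ab[of om] that E[of om] c(1) unfolding abs_mult by (intro mult_mono) (auto simp: law)
 qed
 have iE: "integrable (Pr (Some x)) (%om. r * E om)" for r :: real
  using bounded_integrable[OF Em, of c] E by (intro integrable_mult_right) auto
 have P: "r * P t f x = (LINT om|Pr (Some x). r * E om)" for r by (simp add: P_eq E_def)
 have FKb: "FK b t f x = (LINT om|Pr (Some x). exp (A b t om) * E om)" by (simp only: FK_eq E_def)
 show "exp (- B * t) * P t f x <= FK b t f x"
  unfolding P FKb
  by (rule integral_mono[OF iE i]) (use Ab E in \<open>auto intro!: mult_right_mono simp: abs_le_iff minus_le_iff\<close>)
 show "FK b t f x <= exp (B * t) * P t f x"
  unfolding P FKb
  by (rule integral_mono[OF i iE]) (use Ab E in \<open>auto intro!: mult_right_mono simp: abs_le_iff minus_le_iff\<close>)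
qed

lemma critical_semigroup_feynman_kac:
 assumes pk: "principal_kernel m k B g h ph ph'" and b: "b : bounded_borel" "!!y. \<bar>b y\<bar> <= B"
  and Q: "!!t f x. 0 < t ==> f : bounded_borel ==> FK b t f x = (LINT y|m. k t x y * f y)"
 shows "critical_semigroup m (FK b) ph ph'"
proof -
 interpret k: principal_kernel m k B g h ph ph' by (rule pk)
 note [measurable] = k.ph_measurable
 note bm = bbD[OF b(1)]
 have pB: "(%y. f y * ph' y) : \<B> m" "integrable m (%y. f y * ph' y)" if f: "f : bounded_borel" for f
 proof -
  have [measurable]: "f : \<B> borel" by (rule bbD[OF f])
  show "(%y. f y * ph' y) : \<B> m" by measurable
  obtain c where c: "0 <= c" "!!y. \<bar>f y\<bar> <= c" using bbE[OF f] by blast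
  show "integrable m (%y. f y * ph' y)"
   by (rule Bochner_Integration.integrable_bound[where f="%y. c * ph' y"])
    (use k.ph'_integrable k.ph_pos(2) c in \<open>auto simp: abs_mult intro!: mult_right_mono\<close>)
 qed
 have ik: "integrable m (%y. k t x y * f y)" if t: "0 < t" and f: "f : bounded_borel" for t f x
 proof -
  have [measurable]: "f : \<B> borel" by (rule bbD[OF f])
  obtain c where c: "0 <= c" "!!y. \<bar>f y\<bar> <= c" using bbE[OF f] by blast
  show ?thesis
  proof (rule Bochner_Integration.integrable_bound)
   show "integrable m (%y. c * k t x y)" using k.integrable_k[OF t] by simp
   show "AE y in m. norm (k t x y * f y) <= norm (c * k t x y)"
    using c k.nonneg[OF t] by (auto simp: abs_mult mult.commute intro!: mult_right_mono)
  qed (use t in measurable)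
 qed
 \<comment> \<open>Fubini is justified by the invariance of \<open>ph'\<close> itself, which
   evaluates the inner integral of the absolute values.\<close>
 have duality: "(LINT x|m. FK b t f x * ph' x) = (LINT x|m. f x * ph' x)" if t: "0 < t" and f: "f : bounded_borel" for t f
 proof -
  have [measurable]: "f : \<B> borel" by (rule bbD[OF f])
  obtain c where c: "0 <= c" "!!y. \<bar>f y\<bar> <= c" using bbE[OF f] by blast
  have ic: "integrable m (%x. k t x y * ph' x)" for y
  proof -
   interpret T: dominated_kernel m "%t x y. k t y x" B h g by (rule k.transpose)
   show ?thesis using T.L2_integrable[OF t, of ph' y] k.ph_L2(2) by (simp add: T.L2_def k.L2_def)
  qed
  define F where "F y x = k t x y * f y * ph' x" for x y
  have Fm: "(%z. F (fst z) (snd z)) : \<B> (m \<Otimes>\<^sub>M m)" unfolding F_def using t by measurable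
  have iF: "integrable m (F y)" for y
   using integrable_mult_right[OF ic, of "f y" y] by (simp add: F_def[abs_def] mult_ac)
  have "integrable (m \<Otimes>\<^sub>M m) (%z. F (fst z) (snd z))"
  proof (rule k.pair.Fubini_integrable[OF Fm])
   have "(LINT x|m. norm (F y x)) = (LINT x|m. \<bar>f y\<bar> * (k t x y * ph' x))" for y
    using k.nonneg[OF t] k.ph_pos(2) by (intro bochner_cong) (auto simp: F_def abs_mult less_imp_le)
   hence "(LINT x|m. norm (F y x)) = \<bar>f y\<bar> * ph' y" for y using k.ph'_inv[OF t, of y] by simp
   moreover have "integrable m (%y. \<bar>f y\<bar> * ph' y)"
    using c by (intro pB bbI[of _ c]) auto
   ultimately show "integrable m (%x. \<integral>y. norm (F (fst (x, y)) (snd (x, y))) \<partial>m)" by simp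
  qed (use iF in simp)
  hence "integrable (m \<Otimes>\<^sub>M m) (%(y, x). F y x)" by (simp add: case_prod_beta')
  from k.pair.Fubini_integral[OF this]
  have "(LINT x|m. \<integral>y. F y x \<partial>m) = (LINT y|m. \<integral>x. F y x \<partial>m)" .
  moreover have "(LINT y|m. F y x) = FK b t f x * ph' x" for x unfolding F_def Q[OF t f] by simp
  moreover have "(LINT x|m. F y x) = f y * ph' y" for y
  proof -
   have "(LINT x|m. F y x) = (LINT x|m. f y * (k t x y * ph' x))" by (simp add: F_def mult_ac)
   thus ?thesis using k.ph'_inv[OF t, of y] by simp
  qed
  ultimately show ?thesis by simp
 qed
 have ultra: "FK b t f x <= C * ph x * (LINT y|m. f y * ph' y)"
  if t: "0 < t" and C: "!!x y. k t x y <= C * ph x * ph' y" and f: "f : bounded_borel" "!!y. 0 <= f y" for t C f x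
 proof -
  have "FK b t f x <= (LINT y|m. C * ph x * (f y * ph' y))"
   unfolding Q[OF t f(1)] by (intro integral_mono ik t f integrable_mult_right pB)
    (use mult_right_mono[OF C f(2)] in \<open>simp add: mult_ac\<close>)
  thus ?thesis by simp
 qed
 have ultra': "C * ph x * (LINT y|m. f y * ph' y) <= FK b t f x"
  if t: "0 < t" and C: "!!x y. C * ph x * ph' y <= k t x y" and f: "f : bounded_borel" "!!y. 0 <= f y" for t C f x
 proof -
  have "(LINT y|m. C * ph x * (f y * ph' y)) <= FK b t f x"
   unfolding Q[OF t f(1)] by (intro integral_mono ik t f integrable_mult_right pB)
    (use mult_right_mono[OF C f(2)] in \<open>simp add: mult_ac\<close>)
  thus ?thesis by simp
 qed
 have B: "0 <= B" using b(2)[of undefined] by linarith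
 have one: "(%_. 1 :: real) : bounded_borel" by (auto intro: bbI[of _ 1])
 obtain cph where cph: "!!x. ph x <= cph" using k.ph_bounded by blast
 have phB: "ph : bounded_borel" using cph k.ph_pos(1) by (auto intro!: bbI[of _ cph] simp: less_imp_le)
 show ?thesis
 proof (rule critical_semigroup.intro)
  show "sets m = sets borel" by (rule k.sets_m)
  show "sigma_finite_measure m" by (rule k.sigma_finite)
  show "FK b 0 f x = f x" if "f : bounded_borel" for f x by (rule FK_0[OF bbD[OF that]])
  show "FK b t (%y. c * f y + d * f' y) x = c * FK b t f x + d * FK b t f' x"
   if "0 <= t" "f : bounded_borel" "f' : bounded_borel" for t f f' c d x
   by (rule FK_linear[OF b(1) that])
  show "FK b t f x <= FK b t f' x" if "0 <= t" "f : bounded_borel" "f' : bounded_borel" "!!y. f y <= f' y" for t f f' x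
   by (rule FK_mono[OF b(1) that])
  show "FK b t f x <= FK b t f' x" if t: "0 < t" and f: "f : bounded_borel" "f' : bounded_borel" and le: "AE y in m. f y <= f' y" for t f f' x
   unfolding Q[OF t f(1)] Q[OF t f(2)]
   by (rule integral_mono_AE[OF ik[OF t f(1)] ik[OF t f(2)]]) (use le in eventually_elim, use k.nonneg[OF t] in \<open>auto intro: mult_left_mono\<close>)
  show "FK b (s + t) f x = FK b s (FK b t f) x" if "0 <= s" "0 <= t" "f : bounded_borel" for s t f x
   by (rule FK_semigroup[OF b(1) that(2,1,3)])
  show "(%(r, x). FK b (max 0 r) (H r) x) : \<B> borel2"
   if "(%(r, y). H r y) : \<B> borel2" for H
   by (rule FK_time_measurable[OF bm that])
  show "(%n. FK b t (F n) x) ----> FK b t f x"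
   if "0 <= t" "!!n. F n : bounded_borel" "f : bounded_borel" "!!n y. \<bar>F n y\<bar> <= C" "!!y. (%n. F n y) ----> f y" for t f F C x
   by (rule FK_convergence[OF b(1) that])
  show "\<exists>C\<ge>0. \<forall>t\<ge>0. \<forall>x. FK b t (%_. 1) x <= C"
  proof -
   obtain C where C: "0 < C" "!!x y. k 1 x y <= C * ph x * ph' y" using k.k_upper[of 1] by auto
   define I where "I = (LINT y|m. ph' y)"
   have I: "0 <= I" unfolding I_def using k.ph_pos(2) by (simp add: less_imp_le)
   have "FK b t (%_. 1) x <= max (exp B) (C * cph * I)" if t: "0 <= t" for t x
   proof (cases "t <= 1")
    case True
    have "\<bar>FK b t (%_. 1) x\<bar> <= exp (B * t) * 1" by (rule FK_bound[OF bm b(2) t]) auto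
    also have "... <= exp B" using True B t by (simp add: mult_left_le)
    finally show ?thesis by linarith
   next
    case False
    hence t1: "0 <= t - 1" by simp
    \<comment> \<open>Beyond time 1 the last unit of time is estimated by the upper kernel bound,
      and by duality the integral of \<open>f\<close> against \<open>ph'\<close> does not grow with
      \<open>t\<close>. This is where criticality makes the bound uniform in time.\<close>
    define f where "f = FK b (t - 1) (%_. 1)"
    have f: "f : bounded_borel" unfolding f_def by (rule FK_bounded_borel[OF b(1) t1 one])
    have z: "(%_. 0 :: real) : bounded_borel" by (auto intro: bbI[of _ 0])
    have "0 <= f y" for y
     using FK_mono[OF b(1) t1 z one, of y] FK_linear[OF b(1) t1 one one, of 0 0 y] by (simp add: f_def)
    hence "FK b 1 f x <= C * ph x * (LINT y|m. f y * ph' y)" using C(2) f by (intro ultra) auto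
    also have "(LINT y|m. f y * ph' y) = I"
    proof (cases "t = 1")
     case True
     have "f = (%_. 1)" unfolding f_def True by (rule ext) (simp add: FK_0)
     thus ?thesis by (simp add: I_def)
    next
     case neq: False
     hence "0 < t - 1" using False by simp
     from duality[OF this one] show ?thesis by (simp add: f_def I_def)
    qed
    also have "C * ph x * I <= C * cph * I" using C cph I by (intro mult_right_mono mult_left_mono) auto
    also have "FK b 1 f x = FK b t (%_. 1) x"
     unfolding f_def using FK_semigroup[OF b(1) t1 _ one, of 1 x] by simp
    finally show ?thesis by simp
   qed
   thus ?thesis by (intro exI[of _ "max (exp B) (C * cph * I)"]) (simp add: max.coboundedI1)
  qed
  show "ph : \<B> borel" "ph' : \<B> borel" by measurable
  show "0 < ph x" "0 < ph' x" for x by (rule k.ph_pos)+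
  show "\<exists>C. \<forall>x. ph x <= C" by (rule k.ph_bounded)
  show "integrable m ph'" by (rule k.ph'_integrable)
  show "(LINT x|m. FK b t f x * ph' x) = (LINT x|m. f x * ph' x)" if "0 <= t" "f : bounded_borel" for t f
   using that duality[of t f] FK_0[OF bbD[OF that(2)]] by (cases "t = 0") auto
  show "FK b t ph x = ph x" if "0 <= t" for t x
   using that k.ph_inv[of t x] Q[of t ph x] phB FK_0[of ph b x] by (cases "t = 0") (auto simp: k.K_def)
  show "\<exists>C>0. \<forall>f\<in>bounded_borel. \<forall>x. (\<forall>y. 0 <= f y) --> FK b t f x <= C * ph x * (LINT y|m. f y * ph' y)" if t: "0 < t" for t
   using k.k_upper[OF t] ultra[OF t] by blast
  show "\<exists>c>0. \<forall>f\<in>bounded_borel. \<forall>x. (\<forall>y. 0 <= f y) --> c * ph x * (LINT y|m. f y * ph' y) <= FK b t f x" if t: "0 < t" for t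
   using k.k_lower[OF t] ultra'[OF t] by blast
  show "\<exists>s>0. \<forall>f\<in>bounded_borel. \<forall>x. (\<forall>y. 0 <= f y) -->
    \<bar>FK b s f x - ph x * (LINT y|m. f y * ph' y)\<bar> <= e * ph x * (LINT y|m. f y * ph' y)" if e: "0 < e" for e
  proof -
   obtain s where s: "0 < s" "!!x y. \<bar>k s x y - ph x * ph' y\<bar> <= e * ph x * ph' y"
    using k.uniform_convergence[OF e] by blast
   have "k s x y <= (1 + e) * ph x * ph' y" "(1 - e) * ph x * ph' y <= k s x y" for x y
    using s(2)[of x y] by (auto simp: algebra_simps abs_le_iff)
   from ultra[OF s(1) this(1)] ultra'[OF s(1) this(2)] show ?thesis
    using s(1) by (intro exI[of _ s]) (auto simp: algebra_simps abs_le_iff)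
  qed
  show "emeasure m UNIV ~= 0" using k.full_support[OF open_UNIV] by auto
 qed
qed

end

section \<open>Measurability on the space of finite measures\<close>

lemma topspace_weak_topology: "topspace weak_topology = (finite_measures :: 'e::topological_space measure set)"
proof -
 let ?S = "{{mu : finite_measures. (LINT x|mu. f x) : U} | (f :: 'e => real) U. continuous_on UNIV f \<and> bounded (range f) \<and> open U}"
 have "{mu : finite_measures. (LINT x|mu. (0 :: real)) : UNIV} : ?S"
  by (intro CollectI exI[of _ "%_. 0"] exI[of _ UNIV]) auto
 hence "\<Union>?S = finite_measures" by auto
 thus ?thesis by (simp add: weak_topology_def)
qed

lemma space_weak_borel [simp]: "space (borel_of weak_topology) = (finite_measures :: 'e::topological_space measure set)"
 by (simp add: space_borel_of topspace_weak_topology)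

lemma measurable_integral_continuous:
 fixes f :: "'e::topological_space => real"
 assumes "continuous_on UNIV f" "bounded (range f)"
 shows "(%mu. \<integral>x. f x \<partial>mu) : \<B> (borel_of weak_topology)"
proof (rule borel_measurableI)
 fix U :: "real set" assume "open U"
 hence "openin weak_topology {mu : finite_measures. (LINT x|mu. f x) : U}"
  unfolding weak_topology_def using assms by (intro topology_generated_by_Basis) blast
 hence "{mu : finite_measures. (LINT x|mu. f x) : U} : sets (borel_of weak_topology)" by (rule openin_borel_of)
 thus "(%mu. \<integral>x. f x \<partial>mu) -` U \<inter> space (borel_of weak_topology) : sets (borel_of weak_topology)"
  by (simp add: vimage_def Int_def conj_commute)
qed

lemma finite_measuresD:
 assumes "mu : finite_measures"
 shows "sets mu = sets borel" "finite_measure mu" "space mu = UNIV"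
 using assms sets_eq_imp_space_eq[of mu borel] by (auto simp: finite_measures_def)

lemma finite_measure_integrable:
 assumes mu: "mu : finite_measures" and f: "f : bounded_borel"
 shows "integrable mu f"
proof -
 interpret finite_measure mu by (rule finite_measuresD(2)[OF mu])
 note [measurable_cong] = finite_measuresD(1)[OF mu]
 obtain c where "0 <= c" "!!x. \<bar>f x\<bar> <= c" using bbE[OF f] by blast
 thus ?thesis using bbD[OF f] by (intro integrable_const_bound[where B=c]) auto
qed

text \<open>The continuous functions \<open>min 1 (n * infdist x (- U))\<close> converge boundedly
  to the indicator of \<open>U\<close>. The whole space is treated apart, because the distance to
  the empty set is 0 by convention.\<close>

lemma measurable_measure_open:
 fixes U :: "'e::metric_space set"
 assumes U: "open U"
 shows "(%mu. measure mu U) : \<B> (borel_of weak_topology)"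
proof (cases "U = UNIV")
 case True
 have "(%mu. \<integral>x. (1 :: real) \<partial>mu) : \<B> (borel_of (weak_topology :: 'e measure topology))"
  by (rule measurable_integral_continuous) auto
 thus ?thesis
  by (rule measurable_cong[THEN iffD1, rotated]) (simp add: True finite_measuresD)
next
 case False
 hence ne: "- U ~= {}" by auto
 define f where "f n x = min 1 (real n * infdist x (- U))" for n x
 have fc: "continuous_on UNIV (f n)" for n unfolding f_def by (intro continuous_intros)
 have fb: "\<bar>f n x\<bar> <= 1" for n x unfolding f_def using infdist_nonneg[of x "- U"] by auto
 show ?thesis
 proof (rule borel_measurable_LIMSEQ_real)
  show "(%mu. \<integral>x. f n x \<partial>mu) : \<B> (borel_of weak_topology)" for n
   using fb by (intro measurable_integral_continuous fc) (auto simp: bounded_iff)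
  fix mu :: "'e measure" assume "mu : space (borel_of weak_topology)"
  hence mu: "mu : finite_measures" by simp
  interpret finite_measure mu by (rule finite_measuresD(2)[OF mu])
  note [measurable_cong] = finite_measuresD(1)[OF mu]
  have [measurable]: "U : sets borel" using U by simp
  have "(%n. \<integral>x. f n x \<partial>mu) ----> (LINT x|mu. indicator U x)"
  proof (rule integral_dominated_convergence[where w="%_. 1"])
   show "AE x in mu. (%n. f n x) ----> indicator U x"
   proof (rule AE_I2)
    fix x
    show "(%n. f n x) ----> indicator U x"
    proof (cases "x : U")
     case True
     have "0 < infdist x (- U)"
      using infdist_pos_not_in_closed[of "- U" x] ne U True by (simp add: closed_def)
     then obtain N :: nat where N: "1 < real N * infdist x (- U)" using reals_Archimedean3 by blast
     have "f n x = 1" if "N <= n" for n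
     proof -
      have "real N * infdist x (- U) <= real n * infdist x (- U)" using that by (intro mult_right_mono infdist_nonneg) auto
      thus ?thesis using N by (simp add: f_def)
     qed
     hence "eventually (%n. f n x = 1) sequentially" by (auto simp: eventually_sequentially)
     thus ?thesis using True by (simp add: tendsto_eventually)
    next
     case False
     thus ?thesis using infdist_zero[of x "- U"] by (simp add: f_def)
    qed
   qed
   show "f n : \<B> mu" for n
    using borel_measurable_continuous_onI[OF fc[of n]] by simp
  qed (use fb in auto)
  thus "(%n. \<integral>x. f n x \<partial>mu) ----> measure mu U" by (simp add: finite_measuresD[OF mu])
 qed
qed

text \<open>Division by one plus the total mass maps finite measures to subprobabilities, where
  measurability on open sets, a generating family closed under intersections, extends to all bounded
  Borel integrands; the factor is undone at the end.\<close>

lemma measurable_integral_weak: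
 fixes f :: "'e::metric_space => real"
 assumes f: "f : bounded_borel"
 shows "(%mu. \<integral>x. f x \<partial>mu) : \<B> (borel_of weak_topology)"
proof -
 let ?N = "borel_of (weak_topology :: 'e measure topology)"
 define c where "c mu = 1 / (1 + measure mu UNIV)" for mu :: "'e measure"
 have c: "0 < c mu" "c mu * measure mu UNIV <= 1" for mu
  unfolding c_def using measure_nonneg[of mu UNIV] by (auto simp: field_simps add_pos_nonneg intro!: divide_pos_pos)
 have mm [measurable]: "(%mu. measure mu U) : \<B> ?N" if "open U" for U by (rule measurable_measure_open[OF that])
 have [measurable]: "c : \<B> ?N" unfolding c_def using mm[OF open_UNIV] by measurable
 define k where "k mu = density mu (%_. ennreal (c mu))" for mu
 have ke: "emeasure (k mu) A = ennreal (c mu * measure mu A)" if mu: "mu : finite_measures" and A: "A : sets borel" for mu A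
 proof -
  interpret finite_measure mu by (rule finite_measuresD(2)[OF mu])
  show ?thesis unfolding k_def using A c(1)[of mu]
   by (subst emeasure_density_const) (auto simp: finite_measuresD[OF mu] emeasure_eq_measure ennreal_mult)
 qed
 have "k : ?N \<rightarrow>\<^sub>M subprob_algebra borel"
 proof (rule measurable_subprob_algebra_generated[of borel UNIV "{S. open S}"])
  show "sets borel = sigma_sets UNIV {S :: 'e set. open S}" by (simp add: borel_def)
  show "Int_stable {S :: 'e set. open S}" by (auto simp: Int_stable_def)
  fix mu :: "'e measure" assume "mu : space ?N"
  hence mu: "mu : finite_measures" by simp
  show "sets (k mu) = sets borel" by (simp add: k_def finite_measuresD[OF mu])
  show "subprob_space (k mu)"
  proof
   have "space (k mu) = UNIV" by (simp add: k_def finite_measuresD[OF mu])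
   thus "emeasure (k mu) (space (k mu)) <= 1" "space (k mu) ~= {}"
    using ke[OF mu, of UNIV] c(2)[of mu] by (simp_all add: ennreal_le_1)
  qed
 next
  have m: "(%mu. emeasure (k mu) U) : \<B> ?N" if "open U" for U
  proof -
   have "(%mu. ennreal (c mu * measure mu U)) : \<B> ?N" using mm[OF that] by measurable
   thus ?thesis by (rule measurable_cong[THEN iffD1, rotated]) (use that in \<open>simp add: ke\<close>)
  qed
  show "(%mu. emeasure (k mu) U) : \<B> ?N" if "U : {S. open S}" for U using m that by simp
  show "(%mu. emeasure (k mu) UNIV) : \<B> ?N" by (rule m[OF open_UNIV])
 qed simp
 from measurable_compose[OF this integral_measurable_subprob_algebra[OF bbD[OF f]]]
 have [measurable]: "(%mu. \<integral>x. f x \<partial>k mu) : \<B> ?N" .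
 have "(%mu. (LINT x|k mu. f x) / c mu) : \<B> ?N" by measurable
 thus ?thesis
 proof (rule measurable_cong[THEN iffD1, rotated])
  fix mu :: "'e measure" assume "mu : space ?N"
  hence mu: "mu : finite_measures" by simp
  have "(LINT x|k mu. f x) = (LINT x|mu. c mu *\<^sub>R f x)"
   unfolding k_def using c(1)[of mu] bbD[OF f]
   by (intro integral_density) (auto simp: measurable_cong_sets[OF finite_measuresD(1)[OF mu] refl])
  thus "(LINT x|k mu. f x) / c mu = (LINT x|mu. f x)" using c(1)[of mu] by simp
 qed
qed

text \<open>The value at 0 makes \<open>1 - exp (- z) = z * exp_quotient z\<close> hold without
  exception and the function continuous at 0, so asymptotics of \<open>J\<close> pass to survival
  probabilities even where \<open>J\<close> vanishes.\<close>

definition exp_quotient :: "real => real" where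
 "exp_quotient z = (if z = 0 then 1 else (1 - exp (- z)) / z)"

lemma exp_quotient: "1 - exp (- z) = z * exp_quotient z"
 by (simp add: exp_quotient_def)

lemma isCont_exp_quotient: "isCont exp_quotient 0"
proof -
 have "((%z::real. exp (- z)) has_real_derivative - 1) (at 0)"
  by (auto intro!: derivative_eq_intros)
 hence "((%z::real. (exp (- z) - exp (- 0)) / (z - 0)) ---> - 1) (at 0)"
  by (simp add: has_field_derivative_iff)
 hence "((%z::real. - ((exp (- z) - exp (- 0)) / (z - 0))) ---> - (- 1)) (at 0)" by (rule tendsto_minus)
 hence "(exp_quotient ---> 1) (at 0)"
  by (rule filterlim_cong[THEN iffD1, OF _ refl, rotated 2])
   (auto simp: exp_quotient_def eventually_at_filter minus_divide_left intro!: always_eventually)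
 thus ?thesis by (simp add: isCont_def exp_quotient_def)
qed

lemma exp_quotient_tendsto: "(f ---> 0) F ==> ((%x. exp_quotient (f x)) ---> 1) F"
 using isCont_tendsto_compose[OF isCont_exp_quotient] by (simp add: exp_quotient_def)


text \<open>The limit \<open>w\<close> is a solution only when started at a positive time, so
  regular variation is first known for the coordinate of \<open>w (1 + t)\<close>. Monotonicity
  removes the shift: for \<open>s > 1\<close> and large \<open>t\<close> the value
  \<open>b (1 + t)\<close> lies between \<open>b (s * t)\<close> and \<open>b t\<close>.\<close>

lemma regularly_varying_translate:
 fixes b :: "real => real"
 assumes pos: "!!t. 0 <= t ==> 0 < b t" and mono: "!!t t'. 0 <= t ==> t <= t' ==> b t' <= b t"
  and rv: "!!u. 0 < u ==> ((%t. b (u * t) / b t) ---> u powr r) at_top" and u: "0 < u"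
 shows "((%t. b (u * t - 1) / b (t - 1)) ---> u powr r) at_top"
proof -
 have lim: "((%t. b (1 + t) / b t) ---> 1) at_top"
 proof (rule order_tendstoI)
  fix c :: real assume "1 < c"
  show "eventually (%t. b (1 + t) / b t < c) at_top"
   using eventually_ge_at_top[of 0]
  proof eventually_elim
   case (elim t)
   have "b (1 + t) / b t <= 1" using mono[OF elim, of "1 + t"] pos[OF elim] by simp
   thus ?case using \<open>1 < c\<close> by simp
  qed
 next
  fix c :: real assume c: "c < 1"
  have "((%s::real. s powr r) ---> 1 powr r) (at_right 1)"
   by (intro tendsto_powr tendsto_const tendsto_ident_at) simp
  hence "eventually (%s::real. c < s powr r) (at_right 1)" using c by (intro order_tendstoD(1)) auto
  moreover have "eventually (%s::real. 1 < s) (at_right 1)" by (simp add: eventually_at_filter)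
  ultimately have "eventually (%s::real. c < s powr r \<and> 1 < s) (at_right 1)" by (rule eventually_conj)
  then obtain s :: real where s: "c < s powr r" "1 < s"
   using eventually_happens[of _ "at_right (1::real)"] by auto
  have "((%t. b (s * t) / b t) ---> s powr r) at_top" using s by (intro rv) simp
  hence "eventually (%t. c < b (s * t) / b t) at_top" using s by (intro order_tendstoD(1))
  thus "eventually (%t. c < b (1 + t) / b t) at_top"
   using eventually_ge_at_top[of "max 0 (1 / (s - 1))"]
  proof eventually_elim
   case (elim t)
   have t: "0 <= t" using elim(2) by linarith
   have "1 / (s - 1) <= t" using elim(2) by linarith
   hence t1: "1 <= t * (s - 1)" using s by (simp add: pos_divide_le_eq)
   hence "b (s * t) <= b (1 + t)" using t by (intro mono) (auto simp: algebra_simps)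
   hence "b (s * t) / b t <= b (1 + t) / b t" using pos[OF t] by (intro divide_right_mono) auto
   thus ?case using elim(1) by linarith
  qed
 qed
 have f1: "filterlim (%t::real. t - 1) at_top at_top" by real_asymp
 have f2: "filterlim (%t. u * t - 1) at_top at_top" using u by real_asymp
 have "((%t. (b (1 + (t - 1)) / b (t - 1)) * (b (u * t) / b t) / (b (1 + (u * t - 1)) / b (u * t - 1))) ---> 1 * u powr r / 1) at_top"
  by (intro tendsto_mult tendsto_divide filterlim_compose[OF lim f1] filterlim_compose[OF lim f2] rv u) simp
 moreover have "eventually (%t. (b (1 + (t - 1)) / b (t - 1)) * (b (u * t) / b t) / (b (1 + (u * t - 1)) / b (u * t - 1)) = b (u * t - 1) / b (t - 1)) at_top"
  using eventually_ge_at_top[of "max 1 (1 / u)"]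
 proof eventually_elim
  case (elim t)
  hence t: "0 <= t - 1" "0 <= u * t - 1" using u by (auto simp: pos_divide_le_eq mult.commute)
  have "0 < b t" "0 < b (u * t)" using t by (auto intro!: pos)
  thus ?case using pos[OF t(1)] pos[OF t(2)] by simp
 qed
 ultimately show ?thesis by (auto intro: Lim_transform_eventually)
qed

section \<open>Extinction and survival of the superprocess\<close>

locale branching_process =
 stable_branching_semigroup m Q ph ph' ka ga ka0 ga0 K
 for m :: "'e::{metric_space, second_countable_topology} measure" and Q ph ph' ka ga ka0 ga0 K +
 fixes X :: "real => 'v => 'e measure" and P :: "'e measure => 'v measure"
 assumes prob_space_P: "!!mu. mu : finite_measures ==> prob_space (P mu)"
  and X_measurable: "!!t mu. 0 <= t ==> mu : finite_measures ==> X t : P mu \<rightarrow>\<^sub>M borel_of weak_topology"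
  and laplace: "!!f. f : bounded_borel ==> (!!x. 0 <= f x) ==>
   \<exists>v. solution v \<and> (\<forall>x. v 0 x = f x) \<and>
    (\<forall>t\<ge>0. \<forall>mu\<in>finite_measures. (LINT om|P mu. exp (- (LINT x|X t om. f x))) = exp (- (LINT x|mu. v t x)))"
begin

definition V :: "('e => real) => real => 'e => real" where
 "V f = (SOME v. solution v \<and> (\<forall>x. v 0 x = f x) \<and>
  (\<forall>t\<ge>0. \<forall>mu\<in>finite_measures. (LINT om|P mu. exp (- (LINT x|X t om. f x))) = exp (- (LINT x|mu. v t x))))"

lemma V:
 assumes "f : bounded_borel" "!!x. 0 <= f x"
 shows "solution (V f)" "V f 0 x = f x"
  "!!t mu. 0 <= t ==> mu : finite_measures ==> (LINT om|P mu. exp (- (LINT x|X t om. f x))) = exp (- (LINT x|mu. V f t x))"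
 using someI_ex[OF laplace[OF assms]] unfolding V_def[symmetric] by blast+

lemma a_V:
 assumes "f : bounded_borel" "!!x. 0 <= f x"
 shows "a (V f) 0 = (LINT x|m. f x * ph' x)"
 by (simp add: a_def V(2)[OF assms])

lemma X_finite: "0 <= t ==> mu : finite_measures ==> om : space (P mu) ==> X t om : finite_measures"
 using measurable_space[OF X_measurable] by simp

lemma X_integral_measurable:
 "0 <= t ==> mu : finite_measures ==> f : bounded_borel ==> (%om. \<integral>x. f x \<partial>X t om) : \<B> (P mu)"
 by (rule measurable_compose[OF X_measurable measurable_integral_weak])

lemma return_finite_measures: "return borel x : (finite_measures :: 'e measure set)"
 using prob_space_return[of x "borel :: 'e measure"] by (auto simp: finite_measures_def prob_space_def)

lemma const_bounded_borel: "(%_. c :: real) : (bounded_borel :: ('e => real) set)"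
 by (auto intro: bbI[of _ "\<bar>c\<bar>"])

text \<open>The order of solutions is read off the Laplace functional of the process started in a
  point mass.\<close>

lemma V_mono:
 assumes f: "f : bounded_borel" "!!x. 0 <= f x" and g: "g : bounded_borel" "!!x. f x <= g x" and t: "0 <= t"
 shows "V f t x <= V g t x"
proof -
 have g0: "0 <= g x" for x using f(2)[of x] g(2)[of x] by linarith
 let ?mu = "return borel x"
 note mu = return_finite_measures[of x]
 interpret prob_space "P ?mu" by (rule prob_space_P[OF mu])
 have r: "(LINT y|?mu. V h t y) = V h t x" if "h : bounded_borel" "!!x. 0 <= h x" for h
  using v_measurable_x[OF V(1)[OF that] t] by (simp add: integral_return)
 have nn: "0 <= (LINT x|X t om. h x)" if "!!x. 0 <= h x" for h :: "'e => real" and om using that by simp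
 have i: "integrable (P ?mu) (%om. exp (- (LINT x|X t om. h x)))" if "h : bounded_borel" "!!x. 0 <= h x" for h
 proof (rule integrable_const_bound[where B=1])
  show "(%om. exp (- (LINT x|X t om. h x))) : \<B> (P ?mu)"
   using X_integral_measurable[OF t mu that(1)] by measurable
 qed (use nn[of h] that in simp)
 have "exp (- V g t x) <= exp (- V f t x)"
  unfolding r[OF g(1) g0, symmetric] r[OF f, symmetric] V(3)[OF g(1) g0 t mu, symmetric] V(3)[OF f t mu, symmetric]
 proof (rule integral_mono[OF i[OF g(1) g0] i[OF f]])
  fix om assume "om : space (P ?mu)"
  hence "X t om : finite_measures" by (rule X_finite[OF t mu])
  hence "(LINT x|X t om. f x) <= (LINT x|X t om. g x)"
   using f g by (intro integral_mono finite_measure_integrable)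
  thus "exp (- (LINT x|X t om. g x)) <= exp (- (LINT x|X t om. f x))" by simp
 qed
 thus ?thesis by simp
qed

text \<open>The summand 1 keeps the initial value positive for \<open>n = 0\<close>, so that
  \<open>a\<close> is positive for every member of the family.\<close>

definition Vn :: "nat => real => 'e => real" where
 "Vn n = V (%_. real n + 1)"

text \<open>Meaningful for positive times only: at time 0 the family is unbounded and the supremum
  an arbitrary number.\<close>

definition w :: "real => 'e => real" where
 "w t x = (SUP n. Vn n t x)"

lemma Vn_solution: "solution (Vn n)"
 unfolding Vn_def by (rule V(1)[OF const_bounded_borel]) simp

lemma Vn_0: "0 < a (Vn n) 0"
proof -
 have "a (Vn n) 0 = (real n + 1) * mass'"
  unfolding Vn_def mass'_def by (subst a_V[OF const_bounded_borel]) auto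
 thus ?thesis using mass'_pos by (simp add: add_nonneg_pos)
qed

lemma Vn_mono: "0 <= t ==> Vn n t x <= Vn (Suc n) t x"
 unfolding Vn_def by (intro V_mono const_bounded_borel) auto

lemma w_limit: "0 < t ==> (%n. Vn n t x) ----> w t x"
 by (rule family_limit[OF Vn_solution Vn_0 _ w_def]) (simp_all add: Vn_mono)

lemma w_bound: "0 < T ==> \<exists>C>0. \<forall>n. \<forall>t\<ge>T. \<forall>x. Vn n t x <= C"
 by (rule family_bound[OF Vn_solution Vn_0 _ w_def]) (simp_all add: Vn_mono)

lemma w_solution: "0 < T ==> solution (%t. w (T + t))"
 by (rule limit_solution[OF Vn_solution Vn_0 _ w_def]) (simp_all add: Vn_mono)

lemma w_a_pos: "0 < T ==> 0 < a (%t. w (T + t)) 0"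
 by (rule limit_a_pos[OF Vn_solution Vn_0 _ w_def]) (simp_all add: Vn_mono)

lemma w_shift:
 assumes "0 < t" shows "solution (%s. w (t / 2 + s))" "0 < a (%s. w (t / 2 + s)) 0" "w t = w (t / 2 + t / 2)"
 using w_solution[of "t / 2"] w_a_pos[of "t / 2"] assms by auto

lemma w_pos: "0 < t ==> 0 < w t x"
 using v_pos[OF w_shift(1,2), of t "t / 2" x] by simp

lemma a_w_pos: "0 < t ==> 0 < a w t"
 using a_pos[OF w_shift(1,2), of t "t / 2"] unfolding a_shift by simp

lemma w_bounded_borel: "0 < t ==> w t : bounded_borel"
 using v_bounded_borel[OF w_shift(1), of t "t / 2"] by simp

text \<open>For \<open>t > 0\<close>, minus the logarithm of the extinction probability.\<close>

definition J :: "'e measure => real => real" where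
 "J mu t = (LINT x|mu. w t x)"

lemma integral_pos_finite:
 assumes mu: "mu : finite_measures" "total_mass mu ~= 0" and f: "f : bounded_borel" "!!x. 0 < f x"
 shows "0 < (LINT x|mu. f x)"
proof -
 interpret finite_measure mu by (rule finite_measuresD(2)[OF mu(1)])
 have i: "integrable mu f" by (rule finite_measure_integrable[OF mu(1) f(1)])
 have "(LINT x|mu. f x) ~= 0"
 proof
  assume "(LINT x|mu. f x) = 0"
  hence "AE x in mu. f x = 0" using integral_nonneg_eq_0_iff_AE[OF i] f(2) by (simp add: less_imp_le)
  hence "AE x in mu. False" by eventually_elim (use f(2) in \<open>auto simp: less_imp_neq[symmetric]\<close>)
  hence "emeasure mu (space mu) = 0" by (subst (asm) AE_iff_measurable[OF _ refl]) auto
  thus False using mu(2) by (simp add: total_mass_def emeasure_eq_measure)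
 qed
 moreover have "0 <= (LINT x|mu. f x)" using f(2) by (simp add: less_imp_le)
 ultimately show ?thesis by simp
qed

lemma J_limit:
 assumes mu: "mu : finite_measures" and t: "0 < t"
 shows "(%n. \<integral>x. Vn n t x \<partial>mu) ----> J mu t"
 unfolding J_def
proof -
 obtain C where C: "0 < C" "!!n x. Vn n t x <= C" using w_bound[OF t] by blast
 interpret finite_measure mu by (rule finite_measuresD(2)[OF mu])
 note [measurable_cong] = finite_measuresD(1)[OF mu]
 show "(%n. \<integral>x. Vn n t x \<partial>mu) ----> (LINT x|mu. w t x)"
 proof (rule integral_dominated_convergence[where w="%_. C"])
  show "w t : \<B> mu" using bbD[OF w_bounded_borel[OF t]] by simp
  show "Vn n t : \<B> mu" for n using v_measurable_x[OF Vn_solution, of t n] t by simp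
  show "AE x in mu. (%n. Vn n t x) ----> w t x" using w_limit[OF t] by auto
  show "AE x in mu. norm (Vn n t x) <= C" for n using C(2) v_nonneg[OF Vn_solution, of t n] t by auto
 qed simp
qed

lemma extinction_event:
 assumes mu: "mu : finite_measures" and t: "0 <= t"
 shows "{om : space (P mu). total_mass (X t om) = 0} : sets (P mu)"
  "{om : space (P mu). total_mass (X t om) ~= 0} : sets (P mu)"
  "(%om. total_mass (X t om)) : \<B> (P mu)"
proof -
 have "(%om. \<integral>x. (1 :: real) \<partial>X t om) : \<B> (P mu)"
  by (rule X_integral_measurable[OF t mu const_bounded_borel])
 thus [measurable]: "(%om. total_mass (X t om)) : \<B> (P mu)"
  by (simp add: total_mass_def)
 show "{om : space (P mu). total_mass (X t om) = 0} : sets (P mu)"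
  "{om : space (P mu). total_mass (X t om) ~= 0} : sets (P mu)"
  by measurable
qed

text \<open>For constant functions the Laplace functional is the Laplace transform of the total
  mass; as the constant grows, the exponential tends to the indicator of extinction.\<close>

lemma extinction_probability:
 assumes mu: "mu : finite_measures" and t: "0 < t"
 shows "\<P>(om in P mu. total_mass (X t om) = 0) = exp (- J mu t)"
proof -
 interpret prob_space "P mu" by (rule prob_space_P[OF mu])
 have t0: "0 <= t" using t by simp
 note M = extinction_event[OF mu t0]
 have M0: "0 <= total_mass \<nu>" for \<nu> :: "'e measure" by (simp add: total_mass_def)
 have L: "(LINT om|P mu. exp (- ((real n + 1) * total_mass (X t om)))) = exp (- (LINT x|mu. Vn n t x))" for n
  using V(3)[OF const_bounded_borel _ t0 mu, of "real n + 1"] by (simp add: Vn_def total_mass_def mult.commute)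
 have "(%n. \<integral>om. exp (- ((real n + 1) * total_mass (X t om))) \<partial>P mu) ---->
  (LINT om|P mu. indicator {om : space (P mu). total_mass (X t om) = 0} om)"
 proof (rule integral_dominated_convergence[where w="%_. 1"])
  show "AE om in P mu. (%n. exp (- ((real n + 1) * total_mass (X t om)))) ---->
   indicator {om : space (P mu). total_mass (X t om) = 0} om"
  proof (rule AE_I2)
   fix om assume om: "om : space (P mu)"
   show "(%n. exp (- ((real n + 1) * total_mass (X t om)))) ----> indicator {om : space (P mu). total_mass (X t om) = 0} om"
   proof (cases "total_mass (X t om) = 0")
    case False
    hence p: "0 < total_mass (X t om)" using M0[of "X t om"] by linarith
    hence "(%n. exp (- ((real n + 1) * total_mass (X t om)))) ----> 0" by real_asymp
    thus ?thesis using False by simp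
   qed (use om in simp)
  qed
  show "(%om. exp (- ((real n + 1) * total_mass (X t om)))) : \<B> (P mu)" for n
   using M(3) by measurable
  show "AE om in P mu. norm (exp (- ((real n + 1) * total_mass (X t om)))) <= 1" for n
   using M0 by simp
 qed (use M in auto)
 moreover have "(%n. exp (- (LINT x|mu. Vn n t x))) ----> exp (- J mu t)"
  by (intro tendsto_intros J_limit mu t)
 ultimately have "(LINT om|P mu. indicator {om : space (P mu). total_mass (X t om) = 0} om) = exp (- J mu t)"
  unfolding L by (rule LIMSEQ_unique)
 thus ?thesis using M(1) by simp
qed

lemma survival:
 assumes mu: "mu : finite_measures" and t: "0 < t"
 shows "survival_probability X P mu t = 1 - exp (- J mu t)"
proof -
 interpret prob_space "P mu" by (rule prob_space_P[OF mu])
 have t0: "0 <= t" using t by simp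
 show ?thesis
  using prob_neg[OF extinction_event(1)[OF mu t0]] extinction_probability[OF mu t]
  by (simp add: survival_probability_def)
qed


lemma shift_at_top: "((%t::real. f (1 + t)) ---> l) at_top ==> (f ---> l) at_top"
proof -
 assume "((%t::real. f (1 + t)) ---> l) at_top"
 moreover have "filterlim (%t::real. t - 1) at_top at_top" by real_asymp
 ultimately have "((%t. f (1 + (t - 1))) ---> l) at_top" by (rule filterlim_compose)
 thus ?thesis by simp
qed

lemma J_over_a:
 assumes mu: "mu : finite_measures"
 shows "((%t. J mu t / a w t) ---> (LINT x|mu. ph x)) at_top"
proof (rule shift_at_top)
 have "((%t. (LINT x|mu. w (1 + t) x) / a (%t. w (1 + t)) t) ---> (LINT x|mu. ph x)) at_top"
  by (rule integral_v_over_a[OF finite_measuresD(1,2)[OF mu] w_solution w_a_pos]) auto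
 thus "((%t. J mu (1 + t) / a w (1 + t)) ---> (LINT x|mu. ph x)) at_top"
  unfolding J_def a_shift .
qed

lemma a_w_tendsto_0: "(a w ---> 0) at_top"
proof (rule shift_at_top)
 have "(a (%t. w (1 + t)) ---> 0) at_top" by (rule a_tendsto_0[OF w_solution]) simp
 thus "((%t. a w (1 + t)) ---> 0) at_top" unfolding a_shift[abs_def] by (simp add: a_def[abs_def])
qed

lemma J_tendsto_0:
 assumes mu: "mu : finite_measures"
 shows "(J mu ---> 0) at_top"
proof -
 have "((%t. J mu t / a w t * a w t) ---> (LINT x|mu. ph x) * 0) at_top"
  by (intro tendsto_mult J_over_a a_w_tendsto_0 mu)
 moreover have "eventually (%t. J mu t / a w t * a w t = J mu t) at_top"
  using eventually_gt_at_top[of 0]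
 proof eventually_elim
  case (elim t)
  hence "0 < a w t" using a_w_pos by simp
  thus ?case by simp
 qed
 ultimately show ?thesis by (auto intro: Lim_transform_eventually)
qed

lemma survival_tendsto_0:
 assumes mu: "mu : finite_measures"
 shows "(survival_probability X P mu ---> 0) at_top"
proof -
 have "((%t. 1 - exp (- J mu t)) ---> 1 - exp (- 0)) at_top" by (intro tendsto_intros J_tendsto_0 mu)
 moreover have "eventually (%t. 1 - exp (- J mu t) = survival_probability X P mu t) at_top"
  using eventually_gt_at_top[of 0] by eventually_elim (simp add: survival mu)
 ultimately show ?thesis by (auto intro: Lim_transform_eventually)
qed

lemma J_pos: "mu : finite_measures ==> total_mass mu ~= 0 ==> 0 < t ==> 0 < J mu t"
 unfolding J_def by (rule integral_pos_finite) (auto intro: w_bounded_borel w_pos)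

lemma a_w_regularly_varying:
 assumes u: "0 < u"
 shows "((%t. a w (u * t) / a w t) ---> u powr - (1 / (ga0 - 1))) at_top"
proof -
 have b: "(%t. w (1 + t)) = (%t. w (1 + t))" ..
 note sol = w_solution[of 1, simplified] and ap = w_a_pos[of 1, simplified]
 have "((%t. a (%t. w (1 + t)) (u * t - 1) / a (%t. w (1 + t)) (t - 1)) ---> u powr - (1 / (ga0 - 1))) at_top"
 proof (rule regularly_varying_translate[OF _ _ _ u])
  show "0 < a (%t. w (1 + t)) t" if "0 <= t" for t by (rule a_pos[OF sol ap that])
  show "a (%t. w (1 + t)) t' <= a (%t. w (1 + t)) t" if "0 <= t" "t <= t'" for t t' by (rule a_antimono[OF sol that])
  show "((%t. a (%t. w (1 + t)) (u * t) / a (%t. w (1 + t)) t) ---> u powr - (1 / (ga0 - 1))) at_top" if "0 < u" for u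
   by (rule a_regularly_varying[OF sol ap that])
 qed
 thus ?thesis unfolding a_shift by simp
qed

lemma J_measurable:
 assumes mu: "mu : finite_measures"
 shows "J mu : \<B> (restrict_space borel {0<..})"
proof (rule borel_measurable_LIMSEQ_real)
 interpret finite_measure mu by (rule finite_measuresD(2)[OF mu])
 note [measurable_cong] = finite_measuresD(1)[OF mu]
 fix n
 have S: "\<B> (borel \<Otimes>\<^sub>M mu) = (\<B> borel2 :: (real \<times> 'e => real) set)"
  by (intro measurable_cong_sets sets_pair_measure_cong) (auto simp: finite_measuresD[OF mu])
 have "(%(t, x). Vn n (max 0 t) x) : \<B> (borel \<Otimes>\<^sub>M mu)"
  unfolding S by (rule v_measurable[OF Vn_solution])
 hence "(%t. \<integral>x. Vn n (max 0 t) x \<partial>mu) : \<B> borel" by (rule borel_measurable_lebesgue_integral)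
 thus "(%t. \<integral>x. Vn n (max 0 t) x \<partial>mu) : \<B> (restrict_space borel {0<..})"
  by (rule measurable_restrict_space1)
next
 fix t :: real assume "t : space (restrict_space borel {0<..})"
 hence "0 < t" by (simp add: space_restrict_space)
 thus "(%n. \<integral>x. Vn n (max 0 t) x \<partial>mu) ----> J mu t" using J_limit[OF mu] by (simp add: max_def)
qed

text \<open>Survival is \<open>J\<close> times \<open>exp_quotient J\<close>, and \<open>J\<close>
  behaves like a multiple of \<open>a w\<close>; the multiple is positive since the starting measure
  is not 0. Only \<open>a w\<close> contributes to the index.\<close>

lemma survival_regularly_varying:
 assumes mu: "mu : finite_measures" "total_mass mu ~= 0"
 shows "regularly_varying (survival_probability X P mu) (- (1 / (ga0 - 1)))"
 unfolding regularly_varying_def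
proof (intro conjI allI impI)
 have "(%t. 1 - exp (- J mu t)) : \<B> (restrict_space borel {0<..})"
  using J_measurable[OF mu(1)] by measurable
 thus "survival_probability X P mu : \<B> (restrict_space borel {0<..})"
  by (rule measurable_cong[THEN iffD1, rotated]) (simp add: space_restrict_space survival[OF mu(1)])
 show "0 < survival_probability X P mu t" if "0 < t" for t
  using J_pos[OF mu that] by (simp add: survival[OF mu(1) that])
 fix u :: real assume u: "0 < u"
 define I where "I = (LINT x|mu. ph x)"
 have I: "0 < I" unfolding I_def by (rule integral_pos_finite[OF mu ph_bounded_borel ph_pos(1)])
 have ut: "filterlim (%t. u * t) at_top at_top"
  by (rule filterlim_tendsto_pos_mult_at_top[OF tendsto_const u filterlim_ident])
 have q: "((%t. exp_quotient (J mu t)) ---> 1) at_top" by (intro exp_quotient_tendsto J_tendsto_0 mu)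
 have JI: "((%t. J mu t / a w t) ---> I) at_top" unfolding I_def by (rule J_over_a[OF mu(1)])
 have "((%t. (J mu (u * t) / a w (u * t)) / (J mu t / a w t) * (exp_quotient (J mu (u * t)) / exp_quotient (J mu t)) * (a w (u * t) / a w t))
  ---> I / I * (1 / 1) * u powr - (1 / (ga0 - 1))) at_top"
  using I by (intro tendsto_mult tendsto_divide filterlim_compose[OF JI ut] filterlim_compose[OF q ut] JI q a_w_regularly_varying u) auto
 moreover have "eventually (%t. (J mu (u * t) / a w (u * t)) / (J mu t / a w t) * (exp_quotient (J mu (u * t)) / exp_quotient (J mu t)) * (a w (u * t) / a w t)
  = survival_probability X P mu (u * t) / survival_probability X P mu t) at_top"
  using eventually_gt_at_top[of 0]
 proof eventually_elim
  case (elim t)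
  hence "0 < u * t" using u by simp
  note p = a_w_pos[OF elim] a_w_pos[OF this]
  show ?case
   using p unfolding survival[OF mu(1) elim] survival[OF mu(1) \<open>0 < u * t\<close>] exp_quotient by simp
 qed
 ultimately show "((%t. survival_probability X P mu (u * t) / survival_probability X P mu t) ---> u powr - (1 / (ga0 - 1))) at_top"
  using I by (auto intro: Lim_transform_eventually)
qed

text \<open>Since \<open>w\<close> is used as a solution from time 1 on, the asymptotics is first
  known for \<open>a w (1 + t) / et' t\<close>; the quotient \<open>et' t / et' (1 + t)\<close>
  tends to 1.\<close>

lemma a_w_over_et':
 assumes CX: "0 < CX"
 shows "((%t. a w t / et' t) ---> 1) at_top"
proof (rule shift_at_top)
 have "((%t. a (%t. w (1 + t)) t / et' t) ---> 1) at_top"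
  by (rule a_et'[OF w_solution w_a_pos CX]) auto
 hence "((%t. a w (1 + t) / et' t) ---> 1) at_top" unfolding a_shift .
 moreover have "((%t. (t / (1 + t)) powr (- 1 / (ga0 - 1))) ---> 1 powr (- 1 / (ga0 - 1))) at_top"
  by (intro tendsto_powr tendsto_const) (real_asymp, simp)
 ultimately have "((%t. a w (1 + t) / et' t * (t / (1 + t)) powr (- 1 / (ga0 - 1))) ---> 1 * 1 powr (- 1 / (ga0 - 1))) at_top"
  by (rule tendsto_mult)
 moreover have "eventually (%t. a w (1 + t) / et' t * (t / (1 + t)) powr (- 1 / (ga0 - 1)) = a w (1 + t) / et' (1 + t)) at_top"
  using eventually_gt_at_top[of 0]
 proof eventually_elim
  case (elim t)
  have "0 < CX * (ga0 - 1)" using CX ga0(1) by simp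
  hence "et' t / et' (1 + t) = ((CX * (ga0 - 1) * t) / (CX * (ga0 - 1) * (1 + t))) powr (- 1 / (ga0 - 1))"
   unfolding et'_def using elim by (subst powr_divide) auto
  also have "(CX * (ga0 - 1) * t) / (CX * (ga0 - 1) * (1 + t)) = t / (1 + t)"
   using \<open>0 < CX * (ga0 - 1)\<close> by (intro mult_divide_mult_cancel_left) auto
  finally have "(t / (1 + t)) powr (- 1 / (ga0 - 1)) = et' t / et' (1 + t)" ..
  thus ?case using et'_pos[OF CX elim] by simp
 qed
 ultimately show "((%t. a w (1 + t) / et' (1 + t)) ---> 1) at_top"
  by (auto intro: Lim_transform_eventually)
qed

lemma J_over_et':
 assumes CX: "0 < CX" and mu: "mu : finite_measures"
 shows "((%t. J mu t / et' t) ---> (LINT x|mu. ph x)) at_top"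
proof -
 have "((%t. (J mu t / a w t) * (a w t / et' t)) ---> (LINT x|mu. ph x) * 1) at_top"
  by (intro tendsto_mult J_over_a a_w_over_et' CX mu)
 moreover have "eventually (%t. (J mu t / a w t) * (a w t / et' t) = J mu t / et' t) at_top"
  using eventually_gt_at_top[of 0]
 proof eventually_elim
  case (elim t)
  show ?case using a_w_pos[OF elim] by simp
 qed
 ultimately show ?thesis by (auto intro: Lim_transform_eventually)
qed

lemma survival_over_et':
 assumes CX: "0 < CX" and mu: "mu : finite_measures"
 shows "((%t. inverse (et' t) * survival_probability X P mu t) ---> (LINT x|mu. ph x)) at_top"
proof -
 have "((%t. J mu t / et' t * exp_quotient (J mu t)) ---> (LINT x|mu. ph x) * 1) at_top"
  by (intro tendsto_mult J_over_et' CX mu exp_quotient_tendsto J_tendsto_0)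
 moreover have "eventually (%t. J mu t / et' t * exp_quotient (J mu t) = inverse (et' t) * survival_probability X P mu t) at_top"
  using eventually_gt_at_top[of 0]
  by eventually_elim (simp add: survival[OF mu] exp_quotient divide_inverse mult_ac)
 ultimately show ?thesis by (auto intro: Lim_transform_eventually)
qed

end

section \<open>The law conditioned on survival and its limit\<close>

lemma (in prob_space) integral_uniform_measure:
 fixes g :: "'a => real"
 assumes A: "A : sets M" "0 < measure M A" and g: "g : \<B> M"
 shows "(LINT x|uniform_measure M A. g x) = (LINT x|M. indicator A x * g x) / measure M A"
proof -
 have "uniform_measure M A = density M (%x. ennreal (indicator A x / measure M A))"
  unfolding uniform_measure_def emeasure_eq_measure
 proof (intro density_cong AE_I2)
  show "indicator A x / ennreal (measure M A) = ennreal (indicator A x / measure M A)" for x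
   using A(2) divide_ennreal[of 1 "measure M A"] by (cases "x : A") simp_all
 qed (use A(1) in measurable)
 hence "(LINT x|uniform_measure M A. g x) = (LINT x|M. (indicator A x / measure M A) *\<^sub>R g x)"
  using A g by (simp only:) (intro integral_density, auto)
 thus ?thesis by simp
qed

definition limit_laplace :: "real => real => real" where
 "limit_laplace r u = 1 - (1 + u powr (- r)) powr (- 1 / r)"

lemma limit_laplace_at_0:
 assumes r: "0 < r"
 shows "(limit_laplace r ---> 1) (at_right 0)"
proof (rule tendsto_sandwich)
 have "(1 + u powr - r) powr (- 1 / r) <= u" if u: "0 < u" for u
 proof -
  have "(1 + u powr - r) powr (- 1 / r) <= (u powr - r) powr (- 1 / r)"
   using r u by (intro powr_mono2') auto
  thus ?thesis using r u by (simp add: powr_powr)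
 qed
 thus "eventually (%u. 1 - u <= limit_laplace r u) (at_right 0)"
  by (auto simp: limit_laplace_def eventually_at_filter)
 show "eventually (%u. limit_laplace r u <= 1) (at_right 0)" by (simp add: limit_laplace_def)
 show "((%u. 1 - u) ---> 1) (at_right (0::real))" by (auto intro!: tendsto_eq_intros)
qed auto

lemma limit_laplace_at_top:
 assumes r: "0 < r"
 shows "(limit_laplace r ---> 0) at_top"
proof -
 have "((%u. u powr - r) ---> 0) at_top" using r by (intro tendsto_neg_powr filterlim_ident) auto
 hence "((%u. 1 - (1 + u powr - r) powr (- 1 / r)) ---> 1 - (1 + 0) powr (- 1 / r)) at_top"
  by (intro tendsto_intros) auto
 thus ?thesis by (simp add: limit_laplace_def[abs_def])
qed

text \<open>The atom at 0 is bounded by the Laplace transform at every positive \<open>n\<close>,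
  which tends to 0. This upgrades non-negativity of the limit variable to positivity.\<close>

lemma limit_law_of_laplace:
 assumes r: "0 < r" and Z: "real_distribution Z" "AE z in Z. 0 <= z"
  and L: "!!u. 0 < u ==> (LINT z|Z. exp (- (u * z))) = limit_laplace r u"
 shows "limit_law r Z"
proof -
 interpret Z: real_distribution Z by (rule Z)
 have i: "integrable Z (%z. exp (- (u * z)))" if "0 < u" for u
 proof (rule Z.integrable_const_bound[where B=1])
  show "AE z in Z. norm (exp (- (u * z))) <= 1" using Z(2) by eventually_elim (use that in simp)
 qed simp
 have le: "measure Z {0} <= limit_laplace r (real n)" if "0 < n" for n
 proof -
  have ii: "integrable Z (indicator {0} :: real => real)"
   by (intro integrable_real_indicator) (auto simp: Z.emeasure_eq_measure)
  have "measure Z {0} = (LINT z|Z. indicator {0} z)" by simp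
  also have "... <= (LINT z|Z. exp (- (real n * z)))"
   using that by (intro integral_mono ii i) (auto simp: indicator_def)
  finally show ?thesis using L[of "real n"] that by simp
 qed
 have "eventually (%n. measure Z {0} <= limit_laplace r (real n)) sequentially"
  using eventually_gt_at_top[of 0] by eventually_elim (rule le)
 hence "measure Z {0} <= 0"
  by (intro tendsto_lowerbound[OF filterlim_compose[OF limit_laplace_at_top[OF r] filterlim_real_sequentially]]) auto
 hence z: "measure Z {0} = 0" using measure_nonneg[of Z "{0}"] by linarith
 hence "AE z in Z. z ~= 0"
  by (intro AE_I[where N="{0}"]) (auto simp: Z.emeasure_eq_measure)
 hence "AE z in Z. 0 < z" using Z(2) by eventually_elim simp
 moreover have "(LINT z|Z. exp (- u * z)) = (if u = 0 then 1 else 1 - (1 + u powr (- r)) powr (- 1 / r))" if "0 <= u" for u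
  using that L[of u] Z.prob_space by (cases "u = 0") (simp_all add: limit_laplace_def)
 ultimately show ?thesis using Z(1) by (simp add: limit_law_def)
qed

context branching_process
begin

lemma extinct_integral:
 assumes mu: "mu : finite_measures" and t: "0 <= t" and om: "om : space (P mu)" "total_mass (X t om) = 0"
 shows "(LINT x|X t om. f x) = (0 :: real)"
proof -
 interpret finite_measure "X t om" by (rule finite_measuresD(2)[OF X_finite[OF t mu om(1)]])
 have "emeasure (X t om) (space (X t om)) = 0" using om(2) by (simp add: total_mass_def emeasure_eq_measure)
 hence "AE x in X t om. False" by (intro AE_I[where N="space (X t om)"]) auto
 hence "AE x in X t om. f x = 0" by eventually_elim simp
 thus ?thesis by (rule integral_eq_zero_AE)
qed

lemma survival_pos: "mu : finite_measures ==> total_mass mu ~= 0 ==> 0 < t ==> 0 < survival_probability X P mu t"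
 using J_pos by (simp add: survival)

lemma survival_conditioned_prob_space:
 assumes mu: "mu : finite_measures" "total_mass mu ~= 0" and t: "0 < t"
 shows "prob_space (survival_conditioned X P mu t)"
proof -
 interpret prob_space "P mu" by (rule prob_space_P[OF mu(1)])
 show ?thesis
  unfolding survival_conditioned_def using survival_pos[OF mu t]
  by (intro prob_space_uniform_measure) (auto simp: emeasure_eq_measure survival_probability_def)
qed

text \<open>On extinction the integrand is 1, so its contribution is exactly the extinction
  probability and can be subtracted from the unconditional Laplace functional.\<close>

lemma conditioned_laplace:
 assumes mu: "mu : finite_measures" "total_mass mu ~= 0" and t: "0 < t" and f: "f : bounded_borel" "!!x. 0 <= f x"
 shows "(LINT om|survival_conditioned X P mu t. exp (- (LINT x|X t om. f x))) =
  1 - (1 - exp (- (LINT x|mu. V f t x))) / (1 - exp (- J mu t))"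
proof -
 interpret prob_space "P mu" by (rule prob_space_P[OF mu(1)])
 have t0: "0 <= t" using t by simp
 define S where "S = {om : space (P mu). total_mass (X t om) ~= 0}"
 define E where "E = {om : space (P mu). total_mass (X t om) = 0}"
 have Sm: "S : sets (P mu)" "E : sets (P mu)"
  unfolding S_def E_def by (rule extinction_event[OF mu(1) t0])+
 have pS: "measure (P mu) S = 1 - exp (- J mu t)" and pE: "measure (P mu) E = exp (- J mu t)"
  using survival[OF mu(1) t] extinction_probability[OF mu(1) t] by (simp_all add: S_def E_def survival_probability_def)
 have pS0: "0 < measure (P mu) S" using survival_pos[OF mu t] by (simp add: S_def survival_probability_def)
 define g where "g om = exp (- (LINT x|X t om. f x))" for om
 have gm: "g : \<B> (P mu)"
  unfolding g_def using X_integral_measurable[OF t0 mu(1) f(1)] by measurable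
 have nn: "0 <= (LINT x|X t om. f x)" for om using f(2) by simp
 have gi: "integrable (P mu) g" by (rule integrable_const_bound[where B=1]) (use gm nn in \<open>auto simp: g_def\<close>)
 have "(LINT om|survival_conditioned X P mu t. g om) = (LINT om|P mu. indicator S om * g om) / measure (P mu) S"
  unfolding survival_conditioned_def S_def[symmetric] by (rule integral_uniform_measure[OF Sm(1) pS0 gm])
 also have "(LINT om|P mu. indicator S om * g om) = (LINT om|P mu. g om - indicator E om)"
  using extinct_integral[OF mu(1) t0, of _ f]
  by (intro bochner_cong refl) (auto simp: S_def E_def g_def indicator_def)
 also have "... = exp (- (LINT x|mu. V f t x)) - exp (- J mu t)"
  using gi Sm(2) pE V(3)[OF f t0 mu(1)] by (simp add: g_def[abs_def] emeasure_eq_measure)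
 finally have "(LINT om|survival_conditioned X P mu t. g om) = (exp (- (LINT x|mu. V f t x)) - exp (- J mu t)) / (1 - exp (- J mu t))"
  by (simp add: pS)
 also have "... = 1 - (1 - exp (- (LINT x|mu. V f t x))) / (1 - exp (- J mu t))"
  using pS0 by (simp add: pS field_simps)
 finally show ?thesis by (simp add: g_def)
qed

text \<open>\<open>c * ph\<close> is invariant under the linear flow, which lies above the nonlinear
  one. A solution that starts below \<open>c * ph\<close> therefore stays there for all time; this
  is the smallness that the uniform rates ask for.\<close>

lemma V_le_eigenfunction:
 assumes f: "f : bounded_borel" "!!x. 0 <= f x" "!!x. f x <= c * ph x" and t: "0 <= t"
 shows "V f t x <= c * ph x"
proof -
 note sol = V(1)[OF f(1,2)]
 have V0: "V f 0 = f" by (rule ext) (rule V(2)[OF f(1,2)])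
 have "V f (0 + t) x + (LBINT r:{0..t}. Q r (N (V f) (0 + t - r)) x) = Q t (V f 0) x"
  by (rule v_eq[OF sol t order_refl])
 moreover have "0 <= (LBINT r:{0..t}. Q r (N (V f) (0 + t - r)) x)"
  unfolding set_lebesgue_integral_def
 proof (intro integral_nonneg_AE AE_I2)
  show "0 <= indicator {0..t} r *\<^sub>R Q r (N (V f) (0 + t - r)) x" for r
   using Q_nonneg[OF _ N_bounded_borel[OF sol, of "0 + t - r"] N_nonneg[OF sol], of r x] by (simp add: indicator_def)
 qed
 moreover have "Q t f x <= Q t (%y. c * ph y) x" by (intro Q_mono t f cmult_bounded_borel ph_bounded_borel)
 moreover have "Q t (%y. c * ph y) x = c * ph x" using Q_cmult[OF t ph_bounded_borel] invariant[OF t] by simp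
 ultimately show ?thesis by (simp add: V0)
qed

context
 fixes f :: "'e => real" and c :: real
 assumes CX: "0 < CX" and f: "f : \<B> borel" "!!x. 0 <= f x" "!!x. f x <= c * ph x"
  and pos: "0 < (LINT x|m. f x * ph' x)"
begin

lemma f_bounded_borel: "f : bounded_borel"
proof -
 obtain C where C: "!!x. ph x <= C" using ph_bounded by blast
 have "0 <= c * ph undefined" using f(2,3)[of undefined] by linarith
 hence "0 <= c" using ph_pos(1)[of undefined] by (simp add: zero_le_mult_iff)
 hence "f x <= c * C" for x using f(3)[of x] mult_left_mono[OF C[of x], of c] by linarith
 thus ?thesis using f(1,2) by (intro bbI[of _ "c * C"]) auto
qed

definition scaled_law :: "'e measure => real => real measure" where
 "scaled_law mu t = distr (survival_conditioned X P mu t) borel (%om. et' t * (LINT x|X t om. f x))"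

lemma scaled_measurable:
 assumes mu: "mu : finite_measures" and t: "0 <= t"
 shows "(%om. et' t * (LINT x|X t om. f x)) : \<B> (survival_conditioned X P mu t)"
proof -
 have "(%om. et' t * (LINT x|X t om. f x)) : \<B> (P mu)"
  using X_integral_measurable[OF t mu f_bounded_borel] by measurable
 thus ?thesis by (simp add: survival_conditioned_def measurable_cong_sets[OF sets_uniform_measure refl])
qed

lemma scaled_law:
 assumes mu: "mu : finite_measures" "total_mass mu ~= 0" and t: "0 < t"
 shows "real_distribution (scaled_law mu t)" "AE x in scaled_law mu t. 0 <= x"
  "!!u. 0 < u ==> (LINT x|scaled_law mu t. exp (- (u * x))) =
   1 - (1 - exp (- (LINT x|mu. V (%x. u * et' t * f x) t x))) / (1 - exp (- J mu t))"
proof -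
 interpret C: prob_space "survival_conditioned X P mu t" by (rule survival_conditioned_prob_space[OF mu t])
 have t0: "0 <= t" using t by simp
 note sm = scaled_measurable[OF mu(1) t0]
 have e: "0 < et' t" by (rule et'_pos[OF CX t])
 show "real_distribution (scaled_law mu t)"
  unfolding scaled_law_def by (rule C.real_distribution_distr[OF sm])
 show "AE x in scaled_law mu t. 0 <= x"
  unfolding scaled_law_def using f(2) e by (subst AE_distr_iff[OF sm]) (auto intro!: AE_I2)
 show "(LINT x|scaled_law mu t. exp (- (u * x))) =
   1 - (1 - exp (- (LINT x|mu. V (%x. u * et' t * f x) t x))) / (1 - exp (- J mu t))" if u: "0 < u" for u
 proof -
  have "(LINT x|scaled_law mu t. exp (- (u * x))) = (LINT om|survival_conditioned X P mu t. exp (- (u * (et' t * (LINT x|X t om. f x)))))"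
   unfolding scaled_law_def by (rule integral_distr[OF sm]) measurable
  also have "... = (LINT om|survival_conditioned X P mu t. exp (- (LINT x|X t om. u * et' t * f x)))"
   by (simp add: mult.assoc)
  also have "... = 1 - (1 - exp (- (LINT x|mu. V (%x. u * et' t * f x) t x))) / (1 - exp (- J mu t))"
   using u e f(2) by (intro conditioned_laplace mu t cmult_bounded_borel f_bounded_borel) auto
  finally show ?thesis .
 qed
qed

text \<open>Numerator and denominator of the conditional Laplace transform are both divided by
  \<open>et' t\<close>. They tend to \<open>I * L\<close> and \<open>I\<close>, so the starting
  measure cancels; \<open>scaled_family_limit\<close> provides the first limit because the initial
  value \<open>u * et' t * f\<close> has integral \<open>u * p * et' t\<close> against
  \<open>ph'\<close>.\<close>

lemma scaled_laplace_limit: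
 assumes mu: "mu : finite_measures" "total_mass mu ~= 0"
  and t: "!!n. 0 < t n" "filterlim t at_top sequentially" and u: "0 < u"
 shows "(%n. \<integral>x. exp (- (u * x)) \<partial>scaled_law mu (t n)) ----> limit_laplace (ga0 - 1) (u * (LINT x|m. f x * ph' x))"
proof -
 define I where "I = (LINT x|mu. ph x)"
 have I: "0 < I" unfolding I_def by (rule integral_pos_finite[OF mu ph_bounded_borel ph_pos(1)])
 define p where "p = (LINT x|m. f x * ph' x)"
 define F where "F n x = u * et' (t n) * f x" for n x
 have e: "0 < et' (t n)" for n by (rule et'_pos[OF CX t(1)])
 have F: "F n : bounded_borel" "0 <= F n x" for n x
  unfolding F_def using u e[of n] f(2)[of x] by (auto intro: cmult_bounded_borel f_bounded_borel)
 obtain C where C: "!!x. ph x <= C" using ph_bounded by blast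
 have c: "0 <= c"
 proof -
  have "0 <= c * ph undefined" using f(2,3)[of undefined] by linarith
  thus ?thesis using ph_pos(1)[of undefined] by (simp add: zero_le_mult_iff)
 qed
 define L where "L = (1 + (u * p) powr - (ga0 - 1)) powr (- 1 / (ga0 - 1))"
 define A where "A n = (LINT x|mu. V (F n) (t n) x)" for n
 have et0: "(%n. et' (t n)) ----> 0"
 proof -
  have "0 < CX * (ga0 - 1)" using CX ga0(1) by simp
  hence "filterlim (%n. CX * (ga0 - 1) * t n) at_top sequentially"
   by (intro filterlim_tendsto_pos_mult_at_top[OF tendsto_const _ t(2)])
  thus ?thesis unfolding et'_def using ga0(1) by (intro tendsto_neg_powr) auto
 qed
 have AL: "(%n. A n / et' (t n)) ----> I * L"
  unfolding A_def I_def L_def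
 proof (rule scaled_family_limit[OF finite_measuresD(1,2)[OF mu(1)] CX V(1)[OF F] t])
  show "V (F n) r x <= u * et' (t n) * c * C" if "0 <= r" for n r x
  proof -
   have "F n y <= (u * et' (t n) * c) * ph y" for y
    unfolding F_def using mult_left_mono[OF f(3)[of y], of "u * et' (t n)"] u e[of n] by (simp add: mult_ac)
   hence "V (F n) r x <= (u * et' (t n) * c) * ph x" by (rule V_le_eigenfunction[OF F _ that])
   also have "... <= (u * et' (t n) * c) * C" using C u e[of n] c by (intro mult_left_mono) auto
   finally show ?thesis .
  qed
  have "(%n. u * et' (t n) * c * C) ----> u * 0 * c * C" by (intro tendsto_intros et0)
  thus "(%n. u * et' (t n) * c * C) ----> 0" by simp
  show "0 < u * p" using u pos by (simp add: p_def)
  show "a (V (F n)) 0 = u * p * et' (t n)" for n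
  proof -
   have "a (V (F n)) 0 = (LINT x|m. (u * et' (t n)) * (f x * ph' x))"
    unfolding a_V[OF F] F_def by (simp only: mult.assoc)
   also have "... = (u * et' (t n)) * p" unfolding p_def by (rule integral_mult_right_zero)
   finally show ?thesis by (simp add: mult_ac)
  qed
 qed
 have JL: "(%n. J mu (t n) / et' (t n)) ----> I"
  unfolding I_def by (rule filterlim_compose[OF J_over_et'[OF CX mu(1)] t(2)])
 have J0: "(%n. J mu (t n)) ----> 0" by (rule filterlim_compose[OF J_tendsto_0[OF mu(1)] t(2)])
 have A0: "A ----> 0"
 proof -
  have "(%n. A n / et' (t n) * et' (t n)) ----> I * L * 0" by (intro tendsto_mult AL et0)
  moreover have "A n / et' (t n) * et' (t n) = A n" for n using e[of n] by simp
  ultimately show ?thesis by simp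
 qed
 have "(%n. 1 - (A n / et' (t n) * exp_quotient (A n)) / (J mu (t n) / et' (t n) * exp_quotient (J mu (t n)))) ----> 1 - (I * L * 1) / (I * 1)"
  using I by (intro tendsto_diff tendsto_const tendsto_divide tendsto_mult AL JL exp_quotient_tendsto A0 J0) auto
 moreover have "1 - (A n / et' (t n) * exp_quotient (A n)) / (J mu (t n) / et' (t n) * exp_quotient (J mu (t n))) =
  (LINT x|scaled_law mu (t n). exp (- (u * x)))" for n
  unfolding scaled_law(3)[OF mu t(1) u] exp_quotient F_def[symmetric, abs_def] A_def[symmetric] using e[of n] by simp
 ultimately show ?thesis using I by (simp add: limit_laplace_def L_def p_def)
qed

lemma scaled_law_weak_conv:
 assumes Z: "limit_law (ga0 - 1) Z" and mu: "mu : finite_measures" "total_mass mu ~= 0"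
 shows "weak_conv_at_top (scaled_law mu) (distr Z borel (%z. (LINT x|m. f x * ph' x) * z))"
 unfolding weak_conv_at_top_def
proof (intro allI impI)
 fix t :: "nat => real" assume t: "filterlim t at_top sequentially"
 define p where "p = (LINT x|m. f x * ph' x)"
 have p: "0 < p" using pos by (simp add: p_def)
 interpret Z: real_distribution Z using Z by (simp add: limit_law_def)
 \<comment> \<open>Early times of the sequence may be non-positive, where the estimates do not
   apply; \<open>s\<close> agrees with \<open>t\<close> from some index on.\<close>
 define s where "s n = max 1 (t n)" for n
 have ev: "eventually (%n. s n = t n) sequentially"
  using t[unfolded filterlim_at_top, rule_format, of 1] by eventually_elim (simp add: s_def)
 have s: "0 < s n" for n by (simp add: s_def)
 have sl: "filterlim s at_top sequentially"
  by (rule filterlim_cong[THEN iffD1, OF refl refl _ t]) (use ev in \<open>auto elim: eventually_mono\<close>)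
 have zm: "(%z. p * z) : \<B> Z" by simp
 have "weak_conv_m (%n. scaled_law mu (s n)) (distr Z borel (%z. p * z))"
 proof (rule laplace_weak_conv)
  show "real_distribution (scaled_law mu (s n))" "AE x in scaled_law mu (s n). 0 <= x" for n
   by (rule scaled_law[OF mu s])+
  show "real_distribution (distr Z borel (%z. p * z))" by (rule Z.real_distribution_distr[OF zm])
  have "AE z in Z. 0 < z" using Z by (simp add: limit_law_def)
  thus "AE x in distr Z borel (%z. p * z). 0 <= x"
   by (subst AE_distr_iff[OF zm]) (use p in \<open>auto elim!: eventually_mono\<close>)
  fix k :: nat assume k: "0 < k"
  have "(\<integral>x. exp (- (real k * x)) \<partial>distr Z borel (%z. p * z)) = (LINT z|Z. exp (- (real k * (p * z))))"
   by (rule integral_distr[OF zm]) measurable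
  also have "... = (LINT z|Z. exp (- (real k * p) * z))" by (simp add: mult.assoc)
  also have "... = limit_laplace (ga0 - 1) (real k * p)"
   using Z k p unfolding limit_law_def limit_laplace_def by (auto dest!: spec[of _ "real k * p"])
  finally show "(%n. \<integral>x. exp (- (real k * x)) \<partial>scaled_law mu (s n)) ----> (\<integral>x. exp (- (real k * x)) \<partial>distr Z borel (%z. p * z))"
   using scaled_laplace_limit[OF mu s sl, of "real k"] k by (simp add: p_def)
 qed
 thus "weak_conv_m (%n. scaled_law mu (t n)) (distr Z borel (%z. (LINT x|m. f x * ph' x) * z))"
  unfolding weak_conv_m_def weak_conv_def p_def[symmetric]
 proof (intro allI impI)
  fix x assume "\<forall>x. isCont (cdf (distr Z borel (%z. p * z))) x -->
   (%n. cdf (scaled_law mu (s n)) x) ----> cdf (distr Z borel (%z. p * z)) x"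
   and "isCont (cdf (distr Z borel (%z. p * z))) x"
  hence "(%n. cdf (scaled_law mu (s n)) x) ----> cdf (distr Z borel (%z. p * z)) x" by blast
  moreover have "eventually (%n. cdf (scaled_law mu (s n)) x = cdf (scaled_law mu (t n)) x) sequentially"
   using ev by eventually_elim simp
  ultimately show "(%n. cdf (scaled_law mu (t n)) x) ----> cdf (distr Z borel (%z. p * z)) x"
   by (rule Lim_transform_eventually)
 qed
qed

end

lemma CX_pos:
 assumes A: "0 < emeasure m {x. ga x = ga0}"
 shows "0 < CX"
 unfolding CX_def
proof (rule integral_pos[where A="{x. ga x = ga0}"])
 obtain C where C: "!!x. ph x <= C" using ph_bounded by blast
 have "(%x. indicator {x. ga x = ga0} x * ka x * ph x powr ga0) : bounded_borel"
 proof (rule bbI)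
  show "\<bar>indicator {x. ga x = ga0} x * ka x * ph x powr ga0\<bar> <= K * C powr ga0" for x
  proof -
   have "ph x powr ga0 <= C powr ga0" using C[of x] ph_pos(1)[of x] ga0(1) by (intro powr_mono2) auto
   hence "ka x * ph x powr ga0 <= K * C powr ga0" using ka[of x] by (intro mult_mono) auto
   thus ?thesis using ka(1)[of x] K_pos by (auto simp: indicator_def abs_mult)
  qed
 qed measurable
 thus "integrable m (%x. indicator {x. ga x = ga0} x * ka x * ph x powr ga0 * ph' x)"
  by (rule integrable_mult_ph')
 show "0 <= indicator {x. ga x = ga0} x * ka x * ph x powr ga0 * ph' x" for x
  using ka(1)[of x] ph_pos(2)[of x] by (auto simp: indicator_def)
 show "0 < indicator {x. ga x = ga0} x * ka x * ph x powr ga0 * ph' x" if "x : {x. ga x = ga0}" for x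
  using that ka(1)[of x] ph_pos(1,2)[of x] by (auto intro!: mult_pos_pos)
qed (use A in auto)

text \<open>The law is obtained from the process: for \<open>f = ph\<close> and a point mass the
  conditioned laws have converging Laplace transforms, and a limit point divided by \<open>p\<close>
  has the required transform.\<close>

lemma limit_law_exists:
 assumes CX: "0 < CX"
 shows "\<exists>Z. limit_law (ga0 - 1) Z"
proof -
 have p: "0 < (LINT x|m. ph x * ph' x)"
  using ph_pos m_pos integrable_mult_ph'[OF ph_bounded_borel]
  by (intro integral_pos[where A=UNIV]) (auto simp: less_imp_le)
 \<comment> \<open>Equal to 1 for a normalised pair of eigenfunctions; the abstract semigroup does
   not record the normalisation, hence the rescaling.\<close>
 define p where "p = (LINT x|m. ph x * ph' x)"
 define mu :: "'e measure" where "mu = return borel undefined"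
 have mu: "mu : finite_measures" "total_mass mu ~= 0"
  unfolding mu_def by (rule return_finite_measures) (simp add: total_mass_def measure_return)
 define t :: "nat => real" where "t n = real n + 1" for n
 have t: "0 < t n" "filterlim t at_top sequentially" for n
  unfolding t_def by (simp, real_asymp)
 note ctx = CX bbD[OF ph_bounded_borel] less_imp_le[OF ph_pos(1)] eq_refl[OF mult_1[symmetric]] p
 have "\<exists>Z. real_distribution Z \<and> (AE z in Z. 0 <= z) \<and> (\<forall>u>0. (LINT z|Z. exp (- (u * z))) = limit_laplace (ga0 - 1) (u * p))"
 proof (rule laplace_limit_exists)
  show "real_distribution (scaled_law ph mu (t n))" "AE x in scaled_law ph mu (t n). 0 <= x" for n
   using scaled_law(1,2)[OF ctx mu t(1)] .
  show "(%n. \<integral>x. exp (- (u * x)) \<partial>scaled_law ph mu (t n)) ----> limit_laplace (ga0 - 1) (u * p)" if "0 < u" for u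
   unfolding p_def by (rule scaled_laplace_limit[OF ctx mu t that])
  have "filterlim (%u. u * p) (at_right 0) (at_right 0)"
   using p unfolding p_def[symmetric] filterlim_at by (auto intro!: tendsto_eq_intros simp: eventually_at_filter)
  thus "((%u. limit_laplace (ga0 - 1) (u * p)) ---> 1) (at_right 0)"
   using ga0(1) by (intro filterlim_compose[OF limit_laplace_at_0]) auto
 qed
 then obtain Z where Z: "real_distribution Z" "AE z in Z. 0 <= z" "\<forall>u>0. (LINT z|Z. exp (- (u * z))) = limit_laplace (ga0 - 1) (u * p)"
  by blast
 interpret Z: real_distribution Z by (rule Z)
 have zm: "(%z. z / p) : \<B> Z" by simp
 have p0: "0 < p" using p by (simp add: p_def)
 have "limit_law (ga0 - 1) (distr Z borel (%z. z / p))"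
 proof (rule limit_law_of_laplace)
  show "real_distribution (distr Z borel (%z. z / p))" by (rule Z.real_distribution_distr[OF zm])
  show "AE x in distr Z borel (%z. z / p). 0 <= x"
   by (subst AE_distr_iff[OF zm]) (use p0 Z(2) in \<open>auto elim!: eventually_mono\<close>)
  fix u :: real assume u: "0 < u"
  have "(\<integral>x. exp (- (u * x)) \<partial>distr Z borel (%z. z / p)) = (LINT z|Z. exp (- (u * (z / p))))"
   by (rule integral_distr[OF zm]) measurable
  also have "... = (LINT z|Z. exp (- (u / p * z)))" by simp
  also have "... = limit_laplace (ga0 - 1) u" using Z(3)[rule_format, of "u / p"] u p0 by simp
  finally show "(\<integral>x. exp (- (u * x)) \<partial>distr Z borel (%z. z / p)) = limit_laplace (ga0 - 1) u" .
 qed (use ga0(1) in simp)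
 thus ?thesis by blast
qed

end

section \<open>Transfer from the process and proof of the theorem\<close>

lemma generator_imp_L2:
 assumes "(%x. complex_of_real (f x), h) : generator m k" and pos: "!!x. 0 < f x"
 shows "(\<integral>\<^sup>+x. (ennreal (f x))^2 \<partial>m) < \<infinity>"
proof -
 have "(%x. complex_of_real (f x)) : L2_space m" using assms(1) by (simp add: generator_def)
 hence "(\<integral>\<^sup>+x. ennreal ((cmod (complex_of_real (f x)))^2) \<partial>m) < \<infinity>"
  unfolding L2_space_def sqnorm_L2_def by blast
 also have "(\<integral>\<^sup>+x. ennreal ((cmod (complex_of_real (f x)))^2) \<partial>m) = (\<integral>\<^sup>+x. (ennreal (f x))^2 \<partial>m)"
  using pos by (intro nn_integral_cong) (simp add: ennreal_power less_imp_le)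
 finally show ?thesis .
qed

context motion
begin

lemma P_motion': "motion_semigroup xi Pr = P"
 by (intro ext) (simp add: P_motion)

lemma density_assumptionD:
 assumes "density_assumption xi Pr m p"
 shows "sets m = sets borel" "sigma_finite_measure m" "!!U. open U ==> U ~= {} ==> 0 < emeasure m U"
  "continuous_density m P p" "!!t x y. 0 < t ==> 0 < p t x y" "!!t x. 0 < t ==> (\<integral>\<^sup>+y. ennreal (p t y x) \<partial>m) <= 1"
proof -
 note d = assms[unfolded density_assumption_def P_motion']
 note d1 = d[THEN conjunct2] and d2 = d[THEN conjunct2, THEN conjunct2]
 note d3 = d2[THEN conjunct2, THEN conjunct2]
 show "sets m = sets borel" by (rule d[THEN conjunct1])
 show "sigma_finite_measure m" by (rule d1[THEN conjunct1])
 show "0 < emeasure m U" if "open U" "U ~= {}" for U by (rule d2[THEN conjunct1, rule_format, OF conjI[OF that]])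
 show "continuous_density m P p" by (rule d2[THEN conjunct2, THEN conjunct1])
 show "0 < p t x y" if "0 < t" for t x y
  by (rule d3[THEN spec, THEN mp, OF that, THEN conjunct1, rule_format])
 show "(\<integral>\<^sup>+y. ennreal (p t y x) \<partial>m) <= 1" if "0 < t" for t x
  by (rule d3[THEN spec, THEN mp, OF that, THEN conjunct2, THEN conjunct2, THEN conjunct1, rule_format])
qed

lemma principal_eigenpairD:
 assumes "principal_eigenpair m k l ph ph'"
 shows "(%x. complex_of_real (ph x), %x. complex_of_real (l * ph x)) : generator m k"
  "(%x. complex_of_real (ph' x), %x. complex_of_real (l * ph' x)) : generator m (%t x y. k t y x)"
  "continuous_on UNIV ph" "continuous_on UNIV ph'" "!!x. 0 < ph x" "!!x. 0 < ph' x" "pairing m ph ph' = 1"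
 using assms unfolding principal_eigenpair_def principal_eigenfunction_def by (elim conjE, simp)+

lemma motion_density_semigroup:
 assumes density: "density_assumption xi Pr m p" and eigen: "principal_eigenpair m p l ph ph'"
  and iu: "intrinsically_ultracontractive p ph ph'"
 shows "density_semigroup m P p 0 ph ph'"
proof (rule density_semigroup.intro)
 note d = density_assumptionD[OF density] and e = principal_eigenpairD[OF eigen]
 show "0 <= p t x y" if "0 < t" for t x y using d(5)[OF that, of x y] by simp
 show "P t (%_. 1) x <= exp (0 * t)" if "0 < t" for t x using P_bound[of t "%_. 1" 1 x] that by simp
 show "(\<integral>\<^sup>+x. ennreal (p t x y) \<partial>m) <= ennreal (exp (0 * t))" if "0 < t" for t y
  using d(6)[OF that, of y] by simp
 show "P t f : bounded_borel" if "0 < t" "f : bounded_borel" for t f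
  using that by (intro FK_bounded_borel) (auto intro: bbI[of _ 0])
 show "P (s + t) f x = P s (P t f) x" if "0 < s" "0 < t" "f : bounded_borel" for s t f x
  using that by (intro P_semigroup) auto
 show "\<exists>c. \<forall>x y. p t x y <= c * ph x * ph' y" if "0 < t" for t
  using iu that unfolding intrinsically_ultracontractive_def by blast
 show "(\<integral>\<^sup>+x. (ennreal (ph x))^2 \<partial>m) < \<infinity>" by (rule generator_imp_L2[OF e(1,5)])
 show "(\<integral>\<^sup>+x. (ennreal (ph' x))^2 \<partial>m) < \<infinity>" by (rule generator_imp_L2[OF e(2,6)])
qed (fact density_assumptionD[OF density] principal_eigenpairD[OF eigen])+

text \<open>A potential bounded by \<open>B\<close> changes the kernel of the motion at most by the
  factors \<open>exp (- B * t)\<close> and \<open>exp (B * t)\<close>. So upper and lower bounds are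
  inherited with the eigenfunctions of the motion as \<open>g\<close> and \<open>h\<close>, while
  \<open>ph\<close> and \<open>ph'\<close> enter as invariant functions of the new kernel.\<close>

lemma feynman_kac_principal_kernel:
 assumes b: "b : bounded_borel" "!!y. \<bar>b y\<bar> <= B"
  and density: "density_assumption xi Pr m p" and eigen: "principal_eigenpair m p l pht pht'"
  and density_b: "continuous_density m (FK b) q" and eigen_b: "principal_eigenpair m q 0 ph ph'"
  and bounded: "bounded (range pht)" and iu: "intrinsically_ultracontractive p pht pht'"
 shows "principal_kernel m q B pht pht' ph ph'"
proof -
 interpret p: density_semigroup m P p 0 pht pht' by (rule motion_density_semigroup[OF density eigen iu])
 note bm = bbD[OF b(1)]
 have B: "0 <= B" using b(2)[of undefined] by linarith
 have ppos: "0 < p t x y" if "0 < t" for t x y by (rule density_assumptionD(5)[OF density that])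
 have qc: "continuous_on UNIV (%(x, y). q t x y)" and qi: "integrable m (q t x)"
  and Q: "f : bounded_borel ==> FK b t f x = (LINT y|m. q t x y * f y)" if "0 < t" for t f x
  using density_b that unfolding continuous_density_def by auto
 have qcx: "continuous_on UNIV (q t x)" if "0 < t" for t x
 proof -
  have "continuous_on UNIV (%y. case (x, y) of (x, y) => q t x y)"
   by (rule continuous_on_compose2[OF qc[OF that]]) (auto intro!: continuous_intros)
  thus ?thesis by simp
 qed
 \<comment> \<open>The operator inequalities of \<open>FK_between\<close>, tested with non-negative
   functions, pass to the continuous kernels.\<close>
 have up: "q t x y <= exp (B * t) * p t x y" and lo: "exp (- B * t) * p t x y <= q t x y" if t: "0 < t" for t x y
 proof -
  show "q t x y <= exp (B * t) * p t x y"
  proof (rule continuous_density_mono[OF p.sets_m p.full_support qcx[OF t] qi[OF t]])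
   show "continuous_on UNIV (%y. exp (B * t) * p t x y)" "integrable m (%y. exp (B * t) * p t x y)"
    using p.cont_section(1)[OF t] p.integrable[OF t] by (auto intro: continuous_on_mult_left)
   show "(LINT y|m. q t x y * f y) <= (LINT y|m. exp (B * t) * p t x y * f y)"
    if f: "f : bounded_borel" "!!y. 0 <= f y" for f
    using FK_between(2)[OF bm b(2) less_imp_le[OF t] f, of x] by (simp add: Q[OF t f(1)] p.R_eq[OF t f(1)] mult.assoc)
  qed auto
  show "exp (- B * t) * p t x y <= q t x y"
  proof (rule continuous_density_mono[OF p.sets_m p.full_support _ _ qcx[OF t] qi[OF t]])
   show "continuous_on UNIV (%y. exp (- B * t) * p t x y)" "integrable m (%y. exp (- B * t) * p t x y)"
    using p.cont_section(1)[OF t] p.integrable[OF t] by (auto intro: continuous_on_mult_left)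
   show "(LINT y|m. exp (- B * t) * p t x y * f y) <= (LINT y|m. q t x y * f y)"
    if f: "f : bounded_borel" "!!y. 0 <= f y" for f
    using FK_between(1)[OF bm b(2) less_imp_le[OF t] f, of x] by (simp add: Q[OF t f(1)] p.R_eq[OF t f(1)] mult.assoc)
  qed auto
 qed
 have "density_semigroup m (FK b) q B pht pht'"
 proof (rule density_semigroup.intro)
  show "0 <= q t x y" if "0 < t" for t x y
  proof -
   have "0 <= exp (- B * t) * p t x y" using ppos[OF that, of x y] by simp
   thus ?thesis using lo[OF that, of x y] by linarith
  qed
  show "FK b t (%_. 1) x <= exp (B * t)" if "0 < t" for t x
   using FK_bound[OF bm b(2) less_imp_le[OF that], of "%_. 1" 1 x] by simp
  show "(\<integral>\<^sup>+x. ennreal (q t x y) \<partial>m) <= ennreal (exp (B * t))" if t: "0 < t" for t y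
  proof -
   have "(\<integral>\<^sup>+x. ennreal (q t x y) \<partial>m) <= (\<integral>\<^sup>+x. ennreal (exp (B * t)) * ennreal (p t x y) \<partial>m)"
    using up[OF t] ppos[OF t] by (intro nn_integral_mono) (simp add: ennreal_mult[symmetric] less_imp_le ennreal_leI)
   also have "... = ennreal (exp (B * t)) * (\<integral>\<^sup>+x. ennreal (p t x y) \<partial>m)"
    using t by (intro nn_integral_cmult) measurable
   also have "... <= ennreal (exp (B * t)) * 1" using p.col[OF t, of y] by (intro mult_left_mono) auto
   finally show ?thesis by simp
  qed
  show "\<exists>c. \<forall>x y. q t x y <= c * pht x * pht' y" if t: "0 < t" for t
  proof -
   obtain c where c: "!!x y. p t x y <= c * pht x * pht' y" using p.dom[OF t] by blast
   have "q t x y <= (exp (B * t) * c) * pht x * pht' y" for x y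
    using up[OF t, of x y] mult_left_mono[OF c[of x y] exp_ge_zero[of "B * t"]] unfolding mult.assoc by linarith
   thus ?thesis by blast
  qed
  show "FK b t f : bounded_borel" if "0 < t" "f : bounded_borel" for t f
   using that by (intro FK_bounded_borel b) auto
  show "FK b (s + t) f x = FK b s (FK b t f) x" if "0 < s" "0 < t" "f : bounded_borel" for s t f x
   using that by (intro FK_semigroup b) auto
 qed (fact p.sets_m p.sigma_finite p.full_support density_b p.gh_cont p.gh_pos p.gh_L2)+
 then interpret q: dominated_kernel m q B pht pht' by (rule density_semigroup.dominated_kernel)
 interpret qT: dominated_kernel m "%t x y. q t y x" B pht' pht by (rule q.transpose)
 interpret pd: dominated_kernel m p 0 pht pht' by (rule p.dominated_kernel)
 interpret pT: dominated_kernel m "%t x y. p t y x" 0 pht' pht by (rule pd.transpose)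
 note gen = principal_eigenpairD(1,2)[OF eigen] and gen_b = principal_eigenpairD(1,2)[OF eigen_b]
  and cont = principal_eigenpairD(3,4)[OF eigen_b] and pos = principal_eigenpairD(5,6)[OF eigen_b]
  and norm = principal_eigenpairD(7)[OF eigen_b]
 obtain C :: "nat => 'e set" where C: "!!n. compact (C n)" "incseq C" "(\<Union>n. C n) = UNIV"
  using compact_exhaustion[OF lc] by blast
 show ?thesis
 proof (intro principal_kernel.intro principal_kernel_axioms.intro)
  show "dominated_kernel m q B pht pht'" by (rule q.dominated_kernel_axioms)
  \<comment> \<open>\<open>lower_bound\<close> asks for eigenfunctions of the kernel to which it is
    applied; \<open>pht\<close> and \<open>pht'\<close> belong to the motion, so the bound is proved
    for \<open>p\<close> and transferred to \<open>q\<close>.\<close>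
  show "\<exists>c>0. \<forall>x y. c * pht x * pht' y <= q t x y" if t: "0 < t" for t
  proof -
   have "\<exists>c>0. \<forall>x y. c * pht x * pht' y <= p t x y"
    using pd.lower_bound[OF C t ppos pd.semigroup_eigenfunction(2)[OF p.gh_cont(1) gen(1)]
      pT.semigroup_eigenfunction(2)[OF p.gh_cont(2) gen(2), unfolded pT.K_def]] .
   then obtain c where c: "0 < c" "!!x y. c * pht x * pht' y <= p t x y" by blast
   have "(exp (- B * t) * c) * pht x * pht' y <= q t x y" for x y
    using lo[OF t, of x y] mult_left_mono[OF c(2)[of x y] exp_ge_zero[of "- B * t"]] unfolding mult.assoc by linarith
   thus ?thesis using c(1) by (intro exI[of _ "exp (- B * t) * c"]) auto
  qed
  show "bounded (range pht)" by (rule bounded)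
  show "ph : q.L2" by (rule q.semigroup_eigenfunction(1)[OF cont(1) gen_b(1)])
  show "ph' : q.L2" using qT.semigroup_eigenfunction(1)[OF cont(2) gen_b(2)] by (simp add: q.L2_def qT.L2_def)
  show "q.K t ph x = ph x" if "0 < t" for t x
   using q.semigroup_eigenfunction(2)[OF cont(1) gen_b(1) that] by simp
  show "(LINT x|m. q t x y * ph' x) = ph' y" if "0 < t" for t y
   using qT.semigroup_eigenfunction(2)[OF cont(2) gen_b(2) that] by (simp add: qT.K_def)
  show "(LINT x|m. ph x * ph' x) = 1" using norm by (simp add: pairing_def)
 qed (fact pos)+
qed

text \<open>Criticality upgrades local to global boundedness: \<open>v\<close> lies below the linear
  flow of \<open>f\<close>, which is bounded uniformly in time. The equation between two times is
  \<open>mild_shift\<close>.\<close>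

lemma mild_solution_imp_solution:
 assumes sb: "stable_branching_semigroup m (FK b) ph ph' ka ga ka0 ga0 K"
  and b: "b : bounded_borel" and f: "f : bounded_borel" "!!x. 0 <= f x"
  and mild: "mild_solution xi Pr (stable_branching b ka ga) f v"
 shows "stable_branching_semigroup.solution (FK b) ka ga v" "v 0 x = f x"
proof -
 interpret stable_branching_semigroup m "FK b" ph ph' ka ga ka0 ga0 K by (rule sb)
 have kaB: "ka : bounded_borel" using ka_measurable ka by (intro bbI[of _ K]) (auto simp: less_imp_le)
 note ctx = b kaB less_imp_le[OF ka(1)] ga_measurable ga f(1) mild
 obtain C where C: "0 <= C" "!!t f M x. 0 <= t ==> f : bounded_borel ==> (!!y. \<bar>f y\<bar> <= M) ==> \<bar>FK b t f x\<bar> <= C * M"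
  by (rule Q_abs_bound) blast
 obtain M where M: "0 <= M" "!!x. \<bar>f x\<bar> <= M" using bbE[OF f(1)] by blast
 show "solution v"
  unfolding solution_def
 proof (intro conjI allI impI exI[of _ "C * M"])
  show "(%(t, x). v (max 0 t) x) : \<B> borel2" by (rule mild_measurable[OF ctx])
  show "0 <= v t x" if "0 <= t" for t x by (rule mild_nonneg[OF ctx that])
  show "v t x <= C * M" if "0 <= t" for t x
   using mild_le[OF ctx that, of x] C(2)[OF that f(1) M(2), of x] by linarith
  show "v (t + s) x + (LBINT r:{0..s}. FK b r (N v (t + s - r)) x) = FK b s (v t) x"
   if "0 <= s" "0 <= t" for s t x
   using mild_shift[OF ctx that, of x] by (simp add: N_def[abs_def])
 qed
 have "(LBINT s:{0..0}. FK b s (%y. ka y * v (0 - s) y powr ga y) x) = 0"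
  unfolding set_lebesgue_integral_def
  using AE_lborel_singleton[of "0::real"] by (intro integral_eq_zero_AE) (auto elim!: eventually_mono)
 thus "v 0 x = f x"
  using mild_feynman_kac[OF ctx order_refl, of x] by (simp add: FK_0[OF bbD[OF f(1)]])
qed

end

theorem theorem1p1:
  fixes \<xi> :: "real \<Rightarrow> 'w \<Rightarrow> 'e::{metric_space, second_countable_topology} option"
    and Pr :: "'e option \<Rightarrow> 'w measure" and W :: "'w measure"
    and X :: "real \<Rightarrow> 'v \<Rightarrow> 'e measure" and P :: "'e measure \<Rightarrow> 'v measure" and W' :: "'v measure"
    and \<beta> \<kappa> \<gamma> :: "'e \<Rightarrow> real"
    and m :: "'e measure" and p p\<beta> :: "real \<Rightarrow> 'e \<Rightarrow> 'e \<Rightarrow> real"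
    and ltilde lam :: real and \<phi>tilde \<phi>tilde' \<phi> \<phi>' :: "'e \<Rightarrow> real"
  assumes state_space: "locally_compact_space (euclidean :: 'e topology)"
    and superprocess: "superprocess W \<xi> Pr (stable_branching \<beta> \<kappa> \<gamma>) W' X P"
    and branching: "stable_branching_assumption m \<beta> \<kappa> \<gamma>"
    and density: "density_assumption \<xi> Pr m p"
    and eigen_motion: "principal_eigenpair m p ltilde \<phi>tilde \<phi>tilde'"
    and density_\<beta>: "continuous_density m (feynman_kac \<xi> Pr \<beta>) p\<beta>"
    and eigen_\<beta>: "principal_eigenpair m p\<beta> lam \<phi> \<phi>'"
    and bounded_\<phi>tilde: "bounded (range \<phi>tilde)"
    and ultracontractive: "intrinsically_ultracontractive p \<phi>tilde \<phi>tilde'"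
    and critical: "lam = 0"
  shows
    "(\<forall>t>0. \<forall>x. \<P>(\<omega> in P (return borel x). total_mass (X t \<omega>) = 0) > 0)
     \<and>
     (\<forall>\<mu>\<in>finite_measures.
        (survival_probability X P \<mu> \<longlongrightarrow> 0) at_top \<and>
        (total_mass \<mu> \<noteq> 0 \<longrightarrow>
           regularly_varying (survival_probability X P \<mu>) (- (1 / (ess_inf m \<gamma> - 1)))) \<and>
        (emeasure m {x. \<gamma> x = ess_inf m \<gamma>} > 0 \<longrightarrow>
           ((\<lambda>t. inverse (eta m \<kappa> \<gamma> \<phi> \<phi>' t) * survival_probability X P \<mu> t)
              \<longlongrightarrow> (\<integral>x. \<phi> x \<partial>\<mu>)) at_top))
     \<and>
     (emeasure m {x. \<gamma> x = ess_inf m \<gamma>} > 0 \<longrightarrow>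
        (\<exists>Z. limit_law (ess_inf m \<gamma> - 1) Z \<and>
           (\<forall>f\<in>borel_measurable borel.
              (\<forall>x. 0 \<le> f x) \<and> pairing m f \<phi>' > 0 \<and> bounded (range (\<lambda>x. f x / \<phi> x)) \<longrightarrow>
              (\<forall>\<mu>\<in>finite_measures. total_mass \<mu> \<noteq> 0 \<longrightarrow>
                 weak_conv_at_top
                   (\<lambda>t. distr (survival_conditioned X P \<mu> t) borel
                          (\<lambda>\<omega>. eta m \<kappa> \<gamma> \<phi> \<phi>' t * (\<integral>x. f x \<partial>X t \<omega>)))
                   (distr Z borel (\<lambda>z. pairing m f \<phi>' * z))))))"
proof -
 interpret S: superprocess W \<xi> Pr "stable_branching \<beta> \<kappa> \<gamma>" W' X P by (rule superprocess)
 interpret M: motion W \<xi> Pr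
  by (intro motion.intro motion_axioms.intro S.motion.killed_hunt_process_axioms state_space)
 have \<beta>: "\<beta> \<in> bounded_borel" and \<kappa>B: "\<kappa> \<in> bounded_borel" and \<kappa>: "!!x. 0 < \<kappa> x" "0 < ess_inf m \<kappa>"
  and \<gamma>m: "\<gamma> \<in> borel_measurable borel" and \<gamma>: "!!x. 1 < \<gamma> x" "!!x. \<gamma> x < 2" "1 < ess_inf m \<gamma>"
  using branching unfolding stable_branching_assumption_def by blast+
 obtain B where B: "0 <= B" "!!y. \<bar>\<beta> y\<bar> <= B" using bbE[OF \<beta>] by blast
 obtain K where K: "0 <= K" "!!y. \<bar>\<kappa> y\<bar> <= K" using bbE[OF \<kappa>B] by blast
 have pk: "principal_kernel m p\<beta> B \<phi>tilde \<phi>tilde' \<phi> \<phi>'"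
  using eigen_\<beta> unfolding critical
  by (intro M.feynman_kac_principal_kernel[OF \<beta> B(2) density eigen_motion density_\<beta> _ bounded_\<phi>tilde ultracontractive])
 have crit: "critical_semigroup m (feynman_kac \<xi> Pr \<beta>) \<phi> \<phi>'"
  using density_\<beta> unfolding continuous_density_def by (intro M.critical_semigroup_feynman_kac[OF pk \<beta> B(2)]) blast
 interpret c: critical_semigroup m "feynman_kac \<xi> Pr \<beta>" \<phi> \<phi>' by (rule crit)
 have mb: "borel_measurable m = (borel_measurable borel :: ('e => real) set)"
  by (rule measurable_cong_sets[OF c.sets_m refl])
 have m0: "emeasure m (space m) ~= 0" using c.m_pos by simp
 have \<kappa>m: "\<kappa> \<in> borel_measurable m" and \<gamma>m': "\<gamma> \<in> borel_measurable m"
  using bbD[OF \<kappa>B] \<gamma>m by (simp_all add: mb)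
 have \<kappa>K: "\<kappa> x <= K" for x using K(2)[of x] by linarith
 have sb: "stable_branching_semigroup m (feynman_kac \<xi> Pr \<beta>) \<phi> \<phi>' \<kappa> \<gamma> (ess_inf m \<kappa>) (ess_inf m \<gamma>) K"
 proof (intro stable_branching_semigroup.intro stable_branching_semigroup_axioms.intro crit)
  show "AE x in m. ess_inf m \<kappa> <= \<kappa> x"
   by (rule ess_inf_between(1)[OF \<kappa>m _ \<kappa>K m0, of 0]) (rule less_imp_le[OF \<kappa>(1)])
  show "AE x in m. ess_inf m \<gamma> <= \<gamma> x"
   by (rule ess_inf_between(1)[OF \<gamma>m' less_imp_le[OF \<gamma>(1)] less_imp_le[OF \<gamma>(2)] m0])
  show "emeasure m {x. \<gamma> x < ess_inf m \<gamma> + e} ~= 0" if "0 < e" for e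
   using ess_inf_between(2)[OF \<gamma>m' less_imp_le[OF \<gamma>(1)] less_imp_le[OF \<gamma>(2)] m0 that] by simp
 qed (fact bbD[OF \<kappa>B] \<gamma>m \<kappa> \<kappa>K \<gamma>)+
 interpret s: stable_branching_semigroup m "feynman_kac \<xi> Pr \<beta>" \<phi> \<phi>' \<kappa> \<gamma> "ess_inf m \<kappa>" "ess_inf m \<gamma>" K by (rule sb)
 have topP: "\<mu> \<in> topspace weak_topology" if "\<mu> \<in> finite_measures" for \<mu> :: "'e measure"
  using that by (simp add: topspace_weak_topology)
 interpret b: branching_process m "feynman_kac \<xi> Pr \<beta>" \<phi> \<phi>' \<kappa> \<gamma> "ess_inf m \<kappa>" "ess_inf m \<gamma>" K X P
 proof (intro branching_process.intro branching_process_axioms.intro sb)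
  show "prob_space (P \<mu>)" if "\<mu> \<in> finite_measures" for \<mu> by (rule S.prob_law[OF topP[OF that]])
  show "X t \<in> P \<mu> \<rightarrow>\<^sub>M borel_of weak_topology" if "0 <= t" "\<mu> \<in> finite_measures" for t \<mu>
   using S.measurable_process[OF that(1)] by (simp add: measurable_cong_sets[OF S.sets_law[OF topP[OF that(2)]] refl])
  fix f :: "'e => real" assume f: "f \<in> bounded_borel" "!!x. 0 <= f x"
  obtain v where v: "mild_solution \<xi> Pr (stable_branching \<beta> \<kappa> \<gamma>) f v"
   "\<forall>t\<ge>0. \<forall>\<mu>\<in>finite_measures. (LINT \<omega>|P \<mu>. exp (- (LINT x|X t \<omega>. f x))) = exp (- (LINT x|\<mu>. v t x))"
   using S.laplace_functional[OF f] by blast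
  show "\<exists>v. s.solution v \<and> (\<forall>x. v 0 x = f x) \<and>
    (\<forall>t\<ge>0. \<forall>\<mu>\<in>finite_measures. (LINT \<omega>|P \<mu>. exp (- (LINT x|X t \<omega>. f x))) = exp (- (LINT x|\<mu>. v t x)))"
   using M.mild_solution_imp_solution[OF sb \<beta> f v(1)] v(2) by blast
 qed
 have eta: "eta m \<kappa> \<gamma> \<phi> \<phi>' = s.et'"
  by (rule ext) (simp add: eta_def s.et'_def C_X_def s.CX_def pairing_def)
 show ?thesis
  unfolding eta
 proof (intro conjI allI impI ballI)
  \<comment> \<open>The extinction probability is the exponential of a real number, hence
    positive.\<close>
  show "0 < \<P>(\<omega> in P (return borel x). total_mass (X t \<omega>) = 0)" if "0 < t" for t x
   by (simp add: b.extinction_probability[OF b.return_finite_measures that])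
  show "(survival_probability X P \<mu> \<longlongrightarrow> 0) at_top" if "\<mu> \<in> finite_measures" for \<mu>
   by (rule b.survival_tendsto_0[OF that])
  show "regularly_varying (survival_probability X P \<mu>) (- (1 / (ess_inf m \<gamma> - 1)))"
   if "\<mu> \<in> finite_measures" "total_mass \<mu> ~= 0" for \<mu>
   by (rule b.survival_regularly_varying[OF that])
  show "((%t. inverse (s.et' t) * survival_probability X P \<mu> t) \<longlongrightarrow> (LINT x|\<mu>. \<phi> x)) at_top"
   if "\<mu> \<in> finite_measures" "0 < emeasure m {x. \<gamma> x = ess_inf m \<gamma>}" for \<mu>
   by (rule b.survival_over_et'[OF b.CX_pos[OF that(2)] that(1)])
  assume "0 < emeasure m {x. \<gamma> x = ess_inf m \<gamma>}"
  hence CX: "0 < s.CX" by (rule b.CX_pos)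
  \<comment> \<open>One \<open>Z\<close> serves all \<open>f\<close> and all starting measures, so
    it is fixed before them.\<close>
  obtain Z where Z: "limit_law (ess_inf m \<gamma> - 1) Z" using b.limit_law_exists[OF CX] by blast
  show "\<exists>Z. limit_law (ess_inf m \<gamma> - 1) Z \<and>
   (\<forall>f\<in>borel_measurable borel.
    (\<forall>x. 0 <= f x) \<and> 0 < pairing m f \<phi>' \<and> bounded (range (%x. f x / \<phi> x)) -->
    (\<forall>\<mu>\<in>finite_measures. total_mass \<mu> ~= 0 -->
      weak_conv_at_top
       (%t. distr (survival_conditioned X P \<mu> t) borel (%\<omega>. s.et' t * (LINT x|X t \<omega>. f x)))
       (distr Z borel (%z. pairing m f \<phi>' * z))))"
  proof (intro exI[of _ Z] conjI Z ballI impI, elim conjE)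
   fix f :: "'e => real" and \<mu> :: "'e measure"
   assume f: "f \<in> borel_measurable borel" "\<forall>x. 0 <= f x" "0 < pairing m f \<phi>'" "bounded (range (%x. f x / \<phi> x))"
    and \<mu>: "\<mu> \<in> finite_measures" "total_mass \<mu> ~= 0"
   \<comment> \<open>Boundedness of \<open>f / \<phi>\<close> enters as the pointwise bound
     \<open>f <= c * \<phi>\<close>, which keeps the solutions small at all times.\<close>
   obtain c where c: "!!x. f x / \<phi> x <= c" using f(4) by (auto simp: bounded_iff abs_le_iff)
   have "f x <= c * \<phi> x" for x using c[of x] c.ph_pos(1)[of x] by (simp add: pos_divide_le_eq)
   note ctx = CX f(1) f(2)[rule_format] this f(3)[unfolded pairing_def]
   show "weak_conv_at_top (%t. distr (survival_conditioned X P \<mu> t) borel (%\<omega>. s.et' t * (LINT x|X t \<omega>. f x)))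
     (distr Z borel (%z. pairing m f \<phi>' * z))"
    using b.scaled_law_weak_conv[OF ctx Z \<mu>] unfolding b.scaled_law_def[OF ctx, abs_def] pairing_def .
  qed
 qed
qed

end
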